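(* Let $(u_n)$ be a sequence converging weakly to zero in $L^2(\mathbb R^m\times\mathbb R^d)$, and let $(u_{n'})$ be an admissible subsequence in the sense of the context. Then there exists $\mu\in L^2_{w^*}(\mathbb R^{2m};\mathcal M_b(\mathbb R^d\times \mathrm P))$ such that for all $v\in L^2_c(\mathbb R^{2m})$, $\varphi_1,\varphi_2\in C_0(\mathbb R^d)$ and $\psi\in C(\mathrm P)$, $$\lim_{n'}\int_{\mathbb R^{2m}}\int_{\mathbb R^d}v(p,q)\bigl(\mathcal A_{\psi_{\mathrm P}}\,\varphi_1u_{n'}(\cdot,p)\bigr)(x)\,\overline{\varphi_2(x)u_{n'}(x,q)}\,dx\,dp\,dq=\int_{\mathbb R^{2m}}v(p,q)\,\langle\mu(p,q,\cdot,\cdot),\varphi_1\bar\varphi_2\otimes\psi\rangle\,dp\,dq .$$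
   Context: Fix real numbers $\alpha_1,\dots,\alpha_d>0$, let $l$ be the smallest positive integer with $l\alpha_k>d$ for each $k$, and set $\mathrm P=\{\xi\in\mathbb R^d:\sum_{k=1}^d|\xi_k|^{l\alpha_k}=1\}$. The projection $\pi_{\mathrm P}:\mathbb R^d\setminus\{0\}\to \mathrm P$ is $(\pi_{\mathrm P}(\xi))_k=\xi_k\bigl(\sum_{j=1}^d|\xi_j|^{l\alpha_j}\bigr)^{-1/(l\alpha_k)}$. For $\psi\in C(\mathrm P)$ put $\psi_{\mathrm P}=\psi\circ\pi_{\mathrm P}$; $\mathcal A_{\psi_{\mathrm P}}$ is the Fourier multiplier operator on $L^2(\mathbb R^d)$ with symbol $\psi_{\mathrm P}$ ($\hat u(\xi)=\int e^{-2\pi ix\cdot\xi}u(x)\,dx$, $\widehat{\mathcal A_{\psi_{\mathrm P}}u}=\psi_{\mathrm P}\hat u$). $L^2_c$ denotes compactly supported $L^2$ functions, $C_0$ continuous functions vanishing at infinity, and $\mathcal M_b(\mathbb R^d\times \mathrm P)$ the bounded complex Radon measures, the dual of $C_0(\mathbb R^d\times \mathrm P)$. $L^2_{w^*}(\mathbb R^{2m};\mathcal M_b(\mathbb R^d\times \mathrm P))$ is the space of weakly-$*$ measurable $\mu:\mathbb R^{2m}\to\mathcal M_b(\mathbb R^d\times \mathrm P)$ with $\int_{\mathbb R^{2m}}\|\mu(p,q)\|^2\,dp\,dq<\infty$; it is the dual of $L^2(\mathbb R^{2m};C_0(\mathbb R^d\times \mathrm P))$. Regularization: fix a non-negative $\omega\in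 C_c^\infty(\mathbb R^m)$ with $\int\omega=1$, let $\omega_k(p)=k^m\omega(kp)$, $k\in\mathbb N$, and $u_n^k(x,p)=\int_{\mathbb R^m}u_n(x,y)\omega_k(p-y)\,dy$. Admissible subsequence: a subsequence $(u_{n'})$ for which there is a family $\{\mu_k^{pq}:p,q\in\mathbb R^m,\ k\in\mathbb N\}\subset\mathcal M_b(\mathbb R^d\times \mathrm P)$ such that for all $k\in\mathbb N$, $p,q\in\mathbb R^m$, $\varphi_1,\varphi_2\in C_0(\mathbb R^d)$, $\psi\in C(\mathrm P)$, $$\lim_{n'}\int_{\mathbb R^d}\bigl(\mathcal A_{\psi_{\mathrm P}}\,\varphi_1u_{n'}^k(\cdot,p)\bigr)(x)\,\overline{\varphi_2(x)u_{n'}^k(x,q)}\,dx=\int_{\mathbb R^d\times \mathrm P}\varphi_1(x)\overline{\varphi_2(x)}\psi(\xi)\,d\mu_k^{pq}(x,\xi).$$ (Every sequence $(u_n)$ converging weakly to zero in $L^2(\mathbb R^m\times\mathbb R^d)$ has such a subsequence.) *)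

theory Defs
  imports "HOL-Analysis.Analysis"
begin

text \<open>
  Elements of \<open>L\<^sup>2\<close> are handled through Lebesgue measurable representatives; all notions below
  depend only on the classes of the functions involved.
\<close>

definition L2 :: "('a::euclidean_space \<Rightarrow> complex) set" where
  "L2 = {f. f \<in> borel_measurable lebesgue \<and> integrable lebesgue (\<lambda>x. (norm (f x))\<^sup>2)}"

definition L2c :: "('a::euclidean_space \<Rightarrow> complex) set" where
  "L2c = {f \<in> L2. \<exists>K. compact K \<and> (AE x in lebesgue. x \<notin> K \<longrightarrow> f x = 0)}"

definition L2_tendsto :: "(nat \<Rightarrow> 'a::euclidean_space \<Rightarrow> complex) \<Rightarrow> ('a \<Rightarrow> complex) \<Rightarrow> bool" where
  "L2_tendsto f g \<longleftrightarrow> (\<forall>n. f n \<in> L2) \<and> g \<in> L2 \<and>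
     (\<lambda>n. \<integral>x. (norm (f n x - g x))\<^sup>2 \<partial>lebesgue) \<longlonglongrightarrow> 0"

definition L2_weakly_null :: "(nat \<Rightarrow> 'a::euclidean_space \<Rightarrow> complex) \<Rightarrow> bool" where
  "L2_weakly_null f \<longleftrightarrow> (\<forall>n. f n \<in> L2) \<and>
     (\<forall>g\<in>L2. (\<lambda>n. \<integral>x. f n x * cnj (g x) \<partial>lebesgue) \<longlonglongrightarrow> 0)"

definition C0 :: "'a::euclidean_space set \<Rightarrow> ('a \<Rightarrow> complex) set" where
  "C0 X = {f. continuous_on X f \<and>
     (\<forall>e>0. \<exists>K. compact K \<and> K \<subseteq> X \<and> (\<forall>x\<in>X - K. norm (f x) < e))}"

primrec Ck :: "nat \<Rightarrow> ('a::euclidean_space \<Rightarrow> real) \<Rightarrow> bool" where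
  "Ck 0 f \<longleftrightarrow> continuous_on UNIV f"
| "Ck (Suc k) f \<longleftrightarrow> (\<forall>x. f differentiable (at x)) \<and>
     (\<forall>b\<in>Basis. Ck k (\<lambda>x. frechet_derivative f (at x) b))"

definition Cc_infinity :: "('a::euclidean_space \<Rightarrow> real) set" where
  "Cc_infinity = {f. (\<forall>k. Ck k f) \<and> (\<exists>K. compact K \<and> (\<forall>x. x \<notin> K \<longrightarrow> f x = 0))}"

definition fourier :: "('a::euclidean_space \<Rightarrow> complex) \<Rightarrow> 'a \<Rightarrow> complex" where
  "fourier u \<xi> = (\<integral>x. cis (- 2 * pi * (x \<bullet> \<xi>)) * u x \<partial>lebesgue)"

text \<open>
  \<open>is_fourier_L2 f g\<close>: the function \<open>g\<close> represents the \<open>L\<^sup>2\<close> Fourier transform of \<open>f\<close>, i.e. the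
  continuous extension of \<^const>\<open>fourier\<close> from \<open>L\<^sup>1 \<inter> L\<^sup>2\<close> to \<open>L\<^sup>2\<close>.
\<close>

definition is_fourier_L2 :: "('a::euclidean_space \<Rightarrow> complex) \<Rightarrow> ('a \<Rightarrow> complex) \<Rightarrow> bool" where
  "is_fourier_L2 f g \<longleftrightarrow> (\<exists>s. (\<forall>n. integrable lebesgue (s n)) \<and>
     L2_tendsto s f \<and> L2_tendsto (\<lambda>n. fourier (s n)) g)"

text \<open>For \<open>u\<close> in \<open>L\<^sup>2\<close>, this is determined up to a null set.\<close>

definition multiplier_op ::
    "('a::euclidean_space \<Rightarrow> complex) \<Rightarrow> ('a \<Rightarrow> complex) \<Rightarrow> 'a \<Rightarrow> complex" where
  "multiplier_op \<sigma> u =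
     (SOME w. \<exists>h. is_fourier_L2 u h \<and> is_fourier_L2 w (\<lambda>\<xi>. \<sigma> \<xi> * h \<xi>))"

definition borel_on :: "'a::euclidean_space set \<Rightarrow> 'a measure" where
  "borel_on X = restrict_space borel X"

text \<open>The total variation of \<open>\<mu>\<close> on \<open>X\<close>, which is the norm of \<open>\<mu>\<close> as a functional on \<open>C\<^sub>0(X)\<close>.\<close>

definition total_variation :: "'a::euclidean_space set \<Rightarrow> ('a set \<Rightarrow> complex) \<Rightarrow> ennreal" where
  "total_variation X \<mu> =
     (SUP D \<in> {D. finite D \<and> disjoint D \<and> D \<subseteq> sets (borel_on X)}. \<Sum>A\<in>D. ennreal (norm (\<mu> A)))"

text \<open>
  Only the values on Borel subsets of \<open>X\<close> matter. The last condition is inner regularity by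
  compact sets; on the complement it yields outer regularity.
\<close>

definition Mb :: "'a::euclidean_space set \<Rightarrow> ('a set \<Rightarrow> complex) set" where
  "Mb X = {\<mu>.
     (\<forall>A :: nat \<Rightarrow> 'a set. range A \<subseteq> sets (borel_on X) \<longrightarrow> disjoint_family A \<longrightarrow>
        (\<lambda>i. \<mu> (A i)) sums \<mu> (\<Union>i. A i)) \<and>
     total_variation X \<mu> < \<infinity> \<and>
     (\<forall>A\<in>sets (borel_on X). \<forall>e>0. \<exists>K. compact K \<and> K \<subseteq> A \<and>
        (\<forall>B\<in>sets (borel_on X). B \<subseteq> A - K \<longrightarrow> norm (\<mu> B) < e))}"

text \<open>
  The positive part \<open>\<nu>\<^sup>+\<close> of a real signed measure \<open>\<nu>\<close> (Jordan decomposition); the negative part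
  of \<open>\<nu>\<close> is the positive part of \<open>- \<nu>\<close>.
\<close>

definition positive_part :: "'a::euclidean_space set \<Rightarrow> ('a set \<Rightarrow> real) \<Rightarrow> 'a measure" where
  "positive_part X \<nu> = measure_of X (sets (borel_on X))
     (\<lambda>A. SUP B \<in> {B \<in> sets (borel_on X). B \<subseteq> A}. ennreal (\<nu> B))"

definition complex_integral ::
    "'a::euclidean_space set \<Rightarrow> ('a set \<Rightarrow> complex) \<Rightarrow> ('a \<Rightarrow> complex) \<Rightarrow> complex" where
  "complex_integral X \<mu> f =
     (\<integral>x. f x \<partial>positive_part X (\<lambda>A. Re (\<mu> A))) - (\<integral>x. f x \<partial>positive_part X (\<lambda>A. - Re (\<mu> A)))
     + \<i> * ((\<integral>x. f x \<partial>positive_part X (\<lambda>A. Im (\<mu> A))) - (\<integral>x. f x \<partial>positive_part X (\<lambda>A. - Im (\<mu> A))))"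

text \<open>
  Weak-* measurability is tested against the predual \<open>C\<^sub>0(X)\<close> of \<open>\<M>\<^sub>b(X)\<close>. As this space is separable,
  the norm of a weak-* measurable \<open>\<mu>\<close> is a measurable function.
\<close>

definition L2_weak_star :: "'b::euclidean_space set \<Rightarrow> ('a::euclidean_space \<Rightarrow> 'b set \<Rightarrow> complex) set" where
  "L2_weak_star X = {\<mu>. (\<forall>z. \<mu> z \<in> Mb X) \<and>
     (\<forall>\<Phi>\<in>C0 X. (\<lambda>z. complex_integral X (\<mu> z) \<Phi>) \<in> borel_measurable lebesgue) \<and>
     (\<integral>\<^sup>+z. (total_variation X (\<mu> z))\<^sup>2 \<partial>lebesgue) < \<infinity>}"

definition exponent_factor :: "('d::finite \<Rightarrow> real) \<Rightarrow> nat" where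
  "exponent_factor \<alpha> = (LEAST l. 0 < l \<and> (\<forall>k. real l * \<alpha> k > real CARD('d)))"

definition Pgauge :: "('d::finite \<Rightarrow> real) \<Rightarrow> real^'d \<Rightarrow> real" where
  "Pgauge \<alpha> \<xi> = (\<Sum>k\<in>UNIV. \<bar>\<xi> $ k\<bar> powr (real (exponent_factor \<alpha>) * \<alpha> k))"

definition Pman :: "('d::finite \<Rightarrow> real) \<Rightarrow> (real^'d) set" where
  "Pman \<alpha> = {\<xi>. Pgauge \<alpha> \<xi> = 1}"

text \<open>The value at the origin, where the projection is undefined, is irrelevant below.\<close>

definition Pproj :: "('d::finite \<Rightarrow> real) \<Rightarrow> real^'d \<Rightarrow> real^'d" where
  "Pproj \<alpha> \<xi> = (\<chi> k. \<xi> $ k * Pgauge \<alpha> \<xi> powr (- 1 / (real (exponent_factor \<alpha>) * \<alpha> k)))"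

definition mollifier :: "(real^'m::finite \<Rightarrow> real) \<Rightarrow> bool" where
  "mollifier \<omega> \<longleftrightarrow> \<omega> \<in> Cc_infinity \<and> (\<forall>p. 0 \<le> \<omega> p) \<and> (\<integral>p. \<omega> p \<partial>lebesgue) = 1"

definition mollifier_scaled :: "(real^'m::finite \<Rightarrow> real) \<Rightarrow> nat \<Rightarrow> real^'m \<Rightarrow> real" where
  "mollifier_scaled \<omega> k p = real k ^ CARD('m) * \<omega> (real k *\<^sub>R p)"

definition regularize :: "(real^'m::finite \<Rightarrow> real) \<Rightarrow> nat \<Rightarrow>
    ((real^'d::finite) \<times> (real^'m) \<Rightarrow> complex) \<Rightarrow> (real^'d) \<times> (real^'m) \<Rightarrow> complex" where
  "regularize \<omega> k u = (\<lambda>(x, p). \<integral>y. u (x, y) * of_real (mollifier_scaled \<omega> k (p - y)) \<partial>lebesgue)"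

definition admissible :: "('d::finite \<Rightarrow> real) \<Rightarrow> (real^'m::finite \<Rightarrow> real) \<Rightarrow>
    (nat \<Rightarrow> (real^'d) \<times> (real^'m) \<Rightarrow> complex) \<Rightarrow> bool" where
  "admissible \<alpha> \<omega> u \<longleftrightarrow>
     (\<exists>\<mu> :: nat \<Rightarrow> real^'m \<Rightarrow> real^'m \<Rightarrow> ((real^'d) \<times> (real^'d)) set \<Rightarrow> complex.
        \<forall>k\<ge>1. \<forall>p q. \<mu> k p q \<in> Mb (UNIV \<times> Pman \<alpha>) \<and>
          (\<forall>\<phi>\<^sub>1\<in>C0 UNIV. \<forall>\<phi>\<^sub>2\<in>C0 UNIV. \<forall>\<psi>. continuous_on (Pman \<alpha>) \<psi> \<longrightarrow>
            (\<lambda>n. \<integral>x. multiplier_op (\<psi> \<circ> Pproj \<alpha>) (\<lambda>x. \<phi>\<^sub>1 x * regularize \<omega> k (u n) (x, p)) x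
                       * cnj (\<phi>\<^sub>2 x * regularize \<omega> k (u n) (x, q)) \<partial>lebesgue)
            \<longlonglongrightarrow> complex_integral (UNIV \<times> Pman \<alpha>) (\<mu> k p q) (\<lambda>(x, \<xi>). \<phi>\<^sub>1 x * cnj (\<phi>\<^sub>2 x) * \<psi> \<xi>)))"

end

theory Submission
  imports Defs "HOL-Probability.Probability" "HOL-Complex_Analysis.Complex_Analysis"
begin

text \<open>
  Only \<open>k = 1\<close> is needed: by Wiener's theorem countably many translates \<open>\<omega>(p - \<cdot>)\<close> are total in
  \<open>L\<^sup>2\<close>. Orthonormalising them gives a basis \<open>(e\<^sub>i)\<close> such that, with \<open>U\<^sub>n\<^sup>i(x)\<close> the coefficients of
  \<open>u\<^sub>n(x, \<cdot>)\<close>, the forms \<open>\<integral> A\<^sub>\<psi>(\<phi>\<^sub>1 U\<^sub>n\<^sup>i) cnj (\<phi>\<^sub>2 U\<^sub>n\<^sup>j)\<close> converge to integrals of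
  \<open>\<phi>\<^sub>1 cnj \<phi>\<^sub>2 \<psi>\<close> against measures with densities \<open>f\<^sub>i\<^sub>j\<close> with respect to one finite measure \<open>\<rho>\<close>.
  By Plancherel's theorem the multiplier form is nonnegative for \<open>\<psi> \<ge> 0\<close>, so the matrix \<open>(f\<^sub>i\<^sub>j)\<close> is
  positive semidefinite, with trace integrable by the bound on \<open>\<parallel>u\<^sub>n\<parallel>\<close>. Divided by its trace \<open>t\<close> it has
  Hilbert--Schmidt norm at most one, so \<open>\<Sum> e\<^sub>i(p) cnj (e\<^sub>j(q)) f\<^sub>i\<^sub>j(x) / t(x)\<close> converges in \<open>L\<^sup>2\<close> of the
  product of Lebesgue measure and \<open>t\<rho>\<close>, and is the density of \<open>\<mu>\<close>. For \<open>v\<close> a finite combination of the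
  \<open>cnj e\<^sub>i \<otimes> e\<^sub>j\<close> the limit relation holds by construction; the general case follows by density, as
  the multiplier forms of the slices of \<open>u\<^sub>n\<close> are bounded in \<open>L\<^sup>2\<close>.
\<close>

section \<open>Square integrable functions\<close>

text \<open>What has to be overcome is that admissibility yields one measure for each pair of
  translates and no joint bound on them: separate bounds on the entries \<open>f i j\<close> say
  nothing about the double series for the density. Positivity couples the entries, because |f_ij|^2
  <= f_ii f_jj, and the diagonal is controlled by norms: for \<open>\<psi> = 1\<close> the
  multiplier form is an inner product, and Bessel's inequality bounds the sum of the diagonal terms
  by the squared norm of u_n. A second obstacle is measurability. The operator acts on one slice
  u_n(., p) at a time and is fixed up to null sets only, so the form of two slices is not visibly
  measurable in (p, q); it has to be identified almost everywhere with an L^2 limit of finite sums.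
  Bounds uniform in n come from the uniform boundedness of weakly null sequences, and they permit
  the exchange of the limit in n with the expansion of v.\<close>

definition l2 :: "'a measure \<Rightarrow> ('a \<Rightarrow> complex) set" where
  "l2 M = {f \<in> borel_measurable M. integrable M (\<lambda>x. (norm (f x))\<^sup>2)}"

definition ip :: "'a measure \<Rightarrow> ('a \<Rightarrow> complex) \<Rightarrow> ('a \<Rightarrow> complex) \<Rightarrow> complex" where
  "ip M f g = (\<integral>x. f x * cnj (g x) \<partial>M)"

text \<open>This is a seminorm on functions, not a norm on classes: uniqueness statements take the
  form \<open>nm M f = 0\<close> and are turned into almost everywhere equalities by
  \<open>nm_eq_0_iff\<close>.\<close>

definition nm :: "'a measure \<Rightarrow> ('a \<Rightarrow> complex) \<Rightarrow> real" where
  "nm M f = sqrt (\<integral>x. (norm (f x))\<^sup>2 \<partial>M)"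

lemma borel_measurable_cnj [measurable (raw)]: "f \<in> borel_measurable M \<Longrightarrow> (\<lambda>x. cnj (f x)) \<in> borel_measurable M"
  by (rule measurable_compose[OF _ borel_measurable_continuous_onI]) (auto intro: continuous_intros)

lemma l2I: "f \<in> borel_measurable M \<Longrightarrow> integrable M (\<lambda>x. (norm (f x))\<^sup>2) \<Longrightarrow> f \<in> l2 M"
  and l2_measurable [measurable_dest]: "f \<in> l2 M \<Longrightarrow> f \<in> borel_measurable M"
  and l2_integrable: "f \<in> l2 M \<Longrightarrow> integrable M (\<lambda>x. (norm (f x))\<^sup>2)"
  by (auto simp: l2_def)

text \<open>The measure is a parameter because the argument also needs Borel measure, product
  measures and finite measures with densities; products of completed measures are avoided
  throughout.\<close>

lemma L2_eq_l2: "L2 = l2 lebesgue"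
  by (simp add: L2_def l2_def)

lemma l2_dominated:
  assumes g: "g \<in> borel_measurable M" and h: "integrable M h"
    and le: "AE x in M. (norm (g x))\<^sup>2 \<le> h x"
  shows "g \<in> l2 M"
proof (rule l2I[OF g])
  show "integrable M (\<lambda>x. (norm (g x))\<^sup>2)"
    by (rule Bochner_Integration.integrable_bound[OF h])
      (use g le in auto)
qed

lemma norm_add_power2_le: "(norm (a + b :: 'a::real_normed_vector))\<^sup>2 \<le> 2 * (norm a)\<^sup>2 + 2 * (norm b)\<^sup>2"
proof -
  have "(norm (a + b))\<^sup>2 \<le> (norm a + norm b)\<^sup>2"
    by (simp add: norm_triangle_ineq power_mono)
  also have "\<dots> \<le> 2 * (norm a)\<^sup>2 + 2 * (norm b)\<^sup>2"
    using sum_squares_bound[of "norm a" "norm b"] by (simp add: power2_sum)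
  finally show ?thesis .
qed

lemma l2_add: "f \<in> l2 M \<Longrightarrow> g \<in> l2 M \<Longrightarrow> (\<lambda>x. f x + g x) \<in> l2 M"
  by (rule l2_dominated[where h = "\<lambda>x. 2 * (norm (f x))\<^sup>2 + 2 * (norm (g x))\<^sup>2"])
    (auto intro!: l2_integrable norm_add_power2_le simp: l2_measurable)

lemma l2_scale: "f \<in> l2 M \<Longrightarrow> (\<lambda>x. c * f x) \<in> l2 M"
  by (auto simp: l2_def norm_mult power_mult_distrib)

lemma l2_scale_right: "f \<in> l2 M \<Longrightarrow> (\<lambda>x. f x * c) \<in> l2 M"
  by (auto simp: l2_def norm_mult power_mult_distrib)

lemma l2_divide: "f \<in> l2 M \<Longrightarrow> (\<lambda>x. f x / c) \<in> l2 M"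
  by (auto simp: l2_def norm_divide power_divide)

lemma l2_uminus: "f \<in> l2 M \<Longrightarrow> (\<lambda>x. - f x) \<in> l2 M"
  by (auto simp: l2_def)

lemma l2_diff: "f \<in> l2 M \<Longrightarrow> g \<in> l2 M \<Longrightarrow> (\<lambda>x. f x - g x) \<in> l2 M"
  using l2_add[OF _ l2_uminus] by fastforce

lemma l2_zero [simp]: "(\<lambda>x. 0) \<in> l2 M"
  by (simp add: l2_def)

lemma l2_sum: "(\<And>i. i \<in> I \<Longrightarrow> f i \<in> l2 M) \<Longrightarrow> (\<lambda>x. \<Sum>i\<in>I. f i x) \<in> l2 M"
  by (induction I rule: infinite_finite_induct) (auto intro: l2_add)

lemma l2_cnj: "f \<in> l2 M \<Longrightarrow> (\<lambda>x. cnj (f x)) \<in> l2 M"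
  by (auto simp: l2_def)

lemma l2_mult_bounded:
  assumes f: "f \<in> l2 M" and s: "s \<in> borel_measurable M" and b: "\<And>x. x \<in> space M \<Longrightarrow> norm (s x) \<le> B"
  shows "(\<lambda>x. s x * f x) \<in> l2 M"
proof (rule l2_dominated[where h = "\<lambda>x. B\<^sup>2 * (norm (f x))\<^sup>2"])
  show "(\<lambda>x. s x * f x) \<in> borel_measurable M"
    using s l2_measurable[OF f] by measurable
  show "integrable M (\<lambda>x. B\<^sup>2 * (norm (f x))\<^sup>2)"
    using l2_integrable[OF f] by simp
  show "AE x in M. (norm (s x * f x))\<^sup>2 \<le> B\<^sup>2 * (norm (f x))\<^sup>2"
    by (rule AE_I2) (auto simp: norm_mult power_mult_distrib intro!: mult_right_mono power_mono b)
qed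

lemma l2_AE_cong: "f \<in> l2 M \<Longrightarrow> g \<in> borel_measurable M \<Longrightarrow> AE x in M. f x = g x \<Longrightarrow> g \<in> l2 M"
  by (rule l2_dominated[of g M "\<lambda>x. (norm (f x))\<^sup>2"]) (auto simp: l2_integrable)

lemma l2_mult_integrable:
  assumes f: "f \<in> l2 M" and g: "g \<in> l2 M"
  shows "integrable M (\<lambda>x. f x * g x)"
proof (rule Bochner_Integration.integrable_bound)
  show "integrable M (\<lambda>x. (norm (f x))\<^sup>2 + (norm (g x))\<^sup>2)"
    using f g by (auto simp: l2_integrable)
  show "(\<lambda>x. f x * g x) \<in> borel_measurable M"
    using f g by (auto simp: l2_measurable)
  have "norm a * norm b \<le> (norm a)\<^sup>2 + (norm b)\<^sup>2" for a b :: complex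
  proof -
    have "2 * (norm a * norm b) \<le> (norm a)\<^sup>2 + (norm b)\<^sup>2"
      using sum_squares_bound[of "norm a" "norm b"] by simp
    moreover have "0 \<le> norm a * norm b" by simp
    ultimately show ?thesis by linarith
  qed
  then show "AE x in M. norm (f x * g x) \<le> norm ((norm (f x))\<^sup>2 + (norm (g x))\<^sup>2)"
    by (auto simp: norm_mult)
qed

lemma l2_ip_integrable: "f \<in> l2 M \<Longrightarrow> g \<in> l2 M \<Longrightarrow> integrable M (\<lambda>x. f x * cnj (g x))"
  by (rule l2_mult_integrable) (auto intro: l2_cnj)

lemma nm_nonneg [simp]: "0 \<le> nm M f"
  by (simp add: nm_def)

lemma nm_power2: "(nm M f)\<^sup>2 = (\<integral>x. (norm (f x))\<^sup>2 \<partial>M)"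
  by (simp add: nm_def)

lemma ip_self: "ip M f f = of_real ((nm M f)\<^sup>2)"
  unfolding ip_def nm_power2 integral_complex_of_real[symmetric]
  by (rule Bochner_Integration.integral_cong) (simp_all only: complex_norm_square)

lemma ip_cnj: "cnj (ip M f g) = ip M g f"
  unfolding ip_def Bochner_Integration.integral_cnj[symmetric] by (simp add: mult.commute)

lemma ip_add_left: "f \<in> l2 M \<Longrightarrow> g \<in> l2 M \<Longrightarrow> h \<in> l2 M \<Longrightarrow> ip M (\<lambda>x. f x + g x) h = ip M f h + ip M g h"
  by (simp add: ip_def distrib_right l2_ip_integrable)

lemma ip_diff_left: "f \<in> l2 M \<Longrightarrow> g \<in> l2 M \<Longrightarrow> h \<in> l2 M \<Longrightarrow> ip M (\<lambda>x. f x - g x) h = ip M f h - ip M g h"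
  by (simp add: ip_def left_diff_distrib l2_ip_integrable)

lemma ip_scale_left: "ip M (\<lambda>x. c * f x) h = c * ip M f h"
  by (simp add: ip_def mult.assoc)

lemma ip_add_right: "f \<in> l2 M \<Longrightarrow> g \<in> l2 M \<Longrightarrow> h \<in> l2 M \<Longrightarrow> ip M h (\<lambda>x. f x + g x) = ip M h f + ip M h g"
  by (simp add: ip_def distrib_left l2_ip_integrable)

lemma ip_diff_right: "f \<in> l2 M \<Longrightarrow> g \<in> l2 M \<Longrightarrow> h \<in> l2 M \<Longrightarrow> ip M h (\<lambda>x. f x - g x) = ip M h f - ip M h g"
  by (simp add: ip_def right_diff_distrib l2_ip_integrable)

lemma ip_scale_right: "ip M h (\<lambda>x. c * f x) = cnj c * ip M h f"
  by (simp add: ip_def mult.left_commute)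

lemma ip_sum_left:
  "finite I \<Longrightarrow> (\<And>i. i \<in> I \<Longrightarrow> f i \<in> l2 M) \<Longrightarrow> h \<in> l2 M \<Longrightarrow> ip M (\<lambda>x. \<Sum>i\<in>I. f i x) h = (\<Sum>i\<in>I. ip M (f i) h)"
  by (simp add: ip_def sum_distrib_right l2_ip_integrable)

lemma ip_sum_right:
  "finite I \<Longrightarrow> (\<And>i. i \<in> I \<Longrightarrow> f i \<in> l2 M) \<Longrightarrow> h \<in> l2 M \<Longrightarrow> ip M h (\<lambda>x. \<Sum>i\<in>I. f i x) = (\<Sum>i\<in>I. ip M h (f i))"
  by (simp add: ip_def sum_distrib_left l2_ip_integrable)

lemma nm_scale: "nm M (\<lambda>x. c * f x) = norm c * nm M f"
  by (simp add: nm_def norm_mult power_mult_distrib real_sqrt_mult)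

lemma nm_cnj: "nm M (\<lambda>x. cnj (f x)) = nm M f"
  by (simp add: nm_def)

lemma nm_minus_commute: "nm M (\<lambda>x. f x - g x) = nm M (\<lambda>x. g x - f x)"
  by (simp add: nm_def norm_minus_commute)

lemma nm_add_power2:
  assumes "f \<in> l2 M" "g \<in> l2 M"
  shows "(nm M (\<lambda>x. f x + g x))\<^sup>2 = (nm M f)\<^sup>2 + 2 * Re (ip M f g) + (nm M g)\<^sup>2"
proof -
  have "complex_of_real ((nm M (\<lambda>x. f x + g x))\<^sup>2) = ip M (\<lambda>x. f x + g x) (\<lambda>x. f x + g x)"
    by (simp add: ip_self)
  also have "\<dots> = ip M f f + ip M f g + (cnj (ip M f g) + ip M g g)"
    using assms by (simp add: ip_add_left ip_add_right l2_add ip_cnj)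
  also have "\<dots> = of_real ((nm M f)\<^sup>2 + 2 * Re (ip M f g) + (nm M g)\<^sup>2)"
    by (simp add: ip_self complex_eq_iff)
  finally show ?thesis
    using of_real_eq_iff by blast
qed

lemma nm_diff_power2:
  assumes "f \<in> l2 M" "g \<in> l2 M"
  shows "(nm M (\<lambda>x. f x - g x))\<^sup>2 = (nm M f)\<^sup>2 - 2 * Re (ip M f g) + (nm M g)\<^sup>2"
  using nm_add_power2[OF assms(1) l2_scale[OF assms(2), of "-1"]]
    nm_scale[of M "-1" g] by (simp add: ip_scale_right[where c = "-1", simplified])

lemma nm_eq_0_iff: "f \<in> l2 M \<Longrightarrow> nm M f = 0 \<longleftrightarrow> (AE x in M. f x = 0)"
  by (simp add: nm_def integral_nonneg_eq_0_iff_AE l2_integrable)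

lemma nm_AE_cong:
  assumes "AE x in M. f x = g x" "f \<in> borel_measurable M" "g \<in> borel_measurable M"
  shows "nm M f = nm M g"
  unfolding nm_def by (intro arg_cong[where f = sqrt] integral_cong_AE) (use assms in auto)

lemma ip_AE_cong:
  assumes "AE x in M. f x = f' x" "f \<in> borel_measurable M" "f' \<in> borel_measurable M"
    "AE x in M. g x = g' x" "g \<in> borel_measurable M" "g' \<in> borel_measurable M"
  shows "ip M f g = ip M f' g'"
  unfolding ip_def by (intro integral_cong_AE) (use assms in auto)

section \<open>Cauchy-Schwarz inequality, continuity of inner product and norm\<close>

theorem Cauchy_Schwarz_l2:
  assumes "f \<in> l2 M" "g \<in> l2 M"
  shows "norm (ip M f g) \<le> nm M f * nm M g"
proof (cases "nm M g = 0")
  case True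
  then have "AE x in M. g x = 0"
    using assms nm_eq_0_iff by blast
  then have "ip M f g = ip M f (\<lambda>x. 0)"
    by (intro ip_AE_cong) (use assms in \<open>auto simp: l2_measurable\<close>)
  then show ?thesis by (simp add: ip_def)
next
  case False
  \<comment> \<open>\<open>c * g\<close> is the orthogonal projection of \<open>f\<close> onto the
    line through \<open>g\<close>; expanding the squared distance of \<open>f\<close> from it gives
    the inequality.\<close>
  define c where "c = ip M f g / of_real ((nm M g)\<^sup>2)"
  have c: "norm c = norm (ip M f g) / (nm M g)\<^sup>2"
    by (simp add: c_def norm_divide norm_power)
  have "cnj c * ip M f g = of_real ((norm (ip M f g))\<^sup>2 / (nm M g)\<^sup>2)"
    unfolding c_def
    by (simp add: complex_norm_square mult.commute del: of_real_power)
  then have re: "Re (cnj c * ip M f g) = (norm (ip M f g))\<^sup>2 / (nm M g)\<^sup>2"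
    by (simp del: of_real_divide of_real_power)
  have "0 \<le> (nm M (\<lambda>x. f x - c * g x))\<^sup>2" by simp
  also have "\<dots> = (nm M f)\<^sup>2 - 2 * Re (cnj c * ip M f g) + (norm c * nm M g)\<^sup>2"
    using assms by (simp add: nm_diff_power2 l2_scale ip_scale_right nm_scale)
  also have "(norm c * nm M g)\<^sup>2 = (norm (ip M f g))\<^sup>2 / (nm M g)\<^sup>2"
    using False by (simp add: c power_mult_distrib power_divide power2_eq_square)
  finally have "(norm (ip M f g))\<^sup>2 / (nm M g)\<^sup>2 \<le> (nm M f)\<^sup>2"
    unfolding re by simp
  then have "(norm (ip M f g))\<^sup>2 \<le> (nm M f * nm M g)\<^sup>2"
    using False by (simp add: divide_simps power_mult_distrib split: if_splits)
  then show ?thesis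
    by (rule power2_le_imp_le) simp
qed

lemma nm_triangle:
  assumes "f \<in> l2 M" "g \<in> l2 M"
  shows "nm M (\<lambda>x. f x + g x) \<le> nm M f + nm M g"
proof (rule power2_le_imp_le)
  have "Re (ip M f g) \<le> nm M f * nm M g"
    using Cauchy_Schwarz_l2[OF assms] complex_Re_le_cmod order_trans by blast
  then show "(nm M (\<lambda>x. f x + g x))\<^sup>2 \<le> (nm M f + nm M g)\<^sup>2"
    by (simp add: nm_add_power2[OF assms] power2_sum)
qed simp

lemma nm_triangle_diff:
  assumes "f \<in> l2 M" "g \<in> l2 M" "h \<in> l2 M"
  shows "nm M (\<lambda>x. f x - h x) \<le> nm M (\<lambda>x. f x - g x) + nm M (\<lambda>x. g x - h x)"
  using nm_triangle[of "\<lambda>x. f x - g x" M "\<lambda>x. g x - h x"] assms by (simp add: l2_diff)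

lemma nm_le_add_diff:
  assumes "f \<in> l2 M" "g \<in> l2 M"
  shows "nm M f \<le> nm M (\<lambda>x. f x - g x) + nm M g"
  using nm_triangle_diff[of f M g "\<lambda>x. 0"] assms by simp

lemma nm_mult_bounded_le:
  assumes f: "f \<in> l2 M" and s: "s \<in> borel_measurable M" and b: "\<And>x. x \<in> space M \<Longrightarrow> norm (s x) \<le> B" and "0 \<le> B"
  shows "nm M (\<lambda>x. s x * f x) \<le> B * nm M f"
proof (rule power2_le_imp_le)
  have "(nm M (\<lambda>x. s x * f x))\<^sup>2 \<le> (\<integral>x. B\<^sup>2 * (norm (f x))\<^sup>2 \<partial>M)"
    unfolding nm_power2
    by (rule integral_mono)
      (use l2_integrable[OF l2_mult_bounded[OF f s b]] l2_integrable[OF f] b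
        in \<open>auto simp: norm_mult power_mult_distrib intro!: mult_right_mono power_mono\<close>)
  then show "(nm M (\<lambda>x. s x * f x))\<^sup>2 \<le> (B * nm M f)\<^sup>2"
    by (simp add: power_mult_distrib nm_power2)
qed (use \<open>0 \<le> B\<close> in simp)

lemma tendsto_ip:
  assumes "\<And>n. s n \<in> l2 M" "\<And>n. t n \<in> l2 M" "f \<in> l2 M" "g \<in> l2 M"
    and s: "(\<lambda>n. nm M (\<lambda>x. s n x - f x)) \<longlonglongrightarrow> 0" and t: "(\<lambda>n. nm M (\<lambda>x. t n x - g x)) \<longlonglongrightarrow> 0"
  shows "(\<lambda>n. ip M (s n) (t n)) \<longlonglongrightarrow> ip M f g"
proof (rule Lim_null[THEN iffD2], rule Lim_null_comparison)
  let ?a = "\<lambda>n. nm M (\<lambda>x. s n x - f x)" and ?b = "\<lambda>n. nm M (\<lambda>x. t n x - g x)"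
  show "\<forall>\<^sub>F n in sequentially. norm (ip M (s n) (t n) - ip M f g) \<le> ?a n * (?b n + nm M g) + nm M f * ?b n"
  proof (intro always_eventually allI)
    fix n
    have "ip M (s n) (t n) - ip M f g = ip M (\<lambda>x. s n x - f x) (t n) + ip M f (\<lambda>x. t n x - g x)"
      using assms by (simp add: ip_diff_left ip_diff_right)
    also have "norm \<dots> \<le> ?a n * nm M (t n) + nm M f * ?b n"
      by (intro norm_triangle_mono Cauchy_Schwarz_l2) (use assms in \<open>auto intro: l2_diff\<close>)
    also have "\<dots> \<le> ?a n * (?b n + nm M g) + nm M f * ?b n"
      by (intro add_right_mono mult_left_mono nm_le_add_diff) (use assms in auto)
    finally show "norm (ip M (s n) (t n) - ip M f g) \<le> ?a n * (?b n + nm M g) + nm M f * ?b n" .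
  qed
  show "(\<lambda>n. ?a n * (?b n + nm M g) + nm M f * ?b n) \<longlonglongrightarrow> 0"
    using tendsto_add[OF tendsto_mult[OF s tendsto_add[OF t tendsto_const]] tendsto_mult_left[OF t]] by simp
qed

lemma tendsto_nm:
  assumes "\<And>n. s n \<in> l2 M" "f \<in> l2 M" and s: "(\<lambda>n. nm M (\<lambda>x. s n x - f x)) \<longlonglongrightarrow> 0"
  shows "(\<lambda>n. nm M (s n)) \<longlonglongrightarrow> nm M f"
proof -
  have "(\<lambda>n. Re (ip M (s n) (s n))) \<longlonglongrightarrow> Re (ip M f f)"
    by (intro tendsto_Re tendsto_ip assms)
  then have "(\<lambda>n. sqrt ((nm M (s n))\<^sup>2)) \<longlonglongrightarrow> sqrt ((nm M f)\<^sup>2)"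
    unfolding ip_self Re_complex_of_real by (rule tendsto_real_sqrt)
  then show ?thesis by simp
qed

text \<open>Convergence in the seminorm says that the squared differences tend to zero in L^1, so
  the L^1 theorem on almost everywhere convergent subsequences applies to them.\<close>

lemma AE_subseq_nm:
  assumes "\<And>n. s n \<in> l2 M" "f \<in> l2 M" and s: "(\<lambda>n. nm M (\<lambda>x. s n x - f x)) \<longlonglongrightarrow> 0"
  shows "\<exists>r. strict_mono r \<and> (AE x in M. (\<lambda>n. s (r n) x) \<longlonglongrightarrow> f x)"
proof -
  have "(\<lambda>n. (nm M (\<lambda>x. s n x - f x))\<^sup>2) \<longlonglongrightarrow> 0"
    using tendsto_power[OF s, of 2] by simp
  then have "(\<lambda>n. \<integral>x. norm ((norm (s n x - f x))\<^sup>2) \<partial>M) \<longlonglongrightarrow> 0"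
    by (simp add: nm_power2)
  from tendsto_L1_AE_subseq[OF _ this] l2_integrable[OF l2_diff[OF assms(1,2)]]
  obtain r where r: "strict_mono r" "AE x in M. (\<lambda>n. (norm (s (r n) x - f x))\<^sup>2) \<longlonglongrightarrow> 0" by auto
  have "(\<lambda>n. s (r n) x) \<longlonglongrightarrow> f x" if "(\<lambda>n. (norm (s (r n) x - f x))\<^sup>2) \<longlonglongrightarrow> 0" for x
    using tendsto_real_sqrt[OF that] by (simp add: tendsto_norm_zero_iff LIM_zero_iff)
  then show ?thesis using r by auto
qed

lemma Cauchy_nm_if_tendsto:
  assumes "\<And>n. s n \<in> l2 M" "f \<in> l2 M" and s: "(\<lambda>n. nm M (\<lambda>x. s n x - f x)) \<longlonglongrightarrow> 0" and "0 < e"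
  shows "\<exists>N. \<forall>m\<ge>N. \<forall>n\<ge>N. nm M (\<lambda>x. s m x - s n x) < e"
proof -
  obtain N where N: "nm M (\<lambda>x. s n x - f x) < e / 2" if "n \<ge> N" for n
    using order_tendstoD(2)[OF s, of "e / 2"] \<open>0 < e\<close> by (auto simp: eventually_sequentially)
  have "nm M (\<lambda>x. s m x - s n x) < e" if "m \<ge> N" "n \<ge> N" for m n
    using nm_triangle_diff[of "s m" M f "s n"] N[OF that(1)] N[OF that(2)] assms
    by (simp add: nm_minus_commute[of M f])
  then show ?thesis by blast
qed

text \<open>With \<open>\<parallel>d\<^sub>k\<parallel> \<le> 2\<^sup>-\<^sup>k\<close> the sum of \<open>2\<^sup>k |d\<^sub>k|\<^sup>2\<close> is integrable, so \<open>|d\<^sub>k|\<close> is almost everywhere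
  dominated by a geometric sequence.\<close>

lemma AE_summable_if_nm_geometric:
  assumes d: "\<And>k. d k \<in> l2 M" and le: "\<And>k. nm M (d k) \<le> (1/2) ^ k"
  shows "AE x in M. summable (\<lambda>k. d k x)"
proof -
  have [measurable]: "d k \<in> borel_measurable M" for k using d by (simp add: l2_measurable)
  have "(\<integral>\<^sup>+x. (\<Sum>k. ennreal (2 ^ k * (norm (d k x))\<^sup>2)) \<partial>M) = (\<Sum>k. \<integral>\<^sup>+x. ennreal (2 ^ k * (norm (d k x))\<^sup>2) \<partial>M)"
    by (rule nn_integral_suminf) measurable
  also have "\<dots> = (\<Sum>k. ennreal (2 ^ k * (nm M (d k))\<^sup>2))"
    using l2_integrable[OF d] by (subst nn_integral_eq_integral) (auto simp: nm_power2)
  also have "\<dots> \<le> (\<Sum>k. ennreal ((1/2) ^ k))"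
  proof (intro suminf_le ennreal_leI)
    fix k
    have "(nm M (d k))\<^sup>2 \<le> ((1/2) ^ k)\<^sup>2" by (intro power_mono le) simp
    then have "2 ^ k * (nm M (d k))\<^sup>2 \<le> 2 ^ k * ((1/2) ^ k)\<^sup>2" by simp
    also have "\<dots> = (1/2) ^ k"
      by (simp add: power2_eq_square power_divide)
    finally show "2 ^ k * (nm M (d k))\<^sup>2 \<le> (1/2) ^ k" .
  qed auto
  also have "\<dots> < \<infinity>"
    by (subst suminf_ennreal2) (auto simp: summable_geometric)
  finally have "(\<integral>\<^sup>+x. (\<Sum>k. ennreal (2 ^ k * (norm (d k x))\<^sup>2)) \<partial>M) \<noteq> \<infinity>" by simp
  then have "AE x in M. (\<Sum>k. ennreal (2 ^ k * (norm (d k x))\<^sup>2)) \<noteq> \<infinity>"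
    by (intro nn_integral_PInf_AE) measurable
  then show ?thesis
  proof eventually_elim
    case (elim x)
    have "\<exists>C\<ge>0. y = ennreal C" if "y \<noteq> \<infinity>" for y
      using that by (cases y) auto
    from this[OF elim]
    obtain C where C: "(\<Sum>k. ennreal (2 ^ k * (norm (d k x))\<^sup>2)) = ennreal C" "0 \<le> C" by blast
    have bound: "norm (d k x) \<le> sqrt C * (1 / sqrt 2) ^ k" for k
    proof (rule power2_le_imp_le)
      have sq: "((1 / sqrt 2) ^ k)\<^sup>2 = (1 / 2 :: real) ^ k"
        by (simp add: power2_eq_square flip: power_mult_distrib)
      have "ennreal (2 ^ k * (norm (d k x))\<^sup>2) \<le> ennreal C"
        unfolding C(1)[symmetric]
        by (rule sum_le_suminf[of _ "{k}", simplified sum.insert sum.empty finite.intros, simplified]) simp_all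
      then have "2 ^ k * (norm (d k x))\<^sup>2 \<le> C" using C(2) by (simp add: ennreal_le_iff)
      then have "(norm (d k x))\<^sup>2 \<le> C / 2 ^ k" by (simp add: field_simps)
      also have "\<dots> = (sqrt C * (1 / sqrt 2) ^ k)\<^sup>2"
        using C(2) by (simp only: power_mult_distrib sq real_sqrt_pow2) (simp add: power_divide)
      finally show "(norm (d k x))\<^sup>2 \<le> (sqrt C * (1 / sqrt 2) ^ k)\<^sup>2" .
    qed (use C(2) in simp)
    show ?case
      by (rule summable_comparison_test'[OF _ bound]) (auto intro!: summable_mult summable_geometric)
  qed
qed

text \<open>Riesz-Fischer: a subsequence with geometrically small steps converges almost everywhere,
  and Fatou's lemma carries the Cauchy estimate over to its limit, which gives convergence of the
  full sequence.\<close>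

theorem l2_complete:
  assumes s: "\<And>n. s n \<in> l2 M"
    and C: "\<And>e. 0 < e \<Longrightarrow> \<exists>N. \<forall>m\<ge>N. \<forall>n\<ge>N. nm M (\<lambda>x. s m x - s n x) < e"
  shows "\<exists>f\<in>l2 M. (\<lambda>n. nm M (\<lambda>x. s n x - f x)) \<longlonglongrightarrow> 0"
proof -
  obtain N where N: "\<And>k m n. m \<ge> N k \<Longrightarrow> n \<ge> N k \<Longrightarrow> nm M (\<lambda>x. s m x - s n x) < (1/2) ^ k"
    using C[of "(1/2) ^ _"] by (metis zero_less_divide_1_iff zero_less_numeral zero_less_power)
  \<comment> \<open>Taking the maximum makes \<open>r\<close> strictly increasing while still
    passing every threshold \<open>N k\<close>.\<close>
  define r where "r = rec_nat (N 0) (\<lambda>k m. max (Suc m) (N (Suc k)))"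
  have r0: "r 0 = N 0" and rS: "r (Suc k) = max (Suc (r k)) (N (Suc k))" for k
    by (simp_all add: r_def)
  have mono: "strict_mono r"
    by (rule strict_mono_Suc_iff[THEN iffD2]) (simp add: rS less_max_iff_disj)
  have rN: "r k \<ge> N k" for k by (cases k) (simp_all add: r0 rS)
  have [measurable]: "s n \<in> borel_measurable M" for n using s by (simp add: l2_measurable)
  define d where "d k x = s (r (Suc k)) x - s (r k) x" for k x
  have "AE x in M. summable (\<lambda>k. d k x)"
  proof (rule AE_summable_if_nm_geometric)
    show "d k \<in> l2 M" for k unfolding d_def by (intro l2_diff s)
    have "r (Suc k) \<ge> N k" for k
      using rN[of k] mono by (meson lessI less_imp_le order_trans strict_monoD)
    then show "nm M (d k) \<le> (1/2) ^ k" for k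
      unfolding d_def by (intro less_imp_le[OF N] rN)
  qed
  moreover have tel: "s (r 0) x + (\<Sum>k<n. d k x) = s (r n) x" for x n
  proof (induction n)
    case (Suc n)
    then show ?case unfolding sum.lessThan_Suc add.assoc[symmetric] Suc by (simp add: d_def)
  qed simp
  ultimately have conv: "AE x in M. convergent (\<lambda>n. s (r n) x)"
  proof (elim AE_mp, intro AE_I2 impI)
    fix x assume "summable (\<lambda>k. d k x)"
    from tendsto_add[OF tendsto_const[of "s (r 0) x"] summable_LIMSEQ[OF this]]
    show "convergent (\<lambda>n. s (r n) x)" unfolding tel convergent_def by blast
  qed
  define f where "f x = lim (\<lambda>n. s (r n) x)" for x
  have [measurable]: "f \<in> borel_measurable M" unfolding f_def by measurable
  have lim: "AE x in M. (\<lambda>n. s (r n) x) \<longlonglongrightarrow> f x"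
    using conv by eventually_elim (simp add: f_def convergent_LIMSEQ_iff)
  have fatou: "(\<integral>\<^sup>+x. ennreal ((norm (s n x - f x))\<^sup>2) \<partial>M) \<le> ennreal (e\<^sup>2)"
    if e: "0 < e" and n: "\<And>m m'. m \<ge> n0 \<Longrightarrow> m' \<ge> n0 \<Longrightarrow> nm M (\<lambda>x. s m x - s m' x) < e" "n \<ge> n0" for e n n0
  proof -
    have "(\<integral>\<^sup>+x. ennreal ((norm (s n x - f x))\<^sup>2) \<partial>M)
      = (\<integral>\<^sup>+x. liminf (\<lambda>k. ennreal ((norm (s n x - s (r k) x))\<^sup>2)) \<partial>M)"
    proof (intro nn_integral_cong_AE, use lim in eventually_elim)
      case (elim x)
      then have "(\<lambda>k. ennreal ((norm (s n x - s (r k) x))\<^sup>2)) \<longlonglongrightarrow> ennreal ((norm (s n x - f x))\<^sup>2)"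
        by (intro tendsto_intros)
      then show ?case by (intro lim_imp_Liminf[symmetric]) auto
    qed
    also have "\<dots> \<le> liminf (\<lambda>k. \<integral>\<^sup>+x. ennreal ((norm (s n x - s (r k) x))\<^sup>2) \<partial>M)"
      by (rule nn_integral_liminf) measurable
    also have "\<dots> \<le> ennreal (e\<^sup>2)"
    proof (rule order_trans[OF Liminf_le_Limsup[OF sequentially_bot] Limsup_bounded], rule eventually_sequentiallyI[of n0])
      fix k assume "n0 \<le> k"
      then have "r k \<ge> n0" using mono by (meson order_trans seq_suble)
      then have "(nm M (\<lambda>x. s n x - s (r k) x))\<^sup>2 \<le> e\<^sup>2"
        using n(2) by (intro power_mono less_imp_le[OF n(1)] nm_nonneg)
      then show "(\<integral>\<^sup>+x. ennreal ((norm (s n x - s (r k) x))\<^sup>2) \<partial>M) \<le> ennreal (e\<^sup>2)"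
        using l2_integrable[OF l2_diff[OF s s]]
        by (subst nn_integral_eq_integral) (auto simp: nm_power2 intro!: ennreal_leI)
    qed
    finally show ?thesis .
  qed
  have fin: "(\<lambda>x. s n x - f x) \<in> l2 M \<and> nm M (\<lambda>x. s n x - f x) \<le> e"
    if e: "0 < e" and n: "\<And>m m'. m \<ge> n0 \<Longrightarrow> m' \<ge> n0 \<Longrightarrow> nm M (\<lambda>x. s m x - s m' x) < e" "n \<ge> n0" for e n n0
  proof -
    note F = fatou[OF that]
    have "integrable M (\<lambda>x. (norm (s n x - f x))\<^sup>2)"
      using le_less_trans[OF F] by (intro integrableI_nonneg) auto
    then have "(\<lambda>x. s n x - f x) \<in> l2 M" by (intro l2I) measurable
    moreover have "(nm M (\<lambda>x. s n x - f x))\<^sup>2 \<le> e\<^sup>2"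
      unfolding nm_power2 using integral_real_bounded[OF _ F] by simp
    ultimately show ?thesis using e by (auto intro: power2_le_imp_le)
  qed
  \<comment> \<open>So far only differences of \<open>f\<close> from members of the sequence are
    known to be square integrable; \<open>f\<close> is recovered from one of them.\<close>
  have "(\<lambda>x. s (N 0) x - (s (N 0) x - f x)) \<in> l2 M"
    using N[of 0] by (intro l2_diff s fin[THEN conjunct1, of 1 "N 0"]) auto
  then have "f \<in> l2 M" by simp
  moreover have "(\<lambda>n. nm M (\<lambda>x. s n x - f x)) \<longlonglongrightarrow> 0"
  proof (rule LIMSEQ_I)
    fix e :: real assume "0 < e"
    then obtain n0 where n0: "\<forall>m\<ge>n0. \<forall>n\<ge>n0. nm M (\<lambda>x. s m x - s n x) < e / 2"
      using C[of "e / 2"] by auto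
    have "nm M (\<lambda>x. s n x - f x) \<le> e / 2" if "n \<ge> n0" for n
      using fin[of "e / 2" n0 n] n0 that \<open>0 < e\<close> by auto
    then show "\<exists>no. \<forall>n\<ge>no. norm (nm M (\<lambda>x. s n x - f x) - 0) < e"
      using \<open>0 < e\<close> by (intro exI[of _ n0]) force
  qed
  ultimately show ?thesis by blast
qed

section \<open>Orthonormal systems\<close>

text \<open>Zero vectors are allowed, so that the Gram--Schmidt process need not skip dependent vectors.\<close>

definition orthosys :: "'a measure \<Rightarrow> ('i \<Rightarrow> 'a \<Rightarrow> complex) \<Rightarrow> bool" where
  "orthosys M e \<longleftrightarrow> (\<forall>i. e i \<in> l2 M) \<and> (\<forall>i j. i \<noteq> j \<longrightarrow> ip M (e i) (e j) = 0) \<and>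
     (\<forall>i. ip M (e i) (e i) = 1 \<or> nm M (e i) = 0)"

definition total_in_l2 :: "'a measure \<Rightarrow> ('i \<Rightarrow> 'a \<Rightarrow> complex) \<Rightarrow> bool" where
  "total_in_l2 M e \<longleftrightarrow> (\<forall>g\<in>l2 M. (\<forall>i. ip M g (e i) = 0) \<longrightarrow> nm M g = 0)"

lemma orthosys_l2: "orthosys M e \<Longrightarrow> e i \<in> l2 M"
  by (simp add: orthosys_def)

text \<open>For a zero vector both sides vanish by Cauchy-Schwarz, so the usual Kronecker rule
  survives once it is multiplied by the coefficient.\<close>

lemma ip_orthosys:
  assumes "orthosys M e" "f \<in> l2 M"
  shows "ip M f (e j) * ip M (e i) (e j) = (if i = j then ip M f (e i) else 0)"
proof -
  have "nm M (e i) = 0 \<Longrightarrow> ip M f (e i) = 0"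
    using Cauchy_Schwarz_l2[OF assms(2), of "e i"] assms(1) by (simp add: orthosys_def)
  then show ?thesis using assms(1) by (auto simp: orthosys_def)
qed

lemma ip_orthosum:
  assumes e: "orthosys M e" and f: "f \<in> l2 M" and "finite I"
  shows "ip M (\<lambda>x. \<Sum>i\<in>I. ip M f (e i) * e i x) (e j) = (if j \<in> I then ip M f (e j) else 0)"
proof -
  have "ip M f (e i) * ip M (e i) (e j) = (if i = j then ip M f (e j) else 0)" for i
    using ip_orthosys[OF e f, of j i] e by (cases "i = j") (auto simp: orthosys_def)
  then show ?thesis
    using assms orthosys_l2[OF e] by (simp add: ip_sum_left l2_scale ip_scale_left)
qed

lemma nm_orthosum_power2:
  assumes e: "orthosys M e" and f: "f \<in> l2 M" and "finite I"
  shows "(nm M (\<lambda>x. \<Sum>i\<in>I. ip M f (e i) * e i x))\<^sup>2 = (\<Sum>i\<in>I. (norm (ip M f (e i)))\<^sup>2)" (is "(nm M ?P)\<^sup>2 = ?S")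
proof -
  have P: "?P \<in> l2 M" by (intro l2_sum l2_scale orthosys_l2[OF e])
  have "complex_of_real ((nm M ?P)\<^sup>2) = ip M ?P ?P" by (simp add: ip_self)
  also have "\<dots> = (\<Sum>i\<in>I. cnj (ip M f (e i)) * ip M ?P (e i))"
    using P assms orthosys_l2[OF e] by (simp add: ip_sum_right l2_scale ip_scale_right)
  also have "\<dots> = (\<Sum>i\<in>I. complex_of_real ((norm (ip M f (e i)))\<^sup>2))"
    by (intro sum.cong refl) (simp only: ip_orthosum[OF assms] if_True complex_norm_square, simp only: mult.commute)
  also have "\<dots> = complex_of_real ?S" by simp
  finally show ?thesis using of_real_eq_iff by blast
qed

text \<open>When the square is expanded, the cross term and the squared norm of the partial sum are
  the same sum, of which one copy with a minus sign is left.\<close>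

lemma Bessel_identity:
  assumes e: "orthosys M e" and f: "f \<in> l2 M" and "finite I"
  shows "(nm M (\<lambda>x. f x - (\<Sum>i\<in>I. ip M f (e i) * e i x)))\<^sup>2 = (nm M f)\<^sup>2 - (\<Sum>i\<in>I. (norm (ip M f (e i)))\<^sup>2)"
proof -
  let ?P = "\<lambda>x. \<Sum>i\<in>I. ip M f (e i) * e i x"
  have P: "?P \<in> l2 M" by (intro l2_sum l2_scale orthosys_l2[OF e])
  have "ip M f ?P = (\<Sum>i\<in>I. cnj (ip M f (e i)) * ip M f (e i))"
    using assms orthosys_l2[OF e] by (simp add: ip_sum_right l2_scale ip_scale_right)
  also have "\<dots> = (\<Sum>i\<in>I. complex_of_real ((norm (ip M f (e i)))\<^sup>2))"
    by (intro sum.cong refl) (simp only: complex_norm_square mult.commute)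
  finally have "Re (ip M f ?P) = (\<Sum>i\<in>I. (norm (ip M f (e i)))\<^sup>2)" by simp
  then show ?thesis
    using nm_diff_power2[OF f P] nm_orthosum_power2[OF assms] by simp
qed

lemma Bessel_inequality:
  assumes "orthosys M e" "f \<in> l2 M" "finite I"
  shows "(\<Sum>i\<in>I. (norm (ip M f (e i)))\<^sup>2) \<le> (nm M f)\<^sup>2"
proof -
  have "0 \<le> (nm M (\<lambda>x. f x - (\<Sum>i\<in>I. ip M f (e i) * e i x)))\<^sup>2" by (rule zero_le_power2)
  then show ?thesis unfolding Bessel_identity[OF assms] by simp
qed

text \<open>The squared coefficients are summable by Bessel, so the partial sums are Cauchy; their
  limit has the coefficients of \<open>f\<close>, and totality identifies the two. General
  exhausting index sets \<open>I N\<close> are kept because both initial segments and squares of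
  pairs occur later.\<close>

theorem orthosys_expansion:
  assumes e: "orthosys M e" and tot: "total_in_l2 M e" and f: "f \<in> l2 M"
    and fin: "\<And>N. finite (I N)" and mono: "incseq I" and cover: "\<And>i. \<exists>N. i \<in> I N"
  shows "(\<lambda>N. nm M (\<lambda>x. (\<Sum>i\<in>I N. ip M f (e i) * e i x) - f x)) \<longlonglongrightarrow> 0"
proof -
  define P where "P N x = (\<Sum>i\<in>I N. ip M f (e i) * e i x)" for N x
  define S where "S N = (\<Sum>i\<in>I N. (norm (ip M f (e i)))\<^sup>2)" for N
  have P: "P N \<in> l2 M" for N unfolding P_def by (intro l2_sum l2_scale orthosys_l2[OF e])
  have diff: "(nm M (\<lambda>x. P n x - P m x))\<^sup>2 = S n - S m" if "m \<le> n" for m n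
  proof -
    have sub: "I m \<subseteq> I n" using mono that by (simp add: incseq_def)
    have "(\<lambda>x. P n x - P m x) = (\<lambda>x. \<Sum>i\<in>I n - I m. ip M f (e i) * e i x)"
      unfolding P_def by (intro ext) (simp add: sum_diff[OF fin sub])
    then show ?thesis
      using nm_orthosum_power2[OF e f, of "I n - I m"] fin by (simp add: S_def sum_diff[OF fin sub])
  qed
  have "incseq S"
  proof (rule monoI)
    fix m n :: nat assume "m \<le> n"
    from diff[OF this] zero_le_power2[of "nm M (\<lambda>x. P n x - P m x)"] show "S m \<le> S n" by linarith
  qed
  moreover have "S N \<le> (nm M f)\<^sup>2" for N
    unfolding S_def by (rule Bessel_inequality[OF e f fin])
  ultimately have "convergent S"
    by (metis incseq_convergent convergentI)
  then have S: "Cauchy S" by (simp add: Cauchy_convergent_iff)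
  have "\<exists>N. \<forall>m\<ge>N. \<forall>n\<ge>N. nm M (\<lambda>x. P m x - P n x) < d" if "0 < d" for d
  proof -
    obtain N where N: "\<And>m n. m \<ge> N \<Longrightarrow> n \<ge> N \<Longrightarrow> \<bar>S m - S n\<bar> < d\<^sup>2"
      using metric_CauchyD[OF S, of "d\<^sup>2"] \<open>0 < d\<close> by (auto simp: dist_real_def)
    have "nm M (\<lambda>x. P m x - P n x) < d" if "m \<ge> N" "n \<ge> N" for m n
    proof (rule power2_less_imp_less)
      have "(nm M (\<lambda>x. P m x - P n x))\<^sup>2 = \<bar>S m - S n\<bar>"
        using diff[of m n] diff[of n m] nm_minus_commute[of M "P m" "P n"]
          zero_le_power2[of "nm M (\<lambda>x. P n x - P m x)"]
        by (cases "m \<le> n") auto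
      then show "(nm M (\<lambda>x. P m x - P n x))\<^sup>2 < d\<^sup>2" using N[OF that] by simp
    qed (use \<open>0 < d\<close> in simp)
    then show ?thesis by blast
  qed
  from l2_complete[OF P this] obtain g where g: "g \<in> l2 M" and lim: "(\<lambda>n. nm M (\<lambda>x. P n x - g x)) \<longlonglongrightarrow> 0"
    by blast
  have "ip M g (e i) = ip M f (e i)" for i
  proof (rule LIMSEQ_unique)
    show "(\<lambda>n. ip M (P n) (e i)) \<longlonglongrightarrow> ip M g (e i)"
      by (rule tendsto_ip) (use P g lim orthosys_l2[OF e] in \<open>auto simp: nm_def\<close>)
    obtain N where "i \<in> I N" using cover by blast
    then have "i \<in> I n" if "N \<le> n" for n using mono that by (meson incseqD subsetD)
    then have "\<forall>\<^sub>F n in sequentially. ip M (P n) (e i) = ip M f (e i)"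
      unfolding P_def by (intro eventually_sequentiallyI[of N]) (simp add: ip_orthosum[OF e f fin])
    then show "(\<lambda>n. ip M (P n) (e i)) \<longlonglongrightarrow> ip M f (e i)"
      by (rule tendsto_eventually)
  qed
  then have 0: "nm M (\<lambda>x. g x - f x) = 0"
    using tot f g orthosys_l2[OF e] by (auto simp: total_in_l2_def ip_diff_left l2_diff)
  have "nm M (\<lambda>x. P n x - f x) \<le> nm M (\<lambda>x. P n x - g x)" for n
    using nm_triangle_diff[of "P n" M g f] P g f 0 by simp
  then show ?thesis
    unfolding P_def[symmetric] by (intro tendsto_sandwich[OF _ _ tendsto_const lim]) auto
qed

lemma Parseval:
  assumes e: "orthosys M e" and tot: "total_in_l2 M e" and f: "f \<in> l2 M"
    and fin: "\<And>N. finite (I N)" and mono: "incseq I" and cover: "\<And>i. \<exists>N. i \<in> I N"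
  shows "(\<lambda>N. (nm M f)\<^sup>2 - (\<Sum>i\<in>I N. (norm (ip M f (e i)))\<^sup>2)) \<longlonglongrightarrow> 0"
  using tendsto_power[OF orthosys_expansion[OF assms], of 2]
  by (simp add: Bessel_identity[OF e f fin, symmetric] nm_minus_commute[of M f])

text \<open>A remainder of norm zero is divided by zero and becomes the zero function, which is the
  degenerate case that \<open>orthosys\<close> admits.\<close>

fun gram_schmidt :: "'a measure \<Rightarrow> (nat \<Rightarrow> 'a \<Rightarrow> complex) \<Rightarrow> nat \<Rightarrow> 'a \<Rightarrow> complex" where
  "gram_schmidt M h n =
     (let r = (\<lambda>x. h n x - (\<Sum>i<n. ip M (h n) (gram_schmidt M h i) * gram_schmidt M h i x))
      in (\<lambda>x. r x / of_real (nm M r)))"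

declare gram_schmidt.simps [simp del]

lemma nm_divide: "nm M (\<lambda>x. f x / c) = nm M f / norm c"
  using nm_scale[of M "inverse c" f] by (simp add: divide_inverse mult.commute norm_inverse)

context
  fixes M :: "'a measure" and h :: "nat \<Rightarrow> 'a \<Rightarrow> complex"
  assumes h: "\<And>n. h n \<in> l2 M"
begin

private abbreviation "e \<equiv> gram_schmidt M h"

private definition "rem n x = h n x - (\<Sum>i<n. ip M (h n) (e i) * e i x)"

private lemma e_eq: "e n = (\<lambda>x. rem n x / of_real (nm M (rem n)))"
  unfolding rem_def by (subst gram_schmidt.simps) (simp add: Let_def)

private lemma e_l2: "e n \<in> l2 M"
proof (induction n rule: less_induct)
  case (less n)
  have "(\<lambda>x. \<Sum>i<n. ip M (h n) (e i) * e i x) \<in> l2 M"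
    using less by (intro l2_sum l2_scale) auto
  then have "rem n \<in> l2 M"
    unfolding rem_def by (intro l2_diff h)
  then show ?case by (subst e_eq) (rule l2_divide)
qed

private lemma rem_l2: "rem n \<in> l2 M"
  unfolding rem_def by (intro l2_diff l2_sum l2_scale h e_l2)

private lemma e_norm: "ip M (e n) (e n) = 1 \<or> nm M (e n) = 0"
  by (cases "nm M (rem n) = 0") (simp_all add: ip_self nm_divide e_eq[of n] nm_def[of M "\<lambda>x. 0"])

private lemma e_orth: "j < n \<Longrightarrow> ip M (e n) (e j) = 0"
proof (induction n arbitrary: j rule: less_induct)
  case (less n)
  have orth: "ip M (e i) (e j) = 0" if "i < n" "j < n" "i \<noteq> j" for i j
  proof (cases "j < i")
    case False
    then have "ip M (e j) (e i) = 0" using less.IH[of j i] that by simp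
    then show ?thesis using ip_cnj[of M "e j" "e i"] by simp
  qed (use less.IH that in auto)
  have "ip M (rem n) (e j) = ip M (h n) (e j) - (\<Sum>i<n. ip M (h n) (e i) * ip M (e i) (e j))"
    unfolding rem_def
    by (subst ip_diff_left) (auto intro!: l2_sum simp: ip_sum_left ip_scale_left l2_scale h e_l2)
  also have "(\<Sum>i<n. ip M (h n) (e i) * ip M (e i) (e j)) = (\<Sum>i<n. if i = j then ip M (h n) (e i) * ip M (e j) (e j) else 0)"
    by (intro sum.cong) (use orth less.prems in auto)
  also have "\<dots> = ip M (h n) (e j) * ip M (e j) (e j)" using less.prems by simp
  \<comment> \<open>Either the last factor is 1, or \<open>e j\<close> has norm zero and both sides
    vanish.\<close>
  also have "\<dots> = ip M (h n) (e j)"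
    using e_norm[of j] Cauchy_Schwarz_l2[OF h[of n] e_l2[of j]] by auto
  finally have "ip M (rem n) (e j) = 0" by simp
  then show ?case
    using ip_scale_left[of M "inverse (of_real (nm M (rem n)))" "rem n" "e j"]
    by (simp add: e_eq[of n] divide_inverse mult.commute)
qed

lemma orthosys_gram_schmidt: "orthosys M e"
  unfolding orthosys_def
proof (intro conjI allI impI e_l2 e_norm)
  fix i j :: nat assume "i \<noteq> j"
  then consider "i < j" | "j < i" by linarith
  then show "ip M (e i) (e j) = 0"
  proof cases
    case 1
    then show ?thesis using e_orth[of i j] ip_cnj[of M "e j" "e i"] by simp
  qed (rule e_orth)
qed

text \<open>The limits given by admissibility concern translates, which play the role of
  \<open>h\<close>; these coefficients carry them over to the orthonormal system.\<close>

lemma gram_schmidt_combination: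
  "\<exists>c. \<forall>n x. e n x = (\<Sum>a\<le>n. c n a * h a x)"
proof -
  have "\<exists>c. \<forall>x. e n x = (\<Sum>a\<le>n. c a * h a x)" for n
  proof (induction n rule: less_induct)
    case (less n)
    then obtain c where c: "\<And>i x. i < n \<Longrightarrow> e i x = (\<Sum>a\<le>i. c i a * h a x)" by metis
    \<comment> \<open>Extending the coefficients by zero gives all inner sums the same range, so
      that the two sums can be interchanged.\<close>
    define c' where "c' i a = (if a \<le> i then c i a else 0)" for i a
    have c'_eq: "e i x = (\<Sum>a<n. c' i a * h a x)" if "i < n" for i x
    proof -
      have "(\<Sum>a<n. c' i a * h a x) = (\<Sum>a\<le>i. c' i a * h a x)"
        using that by (intro sum.mono_neutral_right) (auto simp: c'_def)
      also have "\<dots> = e i x" by (simp add: c[OF that] c'_def)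
      finally show ?thesis ..
    qed
    define t where "t a = (\<Sum>i<n. ip M (h n) (e i) * c' i a)" for a
    define b where "b a = (if a = n then 1 else - t a) / of_real (nm M (rem n))" for a
    have "e n x = (\<Sum>a\<le>n. b a * h a x)" for x
    proof -
      have "(\<Sum>i<n. ip M (h n) (e i) * e i x) = (\<Sum>i<n. \<Sum>a<n. ip M (h n) (e i) * c' i a * h a x)"
        by (intro sum.cong refl) (simp add: c'_eq sum_distrib_left mult.assoc)
      also have "\<dots> = (\<Sum>a<n. (\<Sum>i<n. ip M (h n) (e i) * c' i a) * h a x)"
        by (subst sum.swap) (simp add: sum_distrib_right)
      finally have "rem n x = h n x - (\<Sum>a<n. t a * h a x)"
        by (simp add: rem_def t_def)
      moreover have "(\<Sum>a\<le>n. b a * h a x) = b n * h n x + (\<Sum>a<n. b a * h a x)"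
        by (simp add: lessThan_Suc_atMost[symmetric])
      moreover have "(\<Sum>a<n. b a * h a x)
          = - (\<Sum>a<n. t a * h a x) / of_real (nm M (rem n))"
        by (simp add: b_def sum_negf sum_divide_distrib)
      ultimately show ?thesis by (simp add: e_eq[of n] b_def[of n] diff_divide_distrib)
    qed
    then show ?case by blast
  qed
  then show ?thesis by metis
qed

text \<open>Each \<open>h n\<close> is its remainder plus a combination of earlier
  \<open>e i\<close>, and the remainder is a multiple of \<open>e n\<close> or of norm zero, so
  orthogonality to all \<open>e i\<close> passes to all \<open>h n\<close>.\<close>

lemma total_gram_schmidt:
  assumes "total_in_l2 M h"
  shows "total_in_l2 M e"
  unfolding total_in_l2_def
proof (intro ballI impI)
  fix g assume g: "g \<in> l2 M" and 0: "\<forall>i. ip M g (e i) = 0"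
  have "ip M g (h n) = 0" for n
  proof -
    have r: "ip M g (rem n) = 0"
    proof (cases "nm M (rem n) = 0")
      case True
      then show ?thesis using Cauchy_Schwarz_l2[OF g rem_l2[of n]] by simp
    next
      case False
      then have "rem n = (\<lambda>x. of_real (nm M (rem n)) * e n x)" by (simp add: e_eq[of n])
      then have "ip M g (rem n) = of_real (nm M (rem n)) * ip M g (e n)"
        using ip_scale_right[of M g "of_real (nm M (rem n))" "e n"] by simp
      then show ?thesis using 0 by simp
    qed
    have "(\<lambda>x. rem n x + (\<Sum>i<n. ip M (h n) (e i) * e i x)) = h n" by (simp add: rem_def)
    moreover have "ip M g (\<lambda>x. rem n x + (\<Sum>i<n. ip M (h n) (e i) * e i x))
        = ip M g (rem n) + ip M g (\<lambda>x. \<Sum>i<n. ip M (h n) (e i) * e i x)"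
      by (intro ip_add_right rem_l2 l2_sum l2_scale e_l2 g)
    ultimately have "ip M g (h n) = ip M g (rem n) + ip M g (\<lambda>x. \<Sum>i<n. ip M (h n) (e i) * e i x)"
      by simp
    also have "\<dots> = 0"
      using 0 g by (simp add: r ip_sum_right l2_scale e_l2 ip_scale_right)
    finally show ?thesis .
  qed
  then show "nm M g = 0" using assms g by (auto simp: total_in_l2_def)
qed

end

section \<open>Weakly null sequences are bounded\<close>

text \<open>Sokal's gliding hump: each step of length \<open>3\<^sup>-\<^sup>k\<close> in the direction of a very long \<open>v\<^sub>k\<close>
  forces a large inner product, which the remaining steps cannot destroy.\<close>

theorem weakly_null_bounded:
  assumes u: "\<And>n. u n \<in> l2 M" and weak: "\<And>g. g \<in> l2 M \<Longrightarrow> (\<lambda>n. ip M (u n) g) \<longlonglongrightarrow> 0"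
  shows "\<exists>B. \<forall>n. nm M (u n) \<le> B"
proof (rule ccontr)
  assume "\<nexists>B. \<forall>n. nm M (u n) \<le> B"
  \<comment> \<open>The factor \<open>3 ^ k\<close> pays for the length of the k-th step; after the
    later steps have taken away at most half, \<open>3 * (k + 1)\<close> of the inner product is
    left.\<close>
  then have "\<forall>k. \<exists>n. nm M (u n) > 6 * 3 ^ k * (real k + 1)" by (meson not_le)
  then obtain p where p: "\<And>k. nm M (u (p k)) > 6 * 3 ^ k * (real k + 1)" by metis
  define v where "v k = u (p k)" for k
  have v: "v k \<in> l2 M" for k by (simp add: v_def u)
  have vpos: "nm M (v k) > 0" for k
    using p[of k] by (auto simp: v_def intro: le_less_trans[rotated])
  \<comment> \<open>Of two numbers A + d and A - d with d >= 0 at least one has modulus at least d,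
    so one of the two signs makes the inner product with \<open>v k\<close> large.\<close>
  define st where "st x k = (if norm (ip M (\<lambda>z. x z + (1/3) ^ k / of_real (nm M (v k)) * v k z) (v k)) \<ge> (1/3) ^ k * nm M (v k)
     then (\<lambda>z. (1/3) ^ k / of_real (nm M (v k)) * v k z) else (\<lambda>z. - ((1/3) ^ k / of_real (nm M (v k))) * v k z))"
    for x :: "'a \<Rightarrow> complex" and k
  define x where "x = rec_nat (\<lambda>z. 0) (\<lambda>k y z. y z + st y k z)"
  have x0: "x 0 = (\<lambda>z. 0)" and xS: "x (Suc k) = (\<lambda>z. x k z + st (x k) k z)" for k
    by (simp_all add: x_def)
  have st: "st y k \<in> l2 M" for y k unfolding st_def by (simp only: split: if_split) (intro conjI impI l2_scale v)
  have x: "x k \<in> l2 M" for k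
    by (induction k) (simp_all add: x0 xS l2_add st)
  have st_nm: "nm M (st y k) \<le> (1/3) ^ k" for y k
    unfolding st_def
    by (simp only: nm_scale norm_minus_cancel split: if_split)
      (use vpos[of k] in \<open>simp add: norm_divide norm_power\<close>)
  have big: "norm (ip M (x (Suc k)) (v k)) \<ge> (1/3) ^ k * nm M (v k)" for k
  proof -
    define c where "c = (1/3) ^ k / complex_of_real (nm M (v k))"
    define A where "A = ip M (x k) (v k)"
    have D: "c * ip M (v k) (v k) = of_real ((1/3) ^ k * nm M (v k))"
      using vpos[of k] by (simp add: c_def ip_self power2_eq_square)
    have s: "ip M (\<lambda>z. x k z + c * v k z) (v k) = A + of_real ((1/3) ^ k * nm M (v k))"
      by (simp add: ip_add_left x v l2_scale ip_scale_left A_def D)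
    have s': "ip M (\<lambda>z. x k z + - c * v k z) (v k) = A - of_real ((1/3) ^ k * nm M (v k))"
      using ip_add_left[OF x l2_scale[OF v, of "- c"] v, of k k k] ip_scale_left[of M "- c" "v k" "v k"] D
      by (simp add: A_def)
    show ?thesis
    proof (cases "norm (A + of_real ((1/3) ^ k * nm M (v k))) \<ge> (1/3) ^ k * nm M (v k)")
      case True
      then show ?thesis unfolding xS st_def c_def[symmetric] s by (simp add: s)
    next
      case False
      have "2 * ((1/3) ^ k * nm M (v k)) = norm ((A + of_real ((1/3) ^ k * nm M (v k))) - (A - of_real ((1/3) ^ k * nm M (v k))))"
        by (simp add: norm_mult norm_power norm_divide)
      also have "\<dots> \<le> norm (A + of_real ((1/3) ^ k * nm M (v k))) + norm (A - of_real ((1/3) ^ k * nm M (v k)))"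
        by (rule norm_triangle_ineq4)
      finally have "norm (A - of_real ((1/3) ^ k * nm M (v k))) \<ge> (1/3) ^ k * nm M (v k)"
        using False by linarith
      then show ?thesis unfolding xS st_def c_def[symmetric] s using False s' by simp
    qed
  qed
  have geo: "nm M (\<lambda>z. x (m + k) z - x m z) \<le> (3/2) * (1/3) ^ m * (1 - (1/3) ^ k)" for m k
  proof (induction k)
    case 0
    then show ?case by (simp add: nm_def)
  next
    case (Suc k)
    have "nm M (\<lambda>z. x (m + Suc k) z - x m z) \<le> nm M (st (x (m + k)) (m + k)) + nm M (\<lambda>z. x (m + k) z - x m z)"
      using nm_triangle_diff[OF x[of "m + Suc k"] x[of "m + k"] x[of m]] by (simp add: xS)
    also have "\<dots> \<le> (1/3) ^ (m + k) + (3/2) * (1/3) ^ m * (1 - (1/3) ^ k)"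
      by (intro add_mono st_nm Suc)
    also have "\<dots> = (3/2) * (1/3) ^ m * (1 - (1/3) ^ Suc k)"
      by (simp add: power_add field_simps)
    finally show ?case .
  qed
  have geo': "nm M (\<lambda>z. x n z - x m z) \<le> (3/2) * (1/3) ^ m" if "m \<le> n" for m n
  proof -
    have "nm M (\<lambda>z. x n z - x m z) \<le> (3/2) * (1/3) ^ m * (1 - (1/3) ^ (n - m))"
      using geo[of m "n - m"] that by simp
    also have "\<dots> \<le> (3/2) * (1/3) ^ m * 1"
      by (intro mult_left_mono) auto
    finally show ?thesis by simp
  qed
  have "\<exists>N. \<forall>m\<ge>N. \<forall>n\<ge>N. nm M (\<lambda>z. x m z - x n z) < e" if "0 < e" for e
  proof -
    obtain N where N: "(1/3 :: real) ^ N < e / 3" using real_arch_pow_inv[of "e / 3" "1/3"] \<open>0 < e\<close> by auto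
    have "nm M (\<lambda>z. x m z - x n z) < e" if "m \<ge> N" "n \<ge> N" for m n
    proof -
      have "nm M (\<lambda>z. x m z - x n z) \<le> nm M (\<lambda>z. x m z - x N z) + nm M (\<lambda>z. x n z - x N z)"
        using nm_triangle_diff[OF x[of m] x[of N] x[of n]] nm_minus_commute[of M "x n" "x N"] by simp
      then show ?thesis using geo'[OF that(1)] geo'[OF that(2)] N by linarith
    qed
    then show ?thesis by blast
  qed
  from l2_complete[OF x this] obtain y where y: "y \<in> l2 M" and lim: "(\<lambda>n. nm M (\<lambda>z. x n z - y z)) \<longlonglongrightarrow> 0"
    by blast
  have tail: "nm M (\<lambda>z. y z - x m z) \<le> (3/2) * (1/3) ^ m" for m
  proof (rule LIMSEQ_le_const2)
    have "(\<lambda>n. nm M (\<lambda>z. (x n z - x m z) - (y z - x m z))) \<longlonglongrightarrow> 0" using lim by simp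
    then show "(\<lambda>n. nm M (\<lambda>z. x n z - x m z)) \<longlonglongrightarrow> nm M (\<lambda>z. y z - x m z)"
      by (intro tendsto_nm l2_diff x y)
    show "\<exists>N. \<forall>n\<ge>N. nm M (\<lambda>z. x n z - x m z) \<le> (3/2) * (1/3) ^ m" using geo' by blast
  qed
  have large: "norm (ip M (v k) y) \<ge> real k + 1" for k
  proof -
    have "ip M (x (Suc k)) (v k) = ip M y (v k) - ip M (\<lambda>z. y z - x (Suc k) z) (v k)"
      by (simp add: ip_diff_left x y v l2_diff)
    then have "norm (ip M (x (Suc k)) (v k)) \<le> norm (ip M y (v k)) + norm (ip M (\<lambda>z. y z - x (Suc k) z) (v k))"
      by (metis norm_triangle_ineq4)
    \<comment> \<open>All steps after the k-th add up to at most half of \<open>(1/3) ^ k\<close>,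
      since \<open>(3/2) * (1/3) ^ Suc k = (1/3) ^ k / 2\<close>.\<close>
    moreover have "norm (ip M (\<lambda>z. y z - x (Suc k) z) (v k)) \<le> (3/2) * (1/3) ^ Suc k * nm M (v k)"
      by (rule order_trans[OF Cauchy_Schwarz_l2 mult_right_mono[OF tail nm_nonneg]]) (intro l2_diff x y v)+
    ultimately have "(1/3) ^ k * nm M (v k) / 2 \<le> norm (ip M y (v k))"
      using big[of k] by simp
    moreover have "6 * (real k + 1) \<le> (1/3) ^ k * nm M (v k)"
    proof -
      have "6 * (real k + 1) = (1/3) ^ k * (6 * 3 ^ k * (real k + 1))"
        by (simp add: power_one_over)
      also have "\<dots> \<le> (1/3) ^ k * nm M (v k)"
        using less_imp_le[OF p[of k]] by (intro mult_left_mono) (simp_all add: v_def)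
      finally show ?thesis .
    qed
    ultimately have "real k + 1 \<le> norm (ip M y (v k))"
      using of_nat_0_le_iff[of k, where 'a = real] by argo
    then show ?thesis using ip_cnj[of M y "v k"] by (metis complex_mod_cnj)
  qed
  obtain C where C: "\<And>n. norm (ip M (u n) y) \<le> C"
    using convergent_imp_Bseq[OF convergentI[OF weak[OF y]]] by (auto simp: Bseq_def)
  obtain k where "C < real k" using reals_Archimedean2 by blast
  then show False using large[of k] C[of "p k"] by (simp add: v_def)
qed

section \<open>Translation continuity\<close>

lemma nm_tendsto_0_dominated:
  assumes f: "\<And>n. f n \<in> borel_measurable M" and h: "integrable M h"
    and lim: "AE x in M. (\<lambda>n. f n x) \<longlonglongrightarrow> 0"
    and bound: "\<And>n. AE x in M. (norm (f n x))\<^sup>2 \<le> h x"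
  shows "(\<lambda>n. nm M (f n)) \<longlonglongrightarrow> 0"
proof -
  have "(\<lambda>n. \<integral>x. (norm (f n x))\<^sup>2 \<partial>M) \<longlonglongrightarrow> (\<integral>x. 0 \<partial>M)"
  proof (rule integral_dominated_convergence[OF _ _ h])
    show "AE x in M. (\<lambda>n. (norm (f n x))\<^sup>2) \<longlonglongrightarrow> 0"
      using lim by eventually_elim (metis tendsto_norm_zero tendsto_power zero_power2)
  qed (use f bound in auto)
  then show ?thesis
    using tendsto_real_sqrt[of "\<lambda>n. \<integral>x. (norm (f n x))\<^sup>2 \<partial>M" 0] by (simp add: nm_def)
qed

text \<open>Fubini's theorem is applied to products of Borel measures, for which a Lebesgue
  measurable representative may fail to be measurable; a Borel representative is taken
  first.\<close>

lemma borel_version: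
  fixes f :: "'a::euclidean_space \<Rightarrow> complex"
  assumes "f \<in> borel_measurable lebesgue"
  shows "\<exists>g\<in>borel_measurable borel. AE x in lborel. f x = g x"
proof -
  have "(\<lambda>x. Re (f x)) \<in> borel_measurable (completion lborel)" "(\<lambda>x. Im (f x)) \<in> borel_measurable (completion lborel)"
    using assms by measurable
  from this[THEN completion_ex_borel_measurable_real] obtain a b
    where [measurable]: "a \<in> borel_measurable lborel" "b \<in> borel_measurable lborel"
      and "AE x in lborel. Re (f x) = a x" "AE x in lborel. Im (f x) = b x" by blast
  then have "AE x in lborel. f x = Complex (a x) (b x)"
    by (auto simp: complex_eq_iff)
  moreover have "(\<lambda>x. Complex (a x) (b x)) \<in> borel_measurable borel"
    unfolding Complex_eq by measurable
  ultimately show ?thesis by (intro bexI[of _ "\<lambda>x. Complex (a x) (b x)"])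
qed

lemma borel_imp_lebesgue_measurable: "f \<in> borel_measurable borel \<Longrightarrow> f \<in> borel_measurable lebesgue"
  by (rule measurable_completion) simp

text \<open>Lebesgue measure is complete, so all subsets of the exceptional null set are measurable.
  This gives measurability of functions, such as the regularised sequence, that are identified only
  up to null sets.\<close>

lemma lebesgue_measurable_AE_cong:
  fixes f g :: "'a::euclidean_space \<Rightarrow> 'b::{second_countable_topology,t2_space}"
  assumes f: "f \<in> borel_measurable lebesgue" and "AE x in lebesgue. f x = g x"
  shows "g \<in> borel_measurable lebesgue"
proof -
  have N: "{x. f x \<noteq> g x} \<in> null_sets lebesgue"
    using assms(2) by (simp add: completion.AE_iff_null_sets)
  show ?thesis
  proof (rule measurableI)
    fix A :: "'b set" assume A: "A \<in> sets borel"
    have f': "f -` A \<in> sets lebesgue"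
      using measurable_sets[OF f A] by simp
    have n: "{x. f x \<noteq> g x} \<inter> S \<in> sets lebesgue" for S
      using completion.complete2[OF Int_lower1 N, of S] by (rule null_setsD2)
    have "g -` A = (f -` A - {x. f x \<noteq> g x} \<inter> UNIV) \<union> ({x. f x \<noteq> g x} \<inter> g -` A)"
      by auto
    also have "\<dots> \<in> sets lebesgue" by (intro sets.Un sets.Diff f' n)
    finally show "g -` A \<inter> space lebesgue \<in> sets lebesgue" by simp
  qed simp
qed

lemma l2_lebesgue_iff: "f \<in> borel_measurable borel \<Longrightarrow> f \<in> l2 lebesgue \<longleftrightarrow> f \<in> l2 lborel"
  by (auto simp: l2_def borel_imp_lebesgue_measurable integrable_completion)

lemma nm_lebesgue: "f \<in> borel_measurable borel \<Longrightarrow> nm lebesgue f = nm lborel f"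
  unfolding nm_def by (subst integral_completion) auto

lemma ip_lebesgue: "f \<in> borel_measurable borel \<Longrightarrow> g \<in> borel_measurable borel \<Longrightarrow> ip lebesgue f g = ip lborel f g"
  unfolding ip_def by (subst integral_completion) auto

section \<open>Affine changes of variables\<close>

lemma
  fixes f :: "'a::euclidean_space \<Rightarrow> 'b::{banach, second_countable_topology}"
  assumes [measurable]: "f \<in> borel_measurable borel" and c: "c \<noteq> 0"
  shows lborel_integral_affine: "(\<integral>x. f x \<partial>lborel) = \<bar>c\<bar> ^ DIM('a) *\<^sub>R (\<integral>x. f (t + c *\<^sub>R x) \<partial>lborel)"
    and lborel_integrable_affine_iff: "integrable lborel f \<longleftrightarrow> integrable lborel (\<lambda>x. f (t + c *\<^sub>R x))"
proof -
  show "(\<integral>x. f x \<partial>lborel) = \<bar>c\<bar> ^ DIM('a) *\<^sub>R (\<integral>x. f (t + c *\<^sub>R x) \<partial>lborel)"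
    by (subst lborel_affine[OF c, of t]) (simp add: integral_density integral_distr)
  have scale: "integrable lborel (\<lambda>x. k *\<^sub>R g x) \<longleftrightarrow> integrable lborel g" if "k \<noteq> 0"
    for k and g :: "'a \<Rightarrow> 'b"
    using integrable_scaleR_right[of "inverse k" lborel "\<lambda>x. k *\<^sub>R g x"] that by auto
  show "integrable lborel f \<longleftrightarrow> integrable lborel (\<lambda>x. f (t + c *\<^sub>R x))"
    using c by (subst lborel_affine[OF c, of t]) (simp add: integrable_density integrable_distr_eq scale)
qed

lemma lborel_integral_translate:
  fixes f :: "'a::euclidean_space \<Rightarrow> 'b::{banach, second_countable_topology}"
  assumes "f \<in> borel_measurable borel"
  shows "(\<integral>x. f (x - t) \<partial>lborel) = (\<integral>x. f x \<partial>lborel)"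
    and "integrable lborel (\<lambda>x. f (x - t)) \<longleftrightarrow> integrable lborel f"
  using lborel_integral_affine[OF assms, of 1 "- t"] lborel_integrable_affine_iff[OF assms, of 1 "- t"]
  by simp_all

lemma lborel_integral_reflect:
  fixes f :: "'a::euclidean_space \<Rightarrow> 'b::{banach, second_countable_topology}"
  assumes "f \<in> borel_measurable borel"
  shows "(\<integral>x. f (t - x) \<partial>lborel) = (\<integral>x. f x \<partial>lborel)"
    and "integrable lborel (\<lambda>x. f (t - x)) \<longleftrightarrow> integrable lborel f"
  using lborel_integral_affine[OF assms, of "-1" t] lborel_integrable_affine_iff[OF assms, of "-1" t]
  by simp_all

lemma l2_translate:
  assumes f: "f \<in> l2 lborel"
  shows "(\<lambda>x. f (x - t)) \<in> l2 lborel" and "nm lborel (\<lambda>x. f (x - t)) = nm lborel f"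
proof -
  have [measurable]: "f \<in> borel_measurable borel" using l2_measurable[OF f] by simp
  note tr = lborel_integral_translate[of "\<lambda>x. (norm (f x))\<^sup>2" t]
  show "(\<lambda>x. f (x - t)) \<in> l2 lborel"
    using tr(2) l2_integrable[OF f] by (intro l2I) auto
  show "nm lborel (\<lambda>x. f (x - t)) = nm lborel f"
    unfolding nm_def using tr(1) by simp
qed

lemma l2_reflect:
  assumes f: "f \<in> l2 lborel"
  shows "(\<lambda>x. f (t - x)) \<in> l2 lborel" and "nm lborel (\<lambda>x. f (t - x)) = nm lborel f"
proof -
  have [measurable]: "f \<in> borel_measurable borel" using l2_measurable[OF f] by simp
  note tr = lborel_integral_reflect[of "\<lambda>x. (norm (f x))\<^sup>2" t]
  show "(\<lambda>x. f (t - x)) \<in> l2 lborel"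
    using tr(2) l2_integrable[OF f] by (intro l2I) auto
  show "nm lborel (\<lambda>x. f (t - x)) = nm lborel f"
    unfolding nm_def using tr(1) by simp
qed

lemma integrable_bounded_support:
  fixes f :: "'a::euclidean_space \<Rightarrow> 'b::{banach, second_countable_topology}"
  assumes f: "f \<in> borel_measurable borel" and "\<And>x. norm (f x) \<le> B" and "\<And>x. norm x > R \<Longrightarrow> f x = 0"
  shows "integrable lborel f"
proof (rule Bochner_Integration.integrable_bound)
  show "integrable lborel (\<lambda>x::'a. B * indicator (cball 0 R) x :: real)"
    by (intro integrable_mult_right integrable_real_indicator)
      (use emeasure_bounded_finite[OF bounded_cball[of "0::'a" R]] in auto)
  show "AE x in lborel. norm (f x) \<le> norm (B * indicator (cball 0 R) x :: real)"
  proof (intro AE_I2)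
    fix x
    have "0 \<le> B" using assms(2)[of x] norm_ge_zero order_trans by blast
    then show "norm (f x) \<le> norm (B * indicator (cball 0 R) x :: real)"
      using assms(2,3)[of x] by (auto simp: indicator_def)
  qed
qed (use f in simp)

text \<open>After truncation of \<open>f\<close> in domain and range, a sequence of continuous
  functions converging to it almost everywhere is cut off in the same way, so that dominated
  convergence applies.\<close>

lemma continuous_dense_l2:
  fixes f :: "'a::euclidean_space \<Rightarrow> complex"
  assumes f: "f \<in> l2 lborel" and "0 < e"
  shows "\<exists>g R B. continuous_on UNIV g \<and> (\<forall>x. norm x > R \<longrightarrow> g x = 0) \<and> (\<forall>x. norm (g x) \<le> B) \<and>
    g \<in> l2 lborel \<and> nm lborel (\<lambda>x. f x - g x) < e"
proof -
  have [measurable]: "f \<in> borel_measurable borel" using l2_measurable[OF f] by simp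
  define F where "F N x = (if norm x \<le> real N \<and> norm (f x) \<le> real N then f x else 0)" for N x
  have [measurable]: "F N \<in> borel_measurable borel" for N unfolding F_def by measurable
  have F: "F N \<in> l2 lborel" for N
    by (rule l2_dominated[where h = "\<lambda>x. (norm (f x))\<^sup>2"]) (auto simp: F_def l2_integrable f)
  have "(\<lambda>N. nm lborel (\<lambda>x. f x - F N x)) \<longlonglongrightarrow> 0"
  proof (rule nm_tendsto_0_dominated[where h = "\<lambda>x. (norm (f x))\<^sup>2"])
    show "AE x in lborel. (\<lambda>N. f x - F N x) \<longlonglongrightarrow> 0"
    proof (rule AE_I2)
      fix x
      obtain N0 where N0: "norm x \<le> real N0" "norm (f x) \<le> real N0"
        using real_arch_simple[of "max (norm x) (norm (f x))"] by auto
      have "\<forall>\<^sub>F N in sequentially. f x - F N x = 0"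
        using eventually_ge_at_top[of N0] by eventually_elim (use N0 in \<open>auto simp: F_def\<close>)
      then show "(\<lambda>N. f x - F N x) \<longlonglongrightarrow> 0" by (rule tendsto_eventually)
    qed
  qed (auto simp: F_def l2_integrable f)
  then obtain N where N: "nm lborel (\<lambda>x. f x - F N x) < e / 2"
    using order_tendstoD(2)[of _ 0 sequentially "e / 2"] \<open>0 < e\<close> by (meson eventually_sequentially half_gt_zero order_refl)
  have "F N \<in> borel_measurable lebesgue" by (rule borel_imp_lebesgue_measurable) measurable
  then have "F N measurable_on UNIV"
    by (subst measurable_on_iff_borel_measurable) (auto simp: lebesgue_on_UNIV_eq)
  then obtain Z g where Z: "negligible Z" and g: "\<And>n. continuous_on UNIV (g n)"
    and lim: "\<And>x. x \<notin> Z \<Longrightarrow> (\<lambda>n. g n x) \<longlonglongrightarrow> F N x"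
    unfolding measurable_on_def by auto
  define K where "K = real N + 1"
  have K: "K > 0" by (simp add: K_def)
  \<comment> \<open>The first factor cuts off in space between the radii \<open>K - 1\<close> and
    \<open>K\<close>, the second pulls values of modulus above \<open>K\<close> back to modulus
    \<open>K\<close>; by the choice of \<open>K\<close> neither changes the values of the limit
    \<open>F N\<close>.\<close>
  define G where "G n x = of_real (max 0 (min 1 (K - norm x)) * (K / max K (norm (g n x)))) * g n x" for n x
  have contG: "continuous_on UNIV (G n)" for n
    unfolding G_def using g K by (intro continuous_intros) auto
  then have [measurable]: "G n \<in> borel_measurable borel" for n by (rule borel_measurable_continuous_onI)
  have G0: "G n x = 0" if "norm x > K" for n x using that by (simp add: G_def)
  have GK: "norm (G n x) \<le> K" for n x
  proof -
    have "norm (G n x) = max 0 (min 1 (K - norm x)) * (K * (norm (g n x) / max K (norm (g n x))))"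
      using K by (simp add: G_def norm_mult abs_mult norm_divide)
    also have "\<dots> \<le> 1 * (K * 1)"
      using K by (intro mult_mono) (auto simp: divide_le_eq)
    finally show ?thesis by simp
  qed
  have "integrable lborel (\<lambda>x. (norm (G n x))\<^sup>2)" for n
    by (rule integrable_bounded_support[where B = "K\<^sup>2" and R = K]) (auto simp: G0 intro!: power_mono GK)
  then have G2: "G n \<in> l2 lborel" for n by (intro l2I) auto
  have "(\<lambda>n. nm lborel (\<lambda>x. F N x - G n x)) \<longlonglongrightarrow> 0"
  proof (rule nm_tendsto_0_dominated[where h = "\<lambda>x. 4 * K\<^sup>2 * indicator (cball 0 K) x"])
    show "integrable lborel (\<lambda>x. 4 * K\<^sup>2 * indicator (cball 0 K) x :: real)"
      by (rule integrable_bounded_support[where B = "4 * K\<^sup>2" and R = K]) (auto simp: indicator_def)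
    have "AE x in lborel. x \<notin> Z"
    proof -
      obtain Z' where "Z' \<in> null_sets lborel" "Z \<subseteq> Z'"
        using Z by (auto simp: negligible_iff_null_sets null_sets_completion_iff2)
      then show ?thesis using AE_not_in[of Z' lborel] by auto
    qed
    then show "AE x in lborel. (\<lambda>n. F N x - G n x) \<longlonglongrightarrow> 0"
    proof eventually_elim
      case (elim x)
      from lim[OF this] have gl: "(\<lambda>n. g n x) \<longlonglongrightarrow> F N x" .
      have "(\<lambda>n. G n x) \<longlonglongrightarrow> of_real (max 0 (min 1 (K - norm x)) * (K / max K (norm (F N x)))) * F N x"
        unfolding G_def using K by (intro tendsto_intros gl) auto
      also have "of_real (max 0 (min 1 (K - norm x)) * (K / max K (norm (F N x)))) * F N x = F N x"
      proof (cases "F N x = 0")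
        case False
        then have "norm x \<le> real N" "norm (F N x) \<le> real N" by (auto simp: F_def split: if_splits)
        then have "max 0 (min 1 (K - norm x)) = 1" "max K (norm (F N x)) = K" by (simp_all add: K_def)
        then show ?thesis using K by simp
      qed simp
      finally show ?case using tendsto_diff[OF tendsto_const[of "F N x"]] by fastforce
    qed
    fix n
    show "AE x in lborel. (norm (F N x - G n x))\<^sup>2 \<le> 4 * K\<^sup>2 * indicator (cball 0 K) x"
    proof (rule AE_I2)
      fix x
      have "norm (F N x) \<le> K" by (auto simp: F_def K_def)
      then have "norm (F N x - G n x) \<le> 2 * K"
        using norm_triangle_ineq4[of "F N x" "G n x"] GK[of n x] by simp
      then have "(norm (F N x - G n x))\<^sup>2 \<le> (2 * K)\<^sup>2" by (intro power_mono) auto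
      moreover have "F N x - G n x = 0" if "norm x > K"
        using that G0[OF that, of n] by (auto simp: F_def K_def)
      ultimately show "(norm (F N x - G n x))\<^sup>2 \<le> 4 * K\<^sup>2 * indicator (cball 0 K) x"
        by (auto simp: indicator_def power_mult_distrib not_le)
    qed
  qed measurable
  then obtain n where n: "nm lborel (\<lambda>x. F N x - G n x) < e / 2"
    using order_tendstoD(2)[of _ 0 sequentially "e / 2"] \<open>0 < e\<close> by (meson eventually_sequentially half_gt_zero order_refl)
  have "nm lborel (\<lambda>x. f x - G n x) < e"
    using nm_triangle_diff[OF f F G2, of n N] N n by linarith
  then show ?thesis
    using contG G0 GK G2 by blast
qed

text \<open>Translations are isometries, so a dense set suffices; for continuous functions of
  bounded support the differences are uniformly bounded and live in one ball, and dominated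
  convergence applies.\<close>

theorem l2_translation_continuous:
  fixes f :: "'a::euclidean_space \<Rightarrow> complex"
  assumes f: "f \<in> l2 lborel" and z: "z \<longlonglongrightarrow> 0"
  shows "(\<lambda>n. nm lborel (\<lambda>x. f (x - z n) - f x)) \<longlonglongrightarrow> 0"
proof (rule LIMSEQ_I)
  fix e :: real assume "0 < e"
  then obtain g R B where g: "continuous_on UNIV g" "\<And>x. norm x > R \<Longrightarrow> g x = 0" "\<And>x. norm (g x) \<le> B"
    "g \<in> l2 lborel" and fg: "nm lborel (\<lambda>x. f x - g x) < e / 3"
    using continuous_dense_l2[OF f, of "e / 3"] by auto
  have [measurable]: "g \<in> borel_measurable borel" by (rule borel_measurable_continuous_onI) fact
  have B: "0 \<le> B" using g(3) norm_ge_zero order_trans by blast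
  obtain C where C: "\<And>n. norm (z n) \<le> C"
    using convergent_imp_Bseq[OF convergentI[OF z]] by (auto simp: Bseq_def)
  have C0: "0 \<le> C" using C norm_ge_zero order_trans by blast
  have "(\<lambda>n. nm lborel (\<lambda>x. g (x - z n) - g x)) \<longlonglongrightarrow> 0"
  proof (rule nm_tendsto_0_dominated[where h = "\<lambda>x. 4 * B\<^sup>2 * indicator (cball 0 (R + C)) x"])
    show "integrable lborel (\<lambda>x. 4 * B\<^sup>2 * indicator (cball 0 (R + C)) x :: real)"
      by (rule integrable_bounded_support[where B = "4 * B\<^sup>2" and R = "R + C"]) (auto simp: indicator_def)
    show "AE x in lborel. (\<lambda>n. g (x - z n) - g x) \<longlonglongrightarrow> 0"
    proof (rule AE_I2)
      fix x
      have "(\<lambda>n. x - z n) \<longlonglongrightarrow> x" using tendsto_diff[OF tendsto_const z, of x] by simp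
      then have "(\<lambda>n. g (x - z n)) \<longlonglongrightarrow> g x"
        using continuous_on_tendsto_compose[OF g(1)] by fastforce
      then show "(\<lambda>n. g (x - z n) - g x) \<longlonglongrightarrow> 0" by (rule LIM_zero)
    qed
    fix n
    show "AE x in lborel. (norm (g (x - z n) - g x))\<^sup>2 \<le> 4 * B\<^sup>2 * indicator (cball 0 (R + C)) x"
    proof (rule AE_I2)
      fix x
      have "norm (g (x - z n) - g x) \<le> 2 * B"
        using norm_triangle_ineq4[of "g (x - z n)" "g x"] g(3)[of x] g(3)[of "x - z n"] by simp
      then have "(norm (g (x - z n) - g x))\<^sup>2 \<le> (2 * B)\<^sup>2" by (intro power_mono) auto
      moreover have "g (x - z n) - g x = 0" if "norm x > R + C"
      proof -
        have "norm (x - z n) > R" using norm_triangle_ineq2[of x "z n"] C[of n] that by linarith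
        then show ?thesis using g(2)[of x] g(2)[of "x - z n"] that C0 by simp
      qed
      ultimately show "(norm (g (x - z n) - g x))\<^sup>2 \<le> 4 * B\<^sup>2 * indicator (cball 0 (R + C)) x"
        by (auto simp: indicator_def power_mult_distrib not_le)
    qed
  qed measurable
  from order_tendstoD(2)[OF this, of "e / 3"] \<open>0 < e\<close> obtain N
    where N: "\<And>n. n \<ge> N \<Longrightarrow> nm lborel (\<lambda>x. g (x - z n) - g x) < e / 3"
    by (auto simp: eventually_sequentially)
  have "nm lborel (\<lambda>x. f (x - z n) - f x) < e" if "n \<ge> N" for n
  proof -
    have "nm lborel (\<lambda>x. f (x - z n) - g (x - z n)) = nm lborel (\<lambda>x. f x - g x)"
      by (rule l2_translate(2)[OF l2_diff[OF f g(4)]])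
    then show ?thesis
      using nm_triangle_diff[OF l2_translate(1)[OF f] l2_translate(1)[OF g(4)] f, of "z n" "z n"]
        nm_triangle_diff[OF l2_translate(1)[OF g(4), of "z n"] g(4) f] N[OF that] fg nm_minus_commute[of lborel f g]
      by linarith
  qed
  then show "\<exists>no. \<forall>n\<ge>no. norm (nm lborel (\<lambda>x. f (x - z n) - f x) - 0) < e" by auto
qed

section \<open>Plancherel's theorem\<close>

definition gauss :: "'a::euclidean_space \<Rightarrow> real" where
  "gauss x = exp (- (norm x)\<^sup>2 / 2)"

lemma gauss_pos [simp]: "0 < gauss x" and gauss_le_1: "gauss x \<le> 1" and gauss_0 [simp]: "gauss 0 = 1"
  and gauss_minus [simp]: "gauss (- x) = gauss x" and abs_gauss [simp]: "\<bar>gauss x\<bar> = gauss x"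
  by (simp_all add: gauss_def)

lemma gauss_measurable [measurable]: "gauss \<in> borel_measurable borel"
  unfolding gauss_def by measurable

lemma cis_sum: "finite I \<Longrightarrow> cis (\<Sum>i\<in>I. f i) = (\<Prod>i\<in>I. cis (f i))"
  by (induction I rule: finite_induct) (auto simp: cis_mult[symmetric])

lemma cis_measurable [measurable]: "cis \<in> borel_measurable borel"
  by (intro borel_measurable_continuous_onI continuous_intros)

text \<open>Up to the factor \<open>sqrt (2 * pi)\<close> this is the characteristic function of the
  standard normal distribution.\<close>

lemma gauss_fourier_real:
  fixes t :: real
  shows "integrable lborel (\<lambda>x. cis (t * x) * of_real (exp (- x\<^sup>2 / 2)))" (is ?A)
    and "(\<integral>x. cis (t * x) * of_real (exp (- x\<^sup>2 / 2)) \<partial>lborel) = of_real (sqrt (2 * pi) * exp (- t\<^sup>2 / 2))" (is ?B)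
proof -
  have eq: "std_normal_density x *\<^sub>R cis (t * x) = (1 / sqrt (2 * pi)) *\<^sub>R (cis (t * x) * of_real (exp (- x\<^sup>2 / 2)))" for x
    by (simp add: std_normal_density_def scaleR_conv_of_real mult.commute)
  have "integrable lborel (\<lambda>x. std_normal_density x *\<^sub>R cis (t * x))"
    by (rule Bochner_Integration.integrable_bound[OF integrable_normal_density[of 1 0]]) auto
  then have "integrable lborel (\<lambda>x. sqrt (2 * pi) *\<^sub>R (std_normal_density x *\<^sub>R cis (t * x)))"
    by (rule integrable_scaleR_right)
  then show ?A unfolding eq by simp
  have "(\<integral>x. std_normal_density x *\<^sub>R cis (t * x) \<partial>lborel) = char std_normal_distribution t"
    unfolding char_def by (subst integral_density) (auto simp: cis_conv_exp)
  also have "\<dots> = of_real (exp (- t\<^sup>2 / 2))"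
    by (simp add: char_std_normal_distribution)
  finally have "(1 / sqrt (2 * pi)) *\<^sub>R (\<integral>x. cis (t * x) * of_real (exp (- x\<^sup>2 / 2)) \<partial>lborel) = of_real (exp (- t\<^sup>2 / 2))"
    unfolding eq by simp
  then have "sqrt (2 * pi) *\<^sub>R ((1 / sqrt (2 * pi)) *\<^sub>R (\<integral>x. cis (t * x) * of_real (exp (- x\<^sup>2 / 2)) \<partial>lborel)) = sqrt (2 * pi) *\<^sub>R of_real (exp (- t\<^sup>2 / 2))"
    by simp
  then show ?B by (simp add: scaleR_conv_of_real)
qed

text \<open>Both the Gaussian and the character are products over the coordinates, which reduces the
  integral to the real line.\<close>

lemma gauss_fourier:
  fixes t :: "'a::euclidean_space"
  shows "integrable lborel (\<lambda>x. cis (t \<bullet> x) * of_real (gauss x))" (is ?A)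
    and "(\<integral>x. cis (t \<bullet> x) * of_real (gauss x) \<partial>lborel) = of_real (sqrt (2 * pi) ^ DIM('a) * gauss t)" (is ?B)
proof -
  interpret product_sigma_finite "\<lambda>_::'a. lborel :: real measure" by standard
  let ?P = "\<Pi>\<^sub>M b\<in>(Basis :: 'a set). (lborel :: real measure)"
  let ?T = "\<lambda>f. \<Sum>b\<in>Basis. f b *\<^sub>R (b :: 'a)"
  let ?h = "\<lambda>x. cis (t \<bullet> x) * complex_of_real (gauss x)"
  have sq: "(norm x)\<^sup>2 = (\<Sum>b\<in>Basis. (x \<bullet> b)\<^sup>2)" for x :: 'a
    unfolding power2_norm_eq_inner euclidean_inner[of x x] by (simp add: power2_eq_square)
  have ex: "exp (- (\<Sum>b\<in>Basis. c b) / 2) = (\<Prod>b\<in>(Basis :: 'a set). exp (- c b / 2 :: real))" for c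
  proof -
    have "- (\<Sum>b\<in>Basis. c b) / 2 = (\<Sum>b\<in>(Basis :: 'a set). - c b / 2 :: real)"
      by (simp add: sum_divide_distrib sum_negf)
    then show ?thesis by (simp only: exp_sum[OF finite_Basis])
  qed
  have h: "?h (?T f) = (\<Prod>b\<in>Basis. cis ((t \<bullet> b) * f b) * of_real (exp (- (f b)\<^sup>2 / 2)))" for f
    unfolding gauss_def sq ex prod.distrib of_real_prod
    by (simp add: inner_sum_right cis_sum mult.commute)
  have [measurable]: "?T \<in> ?P \<rightarrow>\<^sub>M borel" by measurable
  have int: "integrable ?P (\<lambda>f. ?h (?T f))"
    unfolding h by (rule product_integrable_prod) (simp_all only: finite_Basis gauss_fourier_real(1))
  show ?A
    by (subst lborel_eq, subst integrable_distr_eq) (use int in auto)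
  have "(\<integral>x. ?h x \<partial>lborel) = (\<integral>f. ?h (?T f) \<partial>?P)"
    by (subst lborel_eq, subst integral_distr) auto
  also have "\<dots> = (\<Prod>b\<in>Basis. of_real (sqrt (2 * pi) * exp (- (t \<bullet> b)\<^sup>2 / 2)))"
    unfolding h by (subst product_integral_prod) (simp_all only: finite_Basis gauss_fourier_real)
  also have "\<dots> = of_real (sqrt (2 * pi) ^ DIM('a) * gauss t)"
    unfolding gauss_def sq ex of_real_prod[symmetric] prod.distrib by simp
  finally show ?B .
qed

lemma fourier_lborel:
  "u \<in> borel_measurable borel \<Longrightarrow> fourier u \<xi> = (\<integral>x. cis (- 2 * pi * (x \<bullet> \<xi>)) * u x \<partial>lborel)"
  unfolding fourier_def by (subst integral_completion) auto

lemma fourier_borel_measurable [measurable]: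
  assumes [measurable]: "u \<in> borel_measurable borel"
  shows "fourier u \<in> borel_measurable borel"
  by (subst measurable_cong[OF fourier_lborel]) simp_all

lemma fourier_AE_cong:
  assumes "u \<in> borel_measurable lebesgue" "v \<in> borel_measurable lebesgue" "AE x in lebesgue. u x = v x"
  shows "fourier u = fourier v"
proof
  fix \<xi> :: 'a
  have "(\<lambda>x. cis (- 2 * pi * (x \<bullet> \<xi>))) \<in> borel_measurable lebesgue"
    by (rule borel_imp_lebesgue_measurable) measurable
  then show "fourier u \<xi> = fourier v \<xi>"
    unfolding fourier_def using assms by (intro integral_cong_AE) auto
qed

lemma (in pair_sigma_finite) integrable_pair_mult:
  fixes f g :: "_ \<Rightarrow> complex"
  assumes f: "integrable M1 f" and g: "integrable M2 g"
    and k: "k \<in> borel_measurable (M1 \<Otimes>\<^sub>M M2)" "\<And>z. norm (k z) \<le> 1"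
  shows "integrable (M1 \<Otimes>\<^sub>M M2) (\<lambda>(x, y). k (x, y) * (f x * g y))"
proof -
  have [measurable]: "f \<in> borel_measurable M1" "g \<in> borel_measurable M2" using f g by auto
  note k(1)[measurable]
  have "integrable (M1 \<Otimes>\<^sub>M M2) (\<lambda>(x, y). f x * g y)"
  proof (rule Fubini_integrable)
    show "integrable M1 (\<lambda>x. \<integral>y. norm (case (x, y) of (x, y) \<Rightarrow> f x * g y) \<partial>M2)"
      using f by (simp add: norm_mult)
    show "AE x in M1. integrable M2 (\<lambda>y. case (x, y) of (x, y) \<Rightarrow> f x * g y)"
      using g by simp
  qed measurable
  then show ?thesis
    by (rule Bochner_Integration.integrable_bound)
      (auto simp: norm_mult intro!: AE_I2 mult_left_le_one_le k)
qed

text \<open>Fubini: both sides are the same double integral, whose kernel is symmetric in the two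
  variables.\<close>

lemma fourier_multiplication_formula:
  fixes f g :: "'a::euclidean_space \<Rightarrow> complex"
  assumes f: "integrable lborel f" and g: "integrable lborel g"
  shows "(\<integral>\<xi>. fourier f \<xi> * g \<xi> \<partial>lborel) = (\<integral>x. f x * fourier g x \<partial>lborel)"
proof -
  have [measurable]: "f \<in> borel_measurable borel" "g \<in> borel_measurable borel"
    using borel_measurable_integrable[OF f] borel_measurable_integrable[OF g] by auto
  have "integrable (lborel \<Otimes>\<^sub>M lborel) (\<lambda>(x, \<xi>). cis (- 2 * pi * (x \<bullet> \<xi>)) * (f x * g \<xi>))"
    using lborel_pair.integrable_pair_mult[OF f g, of "\<lambda>(x, \<xi>). cis (- 2 * pi * (x \<bullet> \<xi>))"] by (simp add: case_prod_beta)
  from lborel_pair.Fubini_integral[OF this]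
  have "(\<integral>\<xi>. \<integral>x. cis (- 2 * pi * (x \<bullet> \<xi>)) * (f x * g \<xi>) \<partial>lborel \<partial>lborel)
    = (\<integral>x. \<integral>\<xi>. cis (- 2 * pi * (x \<bullet> \<xi>)) * (f x * g \<xi>) \<partial>lborel \<partial>lborel)" .
  moreover have "(\<integral>x. cis (- 2 * pi * (x \<bullet> \<xi>)) * (f x * g \<xi>) \<partial>lborel) = fourier f \<xi> * g \<xi>" for \<xi>
    by (subst fourier_lborel) (simp_all add: mult.assoc[symmetric])
  moreover have "(\<integral>\<xi>. cis (- 2 * pi * (x \<bullet> \<xi>)) * (f x * g \<xi>) \<partial>lborel) = f x * fourier g x" for x
  proof -
    have "(\<integral>\<xi>. cis (- 2 * pi * (x \<bullet> \<xi>)) * (f x * g \<xi>) \<partial>lborel) = (\<integral>\<xi>. f x * (cis (- 2 * pi * (\<xi> \<bullet> x)) * g \<xi>) \<partial>lborel)"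
      by (simp add: mult.left_commute inner_commute)
    then show ?thesis by (subst fourier_lborel) simp_all
  qed
  ultimately show ?thesis by simp
qed

text \<open>The autocorrelation is the convolution of \<open>f\<close> with its conjugate
  reflection, so its transform is a product of conjugates. For square integrable \<open>f\<close>
  its value at 0 is the squared norm, which is why it serves for Plancherel's theorem.\<close>

lemma autocorrelation_fourier:
  fixes f :: "'a::euclidean_space \<Rightarrow> complex"
  assumes f: "integrable lborel f"
  shows "integrable lborel (\<lambda>z. \<integral>x. f x * cnj (f (x - z)) \<partial>lborel)" (is "integrable lborel ?R")
    and "fourier (\<lambda>z. \<integral>x. f x * cnj (f (x - z)) \<partial>lborel) \<xi> = of_real ((norm (fourier f \<xi>))\<^sup>2)"
proof -
  have [measurable]: "f \<in> borel_measurable borel"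
    using borel_measurable_integrable[OF f] by auto
  have reflint: "integrable lborel (\<lambda>z. f (x - z))" for x
    using lborel_integral_reflect(2)[of f x] f by simp
  have int: "integrable (lborel \<Otimes>\<^sub>M lborel) (\<lambda>(x, z). f x * cnj (f (x - z)))"
  proof (rule lborel_pair.Fubini_integrable)
    have "(\<integral>z. norm (f (x - z)) \<partial>lborel) = (\<integral>z. norm (f z) \<partial>lborel)" for x
      by (rule lborel_integral_reflect(1)) measurable
    then show "integrable lborel (\<lambda>x. \<integral>y. norm (case (x, y) of (x, z) \<Rightarrow> f x * cnj (f (x - z))) \<partial>lborel)"
      using f by (simp add: norm_mult)
    show "AE x in lborel. integrable lborel (\<lambda>y. case (x, y) of (x, z) \<Rightarrow> f x * cnj (f (x - z)))"
      using reflint by simp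
  qed measurable
  show R: "integrable lborel ?R"
    using lborel_pair.integrable_snd[OF int] by simp
  have [measurable]: "?R \<in> borel_measurable borel" by measurable
  let ?Q = "\<lambda>x z. cis (- 2 * pi * (z \<bullet> \<xi>)) * (f x * cnj (f (x - z)))"
  have int': "integrable (lborel \<Otimes>\<^sub>M lborel) (\<lambda>(x, z). ?Q x z)"
    by (rule Bochner_Integration.integrable_bound[OF int]) (auto simp: norm_mult)
  have "fourier ?R \<xi> = (\<integral>z. \<integral>x. ?Q x z \<partial>lborel \<partial>lborel)"
    by (subst fourier_lborel) simp_all
  also have "\<dots> = (\<integral>x. \<integral>z. ?Q x z \<partial>lborel \<partial>lborel)"
    by (rule lborel_pair.Fubini_integral[OF int'])
  also have "\<dots> = (\<integral>x. (cis (- 2 * pi * (x \<bullet> \<xi>)) * f x) * cnj (fourier f \<xi>) \<partial>lborel)"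
  proof (rule Bochner_Integration.integral_cong[OF refl])
    fix x :: 'a
    have "?Q x z = f x * (cis (- 2 * pi * (x \<bullet> \<xi>)) * cnj (cis (- 2 * pi * ((x - z) \<bullet> \<xi>)) * f (x - z)))" for z
    proof -
      have "- 2 * pi * (z \<bullet> \<xi>) = - 2 * pi * (x \<bullet> \<xi>) - (- 2 * pi * ((x - z) \<bullet> \<xi>))"
        by (simp add: inner_diff_left algebra_simps)
      then have "cis (- 2 * pi * (z \<bullet> \<xi>)) = cis (- 2 * pi * (x \<bullet> \<xi>)) * cnj (cis (- 2 * pi * ((x - z) \<bullet> \<xi>)))"
        by (simp only: cis_mult cis_cnj diff_conv_add_uminus)
      then show ?thesis by (simp only: complex_cnj_mult ac_simps)
    qed
    then have "(\<integral>z. ?Q x z \<partial>lborel) = f x * (cis (- 2 * pi * (x \<bullet> \<xi>)) * (\<integral>z. cnj (cis (- 2 * pi * ((x - z) \<bullet> \<xi>)) * f (x - z)) \<partial>lborel))"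
      by (simp only: integral_mult_right_zero)
    also have "(\<integral>z. cnj (cis (- 2 * pi * ((x - z) \<bullet> \<xi>)) * f (x - z)) \<partial>lborel) = (\<integral>z. cnj (cis (- 2 * pi * (z \<bullet> \<xi>)) * f z) \<partial>lborel)"
      by (rule lborel_integral_reflect(1)) measurable
    also have "\<dots> = cnj (fourier f \<xi>)"
      by (subst fourier_lborel) (simp_all only: Bochner_Integration.integral_cnj, measurable)
    finally show "(\<integral>z. ?Q x z \<partial>lborel) = (cis (- 2 * pi * (x \<bullet> \<xi>)) * f x) * cnj (fourier f \<xi>)"
      by (simp only: ac_simps)
  qed
  also have "\<dots> = fourier f \<xi> * cnj (fourier f \<xi>)"
    by (subst (2) fourier_lborel) (simp_all only: integral_mult_left_zero, measurable)
  finally show "fourier ?R \<xi> = of_real ((norm (fourier f \<xi>))\<^sup>2)"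
    by (simp only: complex_norm_square)
qed

lemma gauss_scaled_fourier:
  fixes z :: "'a::euclidean_space"
  assumes "0 < \<epsilon>"
  shows "integrable lborel (\<lambda>x::'a. complex_of_real (gauss (\<epsilon> *\<^sub>R x)))"
    and "fourier (\<lambda>x. of_real (gauss (\<epsilon> *\<^sub>R x))) z = of_real ((sqrt (2 * pi) / \<epsilon>) ^ DIM('a) * gauss ((2 * pi / \<epsilon>) *\<^sub>R z))"
proof -
  have "integrable lborel (\<lambda>x::'a. complex_of_real (gauss x))"
    using gauss_fourier(1)[of 0] by simp
  then show "integrable lborel (\<lambda>x::'a. complex_of_real (gauss (\<epsilon> *\<^sub>R x)))"
    using lborel_integrable_affine_iff[of "\<lambda>x::'a. complex_of_real (gauss x)" \<epsilon> 0] assms by simp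
  have "fourier (\<lambda>x. of_real (gauss (\<epsilon> *\<^sub>R x))) z = (\<integral>x. cis (- 2 * pi * (x \<bullet> z)) * of_real (gauss (\<epsilon> *\<^sub>R x)) \<partial>lborel)"
    by (rule fourier_lborel) measurable
  also have "\<dots> = (1 / \<epsilon>) ^ DIM('a) *\<^sub>R (\<integral>x. cis (((- 2 * pi / \<epsilon>) *\<^sub>R z) \<bullet> x) * of_real (gauss x) \<partial>lborel)"
    using assms by (subst lborel_integral_affine[where c = "1 / \<epsilon>" and t = 0]) (simp_all add: inner_commute)
  also have "\<dots> = of_real ((1 / \<epsilon>) ^ DIM('a) * (sqrt (2 * pi) ^ DIM('a) * gauss (- ((2 * pi / \<epsilon>) *\<^sub>R z))))"
    by (simp only: gauss_fourier(2) scaleR_conv_of_real of_real_mult) simp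
  finally show "fourier (\<lambda>x. of_real (gauss (\<epsilon> *\<^sub>R x))) z = of_real ((sqrt (2 * pi) / \<epsilon>) ^ DIM('a) * gauss ((2 * pi / \<epsilon>) *\<^sub>R z))"
    by (simp only: gauss_minus) (simp add: power_divide)
qed

text \<open>The multiplication formula moves the transform from the autocorrelation to the Gaussian.
  The result is an average of \<open>R\<close> at scale \<open>\<epsilon>\<close>, in front of which
  all powers of \<open>\<epsilon>\<close> cancel.\<close>

lemma fourier_gauss_weighted:
  fixes f :: "'a::euclidean_space \<Rightarrow> complex"
  assumes f: "integrable lborel f" and "0 < \<epsilon>"
  defines "R \<equiv> \<lambda>z. \<integral>x. f x * cnj (f (x - z)) \<partial>lborel"
  shows "(\<integral>\<xi>. of_real ((norm (fourier f \<xi>))\<^sup>2 * gauss ((2 * pi * \<epsilon>) *\<^sub>R \<xi>)) \<partial>lborel)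
    = of_real ((1 / sqrt (2 * pi)) ^ DIM('a)) * (\<integral>w. R (\<epsilon> *\<^sub>R w) * of_real (gauss w) \<partial>lborel)"
proof -
  have [measurable]: "f \<in> borel_measurable borel" using borel_measurable_integrable[OF f] by simp
  have [measurable]: "R \<in> borel_measurable borel" unfolding R_def by measurable
  have \<epsilon>: "0 < 2 * pi * \<epsilon>" using assms by simp
  let ?d = "DIM('a)"
  let ?c = "(sqrt (2 * pi) / (2 * pi * \<epsilon>)) ^ ?d"
  have "(\<integral>\<xi>. of_real ((norm (fourier f \<xi>))\<^sup>2 * gauss ((2 * pi * \<epsilon>) *\<^sub>R \<xi>)) \<partial>lborel)
      = (\<integral>\<xi>. fourier R \<xi> * of_real (gauss ((2 * pi * \<epsilon>) *\<^sub>R \<xi>)) \<partial>lborel)"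
    unfolding R_def autocorrelation_fourier(2)[OF f] of_real_mult ..
  also have "\<dots> = (\<integral>z. R z * fourier (\<lambda>x. of_real (gauss ((2 * pi * \<epsilon>) *\<^sub>R x))) z \<partial>lborel)"
    unfolding R_def by (rule fourier_multiplication_formula[OF autocorrelation_fourier(1)[OF f] gauss_scaled_fourier(1)[OF \<epsilon>]])
  also have "\<dots> = (\<integral>z. R z * of_real (?c * gauss ((1 / \<epsilon>) *\<^sub>R z)) \<partial>lborel)"
    unfolding gauss_scaled_fourier(2)[OF \<epsilon>] by simp
  also have "\<dots> = \<epsilon> ^ ?d *\<^sub>R (\<integral>w. R (\<epsilon> *\<^sub>R w) * of_real (?c * gauss w) \<partial>lborel)"
    using assms by (subst lborel_integral_affine[where c = \<epsilon> and t = 0]) simp_all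
  also have "\<dots> = of_real (\<epsilon> ^ ?d * ?c) * (\<integral>w. R (\<epsilon> *\<^sub>R w) * of_real (gauss w) \<partial>lborel)"
  proof -
    have "R (\<epsilon> *\<^sub>R w) * of_real (?c * gauss w) = of_real ?c * (R (\<epsilon> *\<^sub>R w) * of_real (gauss w))" for w
      by (simp only: of_real_mult ac_simps)
    then show ?thesis by (simp only: integral_mult_right_zero scaleR_conv_of_real of_real_mult mult.assoc)
  qed
  also have "\<epsilon> ^ ?d * ?c = (1 / sqrt (2 * pi)) ^ ?d"
  proof -
    have "\<epsilon> * (sqrt (2 * pi) / (2 * pi * \<epsilon>)) = 1 / sqrt (2 * pi)"
      using assms by (simp add: field_simps)
    then show ?thesis by (simp only: power_mult_distrib[symmetric])
  qed
  finally show ?thesis .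
qed

text \<open>As the Gaussian weight tends to 1, the average of the autocorrelation tends to its value
  at 0. This rests on continuity of translations and avoids the inversion formula.\<close>

lemma plancherel_lborel:
  fixes f :: "'a::euclidean_space \<Rightarrow> complex"
  assumes f: "integrable lborel f" and f2: "f \<in> l2 lborel"
  shows "fourier f \<in> l2 lborel" and "nm lborel (fourier f) = nm lborel f"
proof -
  have [measurable]: "f \<in> borel_measurable borel" using borel_measurable_integrable[OF f] by simp
  define R where "R z = (\<integral>x. f x * cnj (f (x - z)) \<partial>lborel)" for z
  have [measurable]: "R \<in> borel_measurable borel" unfolding R_def by measurable
  have R_ip: "R z = ip lborel f (\<lambda>x. f (x - z))" for z by (simp add: R_def ip_def)
  define \<epsilon> where "\<epsilon> n = 1 / real (Suc n)" for n
  have \<epsilon>: "0 < \<epsilon> n" "\<epsilon> \<longlonglongrightarrow> 0" for n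
    unfolding \<epsilon>_def by (simp, rule LIMSEQ_Suc[OF lim_1_over_n])
  define A where "A n = (\<integral>\<xi>. (norm (fourier f \<xi>))\<^sup>2 * gauss ((2 * pi * \<epsilon> n) *\<^sub>R \<xi>) \<partial>lborel)" for n
  have "(\<lambda>n. \<integral>w. R (\<epsilon> n *\<^sub>R w) * of_real (gauss w) \<partial>lborel) \<longlonglongrightarrow> (\<integral>w. R 0 * of_real (gauss (w::'a)) \<partial>lborel)"
  proof (rule integral_dominated_convergence[where w = "\<lambda>w. (nm lborel f)\<^sup>2 * gauss w"])
    show "integrable lborel (\<lambda>w::'a. (nm lborel f)\<^sup>2 * gauss w)"
      using integrable_norm[OF gauss_fourier(1)[of "0::'a"]] by simp
    show "AE w in lborel. (\<lambda>n. R (\<epsilon> n *\<^sub>R w) * of_real (gauss w)) \<longlonglongrightarrow> R 0 * of_real (gauss w)"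
    proof (intro AE_I2 tendsto_mult tendsto_const)
      fix w :: 'a
      have "(\<lambda>n. \<epsilon> n *\<^sub>R w) \<longlonglongrightarrow> 0" using tendsto_scaleR[OF \<epsilon>(2) tendsto_const[of w]] by simp
      then show "(\<lambda>n. R (\<epsilon> n *\<^sub>R w)) \<longlonglongrightarrow> R 0"
        unfolding R_ip
        by (intro tendsto_ip f2 l2_translate) (auto simp: nm_def[of _ "\<lambda>_. 0"] f2 intro: l2_translation_continuous)
    qed
    fix n
    show "AE w in lborel. norm (R (\<epsilon> n *\<^sub>R w) * of_real (gauss w)) \<le> (nm lborel f)\<^sup>2 * gauss w"
    proof (rule AE_I2)
      fix w :: 'a
      have "norm (R (\<epsilon> n *\<^sub>R w)) \<le> (nm lborel f)\<^sup>2"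
        using Cauchy_Schwarz_l2[OF f2 l2_translate(1)[OF f2]] l2_translate(2)[OF f2]
        unfolding R_ip power2_eq_square by simp
      then show "norm (R (\<epsilon> n *\<^sub>R w) * of_real (gauss w)) \<le> (nm lborel f)\<^sup>2 * gauss w"
        by (simp add: norm_mult mult_right_mono less_imp_le)
    qed
  qed measurable
  also have "(\<integral>w. R 0 * of_real (gauss (w::'a)) \<partial>lborel) = R 0 * of_real (sqrt (2 * pi) ^ DIM('a))"
    using gauss_fourier(2)[of "0::'a"] by simp
  finally have "(\<lambda>n. of_real ((1 / sqrt (2 * pi)) ^ DIM('a)) * (\<integral>w. R (\<epsilon> n *\<^sub>R w) * of_real (gauss w) \<partial>lborel))
      \<longlonglongrightarrow> of_real ((1 / sqrt (2 * pi)) ^ DIM('a)) * (R 0 * of_real (sqrt (2 * pi) ^ DIM('a)))"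
    by (rule tendsto_mult_left)
  also have "of_real ((1 / sqrt (2 * pi)) ^ DIM('a)) * (R 0 * of_real (sqrt (2 * pi) ^ DIM('a))) = R 0"
    by (simp add: power_divide)
  also have "R 0 = of_real ((nm lborel f)\<^sup>2)"
    using ip_self[of lborel f] by (simp add: R_ip)
  finally have "(\<lambda>n. complex_of_real (A n)) \<longlonglongrightarrow> of_real ((nm lborel f)\<^sup>2)"
    unfolding A_def integral_complex_of_real[symmetric] fourier_gauss_weighted[OF f \<epsilon>(1)] R_def .
  then have A: "A \<longlonglongrightarrow> (nm lborel f)\<^sup>2"
    by (simp only: tendsto_of_real_iff)
  have bdd: "norm (fourier f \<xi>) \<le> (\<integral>x. norm (f x) \<partial>lborel)" for \<xi>
  proof -
    have "norm (fourier f \<xi>) \<le> (\<integral>x. norm (cis (- 2 * pi * (x \<bullet> \<xi>)) * f x) \<partial>lborel)"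
      by (subst fourier_lborel) (auto intro!: integral_norm_bound)
    then show ?thesis by (simp add: norm_mult)
  qed
  have gint: "integrable lborel (\<lambda>\<xi>::'a. gauss ((2 * pi * \<epsilon> n) *\<^sub>R \<xi>))" for n
    using integrable_norm[OF gauss_scaled_fourier(1)[of "2 * pi * \<epsilon> n"]] \<epsilon>(1)[of n] by simp
  have int: "integrable lborel (\<lambda>\<xi>. (norm (fourier f \<xi>))\<^sup>2 * gauss ((2 * pi * \<epsilon> n) *\<^sub>R \<xi>))" for n
    by (rule Bochner_Integration.integrable_bound[OF integrable_mult_right[OF gint[of n], of "(\<integral>x. norm (f x) \<partial>lborel)\<^sup>2"]])
      (auto intro!: AE_I2 mult_right_mono power_mono bdd simp: less_imp_le abs_mult)
  have lim: "(\<lambda>n. (norm (fourier f \<xi>))\<^sup>2 * gauss ((2 * pi * \<epsilon> n) *\<^sub>R \<xi>)) \<longlonglongrightarrow> (norm (fourier f \<xi>))\<^sup>2" for \<xi>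
  proof -
    have "(\<lambda>n. (norm (fourier f \<xi>))\<^sup>2 * exp (- (norm ((2 * pi * \<epsilon> n) *\<^sub>R \<xi>))\<^sup>2 / 2))
       \<longlonglongrightarrow> (norm (fourier f \<xi>))\<^sup>2 * exp (- (norm ((2 * pi * 0) *\<^sub>R \<xi>))\<^sup>2 / 2)"
      by (intro tendsto_intros \<epsilon>) auto
    then show ?thesis by (simp add: gauss_def)
  qed
  \<comment> \<open>Square integrability of the transform comes first, by Fatou; its squared modulus
    then serves as the dominating function for the equality of norms.\<close>
  have "(\<integral>\<^sup>+\<xi>. ennreal ((norm (fourier f \<xi>))\<^sup>2) \<partial>lborel)
      = (\<integral>\<^sup>+\<xi>. liminf (\<lambda>n. ennreal ((norm (fourier f \<xi>))\<^sup>2 * gauss ((2 * pi * \<epsilon> n) *\<^sub>R \<xi>))) \<partial>lborel)"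
    by (intro nn_integral_cong lim_imp_Liminf[symmetric] tendsto_ennrealI lim) simp
  also have "\<dots> \<le> liminf (\<lambda>n. \<integral>\<^sup>+\<xi>. ennreal ((norm (fourier f \<xi>))\<^sup>2 * gauss ((2 * pi * \<epsilon> n) *\<^sub>R \<xi>)) \<partial>lborel)"
    by (rule nn_integral_liminf) measurable
  also have "\<dots> = liminf (\<lambda>n. ennreal (A n))"
    unfolding A_def by (subst nn_integral_eq_integral[OF int]) (auto simp: less_imp_le)
  also have "\<dots> = ennreal ((nm lborel f)\<^sup>2)"
    by (intro lim_imp_Liminf tendsto_ennrealI A) simp
  finally have fin: "(\<integral>\<^sup>+\<xi>. ennreal ((norm (fourier f \<xi>))\<^sup>2) \<partial>lborel) \<le> ennreal ((nm lborel f)\<^sup>2)" .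
  have int2: "integrable lborel (\<lambda>\<xi>. (norm (fourier f \<xi>))\<^sup>2)"
    using le_less_trans[OF fin] by (intro integrableI_nonneg) auto
  then show "fourier f \<in> l2 lborel" by (intro l2I) auto
  have "A \<longlonglongrightarrow> (\<integral>\<xi>. (norm (fourier f \<xi>))\<^sup>2 \<partial>lborel)"
    unfolding A_def
    by (rule integral_dominated_convergence[OF _ _ int2])
      (auto intro!: AE_I2 lim mult_left_le gauss_le_1 simp: abs_mult less_imp_le)
  then have "(nm lborel f)\<^sup>2 = (\<integral>\<xi>. (norm (fourier f \<xi>))\<^sup>2 \<partial>lborel)"
    by (rule LIMSEQ_unique[OF A])
  then show "nm lborel (fourier f) = nm lborel f"
    by (simp add: nm_def)
qed

section \<open>Fourier multipliers on square integrable functions\<close>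

lemma L2_tendsto_iff:
  "L2_tendsto f g \<longleftrightarrow> (\<forall>n. f n \<in> l2 lebesgue) \<and> g \<in> l2 lebesgue \<and>
     (\<lambda>n. nm lebesgue (\<lambda>x. f n x - g x)) \<longlonglongrightarrow> 0"
proof -
  have "(\<lambda>n. (nm lebesgue (\<lambda>x. f n x - g x))\<^sup>2) \<longlonglongrightarrow> 0 \<longleftrightarrow> (\<lambda>n. nm lebesgue (\<lambda>x. f n x - g x)) \<longlonglongrightarrow> 0" (is "?A \<longleftrightarrow> ?B")
  proof
    assume ?A
    from tendsto_real_sqrt[OF this] show ?B by simp
  next
    assume ?B
    from tendsto_power[OF this, of 2] show ?A by simp
  qed
  then show ?thesis
    unfolding L2_tendsto_def L2_eq_l2 by (simp only: nm_power2)
qed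

lemma integrable_cis_mult:
  fixes f :: "'a::euclidean_space \<Rightarrow> complex"
  assumes "integrable lebesgue f"
  shows "integrable lebesgue (\<lambda>x. cis (- 2 * pi * (x \<bullet> \<xi>)) * f x)"
proof -
  have "(\<lambda>x. cis (- 2 * pi * (x \<bullet> \<xi>))) \<in> borel_measurable lebesgue"
    by (rule borel_imp_lebesgue_measurable) measurable
  then show ?thesis
    using assms by (intro Bochner_Integration.integrable_bound[OF assms]) (auto simp: norm_mult)
qed

lemma fourier_add:
  "integrable lebesgue f \<Longrightarrow> integrable lebesgue g \<Longrightarrow> fourier (\<lambda>x. f x + g x) \<xi> = fourier f \<xi> + fourier g \<xi>"
  unfolding fourier_def distrib_left
  by (rule Bochner_Integration.integral_add; rule integrable_cis_mult)

lemma fourier_scale: "fourier (\<lambda>x. c * f x) \<xi> = c * fourier f \<xi>"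
  unfolding fourier_def mult.left_commute[of _ c] by simp

lemma fourier_diff:
  "integrable lebesgue f \<Longrightarrow> integrable lebesgue g \<Longrightarrow> fourier (\<lambda>x. f x - g x) \<xi> = fourier f \<xi> - fourier g \<xi>"
  using fourier_add[of f "\<lambda>x. - 1 * g x" \<xi>] fourier_scale[of "-1" g \<xi>] by simp

lemma borel_version_integrable:
  fixes f :: "'a::euclidean_space \<Rightarrow> complex"
  assumes f: "integrable lebesgue f"
  obtains g where "g \<in> borel_measurable borel" "AE x in lebesgue. f x = g x" "integrable lborel g" "fourier f = fourier g"
proof -
  obtain g where g: "g \<in> borel_measurable borel" "AE x in lborel. f x = g x"
    using borel_version[OF borel_measurable_integrable[OF f]] by blast
  have ae: "AE x in lebesgue. f x = g x" using AE_completion[OF g(2)] .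
  have "integrable lebesgue g"
    using integrable_cong_AE_imp[OF f borel_imp_lebesgue_measurable[OF g(1)]] ae by (auto simp: eq_commute)
  then have "integrable lborel g"
    using g(1) by (simp add: integrable_completion)
  then show ?thesis
    using that[OF g(1) ae] fourier_AE_cong[OF _ borel_imp_lebesgue_measurable[OF g(1)] ae] f by auto
qed

lemma plancherel_lebesgue:
  fixes f :: "'a::euclidean_space \<Rightarrow> complex"
  assumes f: "integrable lebesgue f" and f2: "f \<in> l2 lebesgue"
  shows "fourier f \<in> l2 lebesgue" and "nm lebesgue (fourier f) = nm lebesgue f"
proof -
  from f obtain g where g: "g \<in> borel_measurable borel" "AE x in lebesgue. f x = g x" "integrable lborel g" "fourier f = fourier g"
    by (rule borel_version_integrable)
  have "g \<in> l2 lebesgue"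
    by (rule l2_AE_cong[OF f2 _ g(2)]) (rule borel_imp_lebesgue_measurable[OF g(1)])
  then have g2: "g \<in> l2 lborel" using g(1) by (simp add: l2_lebesgue_iff)
  have m: "fourier g \<in> borel_measurable borel" by (rule fourier_borel_measurable[OF g(1)])
  show "fourier f \<in> l2 lebesgue"
    using plancherel_lborel(1)[OF g(3) g2] m by (simp add: g(4) l2_lebesgue_iff)
  have "nm lebesgue f = nm lebesgue g"
    by (rule nm_AE_cong[OF g(2)]) (use f2 g(1) in \<open>auto intro: l2_measurable borel_imp_lebesgue_measurable\<close>)
  then show "nm lebesgue (fourier f) = nm lebesgue f"
    using plancherel_lborel(2)[OF g(3) g2] m g(1) by (simp add: g(4) nm_lebesgue)
qed

lemma fourier_multiplication_lebesgue:
  fixes f g :: "'a::euclidean_space \<Rightarrow> complex"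
  assumes f: "integrable lebesgue f" and g: "integrable lebesgue g"
  shows "(\<integral>x. fourier f x * g x \<partial>lebesgue) = (\<integral>x. f x * fourier g x \<partial>lebesgue)"
proof -
  from f obtain f' where f': "f' \<in> borel_measurable borel" "AE x in lebesgue. f x = f' x" "integrable lborel f'" "fourier f = fourier f'"
    by (rule borel_version_integrable)
  from g obtain g' where g': "g' \<in> borel_measurable borel" "AE x in lebesgue. g x = g' x" "integrable lborel g'" "fourier g = fourier g'"
    by (rule borel_version_integrable)
  note [measurable] = f'(1) g'(1) fourier_borel_measurable[OF f'(1)] fourier_borel_measurable[OF g'(1)]
  note m = borel_measurable_integrable[OF f] borel_measurable_integrable[OF g]
    borel_imp_lebesgue_measurable[OF f'(1)] borel_imp_lebesgue_measurable[OF g'(1)]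
    borel_imp_lebesgue_measurable[OF fourier_borel_measurable[OF f'(1)]]
    borel_imp_lebesgue_measurable[OF fourier_borel_measurable[OF g'(1)]]
  have "(\<integral>x. fourier f x * g x \<partial>lebesgue) = (\<integral>x. fourier f' x * g' x \<partial>lebesgue)"
    using g'(2) m by (intro integral_cong_AE) (auto simp: f'(4))
  also have "\<dots> = (\<integral>x. fourier f' x * g' x \<partial>lborel)"
    by (rule integral_completion) simp
  also have "\<dots> = (\<integral>x. f' x * fourier g' x \<partial>lborel)"
    by (rule fourier_multiplication_formula[OF f'(3) g'(3)])
  also have "\<dots> = (\<integral>x. f' x * fourier g' x \<partial>lebesgue)"
    by (rule integral_completion[symmetric]) simp
  also have "\<dots> = (\<integral>x. f x * fourier g x \<partial>lebesgue)"
    using f'(2) m by (intro integral_cong_AE) (auto simp: g'(4))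
  finally show ?thesis .
qed

section \<open>The Fourier transform of square integrable functions as a relation\<close>

lemma is_fourier_L2_l2: "is_fourier_L2 f g \<Longrightarrow> f \<in> l2 lebesgue" "is_fourier_L2 f g \<Longrightarrow> g \<in> l2 lebesgue"
  by (auto simp: is_fourier_L2_def L2_tendsto_iff)

lemma is_fourier_L2_nm:
  assumes "is_fourier_L2 f g"
  shows "nm lebesgue g = nm lebesgue f"
proof -
  obtain s where s: "\<And>n. integrable lebesgue (s n)" "L2_tendsto s f" "L2_tendsto (\<lambda>n. fourier (s n)) g"
    using assms by (auto simp: is_fourier_L2_def)
  have "(\<lambda>n. nm lebesgue (s n)) \<longlonglongrightarrow> nm lebesgue f"
    using s(2) by (intro tendsto_nm) (auto simp: L2_tendsto_iff)
  moreover have "(\<lambda>n. nm lebesgue (fourier (s n))) \<longlonglongrightarrow> nm lebesgue g"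
    using s(3) by (intro tendsto_nm) (auto simp: L2_tendsto_iff)
  moreover have "nm lebesgue (fourier (s n)) = nm lebesgue (s n)" for n
    using s by (intro plancherel_lebesgue) (auto simp: L2_tendsto_iff)
  ultimately show ?thesis
    by (simp add: LIMSEQ_unique)
qed

lemma tendsto_0_le_real:
  fixes a b :: "nat \<Rightarrow> real"
  assumes "\<And>n. 0 \<le> a n" "\<And>n. a n \<le> b n" "b \<longlonglongrightarrow> 0"
  shows "a \<longlonglongrightarrow> 0"
  by (rule tendsto_sandwich[OF _ _ tendsto_const assms(3)]) (use assms in auto)

lemma L2_tendsto_linear:
  assumes "L2_tendsto s f" "L2_tendsto t g"
  shows "L2_tendsto (\<lambda>n x. s n x + c * t n x) (\<lambda>x. f x + c * g x)"
proof -
  have l2: "s n \<in> l2 lebesgue" "t n \<in> l2 lebesgue" "f \<in> l2 lebesgue" "g \<in> l2 lebesgue" for n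
    using assms by (auto simp: L2_tendsto_iff)
  have lim: "(\<lambda>n. nm lebesgue (\<lambda>x. s n x - f x)) \<longlonglongrightarrow> 0" "(\<lambda>n. nm lebesgue (\<lambda>x. t n x - g x)) \<longlonglongrightarrow> 0"
    using assms by (auto simp: L2_tendsto_iff)
  have eq: "(\<lambda>x. s n x + c * t n x - (f x + c * g x)) = (\<lambda>x. (s n x - f x) + c * (t n x - g x))" for n
    by (auto simp: algebra_simps)
  have "nm lebesgue (\<lambda>x. s n x + c * t n x - (f x + c * g x))
      \<le> nm lebesgue (\<lambda>x. s n x - f x) + norm c * nm lebesgue (\<lambda>x. t n x - g x)" for n
    unfolding eq nm_scale[symmetric] by (intro nm_triangle l2_diff l2_scale l2)
  moreover have "(\<lambda>n. nm lebesgue (\<lambda>x. s n x - f x) + norm c * nm lebesgue (\<lambda>x. t n x - g x)) \<longlonglongrightarrow> 0"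
    using tendsto_add[OF lim(1) tendsto_mult_left[OF lim(2), of "norm c"]] by simp
  ultimately have "(\<lambda>n. nm lebesgue (\<lambda>x. s n x + c * t n x - (f x + c * g x))) \<longlonglongrightarrow> 0"
    by (rule tendsto_0_le_real[OF nm_nonneg])
  then show ?thesis
    unfolding L2_tendsto_iff by (intro conjI allI l2_add l2_scale l2)
qed

lemma is_fourier_L2_linear:
  assumes "is_fourier_L2 f f'" "is_fourier_L2 g g'"
  shows "is_fourier_L2 (\<lambda>x. f x + c * g x) (\<lambda>x. f' x + c * g' x)"
proof -
  obtain s where s: "\<And>n. integrable lebesgue (s n)" "L2_tendsto s f" "L2_tendsto (\<lambda>n. fourier (s n)) f'"
    using assms(1) by (auto simp: is_fourier_L2_def)
  obtain t where t: "\<And>n. integrable lebesgue (t n)" "L2_tendsto t g" "L2_tendsto (\<lambda>n. fourier (t n)) g'"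
    using assms(2) by (auto simp: is_fourier_L2_def)
  have eq: "fourier (\<lambda>x. s n x + c * t n x) = (\<lambda>\<xi>. fourier (s n) \<xi> + c * fourier (t n) \<xi>)" for n
    using fourier_add[OF s(1) integrable_mult_right[OF t(1), of c]] by (auto simp: fourier_scale)
  show ?thesis
    unfolding is_fourier_L2_def
    by (rule exI[of _ "\<lambda>n x. s n x + c * t n x"])
      (use s t in \<open>auto simp: eq intro: L2_tendsto_linear\<close>)
qed

text \<open>Polarisation: the norm of a sum determines the real part of the inner product, and the
  transform is linear and preserves norms.\<close>

lemma is_fourier_L2_Re_ip:
  assumes "is_fourier_L2 f f'" "is_fourier_L2 g g'"
  shows "Re (ip lebesgue f' g') = Re (ip lebesgue f g)"
proof -
  note l = is_fourier_L2_l2[OF assms(1)] is_fourier_L2_l2[OF assms(2)]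
  have "nm lebesgue (\<lambda>x. f' x + g' x) = nm lebesgue (\<lambda>x. f x + g x)"
    using is_fourier_L2_nm[OF is_fourier_L2_linear[OF assms, of 1]] by simp
  then show ?thesis
    using nm_add_power2[OF l(1,3)] nm_add_power2[OF l(2,4)] is_fourier_L2_nm[OF assms(1)] is_fourier_L2_nm[OF assms(2)]
    by simp
qed

lemma is_fourier_L2_scale:
  assumes "is_fourier_L2 g g'"
  shows "is_fourier_L2 (\<lambda>x. c * g x) (\<lambda>x. c * g' x)"
  using is_fourier_L2_linear[OF assms assms, of "c - 1"] by (simp add: algebra_simps)

theorem is_fourier_L2_ip:
  assumes "is_fourier_L2 f f'" "is_fourier_L2 g g'"
  shows "ip lebesgue f' g' = ip lebesgue f g"
proof (rule complex_eqI)
  \<comment> \<open>Multiplying the second argument by the imaginary unit brings the imaginary part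
    into the place of the real part.\<close>
  show "Im (ip lebesgue f' g') = Im (ip lebesgue f g)"
    using is_fourier_L2_Re_ip[OF assms(1) is_fourier_L2_scale[OF assms(2), of \<i>]]
    by (simp add: ip_scale_right)
qed (rule is_fourier_L2_Re_ip[OF assms])

lemma is_fourier_L2_nm_diff:
  assumes "is_fourier_L2 f f'" "is_fourier_L2 g g'"
  shows "nm lebesgue (\<lambda>x. f' x - g' x) = nm lebesgue (\<lambda>x. f x - g x)"
  using is_fourier_L2_nm[OF is_fourier_L2_linear[OF assms, of "-1"]] by simp

lemma is_fourier_L2_cong:
  assumes F: "is_fourier_L2 f g" and g': "g' \<in> l2 lebesgue" and 0: "nm lebesgue (\<lambda>x. g x - g' x) = 0"
  shows "is_fourier_L2 f g'"
proof -
  obtain s where s: "\<And>n. integrable lebesgue (s n)" "L2_tendsto s f" "L2_tendsto (\<lambda>n. fourier (s n)) g"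
    using F by (auto simp: is_fourier_L2_def)
  then have l: "fourier (s n) \<in> l2 lebesgue" "g \<in> l2 lebesgue" "(\<lambda>n. nm lebesgue (\<lambda>x. fourier (s n) x - g x)) \<longlonglongrightarrow> 0" for n
    by (auto simp: L2_tendsto_iff)
  have "nm lebesgue (\<lambda>x. fourier (s n) x - g' x) \<le> nm lebesgue (\<lambda>x. fourier (s n) x - g x)" for n
    using nm_triangle_diff[OF l(1,2) g', of n] 0 by simp
  then have "(\<lambda>n. nm lebesgue (\<lambda>x. fourier (s n) x - g' x)) \<longlonglongrightarrow> 0"
    by (rule tendsto_0_le_real[OF nm_nonneg _ l(3)])
  then have "L2_tendsto (\<lambda>n. fourier (s n)) g'" using l g' by (auto simp: L2_tendsto_iff)
  then show ?thesis using s by (auto simp: is_fourier_L2_def)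
qed

text \<open>Truncations to balls are integrable and tend to \<open>u\<close>; Plancherel's theorem
  makes their transforms a Cauchy sequence.\<close>

theorem ex_is_fourier_L2:
  fixes u :: "'a::euclidean_space \<Rightarrow> complex"
  assumes u: "u \<in> l2 lebesgue"
  shows "\<exists>h. is_fourier_L2 u h"
proof -
  define s where "s n x = indicator (cball 0 (real n)) x * u x" for n x
  have [measurable]: "(indicator (cball (0::'a) R) :: 'a \<Rightarrow> complex) \<in> borel_measurable borel" for R
    by (rule borel_measurable_indicator) simp
  have ind: "(indicator (cball (0::'a) R) :: 'a \<Rightarrow> complex) \<in> borel_measurable lebesgue" for R
    by (rule borel_imp_lebesgue_measurable) simp
  have ind2: "(\<lambda>x::'a. indicator (cball 0 R) x :: complex) \<in> l2 lebesgue" for R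
  proof -
    have "integrable lborel (\<lambda>x::'a. (norm (indicator (cball 0 R) x :: complex))\<^sup>2)"
      by (rule integrable_bounded_support[where B = 1 and R = R]) (auto simp: indicator_def)
    then have "(\<lambda>x::'a. indicator (cball 0 R) x :: complex) \<in> l2 lborel" by (intro l2I) auto
    then show ?thesis by (subst l2_lebesgue_iff) auto
  qed
  have s2: "s n \<in> l2 lebesgue" for n
    unfolding s_def by (rule l2_mult_bounded[OF u ind, where B = 1]) (auto simp: indicator_def)
  have s1: "integrable lebesgue (s n)" for n
    unfolding s_def by (rule l2_mult_integrable[OF ind2 u])
  have lim: "(\<lambda>n. nm lebesgue (\<lambda>x. s n x - u x)) \<longlonglongrightarrow> 0"
  proof (rule nm_tendsto_0_dominated[where h = "\<lambda>x. (norm (u x))\<^sup>2"])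
    show "(\<lambda>x. s n x - u x) \<in> borel_measurable lebesgue" for n
      using l2_measurable[OF l2_diff[OF s2 u]] .
    show "AE x in lebesgue. (\<lambda>n. s n x - u x) \<longlonglongrightarrow> 0"
    proof (rule AE_I2)
      fix x :: 'a
      obtain N0 where "norm x \<le> real N0" using real_arch_simple by blast
      then have "\<forall>\<^sub>F n in sequentially. s n x - u x = 0"
        by (intro eventually_sequentiallyI[of N0]) (auto simp: s_def indicator_def)
      then show "(\<lambda>n. s n x - u x) \<longlonglongrightarrow> 0" by (rule tendsto_eventually)
    qed
  qed (use u in \<open>auto simp: l2_integrable s_def indicator_def\<close>)
  have F2: "fourier (s n) \<in> l2 lebesgue" for n by (rule plancherel_lebesgue[OF s1 s2])
  have Fdiff: "fourier (\<lambda>x. s m x - s n x) = (\<lambda>x. fourier (s m) x - fourier (s n) x)" for m n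
    by (rule ext) (rule fourier_diff[OF s1 s1])
  have diff: "nm lebesgue (\<lambda>x. fourier (s m) x - fourier (s n) x) = nm lebesgue (\<lambda>x. s m x - s n x)" for m n
    using plancherel_lebesgue(2)[OF Bochner_Integration.integrable_diff[OF s1 s1] l2_diff[OF s2 s2], of m n]
    unfolding Fdiff .
  have "\<exists>N. \<forall>m\<ge>N. \<forall>n\<ge>N. nm lebesgue (\<lambda>x. fourier (s m) x - fourier (s n) x) < e" if "0 < e" for e
    unfolding diff by (rule Cauchy_nm_if_tendsto[OF s2 u lim that])
  from l2_complete[OF F2 this] obtain h where "h \<in> l2 lebesgue" "(\<lambda>n. nm lebesgue (\<lambda>x. fourier (s n) x - h x)) \<longlonglongrightarrow> 0"
    by blast
  then show ?thesis
    unfolding is_fourier_L2_def L2_tendsto_iff using s1 s2 F2 u lim by blast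
qed

text \<open>This symmetry, which passes to limits from integrable functions, identifies the adjoint
  that is used for surjectivity below.\<close>

lemma is_fourier_L2_multiplication:
  assumes "is_fourier_L2 f f'" "is_fourier_L2 g g'"
  shows "(\<integral>x. f' x * g x \<partial>lebesgue) = (\<integral>x. f x * g' x \<partial>lebesgue)"
proof -
  obtain s where s: "\<And>n. integrable lebesgue (s n)" "L2_tendsto s f" "L2_tendsto (\<lambda>n. fourier (s n)) f'"
    using assms(1) by (auto simp: is_fourier_L2_def)
  obtain t where t: "\<And>n. integrable lebesgue (t n)" "L2_tendsto t g" "L2_tendsto (\<lambda>n. fourier (t n)) g'"
    using assms(2) by (auto simp: is_fourier_L2_def)
  have cnj_lim: "(\<lambda>n. nm lebesgue (\<lambda>x. cnj (p n x) - cnj (q x))) \<longlonglongrightarrow> 0"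
    if "(\<lambda>n. nm lebesgue (\<lambda>x. p n x - q x)) \<longlonglongrightarrow> 0" for p :: "nat \<Rightarrow> 'a \<Rightarrow> complex" and q
    using that nm_cnj[of lebesgue "\<lambda>x. p n x - q x" for n] by simp
  have "(\<lambda>n. ip lebesgue (fourier (s n)) (\<lambda>x. cnj (t n x))) \<longlonglongrightarrow> ip lebesgue f' (\<lambda>x. cnj (g x))"
    using s t by (intro tendsto_ip cnj_lim l2_cnj) (auto simp: L2_tendsto_iff)
  moreover have "(\<lambda>n. ip lebesgue (s n) (\<lambda>x. cnj (fourier (t n) x))) \<longlonglongrightarrow> ip lebesgue f (\<lambda>x. cnj (g' x))"
    using s t by (intro tendsto_ip cnj_lim l2_cnj) (auto simp: L2_tendsto_iff)
  moreover have "ip lebesgue (fourier (s n)) (\<lambda>x. cnj (t n x)) = ip lebesgue (s n) (\<lambda>x. cnj (fourier (t n) x))" for n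
    using fourier_multiplication_lebesgue[OF s(1) t(1)] by (simp add: ip_def)
  ultimately show ?thesis
    using LIMSEQ_unique by (fastforce simp: ip_def)
qed

text \<open>With \<open>F\<^sup>* h\<close> the conjugate of the transform of \<open>cnj h\<close>, both \<open>F\<close> and \<open>F\<^sup>*\<close> are isometries and adjoint
  to each other, whence \<open>\<parallel>F (F\<^sup>* h) - h\<parallel>\<^sup>2 = \<parallel>F\<^sup>* h\<parallel>\<^sup>2 - 2 \<parallel>F\<^sup>* h\<parallel>\<^sup>2 + \<parallel>h\<parallel>\<^sup>2 = 0\<close>.\<close>

theorem ex_is_fourier_L2_inverse:
  fixes h :: "'a::euclidean_space \<Rightarrow> complex"
  assumes h: "h \<in> l2 lebesgue"
  shows "\<exists>w. is_fourier_L2 w h"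
proof -
  obtain k where k: "is_fourier_L2 (\<lambda>x. cnj (h x)) k"
    using ex_is_fourier_L2[OF l2_cnj[OF h]] by blast
  define w where "w x = cnj (k x)" for x
  have w: "w \<in> l2 lebesgue"
    unfolding w_def by (intro l2_cnj is_fourier_L2_l2[OF k])
  have nw: "nm lebesgue w = nm lebesgue h"
    using is_fourier_L2_nm[OF k] by (simp add: w_def[abs_def] nm_cnj)
  obtain h' where h': "is_fourier_L2 w h'" using ex_is_fourier_L2[OF w] by blast
  have "ip lebesgue h' h = (\<integral>x. w x * k x \<partial>lebesgue)"
    using is_fourier_L2_multiplication[OF h' k] by (simp add: ip_def)
  also have "\<dots> = ip lebesgue w w" by (simp add: ip_def w_def)
  finally have "Re (ip lebesgue h' h) = (nm lebesgue h)\<^sup>2" by (simp add: ip_self nw)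
  then have "(nm lebesgue (\<lambda>x. h' x - h x))\<^sup>2 = 0"
    using nm_diff_power2[OF is_fourier_L2_l2(2)[OF h'] h] is_fourier_L2_nm[OF h'] nw by simp
  then have "is_fourier_L2 w h"
    by (intro is_fourier_L2_cong[OF h' h]) simp
  then show ?thesis by blast
qed

text \<open>The choice in \<open>multiplier_op\<close> is a proper one because the transform is
  onto: some function has the transform \<open>\<sigma> x * h x\<close>.\<close>

lemma multiplier_op_fourier:
  fixes \<sigma> :: "'a::euclidean_space \<Rightarrow> complex"
  assumes \<sigma>: "\<sigma> \<in> borel_measurable borel" "\<And>x. norm (\<sigma> x) \<le> B" and u: "u \<in> l2 lebesgue"
  shows "\<exists>h. is_fourier_L2 u h \<and> is_fourier_L2 (multiplier_op \<sigma> u) (\<lambda>x. \<sigma> x * h x)"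
proof -
  obtain h where h: "is_fourier_L2 u h" using ex_is_fourier_L2[OF u] by blast
  have "(\<lambda>x. \<sigma> x * h x) \<in> l2 lebesgue"
    by (rule l2_mult_bounded[OF is_fourier_L2_l2(2)[OF h] borel_imp_lebesgue_measurable[OF \<sigma>(1)] \<sigma>(2)])
  then obtain w where "is_fourier_L2 w (\<lambda>x. \<sigma> x * h x)" using ex_is_fourier_L2_inverse by blast
  then have "\<exists>w h. is_fourier_L2 u h \<and> is_fourier_L2 w (\<lambda>\<xi>. \<sigma> \<xi> * h \<xi>)" using h by blast
  then show ?thesis
    unfolding multiplier_op_def by (rule someI_ex)
qed

text \<open>The expressions in \<open>admissible\<close> as forms in two arguments, with the
  cut-offs \<open>\<phi>\<close> and \<open>\<theta>\<close> kept apart.\<close>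

definition multiplier_form :: "('a::euclidean_space \<Rightarrow> complex) \<Rightarrow> ('a \<Rightarrow> complex) \<Rightarrow> ('a \<Rightarrow> complex) \<Rightarrow>
    ('a \<Rightarrow> complex) \<Rightarrow> ('a \<Rightarrow> complex) \<Rightarrow> complex" where
  "multiplier_form \<sigma> \<phi> \<theta> f g = (\<integral>x. multiplier_op \<sigma> (\<lambda>x. \<phi> x * f x) x * cnj (\<theta> x * g x) \<partial>lebesgue)"

text \<open>The choice made inside \<open>multiplier_op\<close> involves some transform of the
  cut-off function, which agrees almost everywhere with the given \<open>h\<close>; preservation of
  inner products then moves the integral to the Fourier side.\<close>

lemma multiplier_form_fourier:
  fixes \<sigma> :: "'a::euclidean_space \<Rightarrow> complex"
  assumes \<sigma>: "\<sigma> \<in> borel_measurable borel" "\<And>x. norm (\<sigma> x) \<le> B" and B: "0 \<le> B"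
    and h: "is_fourier_L2 (\<lambda>x. \<phi> x * f x) h" and k: "is_fourier_L2 (\<lambda>x. \<theta> x * g x) k"
  shows "multiplier_form \<sigma> \<phi> \<theta> f g = ip lebesgue (\<lambda>x. \<sigma> x * h x) k"
proof -
  note \<sigma>' = borel_imp_lebesgue_measurable[OF \<sigma>(1)] \<sigma>(2)
  obtain h' where h': "is_fourier_L2 (\<lambda>x. \<phi> x * f x) h'"
    and m: "is_fourier_L2 (multiplier_op \<sigma> (\<lambda>x. \<phi> x * f x)) (\<lambda>x. \<sigma> x * h' x)"
    using multiplier_op_fourier[OF \<sigma> is_fourier_L2_l2(1)[OF h]] by blast
  have "nm lebesgue (\<lambda>x. h' x - h x) = 0"
    using is_fourier_L2_nm_diff[OF h' h] by (simp add: nm_def)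
  then have ae: "AE x in lebesgue. h' x = h x"
    using nm_eq_0_iff[OF l2_diff[OF is_fourier_L2_l2(2)[OF h'] is_fourier_L2_l2(2)[OF h]]] by simp
  have "multiplier_form \<sigma> \<phi> \<theta> f g = ip lebesgue (\<lambda>x. \<sigma> x * h' x) k"
    unfolding is_fourier_L2_ip[OF m k] by (simp add: multiplier_form_def ip_def)
  also have "\<dots> = ip lebesgue (\<lambda>x. \<sigma> x * h x) k"
    using ae by (intro ip_AE_cong)
      (auto intro!: l2_measurable l2_mult_bounded[OF _ \<sigma>'] is_fourier_L2_l2(2)[OF h] is_fourier_L2_l2(2)[OF h'] is_fourier_L2_l2(2)[OF k])
  finally show ?thesis .
qed

definition bounded_sesquilinear_l2 :: "'a measure \<Rightarrow> (('a \<Rightarrow> complex) \<Rightarrow> ('a \<Rightarrow> complex) \<Rightarrow> complex) \<Rightarrow> real \<Rightarrow> bool" where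
  "bounded_sesquilinear_l2 M Q C \<longleftrightarrow> 0 \<le> C \<and>
     (\<forall>f\<in>l2 M. \<forall>g\<in>l2 M. \<forall>h\<in>l2 M. \<forall>c. Q (\<lambda>x. f x + c * g x) h = Q f h + c * Q g h) \<and>
     (\<forall>f\<in>l2 M. \<forall>g\<in>l2 M. \<forall>h\<in>l2 M. \<forall>c. Q h (\<lambda>x. f x + c * g x) = Q h f + cnj c * Q h g) \<and>
     (\<forall>f\<in>l2 M. \<forall>g\<in>l2 M. norm (Q f g) \<le> C * nm M f * nm M g)"

text \<open>Linearity is read off from the Fourier side, since \<open>multiplier_op\<close> is a
  choice of representatives and need not be linear pointwise.\<close>

theorem multiplier_form_sesquilinear:
  fixes \<sigma> \<phi> \<theta> :: "'a::euclidean_space \<Rightarrow> complex"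
  assumes \<sigma>: "\<sigma> \<in> borel_measurable borel" "\<And>x. norm (\<sigma> x) \<le> B"
    and \<phi>: "\<phi> \<in> borel_measurable borel" "\<And>x. norm (\<phi> x) \<le> B1"
    and \<theta>: "\<theta> \<in> borel_measurable borel" "\<And>x. norm (\<theta> x) \<le> B2"
  shows "bounded_sesquilinear_l2 lebesgue (multiplier_form \<sigma> \<phi> \<theta>) (B * B1 * B2)"
proof -
  note \<sigma>' = borel_imp_lebesgue_measurable[OF \<sigma>(1)] \<sigma>(2)
  note \<phi>' = borel_imp_lebesgue_measurable[OF \<phi>(1)] \<phi>(2)
  note \<theta>' = borel_imp_lebesgue_measurable[OF \<theta>(1)] \<theta>(2)
  have B: "0 \<le> B" "0 \<le> B1" "0 \<le> B2"
    using \<sigma>(2)[of 0] \<phi>(2)[of 0] \<theta>(2)[of 0] norm_ge_zero order_trans by blast+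
  have 1: "\<exists>h. is_fourier_L2 (\<lambda>x. \<phi> x * f x) h" if "f \<in> l2 lebesgue" for f
    using ex_is_fourier_L2[OF l2_mult_bounded[OF that \<phi>']] by blast
  have 2: "\<exists>h. is_fourier_L2 (\<lambda>x. \<theta> x * f x) h" if "f \<in> l2 lebesgue" for f
    using ex_is_fourier_L2[OF l2_mult_bounded[OF that \<theta>']] by blast
  note mf = multiplier_form_fourier[OF \<sigma> B(1)]
  note l = is_fourier_L2_l2(2)
  have lin1: "multiplier_form \<sigma> \<phi> \<theta> (\<lambda>x. f x + c * g x) h = multiplier_form \<sigma> \<phi> \<theta> f h + c * multiplier_form \<sigma> \<phi> \<theta> g h"
    if f: "f \<in> l2 lebesgue" and g: "g \<in> l2 lebesgue" and h: "h \<in> l2 lebesgue" for f g h c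
  proof -
    obtain f' g' h' where F: "is_fourier_L2 (\<lambda>x. \<phi> x * f x) f'" "is_fourier_L2 (\<lambda>x. \<phi> x * g x) g'"
      "is_fourier_L2 (\<lambda>x. \<theta> x * h x) h'" using 1[OF f] 1[OF g] 2[OF h] by blast
    have "is_fourier_L2 (\<lambda>x. \<phi> x * (f x + c * g x)) (\<lambda>x. f' x + c * g' x)"
      using is_fourier_L2_linear[OF F(1,2), of c] by (simp add: algebra_simps)
    from mf[OF this F(3)] have "multiplier_form \<sigma> \<phi> \<theta> (\<lambda>x. f x + c * g x) h
        = ip lebesgue (\<lambda>x. \<sigma> x * f' x + c * (\<sigma> x * g' x)) h'"
      by (simp add: algebra_simps)
    also have "\<dots> = ip lebesgue (\<lambda>x. \<sigma> x * f' x) h' + c * ip lebesgue (\<lambda>x. \<sigma> x * g' x) h'"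
      by (simp add: ip_add_left l2_scale l2_mult_bounded[OF _ \<sigma>'] l[OF F(1)] l[OF F(2)] l[OF F(3)] ip_scale_left)
    finally show ?thesis using mf[OF F(1,3)] mf[OF F(2,3)] by simp
  qed
  have lin2: "multiplier_form \<sigma> \<phi> \<theta> h (\<lambda>x. f x + c * g x) = multiplier_form \<sigma> \<phi> \<theta> h f + cnj c * multiplier_form \<sigma> \<phi> \<theta> h g"
    if f: "f \<in> l2 lebesgue" and g: "g \<in> l2 lebesgue" and h: "h \<in> l2 lebesgue" for f g h c
  proof -
    obtain f' g' h' where F: "is_fourier_L2 (\<lambda>x. \<theta> x * f x) f'" "is_fourier_L2 (\<lambda>x. \<theta> x * g x) g'"
      "is_fourier_L2 (\<lambda>x. \<phi> x * h x) h'" using 2[OF f] 2[OF g] 1[OF h] by blast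
    have "is_fourier_L2 (\<lambda>x. \<theta> x * (f x + c * g x)) (\<lambda>x. f' x + c * g' x)"
      using is_fourier_L2_linear[OF F(1,2), of c] by (simp add: algebra_simps)
    from mf[OF F(3) this] have "multiplier_form \<sigma> \<phi> \<theta> h (\<lambda>x. f x + c * g x)
        = ip lebesgue (\<lambda>x. \<sigma> x * h' x) (\<lambda>x. f' x + c * g' x)" .
    also have "\<dots> = ip lebesgue (\<lambda>x. \<sigma> x * h' x) f' + cnj c * ip lebesgue (\<lambda>x. \<sigma> x * h' x) g'"
      by (simp add: ip_add_right l2_scale l2_mult_bounded[OF _ \<sigma>'] l[OF F(1)] l[OF F(2)] l[OF F(3)] ip_scale_right)
    finally show ?thesis using mf[OF F(3,1)] mf[OF F(3,2)] by simp
  qed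
  have bound: "norm (multiplier_form \<sigma> \<phi> \<theta> f g) \<le> B * B1 * B2 * nm lebesgue f * nm lebesgue g"
    if f: "f \<in> l2 lebesgue" and g: "g \<in> l2 lebesgue" for f g
  proof -
    obtain f' g' where F: "is_fourier_L2 (\<lambda>x. \<phi> x * f x) f'" "is_fourier_L2 (\<lambda>x. \<theta> x * g x) g'"
      using 1[OF f] 2[OF g] by blast
    have "norm (multiplier_form \<sigma> \<phi> \<theta> f g) \<le> nm lebesgue (\<lambda>x. \<sigma> x * f' x) * nm lebesgue g'"
      unfolding mf[OF F] by (intro Cauchy_Schwarz_l2 l2_mult_bounded[OF _ \<sigma>'] l[OF F(1)] l[OF F(2)])
    also have "\<dots> \<le> (B * nm lebesgue f') * nm lebesgue g'"
      by (intro mult_right_mono nm_mult_bounded_le[OF l[OF F(1)] \<sigma>' B(1)] nm_nonneg)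
    also have "\<dots> = (B * nm lebesgue (\<lambda>x. \<phi> x * f x)) * nm lebesgue (\<lambda>x. \<theta> x * g x)"
      by (simp add: is_fourier_L2_nm[OF F(1)] is_fourier_L2_nm[OF F(2)])
    also have "\<dots> \<le> (B * (B1 * nm lebesgue f)) * (B2 * nm lebesgue g)"
      using B nm_mult_bounded_le[OF f \<phi>' B(2)] nm_mult_bounded_le[OF g \<theta>' B(3)]
      by (intro mult_mono mult_left_mono) auto
    finally show ?thesis by (simp add: ac_simps)
  qed
  show ?thesis
    unfolding bounded_sesquilinear_l2_def using B lin1 lin2 bound by auto
qed

text \<open>With the same cut-off and function in both slots the form is the integral of
  \<open>\<sigma>\<close> times a squared modulus. The order on complex numbers makes
  \<open>0 \<le> z\<close> mean that \<open>z\<close> is real and nonnegative.\<close>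

lemma multiplier_form_nonneg:
  fixes \<sigma> \<phi> :: "'a::euclidean_space \<Rightarrow> complex"
  assumes \<sigma>: "\<sigma> \<in> borel_measurable borel" "\<And>x. norm (\<sigma> x) \<le> B"
    and \<phi>: "\<phi> \<in> borel_measurable borel" "\<And>x. norm (\<phi> x) \<le> B1"
    and pos: "AE x in lebesgue. 0 \<le> \<sigma> x" and f: "f \<in> l2 lebesgue"
  shows "0 \<le> multiplier_form \<sigma> \<phi> \<phi> f f"
proof -
  note \<phi>' = borel_imp_lebesgue_measurable[OF \<phi>(1)] \<phi>(2)
  note \<sigma>' = borel_imp_lebesgue_measurable[OF \<sigma>(1)]
  have B: "0 \<le> B" using \<sigma>(2)[of 0] norm_ge_zero order_trans by blast
  obtain h where h: "is_fourier_L2 (\<lambda>x. \<phi> x * f x) h"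
    using ex_is_fourier_L2[OF l2_mult_bounded[OF f \<phi>']] by blast
  note [measurable] = l2_measurable[OF is_fourier_L2_l2(2)[OF h]] \<sigma>'
  have "multiplier_form \<sigma> \<phi> \<phi> f f = (\<integral>x. \<sigma> x * h x * cnj (h x) \<partial>lebesgue)"
    using multiplier_form_fourier[OF \<sigma> B h h] by (simp add: ip_def)
  also have "\<dots> = (\<integral>x. of_real (Re (\<sigma> x) * (norm (h x))\<^sup>2) \<partial>lebesgue)"
  proof (rule integral_cong_AE)
    show "AE x in lebesgue. \<sigma> x * h x * cnj (h x) = of_real (Re (\<sigma> x) * (norm (h x))\<^sup>2)"
      using pos
    proof eventually_elim
      case (elim x)
      then have "\<sigma> x = of_real (Re (\<sigma> x))" by (simp add: less_eq_complex_def complex_eq_iff)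
      then show ?case by (simp only: of_real_mult complex_norm_square mult.assoc)
    qed
  qed measurable
  also have "\<dots> = of_real (\<integral>x. Re (\<sigma> x) * (norm (h x))\<^sup>2 \<partial>lebesgue)"
    by (rule integral_complex_of_real)
  finally have "multiplier_form \<sigma> \<phi> \<phi> f f = of_real (\<integral>x. Re (\<sigma> x) * (norm (h x))\<^sup>2 \<partial>lebesgue)" .
  moreover have "0 \<le> (\<integral>x. Re (\<sigma> x) * (norm (h x))\<^sup>2 \<partial>lebesgue)"
    using pos by (intro integral_nonneg_AE) (auto simp: less_eq_complex_def)
  ultimately show ?thesis by (simp add: less_eq_complex_def)
qed

text \<open>This is the link between the diagonal of the limit matrix and the norms of the
  sequence.\<close>

lemma multiplier_form_one:
  fixes \<phi> \<theta> :: "'a::euclidean_space \<Rightarrow> complex"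
  assumes \<sigma>: "\<sigma> \<in> borel_measurable borel" "\<And>x. norm (\<sigma> x) \<le> B" and one: "AE x in lebesgue. \<sigma> x = 1"
    and \<phi>: "\<phi> \<in> borel_measurable borel" "\<And>x. norm (\<phi> x) \<le> B1"
    and \<theta>: "\<theta> \<in> borel_measurable borel" "\<And>x. norm (\<theta> x) \<le> B2"
    and f: "f \<in> l2 lebesgue" and g: "g \<in> l2 lebesgue"
  shows "multiplier_form \<sigma> \<phi> \<theta> f g = ip lebesgue (\<lambda>x. \<phi> x * f x) (\<lambda>x. \<theta> x * g x)"
proof -
  note \<sigma>' = borel_imp_lebesgue_measurable[OF \<sigma>(1)] \<sigma>(2)
  have B: "0 \<le> B" using \<sigma>(2)[of 0] norm_ge_zero order_trans by blast
  obtain h where h: "is_fourier_L2 (\<lambda>x. \<phi> x * f x) h"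
    using ex_is_fourier_L2[OF l2_mult_bounded[OF f borel_imp_lebesgue_measurable[OF \<phi>(1)] \<phi>(2)]] by blast
  obtain k where k: "is_fourier_L2 (\<lambda>x. \<theta> x * g x) k"
    using ex_is_fourier_L2[OF l2_mult_bounded[OF g borel_imp_lebesgue_measurable[OF \<theta>(1)] \<theta>(2)]] by blast
  have "multiplier_form \<sigma> \<phi> \<theta> f g = ip lebesgue (\<lambda>x. \<sigma> x * h x) k"
    by (rule multiplier_form_fourier[OF \<sigma> B h k])
  also have "\<dots> = ip lebesgue h k"
    using one by (intro ip_AE_cong)
      (auto intro!: l2_measurable l2_mult_bounded[OF _ \<sigma>'] is_fourier_L2_l2(2)[OF h] is_fourier_L2_l2(2)[OF k])
  finally show ?thesis by (simp add: is_fourier_L2_ip[OF h k])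
qed

section \<open>The manifold P\<close>

text \<open>Some multiplier satisfies the condition in \<open>exponent_factor\<close> by the
  Archimedean property at the smallest exponent, so the least one does.\<close>

lemma exponent_factor_pos:
  fixes \<alpha> :: "'d::finite \<Rightarrow> real"
  assumes "\<And>k. \<alpha> k > 0"
  shows "0 < real (exponent_factor \<alpha>) * \<alpha> k"
proof -
  have "\<exists>l. 0 < l \<and> (\<forall>k. real l * \<alpha> k > real CARD('d))"
  proof -
    define m where "m = Min (range \<alpha>)"
    have m: "m > 0" "\<And>k. m \<le> \<alpha> k" using assms by (auto simp: m_def)
    obtain l where l: "real CARD('d) < real l * m" using reals_Archimedean3[OF m(1)] by blast
    have "0 < l" using l by (cases l) auto
    moreover have "real l * \<alpha> k > real CARD('d)" for k
      using l mult_left_mono[OF m(2)[of k], of "real l"] by linarith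
    ultimately show ?thesis by blast
  qed
  from LeastI_ex[OF this] show ?thesis
    using assms[of k] by (simp add: exponent_factor_def[symmetric])
qed

context
  fixes \<alpha> :: "'d::finite \<Rightarrow> real"
  assumes \<alpha>: "\<And>k. \<alpha> k > 0"
begin

lemma continuous_on_Pgauge: "continuous_on S (Pgauge \<alpha>)"
proof -
  have "continuous_on S (\<lambda>\<xi>. \<bar>\<xi> $ k\<bar> powr (real (exponent_factor \<alpha>) * \<alpha> k))" for k
    by (rule continuous_on_powr') (auto intro!: continuous_intros exponent_factor_pos \<alpha>)
  then show ?thesis unfolding Pgauge_def[abs_def] by (intro continuous_on_sum) auto
qed

lemma Pgauge_pos: "\<xi> \<noteq> 0 \<Longrightarrow> 0 < Pgauge \<alpha> \<xi>"
proof -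
  assume "\<xi> \<noteq> 0"
  then obtain k where "\<xi> $ k \<noteq> 0" by (auto simp: vec_eq_iff)
  then have "0 < \<bar>\<xi> $ k\<bar> powr (real (exponent_factor \<alpha>) * \<alpha> k)" by simp
  then show ?thesis unfolding Pgauge_def by (intro sum_pos2[of _ k]) auto
qed

lemma compact_Pman: "compact (Pman \<alpha>)"
proof -
  have "closed (Pman \<alpha>)"
    unfolding Pman_def using continuous_closed_preimage_constant[OF continuous_on_Pgauge closed_UNIV, of 1] by simp
  moreover have "bounded (Pman \<alpha>)"
  proof (rule boundedI)
    fix \<xi> assume "\<xi> \<in> Pman \<alpha>"
    then have 1: "(\<Sum>k\<in>UNIV. \<bar>\<xi> $ k\<bar> powr (real (exponent_factor \<alpha>) * \<alpha> k)) = 1" by (simp add: Pman_def Pgauge_def)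
    have "\<bar>\<xi> $ k\<bar> \<le> 1" for k
    proof (rule ccontr)
      assume "\<not> \<bar>\<xi> $ k\<bar> \<le> 1"
      then have "1 < \<bar>\<xi> $ k\<bar> powr (real (exponent_factor \<alpha>) * \<alpha> k)"
        using exponent_factor_pos[of \<alpha> k, OF \<alpha>] by (simp add: gr_one_powr)
      also have "\<dots> \<le> 1" unfolding 1[symmetric] by (rule member_le_sum) auto
      finally show False by simp
    qed
    then show "norm \<xi> \<le> real CARD('d)"
      using norm_le_l1_cart[of \<xi>] sum_bounded_above[of UNIV "\<lambda>k. \<bar>\<xi> $ k\<bar>" 1] by simp
  qed
  ultimately show ?thesis by (simp add: compact_eq_bounded_closed)
qed

text \<open>The exponent in \<open>Pproj\<close> is such that each summand of the gauge is divided
  by the value of the gauge itself.\<close>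

lemma Pproj_in_Pman:
  assumes "\<xi> \<noteq> 0"
  shows "Pproj \<alpha> \<xi> \<in> Pman \<alpha>"
proof -
  let ?a = "\<lambda>k. real (exponent_factor \<alpha>) * \<alpha> k"
  have G: "0 < Pgauge \<alpha> \<xi>" by (rule Pgauge_pos[OF assms])
  have "\<bar>Pproj \<alpha> \<xi> $ k\<bar> powr ?a k = \<bar>\<xi> $ k\<bar> powr ?a k / Pgauge \<alpha> \<xi>" for k
  proof -
    have a: "?a k \<noteq> 0" using exponent_factor_pos[of \<alpha> k, OF \<alpha>] by (metis less_irrefl)
    have "\<bar>Pproj \<alpha> \<xi> $ k\<bar> powr ?a k = \<bar>\<xi> $ k\<bar> powr ?a k * Pgauge \<alpha> \<xi> powr (- 1 / ?a k * ?a k)"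
      by (simp add: Pproj_def abs_mult powr_mult powr_powr)
    also have "- 1 / ?a k * ?a k = - 1" using a by simp
    finally show ?thesis using G by (simp add: powr_minus divide_inverse)
  qed
  then have "Pgauge \<alpha> (Pproj \<alpha> \<xi>) = Pgauge \<alpha> \<xi> / Pgauge \<alpha> \<xi>"
    by (simp only: Pgauge_def[of \<alpha> "Pproj \<alpha> \<xi>"] sum_divide_distrib[symmetric]) (simp add: Pgauge_def)
  then show ?thesis using G by (simp add: Pman_def)
qed

text \<open>The symbol is continuous except at the origin, and it is bounded because the manifold is
  compact.\<close>

lemma Pman_symbol:
  assumes \<psi>: "continuous_on (Pman \<alpha>) \<psi>"
  shows "\<psi> \<circ> Pproj \<alpha> \<in> borel_measurable borel" and "\<exists>B\<ge>0. \<forall>\<xi>. norm ((\<psi> \<circ> Pproj \<alpha>) \<xi> :: complex) \<le> B"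
proof -
  have "continuous_on (- {0}) (Pproj \<alpha>)"
    unfolding Pproj_def
    by (rule continuous_on_vec_lambda)
      (auto intro!: continuous_intros continuous_on_powr continuous_on_Pgauge dest: Pgauge_pos)
  then have "continuous_on (- {0}) (\<psi> \<circ> Pproj \<alpha>)"
    by (rule continuous_on_compose) (auto intro!: continuous_on_subset[OF \<psi>] Pproj_in_Pman)
  then show "\<psi> \<circ> Pproj \<alpha> \<in> borel_measurable borel"
    by (intro borel_measurable_continuous_countable_exceptions[of "{0}"]) auto
  have "bounded (\<psi> ` Pman \<alpha>)"
    by (intro compact_imp_bounded compact_continuous_image \<psi> compact_Pman)
  then obtain C where C: "\<And>\<xi>. \<xi> \<in> Pman \<alpha> \<Longrightarrow> norm (\<psi> \<xi>) \<le> C" by (auto simp: bounded_iff)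
  show "\<exists>B\<ge>0. \<forall>\<xi>. norm ((\<psi> \<circ> Pproj \<alpha>) \<xi>) \<le> B"
  \<comment> \<open>The origin is not projected into the manifold, so the value there enters the
    bound separately.\<close>
  proof (intro exI[of _ "max (norm (\<psi> (Pproj \<alpha> 0))) C"] conjI allI)
    show "norm ((\<psi> \<circ> Pproj \<alpha>) \<xi>) \<le> max (norm (\<psi> (Pproj \<alpha> 0))) C" for \<xi>
      using C[OF Pproj_in_Pman[of \<xi>]] by (cases "\<xi> = 0") auto
  qed (auto simp: le_max_iff_disj)
qed

end

section \<open>Functions vanishing at infinity\<close>

lemma C0_measurable: "\<phi> \<in> C0 UNIV \<Longrightarrow> \<phi> \<in> borel_measurable borel"
  by (auto simp: C0_def intro: borel_measurable_continuous_onI)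

lemma C0_bounded:
  assumes "\<phi> \<in> C0 X"
  shows "\<exists>B\<ge>0. \<forall>x\<in>X. norm (\<phi> x) \<le> B"
proof -
  obtain K where K: "compact K" "K \<subseteq> X" "\<And>x. x \<in> X - K \<Longrightarrow> norm (\<phi> x) < 1"
    using assms by (auto simp: C0_def elim: allE[of _ 1])
  have "bounded (\<phi> ` K)"
    using assms K by (intro compact_imp_bounded compact_continuous_image) (auto simp: C0_def intro: continuous_on_subset)
  then obtain C where C: "\<And>x. x \<in> K \<Longrightarrow> norm (\<phi> x) \<le> C" by (auto simp: bounded_iff)
  have "norm (\<phi> x) \<le> max 1 C" if "x \<in> X" for x
    using C[of x] K(3)[of x] that by (cases "x \<in> K") (auto simp: max_def)
  then show ?thesis by (intro exI[of _ "max 1 C"]) auto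
qed

section \<open>Translates of a mollifier are total\<close>

text \<open>Along a ray the transform of a function of bounded support extends to an entire
  function, because the exponential series may be integrated term by term.\<close>

lemma fourier_ray_power_series:
  fixes f :: "'a::euclidean_space \<Rightarrow> complex"
  assumes f: "integrable lborel f" and supp: "\<And>x. norm x > R \<Longrightarrow> f x = 0" and "0 \<le> R"
  defines "c \<equiv> \<lambda>x \<xi>. - 2 * complex_of_real pi * \<i> * of_real (x \<bullet> \<xi>)"
  shows "(\<lambda>n. (\<integral>x. f x * (c x \<xi> ^ n / fact n) \<partial>lborel) * z ^ n) sums (\<integral>x. f x * exp (c x \<xi> * z) \<partial>lborel)"
proof -
  have [measurable]: "f \<in> borel_measurable borel" using borel_measurable_integrable[OF f] by simp
  have [measurable]: "(\<lambda>x. c x \<xi>) \<in> borel_measurable borel" unfolding c_def by measurable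
  define F where "F n x = f x * ((c x \<xi> * z) ^ n / fact n)" for n x
  have [measurable]: "F n \<in> borel_measurable borel" for n unfolding F_def by measurable
  \<comment> \<open>\<open>K\<close> bounds the modulus of the exponent on the ball of radius
    \<open>R\<close>, outside which \<open>f\<close> vanishes.\<close>
  define K where "K = 2 * pi * R * norm \<xi> * norm z"
  have bound: "norm (F n x) \<le> norm (f x) * (K ^ n / fact n)" for n x
  proof (cases "norm x > R")
    case False
    have "norm (c x \<xi> * z) = 2 * pi * \<bar>x \<bullet> \<xi>\<bar> * norm z" by (simp add: c_def norm_mult)
    also have "\<dots> \<le> 2 * pi * (R * norm \<xi>) * norm z"
      using False Cauchy_Schwarz_ineq2[of x \<xi>] mult_right_mono[of "norm x" R "norm \<xi>"]
      by (intro mult_right_mono mult_left_mono) auto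
    also have "\<dots> = K" by (simp add: K_def)
    finally have "norm ((c x \<xi> * z) ^ n) \<le> K ^ n" unfolding norm_power by (intro power_mono) auto
    then show ?thesis
      by (simp add: F_def norm_mult norm_divide mult_left_mono divide_right_mono)
  qed (simp add: F_def supp)
  have nint: "integrable lborel (\<lambda>x. norm (f x) * (K ^ n / fact n))" for n
    using f by simp
  have Fint: "integrable lborel (F n)" for n
  proof (rule Bochner_Integration.integrable_bound[OF nint[of n]])
    show "AE x in lborel. norm (F n x) \<le> norm (norm (f x) * (K ^ n / fact n))"
      unfolding real_norm_def by (intro AE_I2 order_trans[OF bound abs_ge_self])
  qed simp
  have sumK: "summable (\<lambda>n. b * (K ^ n / fact n))" for b :: real
    using summable_exp[of K] by (intro summable_mult) (simp add: divide_inverse mult.commute)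
  have "(\<lambda>n. integral\<^sup>L lborel (F n)) sums (\<integral>x. (\<Sum>n. F n x) \<partial>lborel)"
  proof (rule sums_integral[OF Fint])
    show "AE x in lborel. summable (\<lambda>n. norm (F n x))"
      by (intro AE_I2 summable_comparison_test'[OF sumK, of 0]) (use bound in auto)
    show "summable (\<lambda>n. \<integral>x. norm (F n x) \<partial>lborel)"
    proof (rule summable_comparison_test'[OF sumK[of "\<integral>x. norm (f x) \<partial>lborel"], of 0])
      fix n
      have "(\<integral>x. norm (F n x) \<partial>lborel) \<le> (\<integral>x. norm (f x) * (K ^ n / fact n) \<partial>lborel)"
        by (intro integral_mono bound nint integrable_norm[OF Fint])
      then show "norm (\<integral>x. norm (F n x) \<partial>lborel) \<le> (\<integral>x. norm (f x) \<partial>lborel) * (K ^ n / fact n)"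
        by simp
    qed
  qed
  moreover have "(\<Sum>n. F n x) = f x * exp (c x \<xi> * z)" for x
  proof -
    have "(\<lambda>n. f x * ((c x \<xi> * z) ^ n / fact n)) sums (f x * exp (c x \<xi> * z))"
      using sums_mult[OF exp_converges[of "c x \<xi> * z"], of "f x"]
      by (simp add: scaleR_conv_of_real divide_inverse mult.commute)
    then show ?thesis unfolding F_def by (rule sums_unique[symmetric])
  qed
  moreover have "integral\<^sup>L lborel (F n) = (\<integral>x. f x * (c x \<xi> ^ n / fact n) \<partial>lborel) * z ^ n" for n
  proof -
    have "F n = (\<lambda>x. f x * (c x \<xi> ^ n / fact n) * z ^ n)"
      by (auto simp: F_def power_mult_distrib)
    then show ?thesis by (simp only: integral_mult_left_zero)
  qed
  ultimately show ?thesis by simp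
qed

text \<open>Infinitely many zeros in a compact interval accumulate, so the holomorphic extension
  vanishes by the identity theorem; but its value at 0 is the integral of \<open>f\<close>.\<close>

lemma fourier_ray_zeros_finite:
  fixes f :: "'a::euclidean_space \<Rightarrow> complex"
  assumes f: "integrable lborel f" and supp: "\<And>x. norm x > R \<Longrightarrow> f x = 0" and "0 \<le> R"
    and nz: "(\<integral>x. f x \<partial>lborel) \<noteq> 0"
  shows "finite {t\<in>{1..2}. fourier f (t *\<^sub>R \<xi>) = 0}"
proof (rule ccontr)
  assume inf: "infinite {t\<in>{1..2}. fourier f (t *\<^sub>R \<xi>) = 0}"
  have [measurable]: "f \<in> borel_measurable borel" using borel_measurable_integrable[OF f] by simp
  define G where "G z = (\<integral>x. f x * exp (- 2 * complex_of_real pi * \<i> * of_real (x \<bullet> \<xi>) * z) \<partial>lborel)" for z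
  obtain a where a: "\<And>z. (\<lambda>n. a n * z ^ n) sums G z"
    by (rule that, unfold G_def, rule fourier_ray_power_series[OF f _ \<open>0 \<le> R\<close>], rule supp)
  \<comment> \<open>The disc of radius 3 contains both the interval of zeros and the origin.\<close>
  have hol: "G holomorphic_on ball 0 3"
    by (rule power_series_holomorphic[where a = a]) (simp add: a)
  have GF: "G (of_real t) = fourier f (t *\<^sub>R \<xi>)" for t
    unfolding G_def
    by (subst fourier_lborel) (simp_all add: cis_conv_exp mult_ac)
  let ?T = "complex_of_real ` {t\<in>{1..2}. fourier f (t *\<^sub>R \<xi>) = 0}"
  have "infinite ?T"
    using inf by (simp add: finite_image_iff inj_on_def)
  moreover have "?T \<subseteq> cball 0 2" by auto
  ultimately obtain z where z: "z \<in> cball 0 2" "z islimpt ?T"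
    using compact_eq_Bolzano_Weierstrass[of "cball (0::complex) 2"] by (meson compact_cball)
  have "G 0 = 0"
    by (rule analytic_continuation[OF hol _ _ _ _ z(2)]) (use z(1) in \<open>auto simp: GF\<close>)
  then show False using nz by (simp add: G_def)
qed

text \<open>By Fubini the zero set, which meets almost no point of any segment \<open>{t \<xi> | 1 \<le> t \<le> 2}\<close>,
  has a null dilate.\<close>

theorem fourier_nonzero_AE:
  fixes f :: "'a::euclidean_space \<Rightarrow> complex"
  assumes f: "integrable lborel f" and supp: "\<And>x. norm x > R \<Longrightarrow> f x = 0" and "0 \<le> R"
    and nz: "(\<integral>x. f x \<partial>lborel) \<noteq> 0"
  shows "AE \<xi> in lborel. fourier f \<xi> \<noteq> 0"
proof -
  have [measurable]: "f \<in> borel_measurable borel" using borel_measurable_integrable[OF f] by simp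
  have [measurable]: "fourier f \<in> borel_measurable borel" by (rule fourier_borel_measurable) simp
  have "AE \<xi> in lborel. AE t in lborel. t \<in> {1..2::real} \<longrightarrow> fourier f (t *\<^sub>R \<xi>) \<noteq> 0"
  proof (rule AE_I2)
    fix \<xi> :: 'a
    have "AE t in lborel. t \<notin> {t\<in>{1..2}. fourier f (t *\<^sub>R \<xi>) = 0}"
      by (intro AE_not_in finite_imp_null_set_lborel fourier_ray_zeros_finite[OF assms])
    then show "AE t in lborel. t \<in> {1..2::real} \<longrightarrow> fourier f (t *\<^sub>R \<xi>) \<noteq> 0"
      by eventually_elim auto
  qed
  then have "AE t in lborel. AE \<xi> in lborel. t \<in> {1..2::real} \<longrightarrow> fourier f (t *\<^sub>R \<xi>) \<noteq> 0"
    by (subst (asm) lborel_pair.AE_commute) measurable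
  \<comment> \<open>What holds for almost every point of an interval of positive length holds for
    some point of it.\<close>
  then have "\<exists>t\<in>{1..2}. AE \<xi> in lborel. fourier f (t *\<^sub>R \<xi>) \<noteq> 0"
  proof (rule contrapos_pp)
    assume "\<not> (\<exists>t\<in>{1..2}. AE \<xi> in lborel. fourier f (t *\<^sub>R \<xi>) \<noteq> 0)"
    then have no: "\<not> (AE \<xi> in lborel. fourier f (t *\<^sub>R \<xi>) \<noteq> 0)" if "t \<in> {1..2}" for t :: real
      using that by blast
    show "\<not> (AE t in lborel. AE \<xi> in lborel. t \<in> {1..2::real} \<longrightarrow> fourier f (t *\<^sub>R \<xi>) \<noteq> 0)"
    proof
      assume "AE t in lborel. AE \<xi> in lborel. t \<in> {1..2::real} \<longrightarrow> fourier f (t *\<^sub>R \<xi>) \<noteq> 0"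
      then have "AE t in lborel. t \<notin> {1..2::real}"
        by (rule AE_mp) (intro AE_I2 impI notI, use no in auto)
      then have "{1..2::real} \<in> null_sets lborel"
        by (subst (asm) AE_iff_null_sets[symmetric]) auto
      then show False by (auto simp: null_sets_def)
    qed
  qed
  then obtain t :: real where t: "t \<in> {1..2}" "AE \<xi> in lborel. fourier f (t *\<^sub>R \<xi>) \<noteq> 0" by blast
  \<comment> \<open>Dilation by \<open>t\<close> multiplies Lebesgue measure by a constant, so null
    sets correspond.\<close>
  have "AE \<xi> in density (distr lborel borel (\<lambda>x. 0 + t *\<^sub>R x)) (\<lambda>_. ennreal (\<bar>t\<bar> ^ DIM('a))). fourier f \<xi> \<noteq> 0"
    using t by (subst AE_density, simp, subst AE_distr_iff) auto
  moreover have "t \<noteq> 0" using t(1) by auto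
  ultimately show ?thesis
    by (subst lborel_affine[of t "0::'a"]) auto
qed

lemma is_fourier_L2_fourier:
  assumes "integrable lebesgue f" "f \<in> l2 lebesgue"
  shows "is_fourier_L2 f (fourier f)"
  unfolding is_fourier_L2_def L2_tendsto_iff
  by (rule exI[of _ "\<lambda>_. f"]) (use assms plancherel_lebesgue(1)[OF assms] in \<open>auto simp: nm_def\<close>)

lemma norm_fourier_le:
  assumes "f \<in> borel_measurable borel"
  shows "norm (fourier f \<xi>) \<le> (\<integral>x. norm (f x) \<partial>lborel)"
proof -
  have "norm (fourier f \<xi>) \<le> (\<integral>x. norm (cis (- 2 * pi * (x \<bullet> \<xi>)) * f x) \<partial>lborel)"
    using assms by (subst fourier_lborel) (auto intro!: integral_norm_bound)
  then show ?thesis by (simp add: norm_mult)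
qed

lemma continuous_bounded_support:
  fixes f :: "'a::euclidean_space \<Rightarrow> real"
  assumes f: "continuous_on UNIV f" and supp: "\<And>x. norm x > R \<Longrightarrow> f x = 0"
  shows "\<exists>B. \<forall>x. \<bar>f x\<bar> \<le> B"
proof -
  have "bounded (f ` cball 0 R)"
    by (intro compact_imp_bounded compact_continuous_image continuous_on_subset[OF f]) auto
  then obtain B where B: "\<forall>y\<in>f ` cball 0 R. norm y \<le> B" unfolding bounded_iff by blast
  have "\<bar>f x\<bar> \<le> max B 0" for x
  proof (cases "norm x > R")
    case False
    then show ?thesis using bspec[OF B, of "f x"] by (simp add: le_max_iff_disj)
  qed (simp add: supp)
  then show ?thesis by blast
qed

text \<open>Wiener's theorem for \<open>L\<^sup>2\<close>: if \<open>g\<close> is orthogonal to all translates, then \<open>g\<^sup>^ \<omega>\<^sup>^\<close> has a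
  vanishing Fourier transform, while \<open>\<omega>\<^sup>^\<close> is nonzero almost everywhere.\<close>

theorem translates_total:
  fixes \<omega> :: "'a::euclidean_space \<Rightarrow> real" and g :: "'a \<Rightarrow> complex"
  assumes \<omega>: "continuous_on UNIV \<omega>" and supp: "\<And>x. norm x > R \<Longrightarrow> \<omega> x = 0" and "0 \<le> R"
    and nz: "(\<integral>x. \<omega> x \<partial>lborel) \<noteq> 0"
    and g: "g \<in> l2 lborel"
    and orth: "\<And>p. ip lborel g (\<lambda>y. of_real (\<omega> (p - y))) = 0"
  shows "nm lborel g = 0"
proof -
  have [measurable]: "\<omega> \<in> borel_measurable borel" by (rule borel_measurable_continuous_onI[OF \<omega>])
  have [measurable]: "g \<in> borel_measurable borel" using l2_measurable[OF g] by simp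
  define w where "w x = complex_of_real (\<omega> x)" for x
  have [measurable]: "w \<in> borel_measurable borel" unfolding w_def by measurable
  obtain B where B0: "\<And>x. \<bar>\<omega> x\<bar> \<le> B"
    using continuous_bounded_support[OF \<omega> supp] by blast
  then have B: "norm (w x) \<le> B" for x by (simp add: w_def)
  have w0: "w x = 0" if "norm x > R" for x using supp[OF that] by (simp add: w_def)
  have w1: "integrable lborel w"
    by (rule integrable_bounded_support[OF _ B w0]) simp
  have "integrable lborel (\<lambda>x. (norm (w x))\<^sup>2)"
    by (rule integrable_bounded_support[where B = "B\<^sup>2" and R = R]) (use B w0 in \<open>auto intro!: power_mono\<close>)
  then have w2: "w \<in> l2 lborel" by (intro l2I) auto
  have wi: "(\<integral>x. w x \<partial>lborel) \<noteq> 0" using nz unfolding w_def integral_complex_of_real by simp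
  have wnz: "AE \<xi> in lborel. fourier w \<xi> \<noteq> 0"
    by (rule fourier_nonzero_AE[OF w1 _ \<open>0 \<le> R\<close> wi]) (rule w0)
  have gl: "g \<in> l2 lebesgue" using g by (simp add: l2_lebesgue_iff)
  obtain g' where g': "is_fourier_L2 g g'" using ex_is_fourier_L2[OF gl] by blast
  \<comment> \<open>As \<open>w\<close> is real, reflection conjugates the transform; the
    translation contributes the phase.\<close>
  have fw: "fourier (\<lambda>y. w (p - y)) \<xi> = cis (- 2 * pi * (p \<bullet> \<xi>)) * cnj (fourier w \<xi>)" for p \<xi>
  proof -
    have "fourier (\<lambda>y. w (p - y)) \<xi> = (\<integral>y. cis (- 2 * pi * (y \<bullet> \<xi>)) * w (p - y) \<partial>lborel)"
      by (rule fourier_lborel) measurable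
    also have "\<dots> = (\<integral>y. cis (- 2 * pi * ((p - (p - y)) \<bullet> \<xi>)) * w (p - y) \<partial>lborel)" by simp
    also have "\<dots> = (\<integral>y. cis (- 2 * pi * ((p - y) \<bullet> \<xi>)) * w y \<partial>lborel)"
      by (rule lborel_integral_reflect(1)) measurable
    also have "\<dots> = (\<integral>y. cis (- 2 * pi * (p \<bullet> \<xi>)) * cnj (cis (- 2 * pi * (y \<bullet> \<xi>)) * w y) \<partial>lborel)"
    proof (intro Bochner_Integration.integral_cong refl)
      fix y
      have "- 2 * pi * ((p - y) \<bullet> \<xi>) = - 2 * pi * (p \<bullet> \<xi>) + - (- 2 * pi * (y \<bullet> \<xi>))"
        by (simp add: inner_diff_left algebra_simps)
      then have "cis (- 2 * pi * ((p - y) \<bullet> \<xi>)) = cis (- 2 * pi * (p \<bullet> \<xi>)) * cnj (cis (- 2 * pi * (y \<bullet> \<xi>)))"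
        by (simp only: cis_mult cis_cnj)
      then show "cis (- 2 * pi * ((p - y) \<bullet> \<xi>)) * w y = cis (- 2 * pi * (p \<bullet> \<xi>)) * cnj (cis (- 2 * pi * (y \<bullet> \<xi>)) * w y)"
        by (simp add: w_def)
    qed
    also have "\<dots> = cis (- 2 * pi * (p \<bullet> \<xi>)) * cnj (fourier w \<xi>)"
      by (subst fourier_lborel) (simp_all only: integral_mult_right_zero Bochner_Integration.integral_cnj, measurable)
    finally show ?thesis .
  qed
  define H where "H \<xi> = fourier w \<xi> * g' \<xi>" for \<xi>
  have [measurable]: "fourier w \<in> borel_measurable borel" by (rule fourier_borel_measurable) simp
  have w1l: "integrable lebesgue w" using w1 by (simp add: integrable_completion)
  have w2l: "w \<in> l2 lebesgue" using w2 by (simp add: l2_lebesgue_iff)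
  \<comment> \<open>\<open>H\<close> is square integrable since the transform of \<open>w\<close> is
    bounded, and integrable as a product of two square integrable functions, so Plancherel's theorem
    applies to it.\<close>
  have H2: "H \<in> l2 lebesgue"
    unfolding H_def
    by (rule l2_mult_bounded[OF is_fourier_L2_l2(2)[OF g'] borel_imp_lebesgue_measurable norm_fourier_le]) auto
  have H1: "integrable lebesgue H"
    unfolding H_def by (rule l2_mult_integrable[OF plancherel_lebesgue(1)[OF w1l w2l] is_fourier_L2_l2(2)[OF g']])
  have "fourier H (- p) = 0" for p
  proof -
    let ?wp = "\<lambda>y. w (p - y)"
    have 1: "?wp \<in> l2 lebesgue"
      using l2_reflect(1)[OF w2] by (subst l2_lebesgue_iff) auto
    have 2: "integrable lebesgue ?wp"
      using lborel_integral_reflect(2)[of w p] w1 by (subst integrable_completion) auto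
    have "0 = ip lebesgue g ?wp"
      using orth[of p] by (subst ip_lebesgue) (auto simp: w_def)
    also have "\<dots> = ip lebesgue g' (fourier ?wp)"
      by (rule is_fourier_L2_ip[OF g' is_fourier_L2_fourier[OF 2 1], symmetric])
    also have "\<dots> = fourier H (- p)"
    proof -
      have "g' \<xi> * cnj (fourier ?wp \<xi>) = cis (- 2 * pi * (\<xi> \<bullet> (- p))) * H \<xi>" for \<xi>
        by (simp add: fw H_def cis_cnj inner_commute)
      then show ?thesis unfolding ip_def fourier_def by simp
    qed
    finally show ?thesis by simp
  qed
  from this[of "- _"] have "fourier H = (\<lambda>_. 0)" by auto
  then have "nm lebesgue H = 0"
    using plancherel_lebesgue(2)[OF H1 H2] by (simp add: nm_def)
  then have "AE \<xi> in lebesgue. H \<xi> = 0" using H2 nm_eq_0_iff by blast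
  moreover have "AE \<xi> in lebesgue. fourier w \<xi> \<noteq> 0" using wnz by (rule AE_completion)
  ultimately have "AE \<xi> in lebesgue. g' \<xi> = 0" by eventually_elim (simp add: H_def)
  then have "nm lebesgue g' = 0" using is_fourier_L2_l2(2)[OF g'] nm_eq_0_iff by blast
  then show ?thesis using is_fourier_L2_nm[OF g'] by (simp add: nm_lebesgue)
qed

text \<open>Translates depend continuously on the shift in L^2, so orthogonality to those with
  shifts in a countable dense set extends to all.\<close>

corollary countable_translates_total:
  fixes \<omega> :: "'a::euclidean_space \<Rightarrow> real"
  assumes \<omega>: "continuous_on UNIV \<omega>" and supp: "\<And>x. norm x > R \<Longrightarrow> \<omega> x = 0" and "0 \<le> R"
    and nz: "(\<integral>x. \<omega> x \<partial>lborel) \<noteq> 0"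
  shows "\<exists>P :: nat \<Rightarrow> 'a. (\<forall>a. (\<lambda>y. complex_of_real (\<omega> (P a - y))) \<in> l2 lborel) \<and>
    total_in_l2 lborel (\<lambda>a y. complex_of_real (\<omega> (P a - y)))"
proof -
  have [measurable]: "\<omega> \<in> borel_measurable borel" by (rule borel_measurable_continuous_onI[OF \<omega>])
  obtain B where B: "\<And>x. \<bar>\<omega> x\<bar> \<le> B"
    using continuous_bounded_support[OF \<omega> supp] by blast
  have "integrable lborel (\<lambda>x. (norm (complex_of_real (\<omega> x)))\<^sup>2)"
    by (rule integrable_bounded_support[where B = "B\<^sup>2" and R = R])
      (use supp power_mono[OF B abs_ge_zero, where n = 2] in auto)
  then have w: "(\<lambda>x. complex_of_real (\<omega> x)) \<in> l2 lborel" by (intro l2I) auto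
  have h: "(\<lambda>y. complex_of_real (\<omega> (p - y))) \<in> l2 lborel" for p
    using l2_reflect(1)[OF w] .
  obtain D :: "'a set" where D: "countable D" "\<And>X. open X \<Longrightarrow> X \<noteq> {} \<Longrightarrow> \<exists>d\<in>D. d \<in> X"
    by (rule countable_dense_setE) blast
  have "D \<noteq> {}" using D(2)[OF open_UNIV] by auto
  then obtain P :: "nat \<Rightarrow> 'a" where P: "range P = D" using uncountable_def D(1) by metis
  have "total_in_l2 lborel (\<lambda>a y. complex_of_real (\<omega> (P a - y)))"
    unfolding total_in_l2_def
  proof (intro ballI impI)
    fix g :: "'a \<Rightarrow> complex" assume g: "g \<in> l2 lborel" and orth: "\<forall>a. ip lborel g (\<lambda>y. complex_of_real (\<omega> (P a - y))) = 0"
    have orthD: "ip lborel g (\<lambda>y. complex_of_real (\<omega> (d - y))) = 0" if "d \<in> D" for d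
      using orth that P by (metis rangeE)
    have "ip lborel g (\<lambda>y. complex_of_real (\<omega> (p - y))) = 0" for p
    proof -
      have "\<exists>d\<in>D. dist d p < 1 / real (Suc n)" for n
        using D(2)[of "ball p (1 / real (Suc n))"] by (auto simp: dist_commute)
      then obtain d where d: "\<And>n. d n \<in> D" "\<And>n. dist (d n) p < 1 / real (Suc n)" by metis
      have "(\<lambda>n. norm (d n - p)) \<longlonglongrightarrow> 0"
        by (rule tendsto_0_le_real[OF norm_ge_zero less_imp_le[OF d(2)[unfolded dist_norm]] LIMSEQ_Suc[OF lim_1_over_n]])
      then have z: "(\<lambda>n. d n - p) \<longlonglongrightarrow> 0" by (simp add: tendsto_norm_zero_iff)
      have "(\<lambda>n. nm lborel (\<lambda>y. complex_of_real (\<omega> (d n - y)) - complex_of_real (\<omega> (p - y)))) \<longlonglongrightarrow> 0"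
        using l2_translation_continuous[OF h[of p] z] by (simp add: algebra_simps)
      then have "(\<lambda>n. ip lborel g (\<lambda>y. complex_of_real (\<omega> (d n - y)))) \<longlonglongrightarrow> ip lborel g (\<lambda>y. complex_of_real (\<omega> (p - y)))"
        by (intro tendsto_ip g h) (simp_all add: nm_def[of _ "\<lambda>_. 0"])
      then show ?thesis by (simp add: orthD d(1) LIMSEQ_const_iff)
    qed
    then show "nm lborel g = 0"
      by (intro translates_total[OF \<omega> supp \<open>0 \<le> R\<close> nz g])
  qed
  then show ?thesis using h by blast
qed

section \<open>Square integrable functions on products\<close>

lemma (in pair_sigma_finite)
  assumes u: "u \<in> l2 (M1 \<Otimes>\<^sub>M M2)"
  shows l2_slice_fst: "AE x in M1. (\<lambda>y. u (x, y)) \<in> l2 M2"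
    and integrable_nm_slice_fst: "integrable M1 (\<lambda>x. (nm M2 (\<lambda>y. u (x, y)))\<^sup>2)"
    and integral_nm_slice_fst: "(\<integral>x. (nm M2 (\<lambda>y. u (x, y)))\<^sup>2 \<partial>M1) = (nm (M1 \<Otimes>\<^sub>M M2) u)\<^sup>2"
proof -
  have m: "u \<in> borel_measurable (M1 \<Otimes>\<^sub>M M2)" using u by (rule l2_measurable)
  show "AE x in M1. (\<lambda>y. u (x, y)) \<in> l2 M2"
    using AE_integrable_fst'[OF l2_integrable[OF u]] AE_space
    by eventually_elim (auto intro!: l2I measurable_Pair2[OF m])
  show "integrable M1 (\<lambda>x. (nm M2 (\<lambda>y. u (x, y)))\<^sup>2)"
    unfolding nm_power2 by (rule integrable_fst'[OF l2_integrable[OF u]])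
  show "(\<integral>x. (nm M2 (\<lambda>y. u (x, y)))\<^sup>2 \<partial>M1) = (nm (M1 \<Otimes>\<^sub>M M2) u)\<^sup>2"
    unfolding nm_power2 by (rule integral_fst'[OF l2_integrable[OF u]])
qed

lemma (in pair_sigma_finite)
  assumes u: "u \<in> l2 (M1 \<Otimes>\<^sub>M M2)"
  shows l2_slice_snd: "AE y in M2. (\<lambda>x. u (x, y)) \<in> l2 M1"
    and integrable_nm_slice_snd: "integrable M2 (\<lambda>y. (nm M1 (\<lambda>x. u (x, y)))\<^sup>2)"
    and integral_nm_slice_snd: "(\<integral>y. (nm M1 (\<lambda>x. u (x, y)))\<^sup>2 \<partial>M2) = (nm (M1 \<Otimes>\<^sub>M M2) u)\<^sup>2"
proof -
  have m: "u \<in> borel_measurable (M1 \<Otimes>\<^sub>M M2)" using u by (rule l2_measurable)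
  have i: "integrable (M1 \<Otimes>\<^sub>M M2) (\<lambda>(x, y). (norm (u (x, y)))\<^sup>2)"
    using l2_integrable[OF u] by (simp add: case_prod_unfold)
  show "AE y in M2. (\<lambda>x. u (x, y)) \<in> l2 M1"
    using AE_integrable_snd[OF i] AE_space
    by eventually_elim (auto intro!: l2I measurable_Pair1[OF m])
  show "integrable M2 (\<lambda>y. (nm M1 (\<lambda>x. u (x, y)))\<^sup>2)"
    unfolding nm_power2 by (rule integrable_snd[OF i])
  show "(\<integral>y. (nm M1 (\<lambda>x. u (x, y)))\<^sup>2 \<partial>M2) = (nm (M1 \<Otimes>\<^sub>M M2) u)\<^sup>2"
    unfolding nm_power2 integral_snd[OF i] by (simp add: case_prod_unfold)
qed

section \<open>Tensor products and expansions in one variable\<close>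

lemma (in pair_sigma_finite) l2_tensor:
  assumes f: "f \<in> l2 M1" and g: "g \<in> l2 M2"
  shows "(\<lambda>(x, y). f x * g y) \<in> l2 (M1 \<Otimes>\<^sub>M M2)"
proof (rule l2I)
  have [measurable]: "f \<in> borel_measurable M1" "g \<in> borel_measurable M2" using f g by (auto intro: l2_measurable)
  show "(\<lambda>(x, y). f x * g y) \<in> borel_measurable (M1 \<Otimes>\<^sub>M M2)" by measurable
  have "integrable M1 (\<lambda>x. complex_of_real ((norm (f x))\<^sup>2))" "integrable M2 (\<lambda>x. complex_of_real ((norm (g x))\<^sup>2))"
    using f g by (auto simp only: l2_integrable intro!: integrable_of_real)
  from integrable_norm[OF integrable_pair_mult[OF this, of "\<lambda>_. 1"]]
  show "integrable (M1 \<Otimes>\<^sub>M M2) (\<lambda>z. (norm (case z of (x, y) \<Rightarrow> f x * g y))\<^sup>2)"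
    by (simp add: case_prod_unfold norm_mult power_mult_distrib norm_power)
qed

lemma (in pair_sigma_finite) ip_tensor_right:
  assumes u: "u \<in> l2 (M1 \<Otimes>\<^sub>M M2)" and f: "f \<in> l2 M1" and g: "g \<in> l2 M2"
  shows "ip (M1 \<Otimes>\<^sub>M M2) u (\<lambda>(x, y). f x * g y) = ip M1 (\<lambda>x. ip M2 (\<lambda>y. u (x, y)) g) f"
proof -
  have "ip (M1 \<Otimes>\<^sub>M M2) u (\<lambda>(x, y). f x * g y)
      = (\<integral>x. \<integral>y. u (x, y) * cnj (case (x, y) of (x, y) \<Rightarrow> f x * g y) \<partial>M2 \<partial>M1)"
    unfolding ip_def by (rule integral_fst'[OF l2_ip_integrable[OF u l2_tensor[OF f g]], symmetric])
  also have "\<dots> = (\<integral>x. (\<integral>y. u (x, y) * cnj (g y) \<partial>M2) * cnj (f x) \<partial>M1)"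
  proof (intro Bochner_Integration.integral_cong refl)
    fix x
    have "u (x, y) * cnj (case (x, y) of (x, y) \<Rightarrow> f x * g y) = u (x, y) * cnj (g y) * cnj (f x)" for y
      by (simp add: ac_simps)
    then show "(\<integral>y. u (x, y) * cnj (case (x, y) of (x, y) \<Rightarrow> f x * g y) \<partial>M2) = (\<integral>y. u (x, y) * cnj (g y) \<partial>M2) * cnj (f x)"
      by (simp only: integral_mult_left_zero)
  qed
  finally show ?thesis by (simp add: ip_def)
qed

lemma (in pair_sigma_finite) ip_tensor:
  assumes "f \<in> l2 M1" "g \<in> l2 M2" "f' \<in> l2 M1" "g' \<in> l2 M2"
  shows "ip (M1 \<Otimes>\<^sub>M M2) (\<lambda>(x, y). f x * g y) (\<lambda>(x, y). f' x * g' y) = ip M1 f f' * ip M2 g g'"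
proof -
  have 1: "ip M2 (\<lambda>y. case (x, y) of (x, y) \<Rightarrow> f x * g y) g' = ip M2 g g' * f x" for x
    by (simp add: ip_scale_left mult.commute)
  show ?thesis
    unfolding ip_tensor_right[OF l2_tensor[OF assms(1,2)] assms(3,4)] 1 ip_scale_left
    by (rule mult.commute)
qed

lemma (in pair_sigma_finite) nm_tensor:
  assumes "f \<in> l2 M1" "g \<in> l2 M2"
  shows "nm (M1 \<Otimes>\<^sub>M M2) (\<lambda>(x, y). f x * g y) = nm M1 f * nm M2 g"
proof -
  have "complex_of_real ((nm (M1 \<Otimes>\<^sub>M M2) (\<lambda>(x, y). f x * g y))\<^sup>2) = of_real ((nm M1 f * nm M2 g)\<^sup>2)"
    using ip_tensor[OF assms assms] unfolding ip_self by (simp add: power_mult_distrib)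
  then have "(nm (M1 \<Otimes>\<^sub>M M2) (\<lambda>(x, y). f x * g y))\<^sup>2 = (nm M1 f * nm M2 g)\<^sup>2"
    using of_real_eq_iff by blast
  then show ?thesis by (simp add: power2_eq_iff_nonneg)
qed

lemma nm_mono:
  assumes "f \<in> l2 M" "g \<in> l2 M" "AE x in M. norm (f x) \<le> norm (g x)"
  shows "nm M f \<le> nm M g"
  unfolding nm_def
  by (intro real_sqrt_le_mono integral_mono_AE l2_integrable assms)
    (use assms(3) in \<open>auto intro: power_mono\<close>)

lemma orthosys_nm_le_1: "orthosys M e \<Longrightarrow> nm M (e i) \<le> 1"
proof -
  assume "orthosys M e"
  then have "ip M (e i) (e i) = 1 \<or> nm M (e i) = 0" by (auto simp: orthosys_def)
  then show ?thesis
  proof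
    assume "ip M (e i) (e i) = 1"
    then have "(nm M (e i))\<^sup>2 = 1" unfolding ip_self by (simp flip: of_real_power)
    then show ?thesis using power2_eq_1_iff[of "nm M (e i)"] by auto
  qed simp
qed

text \<open>The functions \<open>x \<mapsto> ip M2 (\<lambda>y. u (x, y)) (e i)\<close> are the coefficients of the expansion of
  \<open>u\<close> in the second variable.\<close>

lemma (in pair_sigma_finite)
  assumes u: "u \<in> l2 (M1 \<Otimes>\<^sub>M M2)" and g: "g \<in> l2 M2"
  shows l2_coefficient: "(\<lambda>x. ip M2 (\<lambda>y. u (x, y)) g) \<in> l2 M1"
proof (rule l2_dominated[where h = "\<lambda>x. (nm M2 (\<lambda>y. u (x, y)))\<^sup>2 * (nm M2 g)\<^sup>2"])
  have [measurable]: "u \<in> borel_measurable (M1 \<Otimes>\<^sub>M M2)" "g \<in> borel_measurable M2"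
    using u g by (auto intro: l2_measurable)
  show "(\<lambda>x. ip M2 (\<lambda>y. u (x, y)) g) \<in> borel_measurable M1"
    unfolding ip_def by measurable
  show "integrable M1 (\<lambda>x. (nm M2 (\<lambda>y. u (x, y)))\<^sup>2 * (nm M2 g)\<^sup>2)"
    using integrable_nm_slice_fst[OF u] by simp
  show "AE x in M1. (norm (ip M2 (\<lambda>y. u (x, y)) g))\<^sup>2 \<le> (nm M2 (\<lambda>y. u (x, y)))\<^sup>2 * (nm M2 g)\<^sup>2"
    using l2_slice_fst[OF u]
    by eventually_elim (simp add: Cauchy_Schwarz_l2 g power_mono flip: power_mult_distrib)
qed

text \<open>Bessel's inequality on almost every slice, integrated over the slices.\<close>

lemma (in pair_sigma_finite) sum_coefficients_le:
  assumes u: "u \<in> l2 (M1 \<Otimes>\<^sub>M M2)" and e: "orthosys M2 e" and "finite I"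
  shows "(\<Sum>i\<in>I. (nm M1 (\<lambda>x. ip M2 (\<lambda>y. u (x, y)) (e i)))\<^sup>2) \<le> (nm (M1 \<Otimes>\<^sub>M M2) u)\<^sup>2"
proof -
  have c: "integrable M1 (\<lambda>x. (norm (ip M2 (\<lambda>y. u (x, y)) (e i)))\<^sup>2)" for i
    by (intro l2_integrable l2_coefficient u orthosys_l2[OF e])
  have "(\<Sum>i\<in>I. (nm M1 (\<lambda>x. ip M2 (\<lambda>y. u (x, y)) (e i)))\<^sup>2) = (\<integral>x. (\<Sum>i\<in>I. (norm (ip M2 (\<lambda>y. u (x, y)) (e i)))\<^sup>2) \<partial>M1)"
    unfolding nm_power2 by (rule Bochner_Integration.integral_sum[symmetric]) (rule c)
  also have "\<dots> \<le> (\<integral>x. (nm M2 (\<lambda>y. u (x, y)))\<^sup>2 \<partial>M1)"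
  proof (rule integral_mono_AE)
    show "AE x in M1. (\<Sum>i\<in>I. (norm (ip M2 (\<lambda>y. u (x, y)) (e i)))\<^sup>2) \<le> (nm M2 (\<lambda>y. u (x, y)))\<^sup>2"
      using l2_slice_fst[OF u] by eventually_elim (rule Bessel_inequality[OF e _ \<open>finite I\<close>])
  qed (use c integrable_nm_slice_fst[OF u] in auto)
  finally show ?thesis unfolding integral_nm_slice_fst[OF u] .
qed

text \<open>On almost every slice the squared error is the defect \<open>D N x\<close> in Bessel's
  inequality; it tends to 0 by Parseval and is dominated by the squared norm of the slice.\<close>

theorem (in pair_sigma_finite) tensor_expansion:
  fixes e :: "nat \<Rightarrow> _"
  assumes u: "u \<in> l2 (M1 \<Otimes>\<^sub>M M2)" and e: "orthosys M2 e" and tot: "total_in_l2 M2 e"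
  defines "s \<equiv> \<lambda>N (x, y). \<Sum>i<N. ip M2 (\<lambda>y. u (x, y)) (e i) * e i y"
  shows "s N \<in> l2 (M1 \<Otimes>\<^sub>M M2)" and "(\<lambda>N. nm (M1 \<Otimes>\<^sub>M M2) (\<lambda>z. s N z - u z)) \<longlonglongrightarrow> 0"
proof -
  have s_eq: "s N = (\<lambda>z. \<Sum>i<N. (case z of (x, y) \<Rightarrow> ip M2 (\<lambda>y. u (x, y)) (e i) * e i y))" for N
    by (auto simp: s_def)
  show s: "s N \<in> l2 (M1 \<Otimes>\<^sub>M M2)" for N
    unfolding s_eq by (intro l2_sum l2_tensor l2_coefficient u orthosys_l2[OF e])
  define D where "D N x = (nm M2 (\<lambda>y. u (x, y)))\<^sup>2 - (\<Sum>i<N. (norm (ip M2 (\<lambda>y. u (x, y)) (e i)))\<^sup>2)" for N x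
  have su: "(\<lambda>z. s N z - u z) \<in> l2 (M1 \<Otimes>\<^sub>M M2)" for N by (intro l2_diff s u)
  have D: "AE x in M1. \<forall>N. (nm M2 (\<lambda>y. s N (x, y) - u (x, y)))\<^sup>2 = D N x"
    using l2_slice_fst[OF u]
  proof eventually_elim
    case (elim x)
    then show ?case
      using Bessel_identity[OF e elim, of "{..<N}" for N] nm_minus_commute[of M2 "\<lambda>y. u (x, y)"]
      by (simp add: s_def D_def)
  qed
  have lim: "AE x in M1. (\<lambda>N. D N x) \<longlonglongrightarrow> 0"
    using l2_slice_fst[OF u]
  proof eventually_elim
    case (elim x)
    have "i < N \<Longrightarrow> \<exists>N. i \<in> {..<N}" for i N :: nat by auto
    then show ?case
      unfolding D_def by (intro Parseval[OF e tot elim]) (auto simp: incseq_def intro: exI[of _ "Suc _"])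
  qed
  have "(\<lambda>N. \<integral>x. (nm M2 (\<lambda>y. s N (x, y) - u (x, y)))\<^sup>2 \<partial>M1) \<longlonglongrightarrow> (\<integral>x. 0 \<partial>M1)"
  proof (rule integral_dominated_convergence[OF _ _ integrable_nm_slice_fst[OF u]])
    show "(\<lambda>x. (nm M2 (\<lambda>y. s N (x, y) - u (x, y)))\<^sup>2) \<in> borel_measurable M1" for N
      using borel_measurable_integrable[OF integrable_nm_slice_fst[OF su]] .
    show "AE x in M1. (\<lambda>N. (nm M2 (\<lambda>y. s N (x, y) - u (x, y)))\<^sup>2) \<longlonglongrightarrow> 0"
      using D lim by eventually_elim simp
    show "AE x in M1. norm ((nm M2 (\<lambda>y. s N (x, y) - u (x, y)))\<^sup>2) \<le> (nm M2 (\<lambda>y. u (x, y)))\<^sup>2" for N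
      using D
    proof eventually_elim
      case (elim x)
      have "norm ((nm M2 (\<lambda>y. s N (x, y) - u (x, y)))\<^sup>2) = (nm M2 (\<lambda>y. s N (x, y) - u (x, y)))\<^sup>2" by simp
      also have "\<dots> = D N x" using elim by blast
      also have "\<dots> \<le> (nm M2 (\<lambda>y. u (x, y)))\<^sup>2" by (simp add: D_def sum_nonneg)
      finally show ?case .
    qed
  qed simp
  then have "(\<lambda>N. (nm (M1 \<Otimes>\<^sub>M M2) (\<lambda>z. s N z - u z))\<^sup>2) \<longlonglongrightarrow> 0"
    unfolding integral_nm_slice_fst[OF su] by simp
  from tendsto_real_sqrt[OF this] show "(\<lambda>N. nm (M1 \<Otimes>\<^sub>M M2) (\<lambda>z. s N z - u z)) \<longlonglongrightarrow> 0" by simp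
qed

lemma ip_cnj_cnj: "ip M (\<lambda>x. cnj (f x)) (\<lambda>x. cnj (g x)) = cnj (ip M f g)"
  unfolding ip_def Bochner_Integration.integral_cnj[symmetric] by simp

lemma orthosys_cnj: "orthosys M e \<Longrightarrow> orthosys M (\<lambda>i x. cnj (e i x))"
  unfolding orthosys_def ip_cnj_cnj nm_cnj by (auto intro: l2_cnj)

lemma total_cnj:
  assumes "total_in_l2 M e"
  shows "total_in_l2 M (\<lambda>i x. cnj (e i x))"
  unfolding total_in_l2_def
proof (intro ballI impI)
  fix g assume g: "g \<in> l2 M" "\<forall>i. ip M g (\<lambda>x. cnj (e i x)) = 0"
  have "ip M (\<lambda>x. cnj (g x)) (e i) = 0" for i
    using ip_cnj_cnj[of M g "\<lambda>x. cnj (e i x)"] g(2) by simp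
  then have "nm M (\<lambda>x. cnj (g x)) = 0"
    using assms l2_cnj[OF g(1)] by (auto simp: total_in_l2_def)
  then show "nm M g = 0" by (simp add: nm_cnj)
qed

lemma (in pair_sigma_finite) orthosys_tensor:
  fixes e :: "'i \<Rightarrow> _" and f :: "'j \<Rightarrow> _"
  assumes e: "orthosys M1 e" and f: "orthosys M2 f"
  shows "orthosys (M1 \<Otimes>\<^sub>M M2) (\<lambda>(i, j) (x, y). e i x * f j y)"
proof -
  note l = orthosys_l2[OF e] orthosys_l2[OF f]
  have 0: "ip (M1 \<Otimes>\<^sub>M M2) (\<lambda>(x, y). e i x * f j y) (\<lambda>(x, y). e k x * f l y) = ip M1 (e i) (e k) * ip M2 (f j) (f l)" for i j k l
    by (rule ip_tensor) (rule l)+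
  have 1: "nm (M1 \<Otimes>\<^sub>M M2) (\<lambda>(x, y). e i x * f j y) = nm M1 (e i) * nm M2 (f j)" for i j
    by (rule nm_tensor) (rule l)+
  show ?thesis
    unfolding orthosys_def
  proof (intro conjI allI impI)
    fix k l :: "'i \<times> 'j"
    obtain i j i' j' where k: "k = (i, j)" "l = (i', j')" by (cases k; cases l)
    show "(case k of (i, j) \<Rightarrow> \<lambda>(x, y). e i x * f j y) \<in> l2 (M1 \<Otimes>\<^sub>M M2)"
      unfolding k prod.case by (rule l2_tensor) (rule l)+
    show "ip (M1 \<Otimes>\<^sub>M M2) (case k of (i, j) \<Rightarrow> \<lambda>(x, y). e i x * f j y) (case k of (i, j) \<Rightarrow> \<lambda>(x, y). e i x * f j y) = 1
        \<or> nm (M1 \<Otimes>\<^sub>M M2) (case k of (i, j) \<Rightarrow> \<lambda>(x, y). e i x * f j y) = 0"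
    proof -
      have "ip M1 (e i) (e i) = 1 \<or> nm M1 (e i) = 0" "ip M2 (f j) (f j) = 1 \<or> nm M2 (f j) = 0"
        using e f by (auto simp: orthosys_def)
      then show ?thesis unfolding k prod.case 0 1 by auto
    qed
    assume "k \<noteq> l"
    then show "ip (M1 \<Otimes>\<^sub>M M2) (case k of (i, j) \<Rightarrow> \<lambda>(x, y). e i x * f j y) (case l of (i, j) \<Rightarrow> \<lambda>(x, y). e i x * f j y) = 0"
      unfolding k prod.case 0 using e f by (auto simp: orthosys_def)
  qed
qed

text \<open>Orthogonality to all products annihilates, by Fubini, every coefficient of
  \<open>v\<close> in the second variable; countably many exceptional null sets can be united, after
  which totality applies slice by slice.\<close>

lemma (in pair_sigma_finite) total_tensor:
  fixes e :: "'i \<Rightarrow> _" and f :: "'j::countable \<Rightarrow> _"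
  assumes e: "\<And>i. e i \<in> l2 M1" "total_in_l2 M1 e" and f: "\<And>j. f j \<in> l2 M2" "total_in_l2 M2 f"
  shows "total_in_l2 (M1 \<Otimes>\<^sub>M M2) (\<lambda>(i, j) (x, y). e i x * f j y)"
  unfolding total_in_l2_def
proof (intro ballI impI)
  fix v assume v: "v \<in> l2 (M1 \<Otimes>\<^sub>M M2)" and 0: "\<forall>k. ip (M1 \<Otimes>\<^sub>M M2) v (case k of (i, j) \<Rightarrow> \<lambda>(x, y). e i x * f j y) = 0"
  have "ip M1 (\<lambda>x. ip M2 (\<lambda>y. v (x, y)) (f j)) (e i) = 0" for i j
    using 0[rule_format, of "(i, j)"] ip_tensor_right[OF v e(1)[of i] f(1)[of j]] by simp
  then have "nm M1 (\<lambda>x. ip M2 (\<lambda>y. v (x, y)) (f j)) = 0" for j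
    using e(2) l2_coefficient[OF v f(1)[of j]] by (auto simp: total_in_l2_def)
  then have "AE x in M1. ip M2 (\<lambda>y. v (x, y)) (f j) = 0" for j
    using nm_eq_0_iff[OF l2_coefficient[OF v f(1)[of j]]] by simp
  then have "AE x in M1. \<forall>j. ip M2 (\<lambda>y. v (x, y)) (f j) = 0"
    by (simp add: AE_all_countable)
  then have "AE x in M1. (nm M2 (\<lambda>y. v (x, y)))\<^sup>2 = 0"
    using l2_slice_fst[OF v] by eventually_elim (use f(2) in \<open>auto simp: total_in_l2_def\<close>)
  then have "(\<integral>x. (nm M2 (\<lambda>y. v (x, y)))\<^sup>2 \<partial>M1) = 0"
    by (rule integral_eq_zero_AE)
  then show "nm (M1 \<Otimes>\<^sub>M M2) v = 0"
    unfolding integral_nm_slice_fst[OF v] by simp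
qed

lemma orthosys_orth: "orthosys M e \<Longrightarrow> i \<noteq> j \<Longrightarrow> ip M (e i) (e j) = 0"
  by (simp add: orthosys_def)

lemma nm_lincomb_power2:
  assumes l: "\<And>i. e i \<in> l2 M" and orth: "\<And>i j. i \<noteq> j \<Longrightarrow> ip M (e i) (e j) = 0" and "finite I"
  shows "(nm M (\<lambda>x. \<Sum>i\<in>I. c i * e i x))\<^sup>2 = (\<Sum>i\<in>I. (norm (c i))\<^sup>2 * (nm M (e i))\<^sup>2)"
    and "ip M (\<lambda>x. \<Sum>i\<in>I. c i * e i x) (e j) = (if j \<in> I then c j * of_real ((nm M (e j))\<^sup>2) else 0)"
proof -
  have P: "(\<lambda>x. \<Sum>i\<in>I. c i * e i x) \<in> l2 M" by (intro l2_sum l2_scale l)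
  have ij: "ip M (e i) (e j) = (if i = j then of_real ((nm M (e j))\<^sup>2) else 0)" for i j
    using orth ip_self[of M "e j"] by auto
  show 1: "ip M (\<lambda>x. \<Sum>i\<in>I. c i * e i x) (e j) = (if j \<in> I then c j * of_real ((nm M (e j))\<^sup>2) else 0)" for j
    using \<open>finite I\<close> l by (simp add: ip_sum_left l2_scale ip_scale_left ij if_distrib cong: if_cong)
  have "complex_of_real ((nm M (\<lambda>x. \<Sum>i\<in>I. c i * e i x))\<^sup>2)
      = (\<Sum>i\<in>I. cnj (c i) * ip M (\<lambda>x. \<Sum>i\<in>I. c i * e i x) (e i))"
    unfolding ip_self[symmetric] ip_sum_right[OF \<open>finite I\<close> l2_scale[OF l] P] ip_scale_right ..
  also have "\<dots> = (\<Sum>i\<in>I. complex_of_real ((norm (c i))\<^sup>2 * (nm M (e i))\<^sup>2))"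
  proof (intro sum.cong refl)
    fix i assume "i \<in> I"
    then show "cnj (c i) * ip M (\<lambda>x. \<Sum>i\<in>I. c i * e i x) (e i) = complex_of_real ((norm (c i))\<^sup>2 * (nm M (e i))\<^sup>2)"
      unfolding 1 of_real_mult complex_norm_square by simp
  qed
  also have "\<dots> = complex_of_real (\<Sum>i\<in>I. (norm (c i))\<^sup>2 * (nm M (e i))\<^sup>2)" by simp
  finally show "(nm M (\<lambda>x. \<Sum>i\<in>I. c i * e i x))\<^sup>2 = (\<Sum>i\<in>I. (norm (c i))\<^sup>2 * (nm M (e i))\<^sup>2)"
    using of_real_eq_iff by blast
qed

text \<open>The vectors are orthogonal but not normalised, because zero vectors and products with
  arbitrary second factors occur later; the weights \<open>nm M (e i)\<close> account for
  this.\<close>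

theorem orthogonal_series_converges:
  assumes l: "\<And>i. e i \<in> l2 M" and orth: "\<And>i j. i \<noteq> j \<Longrightarrow> ip M (e i) (e j) = 0" and fin: "\<And>N. finite (I N)" and mono: "incseq I"
    and bound: "\<And>N. (\<Sum>i\<in>I N. (norm (c i))\<^sup>2 * (nm M (e i))\<^sup>2) \<le> B"
  shows "\<exists>g\<in>l2 M. (\<lambda>N. nm M (\<lambda>x. (\<Sum>i\<in>I N. c i * e i x) - g x)) \<longlonglongrightarrow> 0"
proof -
  define P where "P N x = (\<Sum>i\<in>I N. c i * e i x)" for N x
  define S where "S N = (\<Sum>i\<in>I N. (norm (c i))\<^sup>2 * (nm M (e i))\<^sup>2)" for N
  have P: "P N \<in> l2 M" for N unfolding P_def by (intro l2_sum l2_scale l)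
  have diff: "(nm M (\<lambda>x. P n x - P m x))\<^sup>2 = S n - S m" if "m \<le> n" for m n
  proof -
    have sub: "I m \<subseteq> I n" using mono that by (simp add: incseq_def)
    have "(\<lambda>x. P n x - P m x) = (\<lambda>x. \<Sum>i\<in>I n - I m. c i * e i x)"
      unfolding P_def by (intro ext) (simp add: sum_diff[OF fin sub])
    then show ?thesis
      using nm_lincomb_power2(1)[OF l orth, where I = "I n - I m" and c = c] fin by (simp add: S_def sum_diff[OF fin sub])
  qed
  have "incseq S"
  proof (rule monoI)
    fix m n :: nat assume "m \<le> n"
    from diff[OF this] zero_le_power2[of "nm M (\<lambda>x. P n x - P m x)"] show "S m \<le> S n" by linarith
  qed
  then have S: "Cauchy S"
    using bound unfolding S_def[symmetric] by (metis incseq_convergent LIMSEQ_imp_Cauchy)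
  have "\<exists>N. \<forall>m\<ge>N. \<forall>n\<ge>N. nm M (\<lambda>x. P m x - P n x) < d" if "0 < d" for d
  proof -
    obtain N where N: "\<And>m n. m \<ge> N \<Longrightarrow> n \<ge> N \<Longrightarrow> \<bar>S m - S n\<bar> < d\<^sup>2"
      using metric_CauchyD[OF S, of "d\<^sup>2"] \<open>0 < d\<close> by (auto simp: dist_real_def)
    have "nm M (\<lambda>x. P m x - P n x) < d" if "m \<ge> N" "n \<ge> N" for m n
    proof (rule power2_less_imp_less)
      have "(nm M (\<lambda>x. P m x - P n x))\<^sup>2 = \<bar>S m - S n\<bar>"
        using diff[of m n] diff[of n m] nm_minus_commute[of M "P m" "P n"]
          zero_le_power2[of "nm M (\<lambda>x. P n x - P m x)"]
        by (cases "m \<le> n") auto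
      then show "(nm M (\<lambda>x. P m x - P n x))\<^sup>2 < d\<^sup>2" using N[OF that] by simp
    qed (use \<open>0 < d\<close> in simp)
    then show ?thesis by blast
  qed
  from l2_complete[OF P this] show ?thesis unfolding P_def .
qed

section \<open>Sesquilinear forms on slices\<close>

text \<open>Functions that are square integrable for \<open>lborel\<close> are Borel, so this
  restricts the domain of the form; it prepares for Fubini's theorem.\<close>

lemma bounded_sesquilinear_lborel:
  assumes "bounded_sesquilinear_l2 lebesgue Q C"
  shows "bounded_sesquilinear_l2 lborel Q C"
proof -
  have *: "f \<in> l2 lebesgue" "nm lborel f = nm lebesgue f" if "f \<in> l2 lborel" for f :: "'a \<Rightarrow> complex"
    using l2_measurable[OF that] that by (simp_all add: l2_lebesgue_iff nm_lebesgue)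
  show ?thesis using assms unfolding bounded_sesquilinear_l2_def by (auto simp: *)
qed

context
  fixes M :: "'a measure" and Q and C :: real
  assumes Q: "bounded_sesquilinear_l2 M Q C"
begin

lemma sesquilinear_bound: "f \<in> l2 M \<Longrightarrow> g \<in> l2 M \<Longrightarrow> norm (Q f g) \<le> C * nm M f * nm M g"
  and sesquilinear_add_left: "f \<in> l2 M \<Longrightarrow> g \<in> l2 M \<Longrightarrow> h \<in> l2 M \<Longrightarrow> Q (\<lambda>x. f x + c * g x) h = Q f h + c * Q g h"
  and sesquilinear_add_right: "f \<in> l2 M \<Longrightarrow> g \<in> l2 M \<Longrightarrow> h \<in> l2 M \<Longrightarrow> Q h (\<lambda>x. f x + c * g x) = Q h f + cnj c * Q h g"
  and sesquilinear_C: "0 \<le> C"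
  using Q by (auto simp: bounded_sesquilinear_l2_def)

lemma sesquilinear_zero: "h \<in> l2 M \<Longrightarrow> Q (\<lambda>x. 0) h = 0" "h \<in> l2 M \<Longrightarrow> Q h (\<lambda>x. 0) = 0"
  using sesquilinear_bound[of "\<lambda>x. 0" h] sesquilinear_bound[of h "\<lambda>x. 0"] by (simp_all add: nm_def[of M "\<lambda>x. 0"])

lemma sesquilinear_sum_left:
  assumes "finite I" "\<And>i. f i \<in> l2 M" "h \<in> l2 M"
  shows "Q (\<lambda>x. \<Sum>i\<in>I. c i * f i x) h = (\<Sum>i\<in>I. c i * Q (f i) h)"
  using assms(1)
proof (induction I rule: finite_induct)
  case (insert i I)
  have "Q (\<lambda>x. (\<Sum>i\<in>I. c i * f i x) + c i * f i x) h = Q (\<lambda>x. \<Sum>i\<in>I. c i * f i x) h + c i * Q (f i) h"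
    by (intro sesquilinear_add_left l2_sum l2_scale assms)
  then show ?case using insert by (simp add: add.commute)
qed (simp add: sesquilinear_zero assms)

lemma sesquilinear_sum_right:
  assumes "finite I" "\<And>i. f i \<in> l2 M" "h \<in> l2 M"
  shows "Q h (\<lambda>x. \<Sum>i\<in>I. c i * f i x) = (\<Sum>i\<in>I. cnj (c i) * Q h (f i))"
  using assms(1)
proof (induction I rule: finite_induct)
  case (insert i I)
  have "Q h (\<lambda>x. (\<Sum>i\<in>I. c i * f i x) + c i * f i x) = Q h (\<lambda>x. \<Sum>i\<in>I. c i * f i x) + cnj (c i) * Q h (f i)"
    by (intro sesquilinear_add_right l2_sum l2_scale assms)
  then show ?case using insert by (simp add: add.commute)
qed (simp add: sesquilinear_zero assms)

lemma sesquilinear_tendsto: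
  assumes s: "\<And>n. s n \<in> l2 M" and t: "\<And>n. t n \<in> l2 M" and f: "f \<in> l2 M" and g: "g \<in> l2 M"
    and sl: "(\<lambda>n. nm M (\<lambda>x. s n x - f x)) \<longlonglongrightarrow> 0" and tl: "(\<lambda>n. nm M (\<lambda>x. t n x - g x)) \<longlonglongrightarrow> 0"
  shows "(\<lambda>n. Q (s n) (t n)) \<longlonglongrightarrow> Q f g"
proof (rule Lim_null[THEN iffD2], rule Lim_null_comparison)
  let ?a = "\<lambda>n. nm M (\<lambda>x. s n x - f x)" and ?b = "\<lambda>n. nm M (\<lambda>x. t n x - g x)"
  show "\<forall>\<^sub>F n in sequentially. norm (Q (s n) (t n) - Q f g) \<le> C * ?a n * (?b n + nm M g) + C * nm M f * ?b n"
  proof (intro always_eventually allI)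
    fix n
    have 1: "Q (\<lambda>x. s n x - f x) (t n) = Q (s n) (t n) - Q f (t n)"
      using sesquilinear_add_left[OF s[of n] f t[of n], of "-1"] by simp
    have 2: "Q f (\<lambda>x. t n x - g x) = Q f (t n) - Q f g"
      using sesquilinear_add_right[OF t[of n] g f, of "-1"] by simp
    have "Q (s n) (t n) - Q f g = Q (\<lambda>x. s n x - f x) (t n) + Q f (\<lambda>x. t n x - g x)"
      unfolding 1 2 by simp
    also have "norm \<dots> \<le> C * ?a n * nm M (t n) + C * nm M f * ?b n"
      by (intro norm_triangle_mono sesquilinear_bound l2_diff s t f g)
    also have "\<dots> \<le> C * ?a n * (?b n + nm M g) + C * nm M f * ?b n"
      by (intro add_right_mono mult_left_mono nm_le_add_diff t g mult_nonneg_nonneg sesquilinear_C nm_nonneg)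
    finally show "norm (Q (s n) (t n) - Q f g) \<le> C * ?a n * (?b n + nm M g) + C * nm M f * ?b n" .
  qed
  show "(\<lambda>n. C * ?a n * (?b n + nm M g) + C * nm M f * ?b n) \<longlonglongrightarrow> 0"
    using tendsto_add[OF tendsto_mult[OF tendsto_mult_left[OF sl, of C] tendsto_add[OF tl tendsto_const]]
      tendsto_mult_left[OF tl, of "C * nm M f"]] by simp
qed

text \<open>Boundedness makes the form blind to null sets, so representatives can be
  exchanged.\<close>

lemma sesquilinear_AE_cong:
  assumes "f \<in> l2 M" "g \<in> l2 M" "h \<in> l2 M" "AE x in M. f x = g x"
  shows "Q f h = Q g h" "Q h f = Q h g"
proof -
  have "AE x in M. f x - g x = 0" using assms(4) by eventually_elim simp
  then have 0: "nm M (\<lambda>x. f x - g x) = 0"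
    using nm_eq_0_iff[OF l2_diff[OF assms(1,2)]] by simp
  have "Q (\<lambda>x. f x - g x) h = Q f h - Q g h" "Q h (\<lambda>x. f x - g x) = Q h f - Q h g"
    using sesquilinear_add_left[OF assms(1,2,3), of "-1"] sesquilinear_add_right[OF assms(1,2,3), of "-1"] by simp_all
  then show "Q f h = Q g h" "Q h f = Q h g"
    using sesquilinear_bound[OF l2_diff[OF assms(1,2)] assms(3)] sesquilinear_bound[OF assms(3) l2_diff[OF assms(1,2)]] 0
    by simp_all
qed

end

lemma (in sigma_finite_measure) AE_pair_both:
  assumes "AE p in M. P p"
  shows "AE z in M \<Otimes>\<^sub>M M. P (fst z) \<and> P (snd z)"
proof -
  interpret pair_sigma_finite M M ..
  obtain N where N: "N \<in> null_sets M" "{p \<in> space M. \<not> P p} \<subseteq> N"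
    using assms by (auto elim!: AE_E simp: null_sets_def)
  have [measurable]: "N \<in> sets M" using N by auto
  have "AE z in M \<Otimes>\<^sub>M M. fst z \<notin> N \<and> snd z \<notin> N"
  proof (rule AE_pair_measure)
    show "AE x in M. AE y in M. fst (x, y) \<notin> N \<and> snd (x, y) \<notin> N"
      using AE_not_in[OF N(1)] by eventually_elim (use AE_not_in[OF N(1)] in simp)
  qed measurable
  then show ?thesis
    using AE_space by eventually_elim (use N(2) in \<open>auto simp: space_pair_measure\<close>)
qed

text \<open>A form of two slices carries no evident measurability in the pair of parameters. For
  partial sums of the tensor expansion it is a finite combination of products
  \<open>e i p * cnj (e j q)\<close>. These sums are bounded in L^2 and their terms orthogonal, so
  they converge in L^2; almost everywhere, along a subsequence, they also converge to the form of
  the slices.\<close>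

theorem (in pair_sigma_finite) sesquilinear_slices:
  fixes e :: "nat \<Rightarrow> _" and Q
  assumes Q: "bounded_sesquilinear_l2 M1 Q C"
    and u: "u \<in> l2 (M1 \<Otimes>\<^sub>M M2)" and e: "orthosys M2 e" and tot: "total_in_l2 M2 e"
  defines "U \<equiv> \<lambda>i x. ip M2 (\<lambda>y. u (x, y)) (e i)"
  shows "\<exists>G\<in>l2 (M2 \<Otimes>\<^sub>M M2).
    (AE z in M2 \<Otimes>\<^sub>M M2. Q (\<lambda>x. u (x, fst z)) (\<lambda>x. u (x, snd z)) = G z) \<and>
    nm (M2 \<Otimes>\<^sub>M M2) G \<le> C * (nm (M1 \<Otimes>\<^sub>M M2) u)\<^sup>2 \<and>
    (\<forall>i j. ip (M2 \<Otimes>\<^sub>M M2) G (\<lambda>(p, q). e i p * cnj (e j q))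
       = Q (U i) (U j) * of_real ((nm (M2 \<Otimes>\<^sub>M M2) (\<lambda>(p, q). e i p * cnj (e j q)))\<^sup>2))"
proof -
  interpret M22: pair_sigma_finite M2 M2 ..
  define s where "s N z = (case z of (x, y) \<Rightarrow> \<Sum>i<N. U i x * e i y)" for N z
  have s_eq: "s = (\<lambda>N (x, y). \<Sum>i<N. ip M2 (\<lambda>y. u (x, y)) (e i) * e i y)"
    by (intro ext) (auto simp: s_def U_def)
  have s: "s N \<in> l2 (M1 \<Otimes>\<^sub>M M2)" and s_lim: "(\<lambda>N. nm (M1 \<Otimes>\<^sub>M M2) (\<lambda>z. s N z - u z)) \<longlonglongrightarrow> 0" for N
    unfolding s_eq by (rule tensor_expansion[OF u e tot])+
  have U: "U i \<in> l2 M1" for i unfolding U_def by (rule l2_coefficient[OF u orthosys_l2[OF e]])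
  have sl: "(\<lambda>x. s N (x, p)) \<in> l2 M1" for N p
    unfolding s_def prod.case by (intro l2_sum l2_scale_right U)
  define E where "E = (\<lambda>(i, j) (p, q). e i p * cnj (e j q))"
  have E: "orthosys (M2 \<Otimes>\<^sub>M M2) E"
    unfolding E_def by (rule M22.orthosys_tensor[OF e orthosys_cnj[OF e]])
  define I where "I N = {..<N} \<times> {..<N}" for N :: nat
  have I: "finite (I N)" "incseq I" for N by (auto simp: I_def incseq_def)
  define c where "c = (\<lambda>(i, j). Q (U i) (U j))"
  define G where "G N z = (\<Sum>k\<in>I N. c k * E k z)" for N z
  have G: "G N \<in> l2 (M2 \<Otimes>\<^sub>M M2)" for N
    unfolding G_def by (intro l2_sum l2_scale orthosys_l2[OF E])
  have GQ: "G N z = Q (\<lambda>x. s N (x, fst z)) (\<lambda>x. s N (x, snd z))" for N z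
  proof -
    have "Q (\<lambda>x. \<Sum>i<N. e i p * U i x) (\<lambda>x. \<Sum>j<N. e j q * U j x) = (\<Sum>i<N. \<Sum>j<N. e i p * (cnj (e j q) * Q (U i) (U j)))" for p q
      by (simp add: sesquilinear_sum_left[OF Q] sesquilinear_sum_right[OF Q] U l2_sum l2_scale sum_distrib_left)
    moreover have "G N z = (\<Sum>i<N. \<Sum>j<N. c (i, j) * E (i, j) z)"
      by (simp add: G_def I_def sum.cartesian_product case_prod_unfold)
    ultimately show ?thesis
      by (cases z) (simp add: c_def E_def s_def ac_simps)
  qed
  \<comment> \<open>The norms of the slices are taken as a complex function of the parameter, so
    that the bound on \<open>G N\<close> becomes the norm of a tensor product.\<close>
  define n where "n N p = complex_of_real (nm M1 (\<lambda>x. s N (x, p)))" for N p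
  have n2: "n N \<in> l2 M2" "nm M2 (n N) = nm (M1 \<Otimes>\<^sub>M M2) (s N)" for N
  proof -
    have "(\<lambda>p. sqrt ((nm M1 (\<lambda>x. s N (x, p)))\<^sup>2)) \<in> borel_measurable M2"
      using borel_measurable_integrable[OF integrable_nm_slice_snd[OF s]] by measurable
    then show "n N \<in> l2 M2"
      unfolding n_def using integrable_nm_slice_snd[OF s, of N] by (intro l2I) auto
    show "nm M2 (n N) = nm (M1 \<Otimes>\<^sub>M M2) (s N)"
      using integral_nm_slice_snd[OF s, of N] by (simp add: nm_def[of M2] n_def)
  qed
  have Gbound: "nm (M2 \<Otimes>\<^sub>M M2) (G N) \<le> C * (nm (M1 \<Otimes>\<^sub>M M2) (s N))\<^sup>2" for N
  proof -
    have "nm (M2 \<Otimes>\<^sub>M M2) (G N) \<le> nm (M2 \<Otimes>\<^sub>M M2) (\<lambda>z. of_real C * (case z of (p, q) \<Rightarrow> n N p * n N q))"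
    proof (rule nm_mono[OF G l2_scale[OF M22.l2_tensor[OF n2(1) n2(1)]] AE_I2])
      fix z
      show "norm (G N z) \<le> norm (of_real C * (case z of (p, q) \<Rightarrow> n N p * n N q))"
        using sesquilinear_bound[OF Q sl sl, of N "fst z" N "snd z"] sesquilinear_C[OF Q]
        by (cases z) (simp add: GQ n_def norm_mult mult.assoc)
    qed
    also have "\<dots> = C * (nm (M1 \<Otimes>\<^sub>M M2) (s N))\<^sup>2"
      using sesquilinear_C[OF Q] by (simp add: nm_scale M22.nm_tensor n2 power2_eq_square)
    finally show ?thesis .
  qed
  have slim: "(\<lambda>N. nm (M1 \<Otimes>\<^sub>M M2) (s N)) \<longlonglongrightarrow> nm (M1 \<Otimes>\<^sub>M M2) u"
    by (rule tendsto_nm[OF s u s_lim])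
  obtain B where B: "\<And>N. nm (M1 \<Otimes>\<^sub>M M2) (s N) \<le> B"
    using convergent_imp_Bseq[OF convergentI[OF slim]] by (auto simp: Bseq_def)
  have "(\<Sum>k\<in>I N. (norm (c k))\<^sup>2 * (nm (M2 \<Otimes>\<^sub>M M2) (E k))\<^sup>2) \<le> (C * B\<^sup>2)\<^sup>2" for N
  proof -
    have "nm (M2 \<Otimes>\<^sub>M M2) (G N) \<le> C * B\<^sup>2"
      using Gbound[of N] mult_left_mono[OF power_mono[OF B[of N] nm_nonneg, of 2] sesquilinear_C[OF Q]] by linarith
    then have "(nm (M2 \<Otimes>\<^sub>M M2) (G N))\<^sup>2 \<le> (C * B\<^sup>2)\<^sup>2" by (intro power_mono) auto
    then show ?thesis unfolding G_def by (simp add: nm_lincomb_power2(1)[OF orthosys_l2[OF E] orthosys_orth[OF E] I(1)])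
  qed
  from orthogonal_series_converges[OF orthosys_l2[OF E] orthosys_orth[OF E] I this]
  obtain g where g: "g \<in> l2 (M2 \<Otimes>\<^sub>M M2)" and glim: "(\<lambda>N. nm (M2 \<Otimes>\<^sub>M M2) (\<lambda>z. G N z - g z)) \<longlonglongrightarrow> 0"
    unfolding G_def by blast
  have "nm (M2 \<Otimes>\<^sub>M M2) g \<le> C * (nm (M1 \<Otimes>\<^sub>M M2) u)\<^sup>2"
    by (rule LIMSEQ_le[OF tendsto_nm[OF G g glim] tendsto_mult_left[OF tendsto_power[OF slim]]]) (use Gbound in blast)
  moreover have "ip (M2 \<Otimes>\<^sub>M M2) g (E k) = c k * of_real ((nm (M2 \<Otimes>\<^sub>M M2) (E k))\<^sup>2)" for k
  proof (rule LIMSEQ_unique)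
    show "(\<lambda>N. ip (M2 \<Otimes>\<^sub>M M2) (G N) (E k)) \<longlonglongrightarrow> ip (M2 \<Otimes>\<^sub>M M2) g (E k)"
      by (rule tendsto_ip[OF G orthosys_l2[OF E] g orthosys_l2[OF E] glim]) (simp add: nm_def)
    have "\<forall>\<^sub>F N in sequentially. k \<in> I N"
      by (rule eventually_sequentiallyI[of "Suc (max (fst k) (snd k))"]) (cases k, auto simp: I_def)
    then have "\<forall>\<^sub>F N in sequentially. ip (M2 \<Otimes>\<^sub>M M2) (G N) (E k) = c k * of_real ((nm (M2 \<Otimes>\<^sub>M M2) (E k))\<^sup>2)"
      unfolding G_def[abs_def] by eventually_elim (subst nm_lincomb_power2(2)[OF orthosys_l2[OF E] _ I(1)], rule orthosys_orth[OF E], simp_all)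
    then show "(\<lambda>N. ip (M2 \<Otimes>\<^sub>M M2) (G N) (E k)) \<longlonglongrightarrow> c k * of_real ((nm (M2 \<Otimes>\<^sub>M M2) (E k))\<^sup>2)"
      by (rule tendsto_eventually)
  qed
  moreover have "AE z in M2 \<Otimes>\<^sub>M M2. Q (\<lambda>x. u (x, fst z)) (\<lambda>x. u (x, snd z)) = g z"
  proof -
    have su: "(\<lambda>z. s N z - u z) \<in> l2 (M1 \<Otimes>\<^sub>M M2)" for N by (intro l2_diff s u)
    define D where "D N p = complex_of_real (nm M1 (\<lambda>x. s N (x, p) - u (x, p)))" for N p
    have D2: "D N \<in> l2 M2" "nm M2 (D N) = nm (M1 \<Otimes>\<^sub>M M2) (\<lambda>z. s N z - u z)" for N
    proof -
      have "(\<lambda>p. sqrt ((nm M1 (\<lambda>x. s N (x, p) - u (x, p)))\<^sup>2)) \<in> borel_measurable M2"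
        using borel_measurable_integrable[OF integrable_nm_slice_snd[OF su]] by measurable
      then show "D N \<in> l2 M2"
        unfolding D_def using integrable_nm_slice_snd[OF su, of N] by (intro l2I) auto
      show "nm M2 (D N) = nm (M1 \<Otimes>\<^sub>M M2) (\<lambda>z. s N z - u z)"
        using integral_nm_slice_snd[OF su, of N] by (simp add: nm_def[of M2] D_def)
    qed
    have "(\<lambda>N. nm M2 (\<lambda>p. D N p - 0)) \<longlonglongrightarrow> 0" using s_lim by (simp add: D2)
    \<comment> \<open>The first subsequence makes almost every slice converge, and with it the form
      of two slices; a further one will make \<open>G\<close> converge pointwise to
      \<open>g\<close>.\<close>
    from AE_subseq_nm[OF D2(1) l2_zero this] obtain r
      where r: "strict_mono r" "AE p in M2. (\<lambda>N. D (r N) p) \<longlonglongrightarrow> 0" by blast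
    have "AE p in M2. (\<lambda>x. u (x, p)) \<in> l2 M1 \<and> (\<lambda>N. nm M1 (\<lambda>x. s (r N) (x, p) - u (x, p))) \<longlonglongrightarrow> 0"
      using r(2) l2_slice_snd[OF u]
    proof eventually_elim
      case (elim p)
      then show ?case using tendsto_norm_zero[OF elim(1)] by (simp add: D_def)
    qed
    from M2.AE_pair_both[OF this]
    have Qlim: "AE z in M2 \<Otimes>\<^sub>M M2. (\<lambda>N. G (r N) z) \<longlonglongrightarrow> Q (\<lambda>x. u (x, fst z)) (\<lambda>x. u (x, snd z))"
      unfolding GQ by eventually_elim (auto intro!: sesquilinear_tendsto[OF Q] sl)
    have "(\<lambda>N. nm (M2 \<Otimes>\<^sub>M M2) (\<lambda>z. G (r N) z - g z)) \<longlonglongrightarrow> 0"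
      using LIMSEQ_subseq_LIMSEQ[OF glim r(1)] by (simp add: o_def)
    from AE_subseq_nm[OF G g this] obtain r'
      where r': "strict_mono r'" "AE z in M2 \<Otimes>\<^sub>M M2. (\<lambda>N. G (r (r' N)) z) \<longlonglongrightarrow> g z" by blast
    show ?thesis
      using Qlim r'(2)
    proof eventually_elim
      case (elim z)
      have "(\<lambda>N. G (r (r' N)) z) \<longlonglongrightarrow> Q (\<lambda>x. u (x, fst z)) (\<lambda>x. u (x, snd z))"
        using LIMSEQ_subseq_LIMSEQ[OF elim(1) r'(1)] by (simp add: o_def)
      then show ?case using elim(2) by (rule LIMSEQ_unique)
    qed
  qed
  ultimately show ?thesis
    using g by (intro bexI[of _ g]) (auto simp: E_def c_def dest: spec[of _ "(_, _)"])
qed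

section \<open>Complex measures and their densities\<close>

text \<open>Covers the real and imaginary parts of members of \<open>Mb X\<close> and their
  negatives; the uniform bound \<open>C\<close> is what makes the positive part finite.\<close>

locale bounded_signed_measure =
  fixes X :: "'a::euclidean_space set" and \<nu> :: "'a set \<Rightarrow> real" and C :: real
  assumes sums: "\<And>A :: nat \<Rightarrow> 'a set. range A \<subseteq> sets (borel_on X) \<Longrightarrow> disjoint_family A \<Longrightarrow>
      (\<lambda>i. \<nu> (A i)) sums \<nu> (\<Union>i. A i)"
    and bounded: "\<And>A. A \<in> sets (borel_on X) \<Longrightarrow> \<bar>\<nu> A\<bar> \<le> C"
begin

lemma neg: "bounded_signed_measure X (\<lambda>A. - \<nu> A) C"
  by unfold_locales (use sums bounded in \<open>auto intro: sums_minus\<close>)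

lemma empty: "\<nu> {} = 0"
proof -
  have "(\<lambda>i. \<nu> {}) sums \<nu> {}"
    using sums[of "\<lambda>_. {}"] by (simp add: disjoint_family_on_def)
  then have "(\<lambda>i. \<nu> {}) \<longlonglongrightarrow> 0" by (intro summable_LIMSEQ_zero sums_summable)
  then show ?thesis by (simp add: LIMSEQ_const_iff)
qed

lemma add:
  assumes "A \<in> sets (borel_on X)" "B \<in> sets (borel_on X)" "A \<inter> B = {}"
  shows "\<nu> (A \<union> B) = \<nu> A + \<nu> B"
proof -
  have "(\<lambda>i. \<nu> (binaryset A B i)) sums \<nu> (\<Union>i. binaryset A B i)"
    using assms by (intro sums) (auto simp: range_binaryset_eq disjoint_family_on_def binaryset_def)
  moreover have "(\<lambda>i. \<nu> (binaryset A B i)) sums (\<nu> A + \<nu> B)"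
    by (rule binaryset_sums[where f = \<nu>, OF empty])
  ultimately show ?thesis using sums_unique2 by (simp add: UN_binaryset_eq) blast
qed

text \<open>Negative values are sent to 0 by \<open>ennreal\<close>, which leaves the supremum
  unchanged because the empty set already contributes 0.\<close>

definition "pp A = (SUP B \<in> {B \<in> sets (borel_on X). B \<subseteq> A}. ennreal (\<nu> B))"

lemma le_pp: "B \<in> sets (borel_on X) \<Longrightarrow> B \<subseteq> A \<Longrightarrow> ennreal (\<nu> B) \<le> pp A"
  unfolding pp_def by (rule SUP_upper) simp

lemma pp_le: "pp A \<le> ennreal C"
  unfolding pp_def
proof (rule SUP_least, safe)
  fix B assume "B \<in> sets (borel_on X)"
  then have "\<nu> B \<le> C" using bounded[of B] by simp
  then show "ennreal (\<nu> B) \<le> ennreal C" by (rule ennreal_leI)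
qed

text \<open>The union of competitors for \<open>A\<close> and \<open>B\<close> competes for
  \<open>A \<union> B\<close>; a competitor of negative value is truncated to 0 and simply
  dropped.\<close>

lemma pp_add_le:
  assumes "A \<in> sets (borel_on X)" "B \<in> sets (borel_on X)" "A \<inter> B = {}"
  shows "pp A + pp B \<le> pp (A \<union> B)"
proof -
  have ne: "{B \<in> sets (borel_on X). B \<subseteq> A} \<noteq> {}" for A by blast
  have "ennreal (\<nu> S) + ennreal (\<nu> T) \<le> pp (A \<union> B)"
    if S: "S \<in> sets (borel_on X)" "S \<subseteq> A" and T: "T \<in> sets (borel_on X)" "T \<subseteq> B" for S T
  proof -
    consider "\<nu> S \<le> 0" | "\<nu> T \<le> 0" | "0 \<le> \<nu> S" "0 \<le> \<nu> T" by linarith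
    then show ?thesis
    proof cases
      case 1
      then show ?thesis using le_pp[OF T(1), of "A \<union> B"] T(2) by (simp add: ennreal_neg le_supI2)
    next
      case 2
      then show ?thesis using le_pp[OF S(1), of "A \<union> B"] S(2) by (simp add: ennreal_neg le_supI1)
    next
      case 3
      have "\<nu> (S \<union> T) = \<nu> S + \<nu> T" using S T assms by (intro add) auto
      then show ?thesis using le_pp[of "S \<union> T" "A \<union> B"] S T 3 by (auto simp flip: ennreal_plus)
    qed
  qed
  then have "ennreal (\<nu> S) + pp B \<le> pp (A \<union> B)" if "S \<in> sets (borel_on X)" "S \<subseteq> A" for S
    unfolding pp_def[of B] ennreal_SUP_add_right[OF ne] using that by (intro SUP_least) auto
  then show ?thesis
    unfolding pp_def[of A] ennreal_SUP_add_left[OF ne, symmetric] by (intro SUP_least) auto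
qed

text \<open>Superadditivity on finite unions gives one inequality; for the other a competitor
  \<open>B\<close> is cut into the pieces \<open>B \<inter> A i\<close>, over which the signed
  measure adds up.\<close>

lemma countably_additive_pp: "countably_additive (sets (borel_on X)) pp"
proof (rule countably_additiveI)
  fix A :: "nat \<Rightarrow> 'a set"
  assume A: "range A \<subseteq> sets (borel_on X)" "disjoint_family A"
  have part: "(\<Sum>i<n. pp (A i)) \<le> pp (\<Union>i<n. A i)" for n
  proof (induction n)
    case (Suc n)
    have "A i \<inter> A n = {}" if "i < n" for i using A(2) that by (simp add: disjoint_family_on_def)
    then have "(\<Union>i<n. A i) \<inter> A n = {}" by blast
    moreover have "(\<Union>i<n. A i) \<in> sets (borel_on X)" using A(1) by auto
    ultimately have "pp (\<Union>i<n. A i) + pp (A n) \<le> pp ((\<Union>i<n. A i) \<union> A n)"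
      using A(1) by (intro pp_add_le) auto
    from order_trans[OF add_right_mono[OF Suc] this] show ?case
      by (simp add: lessThan_Suc Un_commute add.commute)
  qed (simp add: pp_def)
  show "(\<Sum>i. pp (A i)) = pp (\<Union>i. A i)"
  proof (rule antisym)
    show "(\<Sum>i. pp (A i)) \<le> pp (\<Union>i. A i)"
    proof (rule suminf_le_const)
      fix n
      have "pp (\<Union>i<n. A i) \<le> pp (\<Union>i. A i)"
        unfolding pp_def by (rule SUP_subset_mono) auto
      then show "(\<Sum>i<n. pp (A i)) \<le> pp (\<Union>i. A i)" using part[of n] by (rule order_trans[rotated])
    qed simp
    show "pp (\<Union>i. A i) \<le> (\<Sum>i. pp (A i))"
      unfolding pp_def[of "\<Union>i. A i"]
    proof (rule SUP_least, safe)
      fix B assume B: "B \<in> sets (borel_on X)" "B \<subseteq> (\<Union>i. A i)"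
      have BA: "B \<inter> A i \<in> sets (borel_on X)" for i using A(1) B(1) by auto
      have "(\<lambda>i. \<nu> (B \<inter> A i)) sums \<nu> (\<Union>i. B \<inter> A i)"
        using A(2) BA by (intro sums) (auto simp: disjoint_family_on_def)
      moreover have "(\<Union>i. B \<inter> A i) = B" using B(2) by auto
      ultimately have s: "(\<lambda>n. \<Sum>i<n. \<nu> (B \<inter> A i)) \<longlonglongrightarrow> \<nu> B" by (simp add: sums_def)
      show "ennreal (\<nu> B) \<le> (\<Sum>i. pp (A i))"
      proof (rule LIMSEQ_le_const2[OF tendsto_ennrealI[OF s]], intro exI allI impI)
        fix n
        have "ennreal (\<Sum>i<n. \<nu> (B \<inter> A i)) \<le> (\<Sum>i<n. ennreal (\<nu> (B \<inter> A i)))"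
        proof (induction n)
          case (Suc n)
          have "ennreal (a + b) \<le> ennreal a + ennreal b" for a b
            by (cases "0 \<le> a"; cases "0 \<le> b") (auto simp: ennreal_neg ennreal_leI ennreal_plus[symmetric] simp del: ennreal_plus)
          from order_trans[OF this add_right_mono[OF Suc]] show ?case by simp
        qed simp
        also have "\<dots> \<le> (\<Sum>i<n. pp (A i))" by (intro sum_mono le_pp BA) auto
        also have "\<dots> \<le> (\<Sum>i. pp (A i))" by (intro sum_le_suminf) auto
        finally show "ennreal (\<Sum>i<n. \<nu> (B \<inter> A i)) \<le> (\<Sum>i. pp (A i))" .
      qed
    qed
  qed
qed

lemma
  shows sets_positive_part: "sets (positive_part X \<nu>) = sets (borel_on X)"
    and emeasure_positive_part: "A \<in> sets (borel_on X) \<Longrightarrow> emeasure (positive_part X \<nu>) A = pp A"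
    and finite_positive_part: "finite_measure (positive_part X \<nu>)"
proof -
  have sp: "space (borel_on X) = X" by (simp add: borel_on_def space_restrict_space)
  have sa: "sigma_algebra X (sets (borel_on X))"
    using sets.sigma_algebra_axioms[of "borel_on X"] by (simp add: sp)
  have pp: "positive_part X \<nu> = measure_of X (sets (borel_on X)) pp"
    by (simp add: positive_part_def pp_def[abs_def])
  show s: "sets (positive_part X \<nu>) = sets (borel_on X)"
    unfolding pp using sigma_algebra.sigma_sets_eq[OF sa] sigma_algebra.axioms(1)[OF sa]
    by (subst sets_measure_of) (use sets.sets_into_space[of _ "borel_on X"] sp in auto)
  have p: "space (positive_part X \<nu>) = X"
    unfolding pp by (rule space_measure_of) (use sets.sets_into_space[of _ "borel_on X"] sp in auto)
  show e: "emeasure (positive_part X \<nu>) A = pp A" if "A \<in> sets (borel_on X)" for A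
    unfolding pp
  proof (rule emeasure_measure_of_sigma[OF sa _ countably_additive_pp that])
    have "pp {} = 0" using empty by (simp add: pp_def)
    then show "positive (sets (borel_on X)) pp" by (simp add: positive_def)
  qed
  show "finite_measure (positive_part X \<nu>)"
    using pp_le[of X] e[of X] sets.top[of "borel_on X"] by (intro finite_measureI) (auto simp: p sp top_unique)
qed

end

lemma Mb_signed:
  assumes \<mu>: "\<mu> \<in> Mb X"
  shows "bounded_signed_measure X (\<lambda>A. Re (\<mu> A)) (enn2real (total_variation X \<mu>))"
    and "bounded_signed_measure X (\<lambda>A. Im (\<mu> A)) (enn2real (total_variation X \<mu>))"
proof -
  have s: "(\<lambda>i. \<mu> (A i)) sums \<mu> (\<Union>i. A i)" if "range A \<subseteq> sets (borel_on X)" "disjoint_family A" for A :: "nat \<Rightarrow> 'a set"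
    using \<mu> that by (auto simp: Mb_def)
  have fin: "total_variation X \<mu> < \<infinity>" using \<mu> by (auto simp: Mb_def)
  have b: "norm (\<mu> A) \<le> enn2real (total_variation X \<mu>)" if "A \<in> sets (borel_on X)" for A
  proof -
    have "(\<Sum>A\<in>{A}. ennreal (norm (\<mu> A))) \<le> total_variation X \<mu>"
      unfolding total_variation_def by (rule SUP_upper) (use that in auto)
    then have "ennreal (norm (\<mu> A)) \<le> ennreal (enn2real (total_variation X \<mu>))"
      using fin by simp
    then show ?thesis by (simp add: ennreal_le_iff)
  qed
  show "bounded_signed_measure X (\<lambda>A. Re (\<mu> A)) (enn2real (total_variation X \<mu>))"
  proof
    fix A :: "nat \<Rightarrow> 'a set" assume "range A \<subseteq> sets (borel_on X)" "disjoint_family A"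
    from s[OF this] show "(\<lambda>i. Re (\<mu> (A i))) sums Re (\<mu> (\<Union>i. A i))" by (rule sums_Re)
  next
    fix A assume "A \<in> sets (borel_on X)"
    from b[OF this] show "\<bar>Re (\<mu> A)\<bar> \<le> enn2real (total_variation X \<mu>)" by (rule order_trans[OF abs_Re_le_cmod])
  qed
  show "bounded_signed_measure X (\<lambda>A. Im (\<mu> A)) (enn2real (total_variation X \<mu>))"
  proof
    fix A :: "nat \<Rightarrow> 'a set" assume "range A \<subseteq> sets (borel_on X)" "disjoint_family A"
    from s[OF this] show "(\<lambda>i. Im (\<mu> (A i))) sums Im (\<mu> (\<Union>i. A i))" by (rule sums_Im)
  next
    fix A assume "A \<in> sets (borel_on X)"
    from b[OF this] show "\<bar>Im (\<mu> A)\<bar> \<le> enn2real (total_variation X \<mu>)" by (rule order_trans[OF abs_Im_le_cmod])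
  qed
qed

text \<open>The measures are extended by zero to the whole space, where Borel measurability and
  regularity are readily available.\<close>

lemma integral_extend:
  fixes f :: "'a::euclidean_space \<Rightarrow> complex"
  assumes X: "X \<in> sets borel" and s: "sets P = sets (borel_on X)"
    and f: "(\<lambda>x. indicator X x *\<^sub>R f x) \<in> borel_measurable borel"
  shows "(\<integral>x. f x \<partial>P) = (\<integral>x. indicator X x *\<^sub>R f x \<partial>distr P borel (\<lambda>x. x))"
proof -
  have [measurable]: "(\<lambda>x. x) \<in> P \<rightarrow>\<^sub>M borel"
    by (subst measurable_cong_sets[OF s refl]) (simp add: borel_on_def measurable_restrict_space1)
  have "space P = X" using sets_eq_imp_space_eq[OF s] by (simp add: borel_on_def space_restrict_space)
  then have "(\<integral>x. f x \<partial>P) = (\<integral>x. indicator X x *\<^sub>R f x \<partial>P)"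
    by (intro Bochner_Integration.integral_cong) auto
  also have "\<dots> = (\<integral>x. indicator X x *\<^sub>R f x \<partial>distr P borel (\<lambda>x. x))"
    by (rule integral_distr[symmetric]) (use f in auto)
  finally show ?thesis .
qed

text \<open>A convergent weighted sum of all \<open>P n\<close> dominates each of them, and
  Radon-Nikodym supplies the densities.\<close>

lemma finite_borel_dominating:
  fixes P :: "nat \<Rightarrow> 'a::topological_space measure"
  assumes fin: "\<And>n. finite_measure (P n)" and s: "\<And>n. sets (P n) = sets borel"
  shows "\<exists>\<rho>. finite_measure \<rho> \<and> sets \<rho> = sets borel \<and>
    (\<exists>d. (\<forall>n. d n \<in> borel_measurable \<rho> \<and> (\<forall>x. 0 \<le> d n x) \<and> integrable \<rho> (d n) \<and> P n = density \<rho> (\<lambda>x. ennreal (d n x))))"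
proof -
  \<comment> \<open>The weights give the n-th summand total mass at most \<open>(1/2) ^ n\<close>;
    adding 1 keeps the denominator positive.\<close>
  define w where "w n = (1/2) ^ n / (1 + measure (P n) (space (P n)))" for n
  have w: "0 < w n" for n by (auto simp: w_def intro!: divide_pos_pos add_pos_nonneg)
  \<comment> \<open>The series is written as an integral over counting measure, so that countable
    additivity is an exchange of sum and integral.\<close>
  define m where "m A = (\<integral>\<^sup>+n. ennreal (w n) * emeasure (P n) A \<partial>count_space UNIV)" for A
  define \<rho> where "\<rho> = measure_of UNIV (sets (borel :: 'a measure)) m"
  have s\<rho>: "sets \<rho> = sets borel"
    unfolding \<rho>_def using sets.sets_measure_of_eq[of "borel :: 'a measure" m] by (simp only: space_borel)
  have sp: "space \<rho> = UNIV" by (simp add: \<rho>_def space_measure_of_conv)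
  have em: "emeasure \<rho> A = m A" if "A \<in> sets borel" for A
    unfolding \<rho>_def
  proof (rule emeasure_measure_of_sigma[OF _ _ _ that])
    show "sigma_algebra UNIV (sets (borel :: 'a measure))"
      using sets.sigma_algebra_axioms[of "borel :: 'a measure"] by simp
    show "positive (sets borel) m" by (simp add: positive_def m_def)
    show "countably_additive (sets borel) m"
    proof (rule countably_additiveI)
      fix A :: "nat \<Rightarrow> 'a set" assume A: "range A \<subseteq> sets borel" "disjoint_family A"
      have "(\<Sum>i. m (A i)) = (\<integral>\<^sup>+n. (\<Sum>i. ennreal (w n) * emeasure (P n) (A i)) \<partial>count_space UNIV)"
        unfolding m_def by (rule nn_integral_suminf[symmetric]) simp
      also have "\<dots> = (\<integral>\<^sup>+n. ennreal (w n) * emeasure (P n) (\<Union>i. A i) \<partial>count_space UNIV)"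
        using A by (intro nn_integral_cong) (simp add: ennreal_suminf_cmult suminf_emeasure s)
      finally show "(\<Sum>i. m (A i)) = m (\<Union>i. A i)" by (simp add: m_def)
    qed
  qed
  have "m UNIV \<le> (\<Sum>n. ennreal ((1/2) ^ n))"
    unfolding m_def nn_integral_count_space_nat
  proof (intro suminf_le)
    fix n
    interpret finite_measure "P n" by (rule fin)
    have "space (P n) = UNIV" using sets_eq_imp_space_eq[OF s[of n]] by simp
    then have "ennreal (w n) * emeasure (P n) UNIV = ennreal (w n * measure (P n) (space (P n)))"
      using w[of n] by (simp add: emeasure_eq_measure ennreal_mult)
    also have "w n * measure (P n) (space (P n)) \<le> (1/2) ^ n"
      by (simp add: w_def divide_le_eq mult_left_mono add_pos_nonneg)
    finally show "ennreal (w n) * emeasure (P n) UNIV \<le> ennreal ((1/2) ^ n)"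
      by (simp add: ennreal_leI)
  qed auto
  also have "\<dots> < \<infinity>" by (subst suminf_ennreal2) (auto simp: summable_geometric)
  finally have fm: "finite_measure \<rho>" by (intro finite_measureI) (simp add: em sp less_top)
  interpret finite_measure \<rho> by (rule fm)
  have "\<exists>d. d \<in> borel_measurable \<rho> \<and> (\<forall>x. 0 \<le> d x) \<and> integrable \<rho> d \<and> P n = density \<rho> (\<lambda>x. ennreal (d x))" for n
  proof -
    have "absolutely_continuous \<rho> (P n)"
      unfolding absolutely_continuous_def
    proof
      fix A assume "A \<in> null_sets \<rho>"
      then have A: "A \<in> sets borel" "m A = 0" by (auto simp: null_sets_def s\<rho> em)
      have "ennreal (w n) * emeasure (P n) A \<le> m A"
        unfolding m_def by (rule nn_integral_ge_point) simp
      then show "A \<in> null_sets (P n)" using A w[of n] by (auto simp: null_sets_def s ennreal_eq_0_iff)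
    qed
    from Radon_Nikodym[OF this] obtain f where f: "f \<in> borel_measurable \<rho>" "density \<rho> f = P n"
      by (auto simp: s s\<rho>)
    interpret Pn: finite_measure "P n" by (rule fin)
    have "(\<integral>\<^sup>+x. f x \<partial>\<rho>) = emeasure (P n) UNIV"
      using f(1) sp by (subst f(2)[symmetric], subst emeasure_density) (auto simp: s\<rho>)
    then have "(\<integral>\<^sup>+x. f x \<partial>\<rho>) \<noteq> \<infinity>" by (simp add: Pn.emeasure_eq_measure)
    then have "AE x in \<rho>. f x \<noteq> \<infinity>" by (rule nn_integral_PInf_AE[OF f(1)])
    then have ae: "AE x in \<rho>. ennreal (enn2real (f x)) = f x" by eventually_elim (simp add: less_top)
    have "integrable \<rho> (\<lambda>x. enn2real (f x))"
    proof (rule integrableI_nonneg)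
      have "(\<integral>\<^sup>+x. ennreal (enn2real (f x)) \<partial>\<rho>) = (\<integral>\<^sup>+x. f x \<partial>\<rho>)"
        by (rule nn_integral_cong_AE[OF ae])
      then show "(\<integral>\<^sup>+x. ennreal (enn2real (f x)) \<partial>\<rho>) < \<infinity>"
        using \<open>(\<integral>\<^sup>+x. f x \<partial>\<rho>) \<noteq> \<infinity>\<close> by (simp add: less_top)
    qed (use f(1) in auto)
    moreover have "density \<rho> (\<lambda>x. ennreal (enn2real (f x))) = P n"
      unfolding f(2)[symmetric] by (rule density_cong) (use f(1) ae in auto)
    ultimately show ?thesis
      using f(1) by (intro exI[of _ "\<lambda>x. enn2real (f x)"]) auto
  qed
  then obtain d where "\<And>n. d n \<in> borel_measurable \<rho> \<and> (\<forall>x. 0 \<le> d n x) \<and> integrable \<rho> (d n) \<and> P n = density \<rho> (\<lambda>x. ennreal (d n x))"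
    by metis
  then show ?thesis using fm s\<rho> by blast
qed

text \<open>One dominating measure is taken because positivity will be stated for the matrix of
  densities at each point. The four Jordan parts of \<open>\<mu> n\<close> get the indices
  \<open>4 * n\<close> to \<open>4 * n + 3\<close>.\<close>

theorem Mb_common_density:
  fixes \<mu> :: "nat \<Rightarrow> 'a::euclidean_space set \<Rightarrow> complex"
  assumes X: "X \<in> sets borel" and \<mu>: "\<And>n. \<mu> n \<in> Mb X"
  shows "\<exists>\<rho> g. finite_measure \<rho> \<and> sets \<rho> = sets borel \<and> (\<forall>n. integrable \<rho> (g n)) \<and>
    (\<forall>n f B. (\<lambda>x. indicator X x *\<^sub>R f x) \<in> borel_measurable borel \<longrightarrow> (\<forall>x\<in>X. norm (f x) \<le> B) \<longrightarrow>
      complex_integral X (\<mu> n) f = (\<integral>x. (indicator X x *\<^sub>R f x) * g n x \<partial>\<rho>))"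
proof -
  define part where "part n k A = (if k = 0 then Re (\<mu> n A) else if k = 1 then - Re (\<mu> n A)
     else if k = 2 then Im (\<mu> n A) else - Im (\<mu> n A))" for n k :: nat and A
  define Q where "Q n k = positive_part X (part n k)" for n k
  have bsm: "\<exists>C. bounded_signed_measure X (part n k) C" for n k
    using Mb_signed[OF \<mu>[of n]] bounded_signed_measure.neg[OF Mb_signed(1)[OF \<mu>[of n]]]
      bounded_signed_measure.neg[OF Mb_signed(2)[OF \<mu>[of n]]]
    unfolding part_def by (cases "k = 0"; cases "k = 1"; cases "k = 2") auto
  have sQ: "sets (Q n k) = sets (borel_on X)" and fQ: "finite_measure (Q n k)" for n k
    unfolding Q_def using bsm[of n k] bounded_signed_measure.sets_positive_part bounded_signed_measure.finite_positive_part by blast+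
  have id: "(\<lambda>x. x) \<in> Q n k \<rightarrow>\<^sub>M borel" for n k
    by (subst measurable_cong_sets[OF sQ refl]) (simp add: borel_on_def measurable_restrict_space1)
  define R where "R j = distr (Q (j div 4) (j mod 4)) borel (\<lambda>x. x)" for j
  have "finite_measure (R j)" "sets (R j) = sets borel" for j
    unfolding R_def using finite_measure.finite_measure_distr[OF fQ id] by auto
  from finite_borel_dominating[of R, OF this] obtain \<rho> d where \<rho>: "finite_measure \<rho>" "sets \<rho> = sets borel"
    and d: "\<And>j. d j \<in> borel_measurable \<rho>" "\<And>j x. 0 \<le> d j x" "\<And>j. integrable \<rho> (d j)" "\<And>j. R j = density \<rho> (\<lambda>x. ennreal (d j x))"
    by blast
  define g where "g n x = Complex (d (4 * n) x - d (4 * n + 1) x) (d (4 * n + 2) x - d (4 * n + 3) x)" for n x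
  have g: "integrable \<rho> (g n)" for n
    unfolding g_def Complex_eq by (intro Bochner_Integration.integrable_add integrable_of_real integrable_mult_right Bochner_Integration.integrable_diff d)
  have "complex_integral X (\<mu> n) f = (\<integral>x. (indicator X x *\<^sub>R f x) * g n x \<partial>\<rho>)"
    if m: "(\<lambda>x. indicator X x *\<^sub>R f x) \<in> borel_measurable borel" and B: "\<forall>x\<in>X. norm (f x) \<le> B" for n f B
  proof -
    let ?F = "\<lambda>x. indicator X x *\<^sub>R f x"
    have [measurable]: "?F \<in> borel_measurable \<rho>" using m by (simp add: measurable_cong_sets[OF \<rho>(2) refl])
    have I: "integrable \<rho> (\<lambda>x. d j x *\<^sub>R ?F x)" for j
    proof (rule Bochner_Integration.integrable_bound)
      show "integrable \<rho> (\<lambda>x. d j x * \<bar>B\<bar>)" using d(3) by simp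
      show "AE x in \<rho>. norm (d j x *\<^sub>R ?F x) \<le> norm (d j x * \<bar>B\<bar>)"
        using B d(2) by (intro AE_I2) (auto simp: indicator_def abs_mult intro!: mult_left_mono order_trans[OF _ abs_ge_self])
    qed (use d(1) in measurable)
    have J: "integral\<^sup>L (Q n k) f = (\<integral>x. d (4 * n + k) x *\<^sub>R ?F x \<partial>\<rho>)" if "k < 4" for k
    proof -
      have "integral\<^sup>L (Q n k) f = (\<integral>x. ?F x \<partial>R (4 * n + k))"
        unfolding R_def using that integral_extend[OF X sQ m, of n k] by simp
      also have "\<dots> = (\<integral>x. d (4 * n + k) x *\<^sub>R ?F x \<partial>\<rho>)"
        unfolding d(4) by (rule integral_density) (use d in auto)
      finally show ?thesis .
    qed
    have "complex_integral X (\<mu> n) f = integral\<^sup>L (Q n 0) f - integral\<^sup>L (Q n 1) f + \<i> * (integral\<^sup>L (Q n 2) f - integral\<^sup>L (Q n 3) f)"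
      by (simp add: complex_integral_def Q_def part_def[abs_def])
    also have "\<dots> = (\<integral>x. (d (4 * n) x *\<^sub>R ?F x - d (4 * n + 1) x *\<^sub>R ?F x) + \<i> * (d (4 * n + 2) x *\<^sub>R ?F x - d (4 * n + 3) x *\<^sub>R ?F x) \<partial>\<rho>)"
    proof -
      have "integral\<^sup>L (Q n 0) f = (\<integral>x. d (4 * n) x *\<^sub>R ?F x \<partial>\<rho>)" using J[of 0] by simp
      moreover have "integral\<^sup>L (Q n 1) f = (\<integral>x. d (4 * n + 1) x *\<^sub>R ?F x \<partial>\<rho>)" using J[of 1] by simp
      moreover have "integral\<^sup>L (Q n 2) f = (\<integral>x. d (4 * n + 2) x *\<^sub>R ?F x \<partial>\<rho>)" using J[of 2] by simp
      moreover have "integral\<^sup>L (Q n 3) f = (\<integral>x. d (4 * n + 3) x *\<^sub>R ?F x \<partial>\<rho>)" using J[of 3] by simp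
      ultimately show ?thesis
        by (simp only: Bochner_Integration.integral_add[OF Bochner_Integration.integrable_diff[OF I I] integrable_mult_right[OF Bochner_Integration.integrable_diff[OF I I]]]
          integral_mult_right_zero Bochner_Integration.integral_diff[OF I I])
    qed
    also have "\<dots> = (\<integral>x. ?F x * g n x \<partial>\<rho>)"
      by (intro Bochner_Integration.integral_cong refl)
        (simp add: g_def Complex_eq scaleR_conv_of_real algebra_simps)
    finally show ?thesis .
  qed
  then show ?thesis using \<rho> g by blast
qed

section \<open>Measures with a density\<close>

context
  fixes X :: "'a::euclidean_space set" and \<nu> :: "'a measure"
  assumes X: "X \<in> sets borel" and fin: "finite_measure \<nu>" and s\<nu>: "sets \<nu> = sets borel"
begin

lemma sets_borel_on_iff: "A \<in> sets (borel_on X) \<longleftrightarrow> A \<in> sets borel \<and> A \<subseteq> X"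
  unfolding borel_on_def using X by (subst sets_restrict_space_iff) auto

lemma density_sums:
  fixes f :: "'a \<Rightarrow> 'b::{banach, second_countable_topology}"
  assumes f: "integrable \<nu> f" and A: "\<And>i::nat. A i \<in> sets borel" "disjoint_family A"
  shows "(\<lambda>i. \<integral>x. indicator (A i) x *\<^sub>R f x \<partial>\<nu>) sums (\<integral>x. indicator (\<Union>i. A i) x *\<^sub>R f x \<partial>\<nu>)"
proof -
  have int: "integrable \<nu> (\<lambda>x. indicator (A i) x *\<^sub>R f x)" for i
    by (rule integrable_mult_indicator[OF _ f]) (simp add: s\<nu> A)
  have eq: "(\<Sum>i<n. indicator (A i) x *\<^sub>R f x) = indicator (\<Union>i<n. A i) x *\<^sub>R f x" for n x
  proof -
    have "disjoint_family_on A {..<n}" using A(2) by (auto simp: disjoint_family_on_def)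
    then show ?thesis
      by (simp add: indicator_UN_disjoint scaleR_left.sum[symmetric])
  qed
  have "(\<lambda>n. \<integral>x. indicator (\<Union>i<n. A i) x *\<^sub>R f x \<partial>\<nu>) \<longlonglongrightarrow> (\<integral>x. indicator (\<Union>i. A i) x *\<^sub>R f x \<partial>\<nu>)"
  proof (rule integral_dominated_convergence[where w = "\<lambda>x. norm (f x)"])
    show "AE x in \<nu>. (\<lambda>n. indicator (\<Union>i<n. A i) x *\<^sub>R f x) \<longlonglongrightarrow> indicator (\<Union>i. A i) x *\<^sub>R f x"
      by (intro AE_I2 tendsto_scaleR LIMSEQ_indicator_UN tendsto_const)
    show "(\<lambda>x. indicator (\<Union>i. A i) x *\<^sub>R f x) \<in> borel_measurable \<nu>"
      by (rule borel_measurable_integrable[OF integrable_mult_indicator[OF _ f]]) (use A in \<open>auto simp: s\<nu>\<close>)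
    show "(\<lambda>x. indicator (\<Union>i<n. A i) x *\<^sub>R f x) \<in> borel_measurable \<nu>" for n
      by (rule borel_measurable_integrable[OF integrable_mult_indicator[OF _ f]]) (use A in \<open>auto simp: s\<nu>\<close>)
  qed (use f in \<open>auto simp: indicator_def\<close>)
  then show ?thesis
    unfolding sums_def Bochner_Integration.integral_sum[OF int, symmetric] eq .
qed

text \<open>This is inner regularity of the finite Borel measure with density
  \<open>norm (f x)\<close>, which bounds the integrals over subsets of
  \<open>A - K\<close>.\<close>

lemma density_compact_approx:
  fixes f :: "'a \<Rightarrow> 'b::{banach, second_countable_topology}"
  assumes f: "integrable \<nu> f" and A: "A \<in> sets borel" and "0 < e"
  shows "\<exists>K. compact K \<and> K \<subseteq> A \<and> (\<forall>B\<in>sets borel. B \<subseteq> A - K \<longrightarrow> norm (\<integral>x. indicator B x *\<^sub>R f x \<partial>\<nu>) < e)"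
proof -
  define M where "M = density \<nu> (\<lambda>x. ennreal (norm (f x)))"
  have fm: "f \<in> borel_measurable \<nu>" using f by simp
  have sM: "sets M = sets borel" by (simp add: M_def s\<nu>)
  have eM: "emeasure M S = ennreal (\<integral>x. indicator S x *\<^sub>R norm (f x) \<partial>\<nu>)" if "S \<in> sets borel" for S
  proof -
    have "emeasure M S = (\<integral>\<^sup>+x. ennreal (indicator S x *\<^sub>R norm (f x)) \<partial>\<nu>)"
      unfolding M_def using fm that
      by (subst emeasure_density) (auto simp: s\<nu> indicator_def intro!: nn_integral_cong)
    also have "\<dots> = ennreal (\<integral>x. indicator S x *\<^sub>R norm (f x) \<partial>\<nu>)"
      using f that by (intro nn_integral_eq_integral integrable_mult_indicator integrable_norm) (auto simp: s\<nu>)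
    finally show ?thesis .
  qed
  have "space M = UNIV" using sets_eq_imp_space_eq[OF sM] by simp
  then have finM: "finite_measure M" using eM[of UNIV] by (intro finite_measureI) simp
  interpret M: finite_measure M by (rule finM)
  have S: "emeasure M A = (SUP K \<in> {K. K \<subseteq> A \<and> compact K}. emeasure M K)"
    by (rule inner_regular[OF sM _ A]) (use M.emeasure_finite in auto)
  obtain K where K: "K \<subseteq> A" "compact K" "measure M A < measure M K + e"
  \<comment> \<open>If the measure of \<open>A\<close> is below \<open>e\<close>, the empty set
    serves; otherwise \<open>measure M A - e\<close> is nonnegative and can be compared in
    \<open>ennreal\<close>.\<close>
  proof (cases "measure M A < e")
    case True
    then show ?thesis by (intro that[of "{}"]) auto
  next
    case False
    then have "ennreal (measure M A - e) < emeasure M A"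
      using \<open>0 < e\<close> unfolding M.emeasure_eq_measure by (intro ennreal_lessI) auto
    then obtain K where K: "K \<subseteq> A" "compact K" "ennreal (measure M A - e) < emeasure M K"
      unfolding S by (auto simp: less_SUP_iff)
    have "measure M A - e < measure M K"
      using K(3) False unfolding M.emeasure_eq_measure by (subst (asm) ennreal_less_iff) auto
    then show ?thesis using K(1,2) by (intro that[of K]) auto
  qed
  have Kb: "K \<in> sets borel" using K(2) by (simp add: borel_compact)
  have "norm (\<integral>x. indicator B x *\<^sub>R f x \<partial>\<nu>) < e" if B: "B \<in> sets borel" "B \<subseteq> A - K" for B
  proof -
    have "norm (\<integral>x. indicator B x *\<^sub>R f x \<partial>\<nu>) \<le> (\<integral>x. norm (indicator B x *\<^sub>R f x) \<partial>\<nu>)"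
      by (rule integral_norm_bound)
    also have "\<dots> = (\<integral>x. indicator B x *\<^sub>R norm (f x) \<partial>\<nu>)" by simp
    also have "\<dots> = measure M B"
      unfolding measure_def eM[OF B(1)] by (subst enn2real_ennreal) (auto intro!: integral_nonneg_AE)
    also have "\<dots> \<le> measure M (A - K)"
      using B A Kb by (intro M.finite_measure_mono) (auto simp: sM)
    also have "\<dots> = measure M A - measure M K"
      using A Kb K(1) by (intro M.finite_measure_Diff) (auto simp: sM)
    also have "\<dots> < e"
      using K(3) by simp
    finally show ?thesis .
  qed
  then show ?thesis using K by blast
qed

text \<open>Disjoint sets pick up disjoint portions of the integral of the modulus.\<close>

lemma total_variation_density_le:
  fixes f :: "'a \<Rightarrow> complex"
  assumes f: "integrable \<nu> f"
  shows "total_variation X (\<lambda>A. \<integral>x. indicator A x *\<^sub>R f x \<partial>\<nu>) \<le> ennreal (\<integral>x. norm (f x) \<partial>\<nu>)"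
  unfolding total_variation_def
proof (rule SUP_least, safe)
  fix D assume D: "finite D" "disjoint D" "D \<subseteq> sets (borel_on X)"
  have Ds: "A \<in> sets \<nu>" if "A \<in> D" for A using D(3) that sets_borel_on_iff s\<nu> by auto
  have int: "integrable \<nu> (\<lambda>x. indicator A x *\<^sub>R norm (f x))" if "A \<in> D" for A
    using f that by (intro integrable_mult_indicator Ds integrable_norm)
  have "(\<Sum>A\<in>D. ennreal (norm (\<integral>x. indicator A x *\<^sub>R f x \<partial>\<nu>))) = ennreal (\<Sum>A\<in>D. norm (\<integral>x. indicator A x *\<^sub>R f x \<partial>\<nu>))"
    by (rule sum_ennreal) simp
  also have "\<dots> \<le> ennreal (\<Sum>A\<in>D. \<integral>x. indicator A x *\<^sub>R norm (f x) \<partial>\<nu>)"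
    by (intro ennreal_leI sum_mono order_trans[OF integral_norm_bound]) simp
  also have "(\<Sum>A\<in>D. \<integral>x. indicator A x *\<^sub>R norm (f x) \<partial>\<nu>) = (\<integral>x. (\<Sum>A\<in>D. indicator A x *\<^sub>R norm (f x)) \<partial>\<nu>)"
    by (rule Bochner_Integration.integral_sum[symmetric]) (rule int)
  also have "\<dots> \<le> (\<integral>x. norm (f x) \<partial>\<nu>)"
  proof (rule integral_mono)
    fix x
    have "(\<Sum>A\<in>D. indicator A x *\<^sub>R norm (f x)) = indicator (\<Union>A\<in>D. A) x *\<^sub>R norm (f x)"
      using D(1,2) by (subst indicator_UN_disjoint) (auto simp: disjoint_family_on_def disjoint_def scaleR_left.sum[symmetric] sum_distrib_right)
    then show "(\<Sum>A\<in>D. indicator A x *\<^sub>R norm (f x)) \<le> norm (f x)" by (simp add: indicator_def)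
  qed (use f int in auto)
  finally show "(\<Sum>A\<in>D. ennreal (norm (\<integral>x. indicator A x *\<^sub>R f x \<partial>\<nu>))) \<le> ennreal (\<integral>x. norm (f x) \<partial>\<nu>)"
    by (simp add: ennreal_leI)
qed

lemma density_in_Mb:
  fixes f :: "'a \<Rightarrow> complex"
  assumes f: "integrable \<nu> f"
  shows "(\<lambda>A. \<integral>x. indicator A x *\<^sub>R f x \<partial>\<nu>) \<in> Mb X"
proof -
  have "\<exists>K. compact K \<and> K \<subseteq> A \<and> (\<forall>B\<in>sets (borel_on X). B \<subseteq> A - K \<longrightarrow> norm (\<integral>x. indicator B x *\<^sub>R f x \<partial>\<nu>) < e)"
    if "A \<in> sets (borel_on X)" "0 < e" for A e
  proof -
    have "A \<in> sets borel" using that(1) sets_borel_on_iff by auto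
    from density_compact_approx[OF f this that(2)] obtain K where "compact K" "K \<subseteq> A"
      "\<forall>B\<in>sets borel. B \<subseteq> A - K \<longrightarrow> norm (\<integral>x. indicator B x *\<^sub>R f x \<partial>\<nu>) < e" by blast
    then show ?thesis using sets_borel_on_iff by (intro exI[of _ K]) auto
  qed
  moreover have "(\<lambda>i. \<integral>x. indicator (A i) x *\<^sub>R f x \<partial>\<nu>) sums (\<integral>x. indicator (\<Union>i. A i) x *\<^sub>R f x \<partial>\<nu>)"
    if "range A \<subseteq> sets (borel_on X)" "disjoint_family A" for A :: "nat \<Rightarrow> 'a set"
    using that sets_borel_on_iff by (intro density_sums[OF f]) auto
  moreover have "total_variation X (\<lambda>A. \<integral>x. indicator A x *\<^sub>R f x \<partial>\<nu>) < \<infinity>"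
    using le_less_trans[OF total_variation_density_le[OF f]] by simp
  ultimately show ?thesis unfolding Mb_def by blast
qed

text \<open>Hahn decomposition for a density: the supremum over subsets of \<open>A\<close> is
  attained at the part of \<open>A\<close> where \<open>h\<close> is nonnegative.\<close>

lemma integral_positive_part_density:
  fixes h :: "'a \<Rightarrow> real" and f :: "'a \<Rightarrow> complex"
  assumes h: "integrable \<nu> h" and f: "(\<lambda>x. indicator X x *\<^sub>R f x) \<in> borel_measurable borel"
  shows "(\<integral>x. f x \<partial>positive_part X (\<lambda>A. \<integral>x. indicator A x *\<^sub>R h x \<partial>\<nu>))
    = (\<integral>x. max 0 (h x) *\<^sub>R (indicator X x *\<^sub>R f x) \<partial>\<nu>)"
proof -
  let ?n = "\<lambda>A. \<integral>x. indicator A x *\<^sub>R h x \<partial>\<nu>"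
  have int: "integrable \<nu> (\<lambda>x. indicator A x *\<^sub>R h x)" "integrable \<nu> (\<lambda>x. indicator A x *\<^sub>R max 0 (h x))"
    if "A \<in> sets borel" for A
    using that by (auto intro!: integrable_mult_indicator h integrable_max integrable_zero simp: s\<nu> simp del: real_scaleR_def)
  have bsm: "bounded_signed_measure X ?n (\<integral>x. norm (h x) \<partial>\<nu>)"
  proof
    fix A :: "nat \<Rightarrow> 'a set"
    assume "range A \<subseteq> sets (borel_on X)" "disjoint_family A"
    then show "(\<lambda>i. ?n (A i)) sums ?n (\<Union>i. A i)"
      using sets_borel_on_iff by (intro density_sums[OF h]) auto
  next
    fix A assume A: "A \<in> sets (borel_on X)"
    have "norm (?n A) \<le> (\<integral>x. norm (indicator A x *\<^sub>R h x) \<partial>\<nu>)" by (rule integral_norm_bound)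
    also have "\<dots> \<le> (\<integral>x. norm (h x) \<partial>\<nu>)"
      using h int(1)[of A] A sets_borel_on_iff by (intro integral_mono integrable_norm) (auto simp: indicator_def)
    finally show "\<bar>?n A\<bar> \<le> (\<integral>x. norm (h x) \<partial>\<nu>)" by simp
  qed
  interpret bounded_signed_measure X ?n "\<integral>x. norm (h x) \<partial>\<nu>" by (rule bsm)
  have hm[measurable]: "h \<in> borel_measurable \<nu>" using h by simp
  have hm'[measurable]: "h \<in> borel_measurable borel" using hm by (simp add: measurable_cong_sets[OF s\<nu> refl])
  have "positive_part X ?n = restrict_space (density \<nu> (\<lambda>x. ennreal (max 0 (h x)))) X"
  proof (rule measure_eqI)
    show "sets (positive_part X ?n) = sets (restrict_space (density \<nu> (\<lambda>x. ennreal (max 0 (h x)))) X)"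
      unfolding sets_positive_part borel_on_def by (rule sets_restrict_space_cong) (simp add: s\<nu>)
    fix A assume "A \<in> sets (positive_part X ?n)"
    then have A: "A \<in> sets (borel_on X)" by (simp only: sets_positive_part)
    then have A': "A \<in> sets borel" "A \<subseteq> X" using sets_borel_on_iff by auto
    have "pp A = ennreal (\<integral>x. indicator A x *\<^sub>R max 0 (h x) \<partial>\<nu>)"
    proof (rule antisym)
      show "pp A \<le> ennreal (\<integral>x. indicator A x *\<^sub>R max 0 (h x) \<partial>\<nu>)"
        unfolding pp_def
      proof (rule SUP_least, safe)
        fix B assume B: "B \<in> sets (borel_on X)" "B \<subseteq> A"
        show "ennreal (?n B) \<le> ennreal (\<integral>x. indicator A x *\<^sub>R max 0 (h x) \<partial>\<nu>)"
          using B A' sets_borel_on_iff by (intro ennreal_leI integral_mono int) (auto simp: indicator_def)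
      qed
      define B where "B = A \<inter> {x. 0 \<le> h x}"
      have hb: "{x. 0 \<le> h x} \<in> sets borel"
        by simp
      have B: "B \<in> sets (borel_on X)" "B \<subseteq> A"
        using A' hb sets_borel_on_iff by (auto simp: B_def)
      have "(\<integral>x. indicator A x *\<^sub>R max 0 (h x) \<partial>\<nu>) = ?n B"
        by (intro Bochner_Integration.integral_cong refl) (auto simp: B_def indicator_def)
      then show "ennreal (\<integral>x. indicator A x *\<^sub>R max 0 (h x) \<partial>\<nu>) \<le> pp A"
        using le_pp[OF B] by simp
    qed
    also have "\<dots> = (\<integral>\<^sup>+x. ennreal (indicator A x *\<^sub>R max 0 (h x)) \<partial>\<nu>)"
      by (rule nn_integral_eq_integral[symmetric, OF int(2)[OF A'(1)]]) simp
    also have "\<dots> = emeasure (density \<nu> (\<lambda>x. ennreal (max 0 (h x)))) A"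
      using A' by (subst emeasure_density) (auto simp: s\<nu> indicator_def intro!: nn_integral_cong)
    also have "\<dots> = emeasure (restrict_space (density \<nu> (\<lambda>x. ennreal (max 0 (h x)))) X) A"
      using A' X by (subst emeasure_restrict_space) (auto simp: s\<nu>)
    finally show "emeasure (positive_part X ?n) A = emeasure (restrict_space (density \<nu> (\<lambda>x. ennreal (max 0 (h x)))) X) A"
      by (simp only: emeasure_positive_part[OF A])
  qed
  then have "(\<integral>x. f x \<partial>positive_part X ?n) = (\<integral>x. indicator X x *\<^sub>R f x \<partial>density \<nu> (\<lambda>x. ennreal (max 0 (h x))))"
    using X by (simp only:) (subst integral_restrict_space, auto simp: s\<nu>)
  also have "\<dots> = (\<integral>x. max 0 (h x) *\<^sub>R (indicator X x *\<^sub>R f x) \<partial>\<nu>)"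
    by (rule integral_density) (use f in \<open>auto simp: measurable_cong_sets[OF s\<nu> refl]\<close>)
  finally show ?thesis .
qed

text \<open>The Jordan parts come from the positive and negative parts of \<open>Re (g x)\<close>
  and \<open>Im (g x)\<close>, and the four integrals recombine to one.\<close>

theorem complex_integral_density:
  fixes g f :: "'a \<Rightarrow> complex"
  assumes g: "integrable \<nu> g" and f: "(\<lambda>x. indicator X x *\<^sub>R f x) \<in> borel_measurable borel"
    and B: "\<And>x. x \<in> X \<Longrightarrow> norm (f x) \<le> B"
  shows "complex_integral X (\<lambda>A. \<integral>x. indicator A x *\<^sub>R g x \<partial>\<nu>) f = (\<integral>x. (indicator X x *\<^sub>R f x) * g x \<partial>\<nu>)"
proof -
  let ?F = "\<lambda>x. indicator X x *\<^sub>R f x"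
  have [measurable]: "?F \<in> borel_measurable \<nu>" using f by (simp add: measurable_cong_sets[OF s\<nu> refl])
  have F_le: "norm (c *\<^sub>R ?F x) \<le> norm (\<bar>h\<bar> * \<bar>B\<bar>)" if "\<bar>c\<bar> \<le> \<bar>h\<bar>" for c h :: real and x
  proof -
    have "norm (c *\<^sub>R y) \<le> norm (\<bar>h\<bar> * \<bar>B\<bar>)" if "norm y \<le> \<bar>B\<bar>" for y :: complex
      using mult_mono[OF \<open>\<bar>c\<bar> \<le> \<bar>h\<bar>\<close> that] by (simp add: abs_mult)
    moreover have "norm (?F x) \<le> \<bar>B\<bar>" using B[of x] by (auto simp: indicator_def)
    ultimately show ?thesis .
  qed
  have I: "integrable \<nu> (\<lambda>x. max 0 (h x) *\<^sub>R ?F x)" if h: "integrable \<nu> h" for h :: "'a \<Rightarrow> real"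
  proof (rule Bochner_Integration.integrable_bound)
    show "integrable \<nu> (\<lambda>x. \<bar>h x\<bar> * \<bar>B\<bar>)" using h by simp
    show "AE x in \<nu>. norm (max 0 (h x) *\<^sub>R ?F x) \<le> norm (\<bar>h x\<bar> * \<bar>B\<bar>)"
      by (intro AE_I2 F_le) simp
  qed (use h in measurable)
  have split: "(\<integral>x. f x \<partial>positive_part X (\<lambda>A. \<integral>x. indicator A x *\<^sub>R h x \<partial>\<nu>))
      - (\<integral>x. f x \<partial>positive_part X (\<lambda>A. - (\<integral>x. indicator A x *\<^sub>R h x \<partial>\<nu>))) = (\<integral>x. h x *\<^sub>R ?F x \<partial>\<nu>)"
    if h: "integrable \<nu> h" for h :: "'a \<Rightarrow> real"
  proof -
    have h': "integrable \<nu> (\<lambda>x. - h x)" using h by simp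
    have neg: "(\<lambda>A. - (\<integral>x. indicator A x *\<^sub>R h x \<partial>\<nu>)) = (\<lambda>A. \<integral>x. indicator A x *\<^sub>R (- h x) \<partial>\<nu>)" by simp
    have "max 0 (h x) *\<^sub>R ?F x - max 0 (- h x) *\<^sub>R ?F x = h x *\<^sub>R ?F x" for x
      unfolding scaleR_left_diff_distrib[symmetric] by (simp add: max_def)
    then show ?thesis
      unfolding neg integral_positive_part_density[OF h f] integral_positive_part_density[OF h' f]
      by (simp only: Bochner_Integration.integral_diff[OF I[OF h] I[OF h'], symmetric])
  qed
  have hI: "integrable \<nu> (\<lambda>x. h x *\<^sub>R ?F x)" if h: "integrable \<nu> h" for h :: "'a \<Rightarrow> real"
  proof (rule Bochner_Integration.integrable_bound)
    show "integrable \<nu> (\<lambda>x. \<bar>h x\<bar> * \<bar>B\<bar>)" using h by simp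
    show "AE x in \<nu>. norm (h x *\<^sub>R ?F x) \<le> norm (\<bar>h x\<bar> * \<bar>B\<bar>)"
      by (intro AE_I2 F_le) simp
  qed (use h in measurable)
  have gR: "integrable \<nu> (\<lambda>x. Re (g x))" "integrable \<nu> (\<lambda>x. Im (g x))" using g by auto
  have parts: "Re (\<integral>x. indicator A x *\<^sub>R g x \<partial>\<nu>) = (\<integral>x. indicator A x *\<^sub>R Re (g x) \<partial>\<nu>)"
    "Im (\<integral>x. indicator A x *\<^sub>R g x \<partial>\<nu>) = (\<integral>x. indicator A x *\<^sub>R Im (g x) \<partial>\<nu>)" if "A \<in> sets borel" for A
    using integrable_mult_indicator[of A \<nu> g] g that by (auto simp: s\<nu> simp flip: integral_Re integral_Im)
  \<comment> \<open>Real and imaginary parts are taken inside the integral for Borel sets, and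
    \<open>positive_part\<close> inspects no other sets.\<close>
  have pc: "positive_part X a = positive_part X b" if "\<And>A. A \<in> sets borel \<Longrightarrow> a A = b A" for a b
  proof -
    have "(SUP B \<in> {B \<in> sets (borel_on X). B \<subseteq> A}. ennreal (a B)) = (SUP B \<in> {B \<in> sets (borel_on X). B \<subseteq> A}. ennreal (b B))" for A
      by (intro SUP_cong refl) (use that sets_borel_on_iff in auto)
    then show ?thesis by (simp only: positive_part_def)
  qed
  have pcs: "positive_part X (\<lambda>A. Re (\<integral>x. indicator A x *\<^sub>R g x \<partial>\<nu>)) = positive_part X (\<lambda>A. \<integral>x. indicator A x *\<^sub>R Re (g x) \<partial>\<nu>)"
    "positive_part X (\<lambda>A. - Re (\<integral>x. indicator A x *\<^sub>R g x \<partial>\<nu>)) = positive_part X (\<lambda>A. - (\<integral>x. indicator A x *\<^sub>R Re (g x) \<partial>\<nu>))"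
    "positive_part X (\<lambda>A. Im (\<integral>x. indicator A x *\<^sub>R g x \<partial>\<nu>)) = positive_part X (\<lambda>A. \<integral>x. indicator A x *\<^sub>R Im (g x) \<partial>\<nu>)"
    "positive_part X (\<lambda>A. - Im (\<integral>x. indicator A x *\<^sub>R g x \<partial>\<nu>)) = positive_part X (\<lambda>A. - (\<integral>x. indicator A x *\<^sub>R Im (g x) \<partial>\<nu>))"
    by (rule pc, simp only: parts)+
  have "complex_integral X (\<lambda>A. \<integral>x. indicator A x *\<^sub>R g x \<partial>\<nu>) f = (\<integral>x. Re (g x) *\<^sub>R ?F x \<partial>\<nu>) + \<i> * (\<integral>x. Im (g x) *\<^sub>R ?F x \<partial>\<nu>)"
    by (simp only: complex_integral_def pcs split[OF gR(1)] split[OF gR(2)])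
  also have "\<dots> = (\<integral>x. Re (g x) *\<^sub>R ?F x + \<i> * (Im (g x) *\<^sub>R ?F x) \<partial>\<nu>)"
    by (simp only: Bochner_Integration.integral_add[OF hI[OF gR(1)] integrable_mult_right[OF hI[OF gR(2)]]] integral_mult_right_zero)
  also have "\<dots> = (\<integral>x. ?F x * g x \<partial>\<nu>)"
  proof (intro Bochner_Integration.integral_cong refl)
    fix x
    have "Re (g x) *\<^sub>R ?F x + \<i> * (Im (g x) *\<^sub>R ?F x) = ?F x * (of_real (Re (g x)) + \<i> * of_real (Im (g x)))"
      by (simp add: scaleR_conv_of_real algebra_simps)
    then show "Re (g x) *\<^sub>R ?F x + \<i> * (Im (g x) *\<^sub>R ?F x) = ?F x * g x" by (simp only: complex_eq[symmetric])
  qed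
  finally show ?thesis .
qed

end

section \<open>Positivity of densities\<close>

lemma closed_nonneg_complex: "closed {z::complex. 0 \<le> z}"
proof -
  have "{z::complex. 0 \<le> z} = {z. 0 \<le> Re z} \<inter> {z. Im z = 0}" by (auto simp: less_eq_complex_def)
  then show ?thesis by (simp add: closed_Int closed_Collect_le closed_Collect_eq continuous_intros)
qed

lemma complex_nonneg_cancel: "0 < c \<Longrightarrow> 0 \<le> complex_of_real c * z \<Longrightarrow> 0 \<le> z"
  by (auto simp: less_eq_complex_def zero_le_mult_iff)

text \<open>Testing against Gaussians, which factor over a product space and whose square roots are
  admissible test functions, suffices, as they form an approximate identity.\<close>

lemma AE_nonneg_if_gauss:
  fixes g :: "'a::euclidean_space \<Rightarrow> complex"
  assumes fin: "finite_measure \<rho>" and s\<rho>: "sets \<rho> = sets borel" and g: "integrable \<rho> g"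
    and pos: "\<And>w n. 0 \<le> (\<integral>z. of_real (gauss (real (Suc n) *\<^sub>R (z - w))) * g z \<partial>\<rho>)"
  shows "AE z in \<rho>. 0 \<le> g z"
proof -
  interpret finite_measure \<rho> by (rule fin)
  have [measurable]: "g \<in> borel_measurable \<rho>" using g by simp
  note [measurable_cong] = s\<rho>
  interpret P: pair_sigma_finite \<rho> lborel ..
  let ?c = "sqrt (2 * pi) ^ DIM('a)"
  \<comment> \<open>A continuous \<open>\<Phi>\<close> is a limit of its averages against Gaussians;
    each average is a superposition of Gaussians with nonnegative weights \<open>\<Phi> w\<close>,
    so Fubini's theorem passes the assumption on to it.\<close>
  have step: "0 \<le> (\<integral>z. of_real (\<Phi> z) * g z \<partial>\<rho>)"
    if \<Phi>: "continuous_on UNIV \<Phi>" "\<And>z. 0 \<le> \<Phi> z" "\<And>z. \<Phi> z \<le> (1::real)" for \<Phi>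
  proof -
    have [measurable]: "\<Phi> \<in> borel_measurable borel" by (rule borel_measurable_continuous_onI[OF \<Phi>(1)])
    define k where "k n z w = gauss (real (Suc n) *\<^sub>R (z - w))" for n and z w :: 'a
    have [measurable]: "(\<lambda>w. k n z w) \<in> borel_measurable borel" for n z unfolding k_def by measurable
    define S where "S n z = (\<integral>w. \<Phi> w * k n z w \<partial>lborel)" for n z
    have S: "S n z = (1 / real (Suc n)) ^ DIM('a) * (\<integral>w. \<Phi> (z - w /\<^sub>R real (Suc n)) * gauss w \<partial>lborel)" for n z
      unfolding S_def k_def
      by (subst lborel_integral_affine[of _ "- 1 / real (Suc n)" z]) (auto simp: field_simps)
    have gi: "integrable lborel (gauss :: 'a \<Rightarrow> real)"
      using integrable_norm[OF gauss_fourier(1)[of "0::'a"]] by simp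
    have gI: "(\<integral>w. gauss (w :: 'a) \<partial>lborel) = ?c"
    proof -
      have "complex_of_real (\<integral>w. gauss (w::'a) \<partial>lborel) = of_real ?c"
        using gauss_fourier(2)[of "0::'a"] by (simp flip: integral_complex_of_real)
      then show ?thesis by (simp only: of_real_eq_iff)
    qed
    \<comment> \<open>\<open>T\<close> is \<open>S\<close> without the power of the scale, which
      would drive the averages to 0.\<close>
    define T where "T n z = (\<integral>w. \<Phi> (z - w /\<^sub>R real (Suc n)) * gauss w \<partial>lborel)" for n z
    have [measurable]: "T n \<in> borel_measurable borel" for n unfolding T_def by measurable
    have T_le: "\<bar>T n z\<bar> \<le> ?c" for n z
    proof -
      have "norm (T n z) \<le> (\<integral>w. norm (\<Phi> (z - w /\<^sub>R real (Suc n)) * gauss w) \<partial>lborel)"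
        unfolding T_def by (rule integral_norm_bound)
      also have "\<dots> \<le> (\<integral>w. gauss (w::'a) \<partial>lborel)"
      proof (rule integral_mono)
        show le: "norm (\<Phi> (z - w /\<^sub>R real (Suc n)) * gauss w) \<le> gauss w" for w :: 'a
          using \<Phi>(2,3)[of "z - w /\<^sub>R real (Suc n)"] by (simp add: abs_mult mult_left_le_one_le less_imp_le)
        show "integrable lborel (\<lambda>w. norm (\<Phi> (z - w /\<^sub>R real (Suc n)) * gauss w))"
          by (rule Bochner_Integration.integrable_bound[OF gi]) (use le in \<open>auto simp: less_imp_le\<close>)
      qed (rule gi)
      finally show ?thesis by (simp add: gI)
    qed
    have T_lim: "(\<lambda>n. T n z) \<longlonglongrightarrow> \<Phi> z * ?c" for z
    proof -
      have "(\<lambda>n. T n z) \<longlonglongrightarrow> (\<integral>w. \<Phi> z * gauss (w::'a) \<partial>lborel)"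
        unfolding T_def
      proof (rule integral_dominated_convergence[OF _ _ gi])
        show "AE w in lborel. (\<lambda>n. \<Phi> (z - w /\<^sub>R real (Suc n)) * gauss w) \<longlonglongrightarrow> \<Phi> z * gauss w"
        proof (intro AE_I2 tendsto_mult tendsto_const)
          fix w :: 'a
          have "(\<lambda>n. 1 / real (Suc n)) \<longlonglongrightarrow> 0" by (rule LIMSEQ_Suc[OF lim_1_over_n])
          from tendsto_diff[OF tendsto_const[of z] tendsto_scaleR[OF this tendsto_const[of w]]]
          have "(\<lambda>n. z - w /\<^sub>R real (Suc n)) \<longlonglongrightarrow> z" by (simp add: divide_inverse)
          then show "(\<lambda>n. \<Phi> (z - w /\<^sub>R real (Suc n))) \<longlonglongrightarrow> \<Phi> z"
            using continuous_on_tendsto_compose[OF \<Phi>(1)] by fastforce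
        qed
        show "AE w in lborel. norm (\<Phi> (z - w /\<^sub>R real (Suc n)) * gauss w) \<le> gauss w" for n
          using \<Phi>(2,3) by (intro AE_I2) (simp add: abs_mult mult_left_le_one_le less_imp_le)
      qed measurable
      then show ?thesis by (simp add: gI)
    qed
    have pn: "0 \<le> (\<integral>z. of_real (T n z) * g z \<partial>\<rho>)" for n
    proof -
      have kI: "integrable lborel (\<lambda>w. \<Phi> w * k n z w)" for z
      proof (rule Bochner_Integration.integrable_bound)
        have "integrable lborel (\<lambda>w. gauss (real (Suc n) *\<^sub>R z + (- real (Suc n)) *\<^sub>R w))"
          using gi lborel_integrable_affine_iff[of "gauss :: 'a \<Rightarrow> real" "- real (Suc n)" "real (Suc n) *\<^sub>R z"] by simp
        then show "integrable lborel (\<lambda>w. k n z w)" by (simp add: k_def algebra_simps)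
        show "AE w in lborel. norm (\<Phi> w * k n z w) \<le> norm (k n z w)"
          using \<Phi>(2,3) by (intro AE_I2) (simp add: k_def abs_mult mult_left_le_one_le less_imp_le)
      qed measurable
      have [measurable]: "(\<lambda>z. k n (fst z) (snd z)) \<in> borel_measurable (\<rho> \<Otimes>\<^sub>M lborel)" unfolding k_def by measurable
      have int: "integrable (\<rho> \<Otimes>\<^sub>M lborel) (\<lambda>(z, w). of_real (\<Phi> w * k n z w) * g z)"
      proof (rule P.Fubini_integrable)
        show "(\<lambda>(z, w). complex_of_real (\<Phi> w * k n z w) * g z) \<in> borel_measurable (\<rho> \<Otimes>\<^sub>M lborel)"
          unfolding case_prod_unfold by measurable
        have "(\<integral>w. norm (complex_of_real (\<Phi> w * k n z w) * g z) \<partial>lborel) = (1 / real (Suc n)) ^ DIM('a) * T n z * norm (g z)" for z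
        proof -
          have "norm (complex_of_real (\<Phi> w * k n z w) * g z) = \<Phi> w * k n z w * norm (g z)" for w
            using \<Phi>(2)[of w] by (simp add: norm_mult k_def less_imp_le)
          then show ?thesis using S[of n z] by (simp add: S_def T_def)
        qed
        moreover have "integrable \<rho> (\<lambda>z. (1 / real (Suc n)) ^ DIM('a) * T n z * norm (g z))"
        proof (rule Bochner_Integration.integrable_bound)
          show "integrable \<rho> (\<lambda>z. (1 / real (Suc n)) ^ DIM('a) * ?c * norm (g z))" using g by simp
          show "AE z in \<rho>. norm ((1 / real (Suc n)) ^ DIM('a) * T n z * norm (g z)) \<le> norm ((1 / real (Suc n)) ^ DIM('a) * ?c * norm (g z))"
            using T_le by (intro AE_I2) (simp add: abs_mult mult_left_mono mult_right_mono)
        qed measurable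
        ultimately show "integrable \<rho> (\<lambda>z. \<integral>w. norm (case (z, w) of (z, w) \<Rightarrow> complex_of_real (\<Phi> w * k n z w) * g z) \<partial>lborel)"
          by simp
        show "AE z in \<rho>. integrable lborel (\<lambda>w. case (z, w) of (z, w) \<Rightarrow> complex_of_real (\<Phi> w * k n z w) * g z)"
          using kI by (intro AE_I2) (simp only: prod.case, intro integrable_mult_left integrable_of_real)
      qed
      have pw: "0 \<le> (\<integral>z. of_real (\<Phi> w * k n z w) * g z \<partial>\<rho>)" for w
      proof -
        have "(\<integral>z. of_real (\<Phi> w * k n z w) * g z \<partial>\<rho>) = of_real (\<Phi> w) * (\<integral>z. of_real (k n z w) * g z \<partial>\<rho>)"
          by (simp only: of_real_mult mult.assoc integral_mult_right_zero)
        then show ?thesis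
          using pos[of n w] \<Phi>(2)[of w] by (simp add: k_def less_eq_complex_def)
      qed
      have "(\<integral>w. \<integral>z. of_real (\<Phi> w * k n z w) * g z \<partial>\<rho> \<partial>lborel)
          = of_real (\<integral>w. Re (\<integral>z. of_real (\<Phi> w * k n z w) * g z \<partial>\<rho>) \<partial>lborel)"
        unfolding integral_complex_of_real[symmetric]
        using pw by (intro Bochner_Integration.integral_cong refl) (simp add: less_eq_complex_def complex_eq_iff)
      then have "0 \<le> (\<integral>w. \<integral>z. of_real (\<Phi> w * k n z w) * g z \<partial>\<rho> \<partial>lborel)"
        using pw by (simp add: less_eq_complex_def)
      also have "\<dots> = (\<integral>z. \<integral>w. of_real (\<Phi> w * k n z w) * g z \<partial>lborel \<partial>\<rho>)"
        by (rule P.Fubini_integral[OF int])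
      also have "\<dots> = (\<integral>z. of_real ((1 / real (Suc n)) ^ DIM('a)) * (of_real (T n z) * g z) \<partial>\<rho>)"
      proof (intro Bochner_Integration.integral_cong refl)
        fix z
        have "(\<integral>w. of_real (\<Phi> w * k n z w) * g z \<partial>lborel) = of_real (S n z) * g z"
          by (simp only: integral_mult_left_zero integral_complex_of_real S_def)
        then show "(\<integral>w. of_real (\<Phi> w * k n z w) * g z \<partial>lborel) = of_real ((1 / real (Suc n)) ^ DIM('a)) * (of_real (T n z) * g z)"
          by (simp only: S T_def of_real_mult mult.assoc)
      qed
      also have "\<dots> = of_real ((1 / real (Suc n)) ^ DIM('a)) * (\<integral>z. of_real (T n z) * g z \<partial>\<rho>)"
        by (rule integral_mult_right_zero)
      finally have le: "0 \<le> of_real ((1 / real (Suc n)) ^ DIM('a)) * (\<integral>z. of_real (T n z) * g z \<partial>\<rho>)" .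
      have "0 < (1 / real (Suc n)) ^ DIM('a)" by simp
      then show ?thesis using le by (rule complex_nonneg_cancel)
    qed
    have "(\<lambda>n. \<integral>z. of_real (T n z) * g z \<partial>\<rho>) \<longlonglongrightarrow> (\<integral>z. of_real (\<Phi> z * ?c) * g z \<partial>\<rho>)"
    proof (rule integral_dominated_convergence[where w = "\<lambda>z. ?c * norm (g z)"])
      show "AE z in \<rho>. (\<lambda>n. of_real (T n z) * g z) \<longlonglongrightarrow> of_real (\<Phi> z * ?c) * g z"
        by (intro AE_I2 tendsto_mult tendsto_of_real T_lim tendsto_const)
      show "AE z in \<rho>. norm (of_real (T n z) * g z) \<le> ?c * norm (g z)" for n
        using T_le by (intro AE_I2) (simp add: norm_mult mult_right_mono)
      show "integrable \<rho> (\<lambda>z. ?c * norm (g z))" using g by simp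
    qed measurable
    then have "(\<integral>z. of_real (\<Phi> z * ?c) * g z \<partial>\<rho>) \<in> {z. 0 \<le> z}"
      by (rule closed_sequentially[OF closed_nonneg_complex, rotated]) (use pn in simp)
    also have "(\<integral>z. of_real (\<Phi> z * ?c) * g z \<partial>\<rho>) = of_real ?c * (\<integral>z. of_real (\<Phi> z) * g z \<partial>\<rho>)"
      by (simp only: of_real_mult mult.commute[of "of_real (\<Phi> _)"] mult.assoc integral_mult_right_zero)
    finally have le: "0 \<le> of_real ?c * (\<integral>z. of_real (\<Phi> z) * g z \<partial>\<rho>)" by simp
    have "0 < ?c" by simp
    then show ?thesis using le by (rule complex_nonneg_cancel)
  qed
  \<comment> \<open>The indicator of a compact set is a pointwise limit of continuous functions of
    the distance to the set.\<close>
  have compact: "0 \<le> (\<integral>z. indicator K z *\<^sub>R g z \<partial>\<rho>)" if K: "compact K" for K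
  proof (cases "K = {}")
    case False
    define \<Phi> where "\<Phi> j z = max 0 (1 - real j * infdist z K)" for j z
    have \<Phi>: "continuous_on UNIV (\<Phi> j)" "0 \<le> \<Phi> j z" "\<Phi> j z \<le> 1" for j z
      unfolding \<Phi>_def by (auto intro!: continuous_intros mult_nonneg_nonneg infdist_nonneg)
    have [measurable]: "\<Phi> j \<in> borel_measurable borel" for j by (rule borel_measurable_continuous_onI[OF \<Phi>(1)])
    have "(\<lambda>j. \<integral>z. of_real (\<Phi> j z) * g z \<partial>\<rho>) \<longlonglongrightarrow> (\<integral>z. indicator K z *\<^sub>R g z \<partial>\<rho>)"
    proof (rule integral_dominated_convergence[where w = "\<lambda>z. norm (g z)"])
      show "AE z in \<rho>. (\<lambda>j. of_real (\<Phi> j z) * g z) \<longlonglongrightarrow> indicator K z *\<^sub>R g z"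
      proof (rule AE_I2)
        fix z
        show "(\<lambda>j. of_real (\<Phi> j z) * g z) \<longlonglongrightarrow> indicator K z *\<^sub>R g z"
        proof (cases "z \<in> K")
          case True
          then show ?thesis by (simp add: \<Phi>_def infdist_zero)
        next
          case out: False
          then have d: "0 < infdist z K"
            using in_closed_iff_infdist_zero[OF compact_imp_closed[OF K] False] infdist_nonneg[of z K] by (simp add: less_le)
          obtain N where "1 < real N * infdist z K" using reals_Archimedean3[OF d] by blast
          then have "1 < real j * infdist z K" if "N \<le> j" for j
            by (rule less_le_trans, intro mult_right_mono) (use that d in auto)
          then have "\<Phi> j z = 0" if "N \<le> j" for j
            unfolding \<Phi>_def using that by (intro max_absorb1) (simp add: less_imp_le)
          then have "\<forall>\<^sub>F j in sequentially. of_real (\<Phi> j z) * g z = 0"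
            by (intro eventually_sequentiallyI[of N]) simp
          then show ?thesis using out by (simp add: tendsto_eventually)
        qed
      qed
      show "(\<lambda>z. indicator K z *\<^sub>R g z) \<in> borel_measurable \<rho>"
        using K by (intro borel_measurable_integrable integrable_mult_indicator g) (simp add: s\<rho> borel_compact)
      show "AE z in \<rho>. norm (of_real (\<Phi> j z) * g z) \<le> norm (g z)" for j
        using \<Phi>(2,3) by (intro AE_I2) (simp add: norm_mult mult_left_le_one_le)
      show "integrable \<rho> (\<lambda>z. norm (g z))" using g by simp
    qed measurable
    then have "(\<integral>z. indicator K z *\<^sub>R g z \<partial>\<rho>) \<in> {z. 0 \<le> z}"
      by (rule closed_sequentially[OF closed_nonneg_complex, rotated]) (use step[OF \<Phi>] in simp)
    then show ?thesis by simp
  qed simp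
  \<comment> \<open>A Borel set is exhausted by compact subsets up to a small integral.\<close>
  have borel: "0 \<le> (\<integral>z. indicator A z *\<^sub>R g z \<partial>\<rho>)" if A: "A \<in> sets borel" for A
  proof -
    have "\<exists>K. compact K \<and> K \<subseteq> A \<and> norm (\<integral>z. indicator (A - K) z *\<^sub>R g z \<partial>\<rho>) < 1 / real (Suc n)" for n
    proof -
      obtain K where "compact K" "K \<subseteq> A" "\<And>B. B \<in> sets borel \<Longrightarrow> B \<subseteq> A - K \<Longrightarrow> norm (\<integral>z. indicator B z *\<^sub>R g z \<partial>\<rho>) < 1 / real (Suc n)"
        using density_compact_approx[OF space_in_borel fin s\<rho> g A, of "1 / real (Suc n)"] by auto
      moreover have "A - K \<in> sets borel" using A borel_compact[OF \<open>compact K\<close>] by (rule sets.Diff)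
      ultimately show ?thesis by (intro exI[of _ K]) auto
    qed
    then obtain K where K: "\<And>n. compact (K n)" "\<And>n. K n \<subseteq> A"
      "\<And>n. norm (\<integral>z. indicator (A - K n) z *\<^sub>R g z \<partial>\<rho>) < 1 / real (Suc n)" by metis
    have Ks: "K n \<in> sets \<rho>" "A \<in> sets \<rho>" for n using K(1) A by (simp_all add: s\<rho> borel_compact)
    have eq: "(\<integral>z. indicator A z *\<^sub>R g z \<partial>\<rho>) - (\<integral>z. indicator (A - K n) z *\<^sub>R g z \<partial>\<rho>) = (\<integral>z. indicator (K n) z *\<^sub>R g z \<partial>\<rho>)" for n
    proof -
      have "(\<integral>z. indicator A z *\<^sub>R g z \<partial>\<rho>) - (\<integral>z. indicator (A - K n) z *\<^sub>R g z \<partial>\<rho>)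
          = (\<integral>z. indicator A z *\<^sub>R g z - indicator (A - K n) z *\<^sub>R g z \<partial>\<rho>)"
        by (rule Bochner_Integration.integral_diff[symmetric]; rule integrable_mult_indicator[OF _ g]) (use Ks in auto)
      also have "\<dots> = (\<integral>z. indicator (K n) z *\<^sub>R g z \<partial>\<rho>)"
        by (intro Bochner_Integration.integral_cong refl) (use K(2)[of n] in \<open>auto simp: indicator_def\<close>)
      finally show ?thesis .
    qed
    have "(\<lambda>n. norm (\<integral>z. indicator (A - K n) z *\<^sub>R g z \<partial>\<rho>)) \<longlonglongrightarrow> 0"
      by (rule tendsto_0_le_real[OF norm_ge_zero less_imp_le[OF K(3)] LIMSEQ_Suc[OF lim_1_over_n]])
    then have "(\<lambda>n. \<integral>z. indicator (K n) z *\<^sub>R g z \<partial>\<rho>) \<longlonglongrightarrow> (\<integral>z. indicator A z *\<^sub>R g z \<partial>\<rho>)"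
      using tendsto_diff[OF tendsto_const[of "\<integral>z. indicator A z *\<^sub>R g z \<partial>\<rho>"] tendsto_norm_zero_cancel]
      unfolding eq[symmetric] by fastforce
    then have "(\<integral>z. indicator A z *\<^sub>R g z \<partial>\<rho>) \<in> {z. 0 \<le> z}"
      by (rule closed_sequentially[OF closed_nonneg_complex, rotated]) (use compact[OF K(1)] in simp)
    then show ?thesis by simp
  qed
  \<comment> \<open>All averages over sets of positive measure lie in the closed set of nonnegative
    numbers, hence so do almost all values.\<close>
  have "AE z in \<rho>. g z \<in> {z. 0 \<le> z}"
  proof (rule averaging_theorem[OF g closed_nonneg_complex])
    fix A assume A: "A \<in> sets \<rho>" "0 < measure \<rho> A"
    have "0 \<le> set_lebesgue_integral \<rho> A g" using borel[of A] A(1) by (simp add: set_lebesgue_integral_def s\<rho>)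
    then show "(1 / measure \<rho> A) *\<^sub>R set_lebesgue_integral \<rho> A g \<in> {z. 0 \<le> z}"
      using A(2) by (simp add: less_eq_complex_def)
  qed
  then show ?thesis by simp
qed

section \<open>Assembling the limit measure\<close>

text \<open>The choices 1 and \<open>\<i>\<close> for \<open>\<zeta>\<close> force the matrix to be
  Hermitian; after that the quadratic in \<open>t\<close> obtained from
  \<open>\<zeta> = - t * b\<close> yields the bound.\<close>

lemma psd_pair:
  fixes a b c d :: complex
  assumes a: "0 \<le> a" and d: "0 \<le> d" and psd: "\<And>\<zeta>. 0 \<le> a + cnj \<zeta> * b + \<zeta> * c + of_real ((norm \<zeta>)\<^sup>2) * d"
  shows "(norm b)\<^sup>2 \<le> Re a * Re d"
proof -
  obtain x where x: "a = of_real x" "0 \<le> x" using a by (metis complex_eq_iff Im_complex_of_real Re_complex_of_real less_eq_complex_def zero_complex.sel)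
  obtain y where y: "d = of_real y" "0 \<le> y" using d by (metis complex_eq_iff Im_complex_of_real Re_complex_of_real less_eq_complex_def zero_complex.sel)
  have "Im b + Im c = 0" using psd[of 1] x y by (simp add: less_eq_complex_def)
  moreover have "Re c - Re b = 0" using psd[of \<i>] x y by (simp add: less_eq_complex_def)
  ultimately have c: "c = cnj b" by (simp add: complex_eq_iff)
  have q: "0 \<le> x - 2 * t * (norm b)\<^sup>2 + t\<^sup>2 * (norm b)\<^sup>2 * y" for t
  proof -
    have "Re (cnj (- of_real t * b) * b + - of_real t * b * cnj b) = - 2 * t * (norm b)\<^sup>2"
      unfolding cmod_power2 by (simp add: algebra_simps power2_eq_square)
    then have "Re (a + cnj (- of_real t * b) * b + - of_real t * b * c + of_real ((norm (- of_real t * b))\<^sup>2) * d)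
        = x - 2 * t * (norm b)\<^sup>2 + t\<^sup>2 * (norm b)\<^sup>2 * y"
      unfolding c x y by (simp add: norm_mult power_mult_distrib)
    then show ?thesis using psd[of "- of_real t * b"] by (simp add: less_eq_complex_def)
  qed
  show ?thesis
  proof (cases "y = 0")
    case True
    show ?thesis
    proof (cases "b = 0")
      case False
      then have "0 < (norm b)\<^sup>2" by simp
      \<comment> \<open>For \<open>y = 0\<close> the expression is affine in \<open>t\<close>, and
        this value would make it -1.\<close>
      then show ?thesis using q[of "(x + 1) / (2 * (norm b)\<^sup>2)"] True x by (simp add: field_simps)
    qed (use x y in simp)
  next
    case False
    then have "0 < y" using y by simp
    \<comment> \<open>The quadratic is minimal at \<open>1 / y\<close>.\<close>
    then show ?thesis using q[of "1 / y"] by (simp add: x y field_simps power2_eq_square)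
  qed
qed

lemma gauss_C0:
  fixes x0 :: "'a::euclidean_space"
  assumes "c \<noteq> 0"
  shows "(\<lambda>x. complex_of_real (gauss (c *\<^sub>R (x - x0)))) \<in> C0 UNIV"
  unfolding C0_def
proof (intro CollectI conjI allI impI)
  show "continuous_on UNIV (\<lambda>x. complex_of_real (gauss (c *\<^sub>R (x - x0))))"
    unfolding gauss_def by (intro continuous_intros) simp
  fix e :: real assume "0 < e"
  show "\<exists>K. compact K \<and> K \<subseteq> UNIV \<and> (\<forall>x\<in>UNIV - K. norm (complex_of_real (gauss (c *\<^sub>R (x - x0)))) < e)"
  \<comment> \<open>Outside this ball the modulus of the exponent exceeds \<open>1 / e\<close>, and
    \<open>exp s > s\<close>.\<close>
  proof (intro exI[of _ "cball x0 (sqrt (2 / e) / \<bar>c\<bar>)"] conjI ballI)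
    fix x assume "x \<in> UNIV - cball x0 (sqrt (2 / e) / \<bar>c\<bar>)"
    then have "sqrt (2 / e) / \<bar>c\<bar> < norm (x - x0)" by (simp add: dist_norm norm_minus_commute)
    then have "sqrt (2 / e) < \<bar>c\<bar> * norm (x - x0)" using assms by (simp add: field_simps)
    then have "sqrt (2 / e) < norm (c *\<^sub>R (x - x0))" by (simp only: norm_scaleR)
    then have "(sqrt (2 / e))\<^sup>2 < (norm (c *\<^sub>R (x - x0)))\<^sup>2" using \<open>0 < e\<close> by (intro power_strict_mono) auto
    then have "1 / e < (norm (c *\<^sub>R (x - x0)))\<^sup>2 / 2" using \<open>0 < e\<close> by simp
    also have "\<dots> < exp ((norm (c *\<^sub>R (x - x0)))\<^sup>2 / 2)" using exp_ge_add_one_self by (rule less_le_trans[rotated]) simp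
    finally have "1 / exp ((norm (c *\<^sub>R (x - x0)))\<^sup>2 / 2) < e" using \<open>0 < e\<close> by (simp add: field_simps)
    then show "norm (complex_of_real (gauss (c *\<^sub>R (x - x0)))) < e"
      by (simp add: less_imp_le) (simp add: gauss_def exp_minus inverse_eq_divide)
  qed auto
qed

text \<open>Exchange of two limits, possible because the approximation of \<open>x\<close> by
  \<open>y N\<close> is uniform in \<open>n\<close>.\<close>

lemma double_limit:
  fixes x :: "nat \<Rightarrow> complex"
  assumes inner: "\<And>N. (\<lambda>n. y N n) \<longlonglongrightarrow> L N" and x: "\<And>N n. norm (x n - y N n) \<le> \<delta> N"
    and R: "\<And>N. norm (R - L N) \<le> \<delta>' N" and \<delta>: "\<delta> \<longlonglongrightarrow> 0" "\<delta>' \<longlonglongrightarrow> (0::real)"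
  shows "x \<longlonglongrightarrow> R"
proof (rule LIMSEQ_I)
  fix e :: real assume "0 < e"
  then have e: "0 < e / 3" by simp
  have "\<forall>\<^sub>F N in sequentially. \<delta> N < e / 3 \<and> \<delta>' N < e / 3"
    using order_tendstoD(2)[OF \<delta>(1) e] order_tendstoD(2)[OF \<delta>(2) e] by eventually_elim simp
  then obtain N where N: "\<delta> N < e / 3" "\<delta>' N < e / 3" by (auto simp: eventually_sequentially)
  obtain n0 where n0: "\<And>n. n \<ge> n0 \<Longrightarrow> norm (y N n - L N) < e / 3"
    using LIMSEQ_D[OF inner e] by blast
  have "norm (x n - R) < e" if "n \<ge> n0" for n
  proof -
    have "x n - R = (x n - y N n) + (y N n - L N) - (R - L N)" by simp
    then have "norm (x n - R) \<le> norm (x n - y N n) + norm (y N n - L N) + norm (R - L N)"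
      using norm_triangle_ineq4[of "(x n - y N n) + (y N n - L N)" "R - L N"] norm_triangle_ineq[of "x n - y N n" "y N n - L N"] by simp
    then show ?thesis using x[of n N] n0[OF that] R[of N] N by linarith
  qed
  then show "\<exists>no. \<forall>n\<ge>no. norm (x n - R) < e" by blast
qed

text \<open>Normalising a positive semidefinite matrix of densities by its trace makes its
  Hilbert--Schmidt norm bounded by one.\<close>

theorem trace_normalization:
  fixes f :: "nat \<Rightarrow> nat \<Rightarrow> 'a::topological_space \<Rightarrow> complex"
  assumes fin: "finite_measure \<rho>" and s\<rho>: "sets \<rho> = sets borel"
    and f: "\<And>i j. integrable \<rho> (f i j)"
    and psd: "AE z in \<rho>. \<forall>i j. 0 \<le> f i i z \<and> (norm (f i j z))\<^sup>2 \<le> Re (f i i z) * Re (f j j z)"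
    and tr: "\<And>N. (\<Sum>i<N. \<integral>z. Re (f i i z) \<partial>\<rho>) \<le> K"
  shows "\<exists>\<nu> g. finite_measure \<nu> \<and> sets \<nu> = sets borel \<and> (\<forall>i j. g i j \<in> l2 \<nu>) \<and>
    (\<forall>N. (\<Sum>(i, j)\<in>{..<N} \<times> {..<N}. (nm \<nu> (g i j))\<^sup>2) \<le> measure \<nu> (space \<nu>)) \<and>
    (\<forall>i j \<Psi>. \<Psi> \<in> borel_measurable borel \<longrightarrow> (\<integral>z. \<Psi> z * f i j z \<partial>\<rho>) = (\<integral>z. \<Psi> z * g i j z \<partial>\<nu>))"
proof -
  note [measurable_cong] = s\<rho>
  have [measurable]: "f i j \<in> borel_measurable \<rho>" for i j using f by simp
  have pos: "AE z in \<rho>. \<forall>i. 0 \<le> Re (f i i z)" using psd by eventually_elim (auto simp: less_eq_complex_def)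
  define T where "T z = (\<Sum>i. ennreal (Re (f i i z)))" for z
  have [measurable]: "T \<in> borel_measurable \<rho>" unfolding T_def by measurable
  define t where "t z = enn2real (T z)" for z
  have [measurable]: "t \<in> borel_measurable \<rho>" unfolding t_def by measurable
  have "(\<integral>\<^sup>+z. T z \<partial>\<rho>) = (\<Sum>i. \<integral>\<^sup>+z. ennreal (Re (f i i z)) \<partial>\<rho>)"
    unfolding T_def by (rule nn_integral_suminf) measurable
  also have "\<dots> = (\<Sum>i. ennreal (\<integral>z. Re (f i i z) \<partial>\<rho>))"
    using pos by (intro suminf_cong nn_integral_eq_integral) (auto simp: f)
  also have "\<dots> \<le> ennreal K"
  proof (rule suminf_le_const)
    fix N
    have "(\<Sum>i<N. ennreal (\<integral>z. Re (f i i z) \<partial>\<rho>)) = ennreal (\<Sum>i<N. \<integral>z. Re (f i i z) \<partial>\<rho>)"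
      using pos by (intro sum_ennreal integral_nonneg_AE) auto
    then show "(\<Sum>i<N. ennreal (\<integral>z. Re (f i i z) \<partial>\<rho>)) \<le> ennreal K"
      using tr by (simp add: ennreal_leI)
  qed simp
  finally have TK: "(\<integral>\<^sup>+z. T z \<partial>\<rho>) \<le> ennreal K" .
  then have "(\<integral>\<^sup>+z. T z \<partial>\<rho>) \<noteq> \<infinity>" by (auto simp: top_unique)
  then have Tfin: "AE z in \<rho>. T z \<noteq> \<infinity>" by (intro nn_integral_PInf_AE) simp_all
  have tT: "AE z in \<rho>. ennreal (t z) = T z" using Tfin by eventually_elim (simp add: t_def less_top)
  define \<nu> where "\<nu> = density \<rho> (\<lambda>z. ennreal (t z))"
  have s\<nu>: "sets \<nu> = sets borel" by (simp add: \<nu>_def s\<rho>)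
  have "emeasure \<nu> (space \<nu>) = (\<integral>\<^sup>+z. T z \<partial>\<rho>)"
    unfolding \<nu>_def using tT by (subst emeasure_density) (auto intro!: nn_integral_cong_AE)
  then have fin\<nu>: "finite_measure \<nu>" using \<open>(\<integral>\<^sup>+z. T z \<partial>\<rho>) \<noteq> \<infinity>\<close> by (intro finite_measureI) simp
  interpret \<nu>: finite_measure \<nu> by (rule fin\<nu>)
  \<comment> \<open>Where the trace vanishes, division gives 0; almost everywhere
    \<open>f i j\<close> vanishes there as well, because the trace dominates its modulus.\<close>
  define g where "g i j z = f i j z / of_real (t z)" for i j z
  have gm\<rho> [measurable]: "g i j \<in> borel_measurable \<rho>" for i j unfolding g_def by measurable
  then have gm: "g i j \<in> borel_measurable \<nu>" for i j by (simp add: \<nu>_def)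
  have part: "AE z in \<rho>. \<forall>N. (\<Sum>i<N. Re (f i i z)) \<le> t z"
    using pos tT
  proof eventually_elim
    case (elim z)
    show ?case
    proof
      fix N
      have "ennreal (\<Sum>i<N. Re (f i i z)) = (\<Sum>i<N. ennreal (Re (f i i z)))"
        using elim by (intro sum_ennreal[symmetric]) auto
      also have "\<dots> \<le> T z" unfolding T_def by (intro sum_le_suminf) auto
      finally have "ennreal (\<Sum>i<N. Re (f i i z)) \<le> ennreal (t z)" using elim by simp
      then show "(\<Sum>i<N. Re (f i i z)) \<le> t z" by (subst (asm) ennreal_le_iff) (simp_all add: t_def)
    qed
  qed
  \<comment> \<open>The double sum of products of diagonal entries factors into the square of a
    partial trace.\<close>
  have HS: "AE z in \<rho>. \<forall>N. (\<Sum>(i, j)\<in>{..<N} \<times> {..<N}. (norm (f i j z))\<^sup>2) \<le> (t z)\<^sup>2"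
    using psd part pos
  proof eventually_elim
    case (elim z)
    show ?case
    proof
      fix N
      have "(\<Sum>(i, j)\<in>{..<N} \<times> {..<N}. (norm (f i j z))\<^sup>2) \<le> (\<Sum>(i, j)\<in>{..<N} \<times> {..<N}. Re (f i i z) * Re (f j j z))"
        using elim(1) by (intro sum_mono) auto
      also have "\<dots> = (\<Sum>i<N. Re (f i i z))\<^sup>2"
        by (simp add: sum.cartesian_product[symmetric] power2_eq_square sum_product)
      also have "\<dots> \<le> (t z)\<^sup>2"
        using elim(2,3) by (intro power_mono sum_nonneg) auto
      finally show "(\<Sum>(i, j)\<in>{..<N} \<times> {..<N}. (norm (f i j z))\<^sup>2) \<le> (t z)\<^sup>2" .
    qed
  qed
  have gHS: "AE z in \<rho>. \<forall>N. (\<Sum>(i, j)\<in>{..<N} \<times> {..<N}. (norm (g i j z))\<^sup>2) \<le> 1"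
    using HS
  proof eventually_elim
    case (elim z)
    show ?case
    proof
      fix N
      have "(\<Sum>(i, j)\<in>{..<N} \<times> {..<N}. (norm (g i j z))\<^sup>2) = (\<Sum>(i, j)\<in>{..<N} \<times> {..<N}. (norm (f i j z))\<^sup>2) / (t z)\<^sup>2"
        by (simp add: g_def norm_divide power_divide sum_divide_distrib case_prod_unfold)
      also have "\<dots> \<le> 1" using elim by (cases "t z = 0") (auto simp: divide_le_eq)
      finally show "(\<Sum>(i, j)\<in>{..<N} \<times> {..<N}. (norm (g i j z))\<^sup>2) \<le> 1" .
    qed
  qed
  have g\<nu>HS: "AE z in \<nu>. \<forall>N. (\<Sum>(i, j)\<in>{..<N} \<times> {..<N}. (norm (g i j z))\<^sup>2) \<le> 1"
    unfolding \<nu>_def using gHS by (subst AE_density) auto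
  have g1: "AE z in \<nu>. (norm (g i j z))\<^sup>2 \<le> 1" for i j
    using g\<nu>HS
  proof eventually_elim
    case (elim z)
    have "(norm (g i j z))\<^sup>2 \<le> (\<Sum>(i, j)\<in>{..<Suc (max i j)} \<times> {..<Suc (max i j)}. (norm (g i j z))\<^sup>2)"
      using member_le_sum[of "(i, j)" "{..<Suc (max i j)} \<times> {..<Suc (max i j)}" "\<lambda>(i, j). (norm (g i j z))\<^sup>2"] by (auto simp: less_Suc_eq_le)
    then show ?case using elim order_trans by blast
  qed
  have g2: "g i j \<in> l2 \<nu>" for i j
    by (rule l2_dominated[OF gm _ g1]) simp
  have "(\<Sum>(i, j)\<in>{..<N} \<times> {..<N}. (nm \<nu> (g i j))\<^sup>2) \<le> measure \<nu> (space \<nu>)" for N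
  proof -
    have "(\<Sum>(i, j)\<in>{..<N} \<times> {..<N}. (nm \<nu> (g i j))\<^sup>2) = (\<integral>z. (\<Sum>(i, j)\<in>{..<N} \<times> {..<N}. (norm (g i j z))\<^sup>2) \<partial>\<nu>)"
      unfolding nm_power2 case_prod_unfold
      by (rule Bochner_Integration.integral_sum[symmetric]) (rule l2_integrable[OF g2])
    also have "\<dots> \<le> (\<integral>z. 1 \<partial>\<nu>)"
      using g\<nu>HS l2_integrable[OF g2] by (intro integral_mono_AE) (auto simp: case_prod_unfold)
    finally show ?thesis by simp
  qed
  moreover have "(\<integral>z. \<Psi> z * f i j z \<partial>\<rho>) = (\<integral>z. \<Psi> z * g i j z \<partial>\<nu>)" if [measurable]: "\<Psi> \<in> borel_measurable borel" for i j \<Psi>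
  proof -
    have "(\<integral>z. \<Psi> z * g i j z \<partial>\<nu>) = (\<integral>z. t z *\<^sub>R (\<Psi> z * g i j z) \<partial>\<rho>)"
      unfolding \<nu>_def by (rule integral_density) (auto simp: t_def)
    also have "\<dots> = (\<integral>z. \<Psi> z * f i j z \<partial>\<rho>)"
    proof (rule integral_cong_AE)
      show "AE z in \<rho>. t z *\<^sub>R (\<Psi> z * g i j z) = \<Psi> z * f i j z"
        using HS
      proof eventually_elim
        case (elim z)
        show ?case
        proof (cases "t z = 0")
          case True
          have "(norm (f i j z))\<^sup>2 \<le> (\<Sum>(i, j)\<in>{..<Suc (max i j)} \<times> {..<Suc (max i j)}. (norm (f i j z))\<^sup>2)"
            using member_le_sum[of "(i, j)" "{..<Suc (max i j)} \<times> {..<Suc (max i j)}" "\<lambda>(i, j). (norm (f i j z))\<^sup>2"] by (auto simp: less_Suc_eq_le)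
          then have "(norm (f i j z))\<^sup>2 \<le> (t z)\<^sup>2" using elim order_trans by blast
          then show ?thesis using True by simp
        qed (simp add: g_def scaleR_conv_of_real)
      qed
    qed measurable
    finally show ?thesis ..
  qed
  ultimately show ?thesis using fin\<nu> s\<nu> g2 by blast
qed

text \<open>The products of \<open>E k\<close> with \<open>g k\<close> are orthogonal because the
  \<open>E k\<close> are, so square summability of the \<open>g k\<close> makes their sum converge.
  Square integrable slices are arranged at every point, since \<open>L2_weak_star\<close> asks for a
  measure at every point.\<close>

theorem (in pair_sigma_finite) ex_orthogonal_kernel:
  assumes E: "orthosys M1 E" and g: "\<And>k. g k \<in> l2 M2"
    and I: "\<And>N. finite (I N)" "incseq I" "\<And>k. \<exists>N. k \<in> I N"
    and bound: "\<And>N. (\<Sum>k\<in>I N. (nm M2 (g k))\<^sup>2) \<le> B"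
  shows "\<exists>H\<in>l2 (M1 \<Otimes>\<^sub>M M2). (\<forall>z\<in>space M1. (\<lambda>x. H (z, x)) \<in> l2 M2) \<and>
    (\<forall>k. \<forall>\<Psi>\<in>l2 M2. ip (M1 \<Otimes>\<^sub>M M2) H (\<lambda>(z, x). E k z * \<Psi> x) = of_real ((nm M1 (E k))\<^sup>2) * ip M2 (g k) \<Psi>)"
proof -
  note El = orthosys_l2[OF E]
  let ?M = "M1 \<Otimes>\<^sub>M M2"
  define F where "F k = (\<lambda>(z, x). E k z * g k x)" for k
  have F: "F k \<in> l2 ?M" for k unfolding F_def by (rule l2_tensor[OF El g])
  have Forth: "ip ?M (F k) (F l) = 0" if "k \<noteq> l" for k l
    unfolding F_def ip_tensor[OF El g El g] using orthosys_orth[OF E that] by simp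
  have "(\<Sum>k\<in>I N. (norm (1::complex))\<^sup>2 * (nm ?M (F k))\<^sup>2) \<le> B" for N
  proof -
    have "(nm ?M (F k))\<^sup>2 \<le> (nm M2 (g k))\<^sup>2" for k
      unfolding F_def nm_tensor[OF El g] using orthosys_nm_le_1[OF E, of k]
      by (intro power_mono) (auto intro: mult_left_le_one_le)
    then have "(\<Sum>k\<in>I N. (norm (1::complex))\<^sup>2 * (nm ?M (F k))\<^sup>2) \<le> (\<Sum>k\<in>I N. (nm M2 (g k))\<^sup>2)"
      by (intro sum_mono) simp
    then show ?thesis using bound[of N] by (rule order_trans)
  qed
  from orthogonal_series_converges[OF F Forth I(1,2) this]
  obtain H0 where H0: "H0 \<in> l2 ?M" and lim: "(\<lambda>N. nm ?M (\<lambda>z. (\<Sum>k\<in>I N. F k z) - H0 z)) \<longlonglongrightarrow> 0" by auto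
  have [measurable]: "H0 \<in> borel_measurable ?M" using H0 by (rule l2_measurable)
  \<comment> \<open>Slices that fail to be square integrable are replaced by 0; the points at which
    this happens form a null set.\<close>
  define good where "good z \<longleftrightarrow> (\<integral>\<^sup>+x. ennreal ((norm (H0 (z, x)))\<^sup>2) \<partial>M2) < \<infinity>" for z
  define H where "H = (\<lambda>(z, x). if good z then H0 (z, x) else 0)"
  have [measurable]: "Measurable.pred M1 good" unfolding good_def by measurable
  have Hm [measurable]: "H \<in> borel_measurable ?M" unfolding H_def by measurable
  have slice: "(\<lambda>x. H (z, x)) \<in> l2 M2" if z: "z \<in> space M1" for z
  proof (rule l2I)
    have [measurable]: "(\<lambda>x. H0 (z, x)) \<in> borel_measurable M2" using z by measurable
    show "(\<lambda>x. H (z, x)) \<in> borel_measurable M2" using z by measurable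
    show "integrable M2 (\<lambda>x. (norm (H (z, x)))\<^sup>2)"
    proof (cases "good z")
      case True
      then have "integrable M2 (\<lambda>x. (norm (H0 (z, x)))\<^sup>2)"
        by (intro integrableI_nonneg) (auto simp: good_def)
      then show ?thesis using True by (simp add: H_def)
    qed (simp add: H_def)
  qed
  have eq: "AE w in ?M. H0 w = H w"
  proof -
    have "AE z in M1. good z"
      using l2_slice_fst[OF H0] by eventually_elim (auto simp: good_def dest!: l2_integrable simp: integrable_iff_bounded)
    then have "AE z in M1. AE x in M2. H0 (z, x) = H (z, x)"
      by eventually_elim (simp add: H_def)
    then show ?thesis
      by (intro AE_pair_measure) (auto intro!: borel_measurable_eq simp: pred_def[symmetric])
  qed
  have H: "H \<in> l2 ?M" by (rule l2_AE_cong[OF H0 Hm eq])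
  have "ip ?M H (\<lambda>(z, x). E k z * \<Psi> x) = of_real ((nm M1 (E k))\<^sup>2) * ip M2 (g k) \<Psi>" if \<Psi>: "\<Psi> \<in> l2 M2" for k \<Psi>
  proof -
    let ?t = "\<lambda>(z, x). E k z * \<Psi> x"
    have t: "?t \<in> l2 ?M" by (rule l2_tensor[OF El \<Psi>])
    have "ip ?M H ?t = ip ?M H0 ?t"
      using eq by (intro ip_AE_cong) (auto intro: l2_measurable[OF t])
    also have "\<dots> = of_real ((nm M1 (E k))\<^sup>2) * ip M2 (g k) \<Psi>"
    proof (rule LIMSEQ_unique)
      show "(\<lambda>N. ip ?M (\<lambda>z. \<Sum>k\<in>I N. F k z) ?t) \<longlonglongrightarrow> ip ?M H0 ?t"
        by (rule tendsto_ip[OF _ t H0 t lim]) (simp_all add: l2_sum F nm_def)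
      obtain N0 where "k \<in> I N0" using I(3) by blast
      then have "k \<in> I N" if "N0 \<le> N" for N using I(2) that by (meson incseqD subsetD)
      moreover have "ip ?M (\<lambda>z. \<Sum>k\<in>I N. F k z) ?t = of_real ((nm M1 (E k))\<^sup>2) * ip M2 (g k) \<Psi>" if k: "k \<in> I N" for N
      proof -
        have "ip ?M (\<lambda>z. \<Sum>k\<in>I N. F k z) ?t = (\<Sum>l\<in>I N. ip ?M (F l) ?t)"
          by (rule ip_sum_left[OF I(1) F t])
        also have "\<dots> = (\<Sum>l\<in>I N. if l = k then of_real ((nm M1 (E k))\<^sup>2) * ip M2 (g k) \<Psi> else 0)"
        proof (intro sum.cong refl)
          fix l
          show "ip ?M (F l) ?t = (if l = k then of_real ((nm M1 (E k))\<^sup>2) * ip M2 (g k) \<Psi> else 0)"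
            unfolding F_def ip_tensor[OF El g El \<Psi>] using orthosys_orth[OF E, of l k] by (auto simp: ip_self)
        qed
        finally show ?thesis using k I(1) by simp
      qed
      ultimately have "\<forall>\<^sub>F N in sequentially. ip ?M (\<lambda>z. \<Sum>k\<in>I N. F k z) ?t = of_real ((nm M1 (E k))\<^sup>2) * ip M2 (g k) \<Psi>"
        by (intro eventually_sequentiallyI[of N0]) blast
      then show "(\<lambda>N. ip ?M (\<lambda>z. \<Sum>k\<in>I N. F k z) ?t) \<longlonglongrightarrow> of_real ((nm M1 (E k))\<^sup>2) * ip M2 (g k) \<Psi>"
        by (rule tendsto_eventually)
    qed
    finally show ?thesis .
  qed
  then show ?thesis using H slice by blast
qed

lemma indicator_C0_measurable:
  fixes f :: "'a::euclidean_space \<Rightarrow> complex"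
  assumes X: "closed X" and f: "continuous_on X f"
  shows "(\<lambda>x. indicator X x *\<^sub>R f x) \<in> borel_measurable (borel :: 'a::euclidean_space measure)"
  by (rule borel_measurable_continuous_on_indicator[OF _ f]) (use X in simp)

text \<open>The variation of a slice measure is at most the L^1 norm of the slice; on a finite
  measure this is bounded by a constant times its L^2 norm, whose square is integrable by
  Fubini.\<close>

theorem kernel_L2_weak_star:
  fixes H :: "'b::euclidean_space \<times> 'a::euclidean_space \<Rightarrow> complex"
  assumes X: "closed X" and fin: "finite_measure \<nu>" and s\<nu>: "sets \<nu> = sets borel"
    and H: "H \<in> l2 (lborel \<Otimes>\<^sub>M \<nu>)" and slice: "\<And>z. (\<lambda>x. H (z, x)) \<in> l2 \<nu>"
  shows "(\<lambda>z A. \<integral>x. indicator A x *\<^sub>R H (z, x) \<partial>\<nu>) \<in> L2_weak_star X"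
proof -
  interpret \<nu>: finite_measure \<nu> by (rule fin)
  interpret P: pair_sigma_finite "lborel :: 'b measure" \<nu> ..
  note [measurable_cong] = s\<nu>
  have [measurable]: "H \<in> borel_measurable (lborel \<Otimes>\<^sub>M \<nu>)" using H by (rule l2_measurable)
  have Xb: "X \<in> sets borel" using X by simp
  have one: "(\<lambda>_. 1) \<in> l2 \<nu>" by (rule l2I) auto
  have int: "integrable \<nu> (\<lambda>x. H (z, x))" for z
    using l2_mult_integrable[OF slice[of z] one] by simp
  show ?thesis
    unfolding L2_weak_star_def
  proof (intro CollectI conjI allI ballI)
    show "(\<lambda>A. \<integral>x. indicator A x *\<^sub>R H (z, x) \<partial>\<nu>) \<in> Mb X" for z
      by (rule density_in_Mb[OF Xb fin s\<nu> int])
    fix \<Phi> assume \<Phi>: "\<Phi> \<in> C0 X"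
    then have m: "(\<lambda>x. indicator X x *\<^sub>R \<Phi> x) \<in> borel_measurable borel"
      by (intro indicator_C0_measurable[OF X]) (simp add: C0_def)
    obtain B where B: "\<forall>x\<in>X. norm (\<Phi> x) \<le> B" using C0_bounded[OF \<Phi>] by blast
    have "complex_integral X (\<lambda>A. \<integral>x. indicator A x *\<^sub>R H (z, x) \<partial>\<nu>) \<Phi> = (\<integral>x. (indicator X x *\<^sub>R \<Phi> x) * H (z, x) \<partial>\<nu>)" for z
      by (rule complex_integral_density[OF Xb fin s\<nu> int m]) (use B in auto)
    moreover have "(\<lambda>z. \<integral>x. (indicator X x *\<^sub>R \<Phi> x) * H (z, x) \<partial>\<nu>) \<in> borel_measurable lborel"
      using m by measurable
    ultimately show "(\<lambda>z. complex_integral X (\<lambda>A. \<integral>x. indicator A x *\<^sub>R H (z, x) \<partial>\<nu>) \<Phi>) \<in> borel_measurable lebesgue"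
      by (simp add: borel_imp_lebesgue_measurable)
  next
    have le: "(total_variation X (\<lambda>A. \<integral>x. indicator A x *\<^sub>R H (z, x) \<partial>\<nu>))\<^sup>2
        \<le> ennreal ((nm \<nu> (\<lambda>x. H (z, x)))\<^sup>2 * (nm \<nu> (\<lambda>_. 1))\<^sup>2)" for z
    proof -
      have n2: "(\<lambda>x. of_real (norm (H (z, x)))) \<in> l2 \<nu>"
        using l2_integrable[OF slice[of z]] l2_measurable[OF slice[of z]] by (intro l2I) auto
      have "(\<integral>x. norm (H (z, x)) \<partial>\<nu>) = Re (ip \<nu> (\<lambda>x. of_real (norm (H (z, x)))) (\<lambda>_. 1))"
        by (simp add: ip_def)
      also have "\<dots> \<le> nm \<nu> (\<lambda>x. of_real (norm (H (z, x)))) * nm \<nu> (\<lambda>_. 1)"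
        by (rule order_trans[OF complex_Re_le_cmod Cauchy_Schwarz_l2[OF n2 one]])
      also have "nm \<nu> (\<lambda>x. complex_of_real (norm (H (z, x)))) = nm \<nu> (\<lambda>x. H (z, x))"
        by (simp add: nm_def)
      finally have "ennreal (\<integral>x. norm (H (z, x)) \<partial>\<nu>) \<le> ennreal (nm \<nu> (\<lambda>x. H (z, x)) * nm \<nu> (\<lambda>_. 1))"
        by (rule ennreal_leI)
      with total_variation_density_le[OF Xb fin s\<nu> int]
      have "total_variation X (\<lambda>A. \<integral>x. indicator A x *\<^sub>R H (z, x) \<partial>\<nu>) \<le> ennreal (nm \<nu> (\<lambda>x. H (z, x)) * nm \<nu> (\<lambda>_. 1))"
        by (rule order_trans)
      then have "(total_variation X (\<lambda>A. \<integral>x. indicator A x *\<^sub>R H (z, x) \<partial>\<nu>))\<^sup>2 \<le> (ennreal (nm \<nu> (\<lambda>x. H (z, x)) * nm \<nu> (\<lambda>_. 1)))\<^sup>2"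
        by (intro power_mono) auto
      then show ?thesis by (simp add: ennreal_power power_mult_distrib)
    qed
    have "(\<integral>\<^sup>+z. (total_variation X (\<lambda>A. \<integral>x. indicator A x *\<^sub>R H (z, x) \<partial>\<nu>))\<^sup>2 \<partial>lebesgue)
        \<le> (\<integral>\<^sup>+z. ennreal ((nm \<nu> (\<lambda>x. H (z, x)))\<^sup>2 * (nm \<nu> (\<lambda>_. 1))\<^sup>2) \<partial>lebesgue)"
      by (intro nn_integral_mono le)
    also have "\<dots> = (\<integral>\<^sup>+z. ennreal ((nm \<nu> (\<lambda>x. H (z, x)))\<^sup>2 * (nm \<nu> (\<lambda>_. 1))\<^sup>2) \<partial>lborel)"
      by (rule nn_integral_completion)
    also have "\<dots> < \<infinity>"
      using P.integrable_nm_slice_fst[OF H] by (subst nn_integral_eq_integral) auto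
    finally show "(\<integral>\<^sup>+z. (total_variation X (\<lambda>A. \<integral>x. indicator A x *\<^sub>R H (z, x) \<partial>\<nu>))\<^sup>2 \<partial>lebesgue) < \<infinity>" .
  qed
qed

text \<open>The exceptional set is enlarged to a Borel null set, as the exchange of the almost
  everywhere quantifiers requires measurability.\<close>

lemma AE_lborel_slices:
  assumes "AE z in (lborel :: ('a::euclidean_space \<times> 'b::euclidean_space) measure). Q z"
  shows "AE x in lborel. AE y in lborel. Q (x, y)" and "AE y in lborel. AE x in lborel. Q (x, y)"
proof -
  obtain N :: "('a \<times> 'b) set" where N: "N \<in> null_sets lborel" "{z. \<not> Q z} \<subseteq> N"
    using assms by (auto elim!: AE_E simp: null_sets_def)
  have [measurable]: "N \<in> sets (lborel \<Otimes>\<^sub>M lborel)" using N(1) unfolding lborel_prod by (simp add: null_sets_def)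
  have "AE z in lborel \<Otimes>\<^sub>M lborel. z \<notin> N" using AE_not_in[OF N(1)] by (simp only: lborel_prod)
  then have 1: "AE x in lborel. AE y in lborel. (x, y) \<notin> N" by (rule lborel_pair.AE_pair)
  then have 2: "AE y in lborel. AE x in lborel. (x, y) \<notin> N"
    by (subst (asm) lborel_pair.AE_commute) measurable
  have sub: "(x, y) \<notin> N \<Longrightarrow> Q (x, y)" for x y using N(2) by blast
  show "AE x in lborel. AE y in lborel. Q (x, y)"
    by (rule eventually_mono[OF 1], erule eventually_mono, rule sub)
  show "AE y in lborel. AE x in lborel. Q (x, y)"
    by (rule eventually_mono[OF 2], erule eventually_mono, rule sub)
qed

text \<open>Extension by zero off the manifold lets the integrand be used with Borel measures on the
  whole product space.\<close>

definition test_symbol :: "'b::euclidean_space set \<Rightarrow> ('a::euclidean_space \<Rightarrow> complex) \<Rightarrow> ('a \<Rightarrow> complex) \<Rightarrow>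
    ('b \<Rightarrow> complex) \<Rightarrow> 'a \<times> 'b \<Rightarrow> complex" where
  "test_symbol P \<phi> \<theta> \<psi> z = indicator (UNIV \<times> P) z *\<^sub>R (case z of (x, \<xi>) \<Rightarrow> \<phi> x * cnj (\<theta> x) * \<psi> \<xi>)"

lemma test_symbol:
  fixes P :: "'b::euclidean_space set" and \<phi> \<theta> :: "'a::euclidean_space \<Rightarrow> complex"
  assumes P: "compact P" and \<phi>: "\<phi> \<in> C0 UNIV" and \<theta>: "\<theta> \<in> C0 UNIV" and \<psi>: "continuous_on P \<psi>"
  shows "test_symbol P \<phi> \<theta> \<psi> \<in> borel_measurable borel"
    and "\<exists>B\<ge>0. \<forall>z. norm (test_symbol P \<phi> \<theta> \<psi> z) \<le> B"
    and "\<exists>B. \<forall>z\<in>UNIV \<times> P. norm (case z of (x, \<xi>) \<Rightarrow> \<phi> x * cnj (\<theta> x) * \<psi> \<xi>) \<le> B"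
proof -
  have "continuous_on (UNIV \<times> P) (\<lambda>z. \<phi> (fst z) * cnj (\<theta> (fst z)) * \<psi> (snd z))"
  proof (intro continuous_on_mult continuous_on_cnj)
    have c: "continuous_on (UNIV \<times> P) (\<lambda>z. f (fst z))" if "f \<in> C0 UNIV" for f :: "'a \<Rightarrow> complex"
      using that by (intro continuous_on_compose2[OF _ continuous_on_fst[OF continuous_on_id]]) (auto simp: C0_def)
    show "continuous_on (UNIV \<times> P) (\<lambda>z. \<phi> (fst z))" "continuous_on (UNIV \<times> P) (\<lambda>z. \<theta> (fst z))"
      by (rule c[OF \<phi>], rule c[OF \<theta>])
    show "continuous_on (UNIV \<times> P) (\<lambda>z. \<psi> (snd z))"
      by (rule continuous_on_compose2[OF \<psi> continuous_on_snd[OF continuous_on_id]]) auto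
  qed
  moreover have "closed (UNIV \<times> P)" by (intro closed_Times closed_UNIV compact_imp_closed P)
  ultimately show "test_symbol P \<phi> \<theta> \<psi> \<in> borel_measurable borel"
    unfolding test_symbol_def[abs_def] case_prod_unfold by (intro indicator_C0_measurable)
  obtain B1 where B1: "0 \<le> B1" "\<And>x. norm (\<phi> x) \<le> B1" using C0_bounded[OF \<phi>] by auto
  obtain B2 where B2: "0 \<le> B2" "\<And>x. norm (\<theta> x) \<le> B2" using C0_bounded[OF \<theta>] by auto
  have "bounded (\<psi> ` P)" by (intro compact_imp_bounded compact_continuous_image \<psi> P)
  then obtain B3 where B3: "\<And>\<xi>. \<xi> \<in> P \<Longrightarrow> norm (\<psi> \<xi>) \<le> B3" by (auto simp: bounded_iff)
  have le: "norm (\<phi> x * cnj (\<theta> x) * \<psi> \<xi>) \<le> B1 * B2 * max B3 0" if "\<xi> \<in> P" for x \<xi>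
    unfolding norm_mult complex_mod_cnj
    using B1 B2 B3[OF that] by (intro mult_mono) auto
  then show "\<exists>B. \<forall>z\<in>UNIV \<times> P. norm (case z of (x, \<xi>) \<Rightarrow> \<phi> x * cnj (\<theta> x) * \<psi> \<xi>) \<le> B" by auto
  show "\<exists>B\<ge>0. \<forall>z. norm (test_symbol P \<phi> \<theta> \<psi> z) \<le> B"
    using le B1(1) B2(1)
    by (intro exI[of _ "B1 * B2 * max B3 0"]) (auto simp: test_symbol_def indicator_def)
qed

lemma integrable_bounded_mult:
  fixes f g :: "'a \<Rightarrow> complex"
  assumes g: "integrable M g" and f: "f \<in> borel_measurable M" "\<And>x. norm (f x) \<le> B"
  shows "integrable M (\<lambda>x. f x * g x)"
proof (rule Bochner_Integration.integrable_bound)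
  show "integrable M (\<lambda>x. B * norm (g x))" using g by simp
  show "AE x in M. norm (f x * g x) \<le> norm (B * norm (g x))"
    using f(2) order_trans[OF norm_ge_zero f(2)] by (intro AE_I2) (simp add: norm_mult abs_mult mult_right_mono)
qed (use f(1) g in measurable)

context
  fixes \<alpha> :: "'d::finite \<Rightarrow> real"
  assumes \<alpha>: "\<And>k. \<alpha> k > 0"
begin

lemma multiplier_form_C0:
  fixes \<phi> \<theta> :: "real^'d \<Rightarrow> complex"
  assumes \<phi>: "\<phi> \<in> C0 UNIV" and \<theta>: "\<theta> \<in> C0 UNIV" and \<psi>: "continuous_on (Pman \<alpha>) \<psi>"
  shows "\<exists>C. bounded_sesquilinear_l2 lebesgue (multiplier_form (\<psi> \<circ> Pproj \<alpha>) \<phi> \<theta>) C"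
proof -
  obtain B where "\<And>\<xi>. norm ((\<psi> \<circ> Pproj \<alpha>) \<xi>) \<le> B" using Pman_symbol(2)[OF \<alpha> \<psi>] by blast
  moreover obtain B1 where "\<And>x. norm (\<phi> x) \<le> B1" using C0_bounded[OF \<phi>] by auto
  moreover obtain B2 where "\<And>x. norm (\<theta> x) \<le> B2" using C0_bounded[OF \<theta>] by auto
  ultimately show ?thesis
    using multiplier_form_sesquilinear[OF Pman_symbol(1)[OF \<alpha> \<psi>] _ C0_measurable[OF \<phi>] _ C0_measurable[OF \<theta>]] by blast
qed

text \<open>At \<open>k = 1\<close> the scaled mollifier is \<open>\<omega>\<close> itself, so the
  regularised functions are pairings with translates of \<open>\<omega>\<close>.\<close>

lemma admissible_regularized:
  assumes "admissible \<alpha> \<omega> v"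
  shows "\<exists>\<mu>. (\<forall>p q. \<mu> p q \<in> Mb (UNIV \<times> Pman \<alpha>)) \<and>
    (\<forall>p q. \<forall>\<phi>\<in>C0 UNIV. \<forall>\<theta>\<in>C0 UNIV. \<forall>\<psi>. continuous_on (Pman \<alpha>) \<psi> \<longrightarrow>
      (\<lambda>n. \<integral>x. multiplier_op (\<psi> \<circ> Pproj \<alpha>) (\<lambda>x. \<phi> x * regularize \<omega> 1 (v n) (x, p)) x
                 * cnj (\<theta> x * regularize \<omega> 1 (v n) (x, q)) \<partial>lebesgue)
      \<longlonglongrightarrow> complex_integral (UNIV \<times> Pman \<alpha>) (\<mu> p q) (\<lambda>(x, \<xi>). \<phi> x * cnj (\<theta> x) * \<psi> \<xi>))"
proof -
  define R where "R k p q m \<longleftrightarrow> m \<in> Mb (UNIV \<times> Pman \<alpha>) \<and>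
    (\<forall>\<phi>\<in>C0 UNIV. \<forall>\<theta>\<in>C0 UNIV. \<forall>\<psi>. continuous_on (Pman \<alpha>) \<psi> \<longrightarrow>
      (\<lambda>n. \<integral>x. multiplier_op (\<psi> \<circ> Pproj \<alpha>) (\<lambda>x. \<phi> x * regularize \<omega> k (v n) (x, p)) x
                 * cnj (\<theta> x * regularize \<omega> k (v n) (x, q)) \<partial>lebesgue)
      \<longlonglongrightarrow> complex_integral (UNIV \<times> Pman \<alpha>) m (\<lambda>(x, \<xi>). \<phi> x * cnj (\<theta> x) * \<psi> \<xi>))" for k p q m
  have "\<exists>\<mu>. \<forall>k\<ge>1. \<forall>p q. R k p q (\<mu> k p q)"
    using assms unfolding admissible_def R_def by (rule exE) (rule exI, assumption)
  then obtain \<mu> where "\<And>p q. R (1::nat) p q (\<mu> (1::nat) p q)" by auto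
  then show ?thesis unfolding R_def by (intro exI[of _ "\<mu> (1::nat)"]) simp
qed

text \<open>Admissibility speaks of pairs of translates. Expanding \<open>e i\<close> and
  \<open>e j\<close> in translates turns it into a statement on coefficient functions, and all limit
  measures involved have densities with respect to one \<open>\<rho>\<close>.\<close>

theorem admissible_densities:
  fixes \<omega> :: "real^'m::finite \<Rightarrow> real" and v w :: "nat \<Rightarrow> (real^'d) \<times> (real^'m) \<Rightarrow> complex"
  assumes \<omega>: "mollifier \<omega>" and adm: "admissible \<alpha> \<omega> v"
    and w: "\<And>n. w n \<in> l2 lborel" and vw: "\<And>n. AE z in lborel. v n z = w n z"
  shows "\<exists>(e :: nat \<Rightarrow> real^'m \<Rightarrow> complex) \<rho> f. orthosys lborel e \<and> total_in_l2 lborel e \<and>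
    finite_measure \<rho> \<and> sets \<rho> = sets borel \<and> (\<forall>i j. integrable \<rho> (f i j)) \<and>
    (\<forall>i j z. z \<notin> UNIV \<times> Pman \<alpha> \<longrightarrow> f i j z = 0) \<and>
    (\<forall>\<phi>\<in>C0 UNIV. \<forall>\<theta>\<in>C0 UNIV. \<forall>\<psi>. continuous_on (Pman \<alpha>) \<psi> \<longrightarrow>
      (\<forall>i j. (\<lambda>n. multiplier_form (\<psi> \<circ> Pproj \<alpha>) \<phi> \<theta>
            (\<lambda>x. ip lborel (\<lambda>y. w n (x, y)) (e i)) (\<lambda>x. ip lborel (\<lambda>y. w n (x, y)) (e j)))
        \<longlonglongrightarrow> (\<integral>z. test_symbol (Pman \<alpha>) \<phi> \<theta> \<psi> z * f i j z \<partial>\<rho>)))"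
proof -
  let ?P = "Pman \<alpha>" and ?X = "(UNIV :: (real^'d) set) \<times> Pman \<alpha>"
  have P: "compact ?P" by (rule compact_Pman[OF \<alpha>])
  have X: "?X \<in> sets borel" by (intro borel_closed closed_Times closed_UNIV compact_imp_closed P)
  have \<omega>c: "continuous_on UNIV \<omega>"
    using \<omega> by (auto simp: mollifier_def Cc_infinity_def dest: spec[of _ 0])
  have [measurable]: "\<omega> \<in> borel_measurable borel" by (rule borel_measurable_continuous_onI[OF \<omega>c])
  obtain K where K: "compact K" "\<And>x. x \<notin> K \<Longrightarrow> \<omega> x = 0"
    using \<omega> by (auto simp: mollifier_def Cc_infinity_def)
  obtain R0 where R0: "\<And>x. x \<in> K \<Longrightarrow> norm x \<le> R0" using compact_imp_bounded[OF K(1)] by (auto simp: bounded_iff)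
  have supp: "\<omega> x = 0" if "norm x > max R0 0" for x using K(2)[of x] R0[of x] that by auto
  have \<omega>1: "(\<integral>x. \<omega> x \<partial>lborel) \<noteq> 0"
    using \<omega> by (simp add: mollifier_def integral_completion)
  have "\<exists>p :: nat \<Rightarrow> real^'m. (\<forall>a. (\<lambda>y. complex_of_real (\<omega> (p a - y))) \<in> l2 lborel) \<and>
      total_in_l2 lborel (\<lambda>a y. complex_of_real (\<omega> (p a - y)))"
    by (rule countable_translates_total[OF \<omega>c _ max.cobounded2 \<omega>1]) (rule supp)
  then obtain p :: "nat \<Rightarrow> real^'m" where h: "\<And>a. (\<lambda>y. complex_of_real (\<omega> (p a - y))) \<in> l2 lborel"
    and tot: "total_in_l2 lborel (\<lambda>a y. complex_of_real (\<omega> (p a - y)))"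
    by blast
  define h where "h a y = complex_of_real (\<omega> (p a - y))" for a y
  have h: "h a \<in> l2 lborel" for a unfolding h_def by (rule h)
  have tot: "total_in_l2 lborel h" unfolding h_def by (rule tot)
  have hm [measurable]: "h a \<in> borel_measurable borel" for a using l2_measurable[OF h] by simp
  define e where "e = gram_schmidt lborel h"
  have e: "orthosys lborel e" "total_in_l2 lborel e"
    unfolding e_def by (rule orthosys_gram_schmidt[OF h], rule total_gram_schmidt[OF h tot])
  obtain c where c: "\<And>i y. e i y = (\<Sum>a\<le>i. c i a * h a y)"
    using gram_schmidt_combination[where h = h, OF h] unfolding e_def by blast
  have w': "w n \<in> l2 (lborel \<Otimes>\<^sub>M lborel)" for n using w by (simp add: lborel_prod)
  have [measurable]: "w n \<in> borel_measurable borel" for n using l2_measurable[OF w] by simp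
  define W where "W n a x = ip lborel (\<lambda>y. w n (x, y)) (h a)" for n a x
  have W: "W n a \<in> l2 lborel" for n a unfolding W_def by (rule lborel_pair.l2_coefficient[OF w' h])
  then have Wl: "W n a \<in> l2 lebesgue" for n a
    using l2_measurable[OF W] by (subst l2_lebesgue_iff) auto
  \<comment> \<open>Almost every slice of \<open>v n\<close> agrees almost everywhere with that of
    its Borel representative \<open>w n\<close>, and \<open>h a\<close> is real, so the
    regularisation at \<open>p a\<close> is an inner product with \<open>h a\<close>.\<close>
  have regW: "AE x in lebesgue. W n a x = regularize \<omega> 1 (v n) (x, p a)" for n a
  proof -
    have "AE x in lborel. W n a x = regularize \<omega> 1 (v n) (x, p a)"
      using AE_lborel_slices(1)[OF vw[of n]]
    proof eventually_elim
      case (elim x)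
      have "(\<lambda>y. w n (x, y) * h a y) \<in> borel_measurable borel" by measurable
      from borel_imp_lebesgue_measurable[OF this]
      have m: "(\<lambda>y. w n (x, y) * h a y) \<in> borel_measurable lebesgue" .
      have ae: "AE y in lebesgue. w n (x, y) * h a y = v n (x, y) * h a y"
        using AE_completion[OF elim] by eventually_elim simp
      have "regularize \<omega> 1 (v n) (x, p a) = (\<integral>y. v n (x, y) * h a y \<partial>lebesgue)"
        by (simp add: regularize_def mollifier_scaled_def h_def)
      also have "\<dots> = (\<integral>y. w n (x, y) * h a y \<partial>lebesgue)"
        using ae by (intro integral_cong_AE lebesgue_measurable_AE_cong[OF m ae] m) auto
      also have "\<dots> = (\<integral>y. w n (x, y) * h a y \<partial>lborel)" by (rule integral_completion) measurable
      finally show ?case by (simp add: W_def ip_def h_def)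
    qed
    then show ?thesis by (rule AE_completion)
  qed
  have regL: "(\<lambda>x. regularize \<omega> 1 (v n) (x, p a)) \<in> l2 lebesgue" for n a
    by (rule l2_AE_cong[OF Wl lebesgue_measurable_AE_cong[OF l2_measurable[OF Wl] regW] regW])
  obtain \<mu> where \<mu>: "\<And>p q. \<mu> p q \<in> Mb ?X"
    and lim: "\<And>p q \<phi> \<theta> \<psi>. \<phi> \<in> C0 UNIV \<Longrightarrow> \<theta> \<in> C0 UNIV \<Longrightarrow> continuous_on ?P \<psi> \<Longrightarrow>
      (\<lambda>n. \<integral>x. multiplier_op (\<psi> \<circ> Pproj \<alpha>) (\<lambda>x. \<phi> x * regularize \<omega> 1 (v n) (x, p)) x
                       * cnj (\<theta> x * regularize \<omega> 1 (v n) (x, q)) \<partial>lebesgue)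
            \<longlonglongrightarrow> complex_integral ?X (\<mu> p q) (\<lambda>(x, \<xi>). \<phi> x * cnj (\<theta> x) * \<psi> \<xi>)"
    using admissible_regularized[OF adm] by blast
  \<comment> \<open>The measures for pairs of translates are arranged in one sequence.\<close>
  define \<mu>' where "\<mu>' k = \<mu> (p (fst (prod_decode k))) (p (snd (prod_decode k)))" for k
  have "\<mu>' k \<in> Mb ?X" for k unfolding \<mu>'_def by (rule \<mu>)
  from Mb_common_density[where \<mu> = \<mu>', OF X this] obtain \<rho> g where \<rho>: "finite_measure \<rho>" "sets \<rho> = sets borel" "\<And>k. integrable \<rho> (g k)"
    and dens: "\<And>k f B. (\<lambda>x. indicator ?X x *\<^sub>R f x) \<in> borel_measurable borel \<Longrightarrow> (\<forall>x\<in>?X. norm (f x) \<le> B) \<Longrightarrow>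
      complex_integral ?X (\<mu>' k) f = (\<integral>x. (indicator ?X x *\<^sub>R f x) * g k x \<partial>\<rho>)"
    by blast
  \<comment> \<open>A coefficient depends conjugate linearly on the basis vector, which yields
    \<open>cnj (c i a)\<close>; in the conjugate linear second slot the two conjugations cancel and
    \<open>c j b\<close> remains.\<close>
  define f where "f i j z = indicator ?X z *\<^sub>R (\<Sum>a\<le>i. \<Sum>b\<le>j. cnj (c i a) * (c j b * g (prod_encode (a, b)) z))" for i j z
  have f: "integrable \<rho> (f i j)" for i j
    unfolding f_def
    by (intro integrable_mult_indicator Bochner_Integration.integrable_sum integrable_mult_right \<rho>(3)) (use X \<rho>(2) in auto)
  have "(\<lambda>n. multiplier_form (\<psi> \<circ> Pproj \<alpha>) \<phi> \<theta>
            (\<lambda>x. ip lborel (\<lambda>y. w n (x, y)) (e i)) (\<lambda>x. ip lborel (\<lambda>y. w n (x, y)) (e j)))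
        \<longlonglongrightarrow> (\<integral>z. test_symbol ?P \<phi> \<theta> \<psi> z * f i j z \<partial>\<rho>)"
    if \<phi>: "\<phi> \<in> C0 UNIV" and \<theta>: "\<theta> \<in> C0 UNIV" and \<psi>: "continuous_on ?P \<psi>" for \<phi> \<theta> \<psi> i j
  proof -
    let ?Q = "multiplier_form (\<psi> \<circ> Pproj \<alpha>) \<phi> \<theta>"
    let ?S = "test_symbol ?P \<phi> \<theta> \<psi>"
    obtain C where Q: "bounded_sesquilinear_l2 lebesgue ?Q C" using multiplier_form_C0[OF \<phi> \<theta> \<psi>] by blast
    note Q' = bounded_sesquilinear_lborel[OF Q]
    have S: "?S = (\<lambda>z. indicator ?X z *\<^sub>R (case z of (x, \<xi>) \<Rightarrow> \<phi> x * cnj (\<theta> x) * \<psi> \<xi>))"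
      by (simp add: test_symbol_def[abs_def])
    note Sm = test_symbol(1)[OF P \<phi> \<theta> \<psi>]
    obtain B where B: "\<And>z. norm (?S z) \<le> B" using test_symbol(2)[OF P \<phi> \<theta> \<psi>] by blast
    have Sg: "integrable \<rho> (\<lambda>z. ?S z * g k z)" for k
      by (rule integrable_bounded_mult[OF \<rho>(3) _ B]) (use Sm in \<open>simp add: measurable_cong_sets[OF \<rho>(2) refl]\<close>)
    have limW: "(\<lambda>n. ?Q (W n a) (W n b)) \<longlonglongrightarrow> (\<integral>z. ?S z * g (prod_encode (a, b)) z \<partial>\<rho>)" for a b
    proof -
      have eq: "?Q (W n a) (W n b) = (\<integral>x. multiplier_op (\<psi> \<circ> Pproj \<alpha>) (\<lambda>x. \<phi> x * regularize \<omega> 1 (v n) (x, p a)) x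
                       * cnj (\<theta> x * regularize \<omega> 1 (v n) (x, p b)) \<partial>lebesgue)" for n
      proof -
        have "?Q (W n a) (W n b) = ?Q (\<lambda>x. regularize \<omega> 1 (v n) (x, p a)) (W n b)"
          by (rule sesquilinear_AE_cong(1)[OF Q Wl regL Wl regW])
        also have "\<dots> = ?Q (\<lambda>x. regularize \<omega> 1 (v n) (x, p a)) (\<lambda>x. regularize \<omega> 1 (v n) (x, p b))"
          by (rule sesquilinear_AE_cong(2)[OF Q Wl regL regL regW])
        finally show ?thesis by (simp add: multiplier_form_def)
      qed
      obtain B' where B': "\<forall>z\<in>?X. norm (case z of (x, \<xi>) \<Rightarrow> \<phi> x * cnj (\<theta> x) * \<psi> \<xi>) \<le> B'"
        using test_symbol(3)[OF P \<phi> \<theta> \<psi>] by blast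
      have "complex_integral ?X (\<mu>' (prod_encode (a, b))) (\<lambda>(x, \<xi>). \<phi> x * cnj (\<theta> x) * \<psi> \<xi>)
          = (\<integral>z. ?S z * g (prod_encode (a, b)) z \<partial>\<rho>)"
        unfolding S by (rule dens[OF _ B']) (use Sm in \<open>simp add: S\<close>)
      then show ?thesis
        using lim[OF \<phi> \<theta> \<psi>, of "p a" "p b"] unfolding eq by (simp add: \<mu>'_def)
    qed
    define V where "V n i x = (\<Sum>a\<le>i. cnj (c i a) * W n a x)" for n i x
    have V: "V n i \<in> l2 lborel" for n i unfolding V_def by (intro l2_sum l2_scale W)
    have U: "(\<lambda>x. ip lborel (\<lambda>y. w n (x, y)) (e i)) \<in> l2 lborel" for n i
      by (rule lborel_pair.l2_coefficient[OF w' orthosys_l2[OF e(1)]])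
    have UV: "AE x in lborel. ip lborel (\<lambda>y. w n (x, y)) (e i) = V n i x" for n i
      using lborel_pair.l2_slice_fst[OF w'[of n]]
    proof eventually_elim
      case (elim x)
      have "e i = (\<lambda>y. \<Sum>a\<le>i. c i a * h a y)" by (rule ext) (rule c)
      then show ?case
        using elim by (simp add: V_def W_def ip_sum_right l2_scale h ip_scale_right)
    qed
    have expand: "?Q (\<lambda>x. ip lborel (\<lambda>y. w n (x, y)) (e i)) (\<lambda>x. ip lborel (\<lambda>y. w n (x, y)) (e j))
        = (\<Sum>a\<le>i. \<Sum>b\<le>j. cnj (c i a) * (c j b * ?Q (W n a) (W n b)))" for n
    proof -
      have "?Q (\<lambda>x. ip lborel (\<lambda>y. w n (x, y)) (e i)) (\<lambda>x. ip lborel (\<lambda>y. w n (x, y)) (e j)) = ?Q (V n i) (V n j)"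
        using sesquilinear_AE_cong(1)[OF Q' U V U UV, of n i n j] sesquilinear_AE_cong(2)[OF Q' U V V UV, of n i n j] by simp
      also have "\<dots> = (\<Sum>a\<le>i. cnj (c i a) * ?Q (W n a) (V n j))"
        unfolding V_def[of n i] by (rule sesquilinear_sum_left[OF Q' _ W V]) simp
      also have "\<dots> = (\<Sum>a\<le>i. cnj (c i a) * (\<Sum>b\<le>j. c j b * ?Q (W n a) (W n b)))"
      proof (intro sum.cong refl arg_cong2[where f = "(*)"])
        fix a
        show "?Q (W n a) (V n j) = (\<Sum>b\<le>j. c j b * ?Q (W n a) (W n b))"
          using sesquilinear_sum_right[OF Q', where I = "{..j}" and f = "W n" and c = "\<lambda>b. cnj (c j b)" and h = "W n a"] W
          by (simp add: V_def[abs_def])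
      qed
      finally show ?thesis by (simp add: sum_distrib_left)
    qed
    have "(\<integral>z. ?S z * f i j z \<partial>\<rho>) = (\<integral>z. (\<Sum>a\<le>i. \<Sum>b\<le>j. cnj (c i a) * (c j b * (?S z * g (prod_encode (a, b)) z))) \<partial>\<rho>)"
    proof (intro Bochner_Integration.integral_cong refl)
      fix z
      have "?S z * f i j z = ?S z * (\<Sum>a\<le>i. \<Sum>b\<le>j. cnj (c i a) * (c j b * g (prod_encode (a, b)) z))"
        by (auto simp: f_def test_symbol_def indicator_def)
      then show "?S z * f i j z = (\<Sum>a\<le>i. \<Sum>b\<le>j. cnj (c i a) * (c j b * (?S z * g (prod_encode (a, b)) z)))"
        by (simp add: sum_distrib_left mult.left_commute)
    qed
    also have "\<dots> = (\<Sum>a\<le>i. \<Sum>b\<le>j. cnj (c i a) * (c j b * (\<integral>z. ?S z * g (prod_encode (a, b)) z \<partial>\<rho>)))"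
      by (simp add: Bochner_Integration.integral_sum Bochner_Integration.integrable_sum Sg)
    finally show ?thesis
      unfolding expand by (simp only:) (intro tendsto_sum tendsto_mult_left limW)
  qed
  moreover have "f i j z = 0" if "z \<notin> ?X" for i j z using that by (simp add: f_def)
  ultimately show ?thesis
    using e \<rho> f by (intro exI[of _ e] exI[of _ \<rho>] exI[of _ f]) auto
qed

section \<open>Positivity and trace of the limit matrix\<close>

lemma gauss_prod: "gauss (c *\<^sub>R (z - w)) = gauss (c *\<^sub>R (fst z - fst w)) * gauss (c *\<^sub>R (snd z - snd w))"
  for z w :: "'a::euclidean_space \<times> 'b::euclidean_space"
proof -
  have "(norm (c *\<^sub>R (z - w)))\<^sup>2 = (norm (c *\<^sub>R (fst z - fst w)))\<^sup>2 + (norm (c *\<^sub>R (snd z - snd w)))\<^sup>2"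
    by (cases z; cases w) (simp add: norm_Pair)
  then show ?thesis by (simp add: gauss_def exp_add[symmetric] add_divide_distrib)
qed

text \<open>In \<open>test_symbol\<close> the cut-offs enter as a product of one with the conjugate
  of the other, so a Gaussian in the space variable is produced from two copies of its square
  root.\<close>

lemma gauss_sqrt: "gauss ((c / sqrt 2) *\<^sub>R x) * gauss ((c / sqrt 2) *\<^sub>R x) = gauss (c *\<^sub>R x)"
  by (simp add: gauss_def exp_add[symmetric] power_mult_distrib power_divide)

text \<open>Positivity of the form at \<open>U n i + \<zeta> * U n j\<close> survives in the limit
  and, tested with Gaussians, holds for the densities almost everywhere. The null set depends on
  \<open>\<zeta>\<close>, so a countable dense set of values comes first and continuity supplies the
  rest.\<close>

theorem density_matrix_psd:
  fixes U :: "nat \<Rightarrow> nat \<Rightarrow> real^'d \<Rightarrow> complex" and f :: "nat \<Rightarrow> nat \<Rightarrow> (real^'d) \<times> (real^'d) \<Rightarrow> complex"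
  assumes \<rho>: "finite_measure \<rho>" "sets \<rho> = sets borel" and f: "\<And>i j. integrable \<rho> (f i j)"
    and off: "\<And>i j z. z \<notin> UNIV \<times> Pman \<alpha> \<Longrightarrow> f i j z = 0"
    and U: "\<And>n i. U n i \<in> l2 lebesgue"
    and lim: "\<And>\<phi> \<theta> \<psi> i j. \<phi> \<in> C0 UNIV \<Longrightarrow> \<theta> \<in> C0 UNIV \<Longrightarrow> continuous_on (Pman \<alpha>) \<psi> \<Longrightarrow>
       (\<lambda>n. multiplier_form (\<psi> \<circ> Pproj \<alpha>) \<phi> \<theta> (U n i) (U n j)) \<longlonglongrightarrow> (\<integral>z. test_symbol (Pman \<alpha>) \<phi> \<theta> \<psi> z * f i j z \<partial>\<rho>)"
  shows "AE z in \<rho>. \<forall>i j. 0 \<le> f i i z \<and> (norm (f i j z))\<^sup>2 \<le> Re (f i i z) * Re (f j j z)"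
proof -
  let ?P = "Pman \<alpha>"
  have P: "compact ?P" by (rule compact_Pman[OF \<alpha>])
  \<comment> \<open>This is the density that belongs to \<open>U n i + \<zeta> * U n j\<close> in
    both slots.\<close>
  define F where "F i j \<zeta> z = f i i z + cnj \<zeta> * f i j z + \<zeta> * f j i z + of_real ((norm \<zeta>)\<^sup>2) * f j j z" for i j \<zeta> z
  have Fint: "integrable \<rho> (F i j \<zeta>)" for i j \<zeta>
    unfolding F_def by (intro Bochner_Integration.integrable_add integrable_mult_right f)
  have pos: "AE z in \<rho>. 0 \<le> F i j \<zeta> z" for i j \<zeta>
  proof (rule AE_nonneg_if_gauss[OF \<rho> Fint])
    fix w :: "(real^'d) \<times> (real^'d)" and m
    define c where "c = real (Suc m)"
    have c: "c / sqrt 2 \<noteq> 0" by (simp add: c_def)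
    define \<phi> where "\<phi> x = complex_of_real (gauss ((c / sqrt 2) *\<^sub>R (x - fst w)))" for x
    have \<phi>: "\<phi> \<in> C0 UNIV" unfolding \<phi>_def by (rule gauss_C0[OF c])
    define \<psi> where "\<psi> \<xi> = complex_of_real (gauss (c *\<^sub>R (\<xi> - snd w)))" for \<xi>
    have \<psi>: "continuous_on ?P \<psi>" unfolding \<psi>_def gauss_def by (intro continuous_intros) simp
    let ?S = "test_symbol ?P \<phi> \<phi> \<psi>" and ?Q = "multiplier_form (\<psi> \<circ> Pproj \<alpha>) \<phi> \<phi>"
    obtain C where Q: "bounded_sesquilinear_l2 lebesgue ?Q C" using multiplier_form_C0[OF \<phi> \<phi> \<psi>] by blast
    obtain B where B: "\<And>z. norm (?S z) \<le> B" using test_symbol(2)[OF P \<phi> \<phi> \<psi>] by blast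
    have Sf: "integrable \<rho> (\<lambda>z. ?S z * f i j z)" for i j
      by (rule integrable_bounded_mult[OF f _ B])
        (use test_symbol(1)[OF P \<phi> \<phi> \<psi>] in \<open>simp add: measurable_cong_sets[OF \<rho>(2) refl]\<close>)
    have "?Q (\<lambda>x. U n i x + \<zeta> * U n j x) (\<lambda>x. U n i x + \<zeta> * U n j x)
        = ?Q (U n i) (U n i) + cnj \<zeta> * ?Q (U n i) (U n j) + \<zeta> * ?Q (U n j) (U n i) + of_real ((norm \<zeta>)\<^sup>2) * ?Q (U n j) (U n j)" for n
    proof -
      have "?Q (\<lambda>x. U n i x + \<zeta> * U n j x) (\<lambda>x. U n i x + \<zeta> * U n j x)
        = ?Q (U n i) (\<lambda>x. U n i x + \<zeta> * U n j x) + \<zeta> * ?Q (U n j) (\<lambda>x. U n i x + \<zeta> * U n j x)"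
        by (rule sesquilinear_add_left[OF Q U U l2_add[OF U l2_scale[OF U]]])
      also have "\<dots> = ?Q (U n i) (U n i) + cnj \<zeta> * ?Q (U n i) (U n j) + \<zeta> * ?Q (U n j) (U n i) + (\<zeta> * cnj \<zeta>) * ?Q (U n j) (U n j)"
        by (simp only: sesquilinear_add_right[OF Q U U U]) (simp add: algebra_simps)
      finally show ?thesis by (simp only: complex_norm_square)
    qed
    moreover have "0 \<le> ?Q (\<lambda>x. U n i x + \<zeta> * U n j x) (\<lambda>x. U n i x + \<zeta> * U n j x)" for n
    proof -
      obtain B' where B': "\<And>\<xi>. norm ((\<psi> \<circ> Pproj \<alpha>) \<xi>) \<le> B'" using Pman_symbol(2)[OF \<alpha> \<psi>] by blast
      obtain B1 where B1: "\<And>x. norm (\<phi> x) \<le> B1" using C0_bounded[OF \<phi>] by auto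
      show ?thesis
        by (rule multiplier_form_nonneg[OF Pman_symbol(1)[OF \<alpha> \<psi>] B' C0_measurable[OF \<phi>] B1 AE_I2 l2_add[OF U l2_scale[OF U]]])
          (simp add: \<psi>_def less_eq_complex_def less_imp_le)
    qed
    ultimately have nn: "0 \<le> ?Q (U n i) (U n i) + cnj \<zeta> * ?Q (U n i) (U n j) + \<zeta> * ?Q (U n j) (U n i) + of_real ((norm \<zeta>)\<^sup>2) * ?Q (U n j) (U n j)" for n
      by metis
    have l: "(\<lambda>n. ?Q (U n i) (U n i) + cnj \<zeta> * ?Q (U n i) (U n j) + \<zeta> * ?Q (U n j) (U n i) + of_real ((norm \<zeta>)\<^sup>2) * ?Q (U n j) (U n j))
        \<longlonglongrightarrow> (\<integral>z. ?S z * f i i z \<partial>\<rho>) + cnj \<zeta> * (\<integral>z. ?S z * f i j z \<partial>\<rho>) + \<zeta> * (\<integral>z. ?S z * f j i z \<partial>\<rho>) + of_real ((norm \<zeta>)\<^sup>2) * (\<integral>z. ?S z * f j j z \<partial>\<rho>)"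
      by (intro tendsto_add tendsto_mult_left lim \<phi> \<psi>)
    have "(\<integral>z. ?S z * f i i z \<partial>\<rho>) + cnj \<zeta> * (\<integral>z. ?S z * f i j z \<partial>\<rho>) + \<zeta> * (\<integral>z. ?S z * f j i z \<partial>\<rho>) + of_real ((norm \<zeta>)\<^sup>2) * (\<integral>z. ?S z * f j j z \<partial>\<rho>) \<in> {z. 0 \<le> z}"
      by (rule closed_sequentially[OF closed_nonneg_complex _ l]) (use nn in simp)
    also have "(\<integral>z. ?S z * f i i z \<partial>\<rho>) + cnj \<zeta> * (\<integral>z. ?S z * f i j z \<partial>\<rho>) + \<zeta> * (\<integral>z. ?S z * f j i z \<partial>\<rho>) + of_real ((norm \<zeta>)\<^sup>2) * (\<integral>z. ?S z * f j j z \<partial>\<rho>)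
        = (\<integral>z. ?S z * f i i z + cnj \<zeta> * (?S z * f i j z) + \<zeta> * (?S z * f j i z) + of_real ((norm \<zeta>)\<^sup>2) * (?S z * f j j z) \<partial>\<rho>)"
      by (simp add: Sf)
    also have "\<dots> = (\<integral>z. of_real (gauss (c *\<^sub>R (z - w))) * F i j \<zeta> z \<partial>\<rho>)"
    proof (intro Bochner_Integration.integral_cong refl)
      fix z
      show "?S z * f i i z + cnj \<zeta> * (?S z * f i j z) + \<zeta> * (?S z * f j i z) + of_real ((norm \<zeta>)\<^sup>2) * (?S z * f j j z)
          = of_real (gauss (c *\<^sub>R (z - w))) * F i j \<zeta> z"
      proof (cases "z \<in> UNIV \<times> ?P")
        case True
        have "\<phi> x * cnj (\<phi> x) = of_real (gauss (c *\<^sub>R (x - fst w)))" for x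
          unfolding \<phi>_def complex_cnj_complex_of_real of_real_mult[symmetric] gauss_sqrt ..
        then have "?S z = of_real (gauss (c *\<^sub>R (z - w)))"
          using True by (simp add: test_symbol_def gauss_prod \<psi>_def case_prod_unfold)
        then show ?thesis by (simp add: F_def algebra_simps)
      qed (simp add: F_def off)
    qed
    finally show "0 \<le> (\<integral>z. of_real (gauss (real (Suc m) *\<^sub>R (z - w))) * F i j \<zeta> z \<partial>\<rho>)" by (simp add: c_def)
  qed
  obtain D :: "complex set" where D: "countable D" "\<And>X. open X \<Longrightarrow> X \<noteq> {} \<Longrightarrow> \<exists>d\<in>D. d \<in> X"
    by (rule countable_dense_setE) blast
  have "AE z in \<rho>. \<forall>\<zeta>\<in>D. 0 \<le> F i j \<zeta> z" for i j
    using pos by (subst AE_ball_countable[OF D(1)]) auto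
  then have "AE z in \<rho>. \<forall>i j. \<forall>\<zeta>\<in>D. 0 \<le> F i j \<zeta> z"
    by (simp add: AE_all_countable)
  then show ?thesis
  proof eventually_elim
    case (elim z)
    have all: "0 \<le> F i j \<zeta> z" for i j \<zeta>
    proof (rule ccontr)
      assume n: "\<not> 0 \<le> F i j \<zeta> z"
      have c: "continuous_on UNIV (\<lambda>\<zeta>. F i j \<zeta> z)" unfolding F_def by (intro continuous_intros)
      have "open {\<zeta>. \<not> 0 \<le> F i j \<zeta> z}"
      proof -
        have "{\<zeta>. \<not> 0 \<le> F i j \<zeta> z} = {\<zeta>. Re (F i j \<zeta> z) < 0} \<union> {\<zeta>. Im (F i j \<zeta> z) \<noteq> 0}"
          by (auto simp: less_eq_complex_def)
        also have "open \<dots>"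
          using c by (intro open_Un open_Collect_less open_Collect_neq continuous_intros)
        finally show ?thesis .
      qed
      then obtain d where "d \<in> D" "\<not> 0 \<le> F i j d z" using D(2)[of "{\<zeta>. \<not> 0 \<le> F i j \<zeta> z}"] n by auto
      then show False using elim by blast
    qed
    show ?case
    proof (intro allI conjI)
      fix i j
      have d: "0 \<le> f i i z" for i using all[of i i 0] by (simp add: F_def)
      then show "0 \<le> f i i z" .
      show "(norm (f i j z))\<^sup>2 \<le> Re (f i i z) * Re (f j j z)"
        by (rule psd_pair[OF d d]) (use all[of i j] in \<open>simp add: F_def\<close>)
    qed
  qed
qed

text \<open>With the symbol 1 the forms are squared norms, whose sum is bounded by \<open>K\<close>.
  The constant 1 does not vanish at infinity, so the cut-offs are widening Gaussians that tend to
  it.\<close>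

theorem density_matrix_trace:
  fixes U :: "nat \<Rightarrow> nat \<Rightarrow> real^'d \<Rightarrow> complex" and f :: "nat \<Rightarrow> nat \<Rightarrow> (real^'d) \<times> (real^'d) \<Rightarrow> complex"
  assumes \<rho>: "finite_measure \<rho>" "sets \<rho> = sets borel" and f: "\<And>i j. integrable \<rho> (f i j)"
    and off: "\<And>i j z. z \<notin> UNIV \<times> Pman \<alpha> \<Longrightarrow> f i j z = 0"
    and U: "\<And>n i. U n i \<in> l2 lebesgue"
    and lim: "\<And>\<phi> \<theta> \<psi> i j. \<phi> \<in> C0 UNIV \<Longrightarrow> \<theta> \<in> C0 UNIV \<Longrightarrow> continuous_on (Pman \<alpha>) \<psi> \<Longrightarrow>
       (\<lambda>n. multiplier_form (\<psi> \<circ> Pproj \<alpha>) \<phi> \<theta> (U n i) (U n j)) \<longlonglongrightarrow> (\<integral>z. test_symbol (Pman \<alpha>) \<phi> \<theta> \<psi> z * f i j z \<partial>\<rho>)"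
    and bound: "\<And>n N. (\<Sum>i<N. (nm lebesgue (U n i))\<^sup>2) \<le> K"
  shows "(\<Sum>i<N. \<integral>z. Re (f i i z) \<partial>\<rho>) \<le> K"
proof -
  let ?P = "Pman \<alpha>"
  have P: "compact ?P" by (rule compact_Pman[OF \<alpha>])
  define \<phi> where "\<phi> k x = complex_of_real (gauss ((1 / real (Suc k)) *\<^sub>R (x - 0)))" for k and x :: "real^'d"
  have \<phi>: "\<phi> k \<in> C0 UNIV" for k unfolding \<phi>_def by (rule gauss_C0) simp
  have \<phi>1: "norm (\<phi> k x) \<le> 1" for k x unfolding \<phi>_def using gauss_le_1 by (simp add: less_imp_le)
  define \<psi> where "\<psi> = (\<lambda>\<xi>::real^'d. 1 :: complex)"
  have \<psi>: "continuous_on ?P \<psi>" by (simp add: \<psi>_def)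
  let ?S = "\<lambda>k. test_symbol ?P (\<phi> k) (\<phi> k) \<psi>"
  have Sm: "?S k \<in> borel_measurable \<rho>" for k
    using test_symbol(1)[OF P \<phi> \<phi> \<psi>] by (simp add: measurable_cong_sets[OF \<rho>(2) refl])
  have S1: "norm (?S k z) \<le> 1" for k z
    using \<phi>1 by (auto simp: test_symbol_def \<psi>_def norm_mult indicator_def mult_le_one case_prod_unfold)
  have k: "Re (\<Sum>i<N. \<integral>z. ?S k z * f i i z \<partial>\<rho>) \<le> K" for k
  proof (rule LIMSEQ_le_const2)
    let ?Q = "multiplier_form (\<psi> \<circ> Pproj \<alpha>) (\<phi> k) (\<phi> k)"
    show "(\<lambda>n. Re (\<Sum>i<N. ?Q (U n i) (U n i))) \<longlonglongrightarrow> Re (\<Sum>i<N. \<integral>z. ?S k z * f i i z \<partial>\<rho>)"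
      by (intro tendsto_Re tendsto_sum lim \<phi> \<psi>)
    have "Re (\<Sum>i<N. ?Q (U n i) (U n i)) \<le> K" for n
    proof -
      have "?Q (U n i) (U n i) = ip lebesgue (\<lambda>x. \<phi> k x * U n i x) (\<lambda>x. \<phi> k x * U n i x)" for i
        by (rule multiplier_form_one[OF Pman_symbol(1)[OF \<alpha> \<psi>] _ _ C0_measurable[OF \<phi>] \<phi>1 C0_measurable[OF \<phi>] \<phi>1 U U, of 1])
          (auto simp: \<psi>_def)
      then have "Re (\<Sum>i<N. ?Q (U n i) (U n i)) = (\<Sum>i<N. (nm lebesgue (\<lambda>x. \<phi> k x * U n i x))\<^sup>2)"
        by (simp add: ip_self)
      also have "\<dots> \<le> (\<Sum>i<N. (nm lebesgue (U n i))\<^sup>2)"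
        using nm_mult_bounded_le[OF U borel_imp_lebesgue_measurable[OF C0_measurable[OF \<phi>]] \<phi>1 zero_le_one]
        by (intro sum_mono power_mono) auto
      finally show ?thesis using bound by (rule order_trans)
    qed
    then show "\<exists>M. \<forall>n\<ge>M. Re (\<Sum>i<N. ?Q (U n i) (U n i)) \<le> K" by blast
  qed
  have "(\<lambda>k. \<integral>z. ?S k z * f i i z \<partial>\<rho>) \<longlonglongrightarrow> (\<integral>z. f i i z \<partial>\<rho>)" for i
  proof (rule integral_dominated_convergence[where w = "\<lambda>z. norm (f i i z)"])
    show "AE z in \<rho>. (\<lambda>k. ?S k z * f i i z) \<longlonglongrightarrow> f i i z"
    proof (rule AE_I2)
      fix z
      show "(\<lambda>k. ?S k z * f i i z) \<longlonglongrightarrow> f i i z"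
      proof (cases "z \<in> UNIV \<times> ?P")
        case True
        have "(\<lambda>k. 1 / real (Suc k)) \<longlonglongrightarrow> 0" by (rule LIMSEQ_Suc[OF lim_1_over_n])
        then have "(\<lambda>k. complex_of_real (exp (- (norm ((1 / real (Suc k)) *\<^sub>R (fst z - 0)))\<^sup>2 / 2))) \<longlonglongrightarrow> complex_of_real (exp (- (norm (0 *\<^sub>R (fst z - 0)))\<^sup>2 / 2))"
          by (intro tendsto_intros) auto
        then have p: "(\<lambda>k. \<phi> k (fst z)) \<longlonglongrightarrow> 1" by (simp add: \<phi>_def gauss_def)
        have "(\<lambda>k. \<phi> k (fst z) * cnj (\<phi> k (fst z)) * 1 * f i i z) \<longlonglongrightarrow> 1 * cnj 1 * 1 * f i i z"
          by (intro tendsto_intros p)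
        then show ?thesis using True by (simp add: test_symbol_def \<psi>_def case_prod_unfold)
      qed (simp add: off)
    qed
    show "AE z in \<rho>. norm (?S k z * f i i z) \<le> norm (f i i z)" for k
      using S1 by (intro AE_I2) (simp add: norm_mult mult_left_le_one_le)
    show "(\<lambda>z. ?S k z * f i i z) \<in> borel_measurable \<rho>" for k using Sm f by measurable
  qed (use f in auto)
  then have "(\<lambda>k. Re (\<Sum>i<N. \<integral>z. ?S k z * f i i z \<partial>\<rho>)) \<longlonglongrightarrow> Re (\<Sum>i<N. \<integral>z. f i i z \<partial>\<rho>)"
    by (intro tendsto_Re tendsto_sum)
  then have "Re (\<Sum>i<N. \<integral>z. f i i z \<partial>\<rho>) \<le> K"
    by (rule LIMSEQ_le_const2) (use k in blast)
  then show ?thesis using f by simp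
qed

end

theorem theorem9:
  fixes \<alpha> :: "'d::finite \<Rightarrow> real"
    and \<omega> :: "real^'m::finite \<Rightarrow> real"
    and u :: "nat \<Rightarrow> (real^'d) \<times> (real^'m) \<Rightarrow> complex"
    and r :: "nat \<Rightarrow> nat"
  assumes "\<And>k. \<alpha> k > 0"
    and "mollifier \<omega>"
    and "L2_weakly_null u"
    and "strict_mono r"
    and "admissible \<alpha> \<omega> (\<lambda>n. u (r n))"
  shows "\<exists>\<mu> :: (real^'m) \<times> (real^'m) \<Rightarrow> ((real^'d) \<times> (real^'d)) set \<Rightarrow> complex.
    \<mu> \<in> L2_weak_star (UNIV \<times> Pman \<alpha>) \<and>
    (\<forall>v\<in>L2c. \<forall>\<phi>\<^sub>1\<in>C0 UNIV. \<forall>\<phi>\<^sub>2\<in>C0 UNIV. \<forall>\<psi>. continuous_on (Pman \<alpha>) \<psi> \<longrightarrow>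
      (\<lambda>n. \<integral>(p, q). (\<integral>x. v (p, q)
               * multiplier_op (\<psi> \<circ> Pproj \<alpha>) (\<lambda>x. \<phi>\<^sub>1 x * u (r n) (x, p)) x
               * cnj (\<phi>\<^sub>2 x * u (r n) (x, q)) \<partial>lebesgue) \<partial>lebesgue)
      \<longlonglongrightarrow> (\<integral>(p, q). v (p, q)
               * complex_integral (UNIV \<times> Pman \<alpha>) (\<mu> (p, q)) (\<lambda>(x, \<xi>). \<phi>\<^sub>1 x * cnj (\<phi>\<^sub>2 x) * \<psi> \<xi>) \<partial>lebesgue))"
proof -
  note \<alpha> = assms(1)
  let ?P = "Pman \<alpha>" and ?X = "(UNIV :: (real^'d) set) \<times> Pman \<alpha>"
  have P: "compact ?P" by (rule compact_Pman[OF \<alpha>])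
  have Xc: "closed ?X" by (intro closed_Times closed_UNIV compact_imp_closed P)
  then have X: "?X \<in> sets borel" by simp
  have ul: "u n \<in> l2 lebesgue" for n using assms(3) by (auto simp: L2_weakly_null_def L2_eq_l2)
  \<comment> \<open>The bound uniform in \<open>n\<close> controls both the trace of the limit
    matrix and the error in the final exchange of limits.\<close>
  obtain B where B: "\<And>n. nm lebesgue (u n) \<le> B"
    using weakly_null_bounded[where u = u, OF ul] assms(3) by (auto simp: L2_weakly_null_def L2_eq_l2 ip_def)
  have "\<exists>g\<in>borel_measurable borel. AE z in lborel. u (r n) z = g z" for n
    by (rule borel_version[OF l2_measurable[OF ul]])
  then obtain w where wb [measurable]: "\<And>n. w n \<in> borel_measurable borel" and uw: "\<And>n. AE z in lborel. u (r n) z = w n z"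
    by metis
  have wl: "w n \<in> l2 lebesgue" for n
    by (rule l2_AE_cong[OF ul borel_imp_lebesgue_measurable[OF wb] AE_completion[OF uw]])
  then have w: "w n \<in> l2 lborel" for n using wb by (simp add: l2_lebesgue_iff)
  have wB: "nm lborel (w n) \<le> B" for n
    using B[of "r n"] nm_AE_cong[OF AE_completion[OF uw] l2_measurable[OF ul] l2_measurable[OF wl], of n]
    by (simp add: nm_lebesgue wb)
  have w': "w n \<in> l2 (lborel \<Otimes>\<^sub>M lborel)" for n using w by (simp add: lborel_prod)
  obtain e \<rho> f where e: "orthosys lborel e" "total_in_l2 lborel (e :: nat \<Rightarrow> real^'m \<Rightarrow> complex)"
    and \<rho>: "finite_measure \<rho>" "sets \<rho> = sets borel" and f0: "\<forall>i j. integrable \<rho> (f i j)"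
    and off0: "\<forall>i j z. z \<notin> ?X \<longrightarrow> f i j z = 0"
    and lim0: "\<forall>\<phi>\<in>C0 UNIV. \<forall>\<theta>\<in>C0 UNIV. \<forall>\<psi>. continuous_on ?P \<psi> \<longrightarrow>
      (\<forall>i j. (\<lambda>n. multiplier_form (\<psi> \<circ> Pproj \<alpha>) \<phi> \<theta>
            (\<lambda>x. ip lborel (\<lambda>y. w n (x, y)) (e i)) (\<lambda>x. ip lborel (\<lambda>y. w n (x, y)) (e j)))
        \<longlonglongrightarrow> (\<integral>z. test_symbol ?P \<phi> \<theta> \<psi> z * f i j z \<partial>\<rho>))"
    using admissible_densities[OF \<alpha> assms(2,5) w uw] by (elim exE conjE) (rule that)
  have f: "\<And>i j. integrable \<rho> (f i j)" and off: "\<And>i j z. z \<notin> ?X \<Longrightarrow> f i j z = 0"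
    using f0 off0 by blast+
  define U where "U n i x = ip lborel (\<lambda>y. w n (x, y)) (e i)" for n i x
  have U: "U n i \<in> l2 lborel" for n i
    unfolding U_def by (rule lborel_pair.l2_coefficient[OF w' orthosys_l2[OF e(1)]])
  have Ub: "U n i \<in> borel_measurable borel" for n i using l2_measurable[OF U] by simp
  then have Ul: "U n i \<in> l2 lebesgue" for n i using U by (simp add: l2_lebesgue_iff)
  have limU: "\<And>\<phi> \<theta> \<psi> i j. \<phi> \<in> C0 UNIV \<Longrightarrow> \<theta> \<in> C0 UNIV \<Longrightarrow> continuous_on ?P \<psi> \<Longrightarrow>
      (\<lambda>n. multiplier_form (\<psi> \<circ> Pproj \<alpha>) \<phi> \<theta> (U n i) (U n j)) \<longlonglongrightarrow> (\<integral>z. test_symbol ?P \<phi> \<theta> \<psi> z * f i j z \<partial>\<rho>)"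
    unfolding U_def using lim0 by blast
  have Usum: "(\<Sum>i<N. (nm lebesgue (U n i))\<^sup>2) \<le> B\<^sup>2" for n N
  proof -
    have "(\<Sum>i<N. (nm lebesgue (U n i))\<^sup>2) = (\<Sum>i<N. (nm lborel (U n i))\<^sup>2)" by (simp add: nm_lebesgue Ub)
    also have "\<dots> \<le> (nm (lborel \<Otimes>\<^sub>M lborel) (w n))\<^sup>2"
      unfolding U_def by (rule lborel_pair.sum_coefficients_le[OF w' e(1)]) simp
    also have "\<dots> \<le> B\<^sup>2" using wB[of n] by (simp add: lborel_prod power_mono)
    finally show ?thesis .
  qed
  obtain \<nu> g where \<nu>: "finite_measure \<nu>" "sets \<nu> = sets borel" and g: "\<And>i j. g i j \<in> l2 \<nu>"
    and gsum: "\<And>N. (\<Sum>(i, j)\<in>{..<N} \<times> {..<N}. (nm \<nu> (g i j))\<^sup>2) \<le> measure \<nu> (space \<nu>)"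
    and fg: "\<And>i j \<Psi>. \<Psi> \<in> borel_measurable borel \<Longrightarrow> (\<integral>z. \<Psi> z * f i j z \<partial>\<rho>) = (\<integral>z. \<Psi> z * g i j z \<partial>\<nu>)"
    using trace_normalization[OF \<rho> f density_matrix_psd[OF \<alpha> \<rho> f off Ul limU] density_matrix_trace[OF \<alpha> \<rho> f off Ul limU Usum]]
    by blast
  interpret \<nu>: finite_measure \<nu> by (rule \<nu>(1))
  interpret N: pair_sigma_finite "lborel :: ((real^'m) \<times> (real^'m)) measure" \<nu> ..
  \<comment> \<open>The second factor is conjugated because the form is conjugate linear in its
    second slot; with this choice the coefficients of the form of two slices are the forms of the
    coefficient functions.\<close>
  define E where "E = (\<lambda>(i, j) (p, q). e i p * cnj (e j q))"
  have E: "orthosys lborel E" and Etot: "total_in_l2 lborel E"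
    unfolding E_def lborel_prod[symmetric]
    by (rule lborel_pair.orthosys_tensor[OF e(1) orthosys_cnj[OF e(1)]],
        rule lborel_pair.total_tensor[OF orthosys_l2[OF e(1)] e(2) orthosys_l2[OF orthosys_cnj[OF e(1)]] total_cnj[OF e(2)]])
  define I where "I N = {..<N} \<times> {..<N}" for N :: nat
  have I: "finite (I N)" "incseq I" "\<exists>N. k \<in> I N" for N k
    by (auto simp: I_def incseq_def mem_Times_iff less_Suc_eq_le intro!: exI[of _ "Suc (max (fst k) (snd k))"])
  have "(\<Sum>k\<in>I N. (nm \<nu> ((\<lambda>(i, j). g i j) k))\<^sup>2) \<le> measure \<nu> (space \<nu>)" for N
    using gsum[of N] by (simp add: I_def case_prod_unfold)
  from N.ex_orthogonal_kernel[OF E _ I this] g obtain H where H: "H \<in> l2 (lborel \<Otimes>\<^sub>M \<nu>)"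
    and slice: "\<And>z. (\<lambda>x. H (z, x)) \<in> l2 \<nu>"
    and HE: "\<And>i j \<Psi>. \<Psi> \<in> l2 \<nu> \<Longrightarrow> ip (lborel \<Otimes>\<^sub>M \<nu>) H (\<lambda>(z, x). E (i, j) z * \<Psi> x) = of_real ((nm lborel (E (i, j)))\<^sup>2) * ip \<nu> (g i j) \<Psi>"
    by (auto simp: split_paired_all)
  define \<mu> where "\<mu> z A = (\<integral>x. indicator A x *\<^sub>R H (z, x) \<partial>\<nu>)" for z A
  have "\<mu> \<in> L2_weak_star ?X"
    unfolding \<mu>_def by (rule kernel_L2_weak_star[OF Xc \<nu> H slice])
  moreover have "(\<lambda>n. \<integral>(p, q). (\<integral>x. v (p, q)
               * multiplier_op (\<psi> \<circ> Pproj \<alpha>) (\<lambda>x. \<phi>\<^sub>1 x * u (r n) (x, p)) x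
               * cnj (\<phi>\<^sub>2 x * u (r n) (x, q)) \<partial>lebesgue) \<partial>lebesgue)
      \<longlonglongrightarrow> (\<integral>(p, q). v (p, q) * complex_integral ?X (\<mu> (p, q)) (\<lambda>(x, \<xi>). \<phi>\<^sub>1 x * cnj (\<phi>\<^sub>2 x) * \<psi> \<xi>) \<partial>lebesgue)"
    if v: "v \<in> L2c" and \<phi>: "\<phi>\<^sub>1 \<in> C0 UNIV" "\<phi>\<^sub>2 \<in> C0 UNIV" and \<psi>: "continuous_on ?P \<psi>" for v \<phi>\<^sub>1 \<phi>\<^sub>2 \<psi>
  proof -
    let ?Q = "multiplier_form (\<psi> \<circ> Pproj \<alpha>) \<phi>\<^sub>1 \<phi>\<^sub>2"
    let ?S = "test_symbol ?P \<phi>\<^sub>1 \<phi>\<^sub>2 \<psi>"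
    obtain C where Q: "bounded_sesquilinear_l2 lebesgue ?Q C" using multiplier_form_C0[OF \<alpha> \<phi> \<psi>] by blast
    note Q' = bounded_sesquilinear_lborel[OF Q]
    note Sm = test_symbol(1)[OF P \<phi> \<psi>]
    obtain BS where BS: "0 \<le> BS" "\<And>z. norm (?S z) \<le> BS" using test_symbol(2)[OF P \<phi> \<psi>] by blast
    have vl: "v \<in> l2 lebesgue" using v by (auto simp: L2c_def L2_eq_l2)
    obtain v' where v'b [measurable]: "v' \<in> borel_measurable borel" and vv': "AE z in lborel. v z = v' z"
      using borel_version[OF l2_measurable[OF vl]] by blast
    have v': "v' \<in> l2 lborel"
      using l2_AE_cong[OF vl borel_imp_lebesgue_measurable[OF v'b] AE_completion[OF vv']] v'b by (simp add: l2_lebesgue_iff)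
    \<comment> \<open>The functions \<open>G\<close> stand in for the form of two slices, with which
      they agree almost everywhere; naming the property lets one such function be chosen for every
      \<open>n\<close>.\<close>
    define R where "R n G \<longleftrightarrow> G \<in> l2 lborel \<and> (AE z in lborel. ?Q (\<lambda>x. w n (x, fst z)) (\<lambda>x. w n (x, snd z)) = G z) \<and>
        nm lborel G \<le> C * (nm lborel (w n))\<^sup>2 \<and>
        (\<forall>i j. ip lborel G (E (i, j)) = ?Q (U n i) (U n j) * of_real ((nm lborel (E (i, j)))\<^sup>2))" for n G
    have "\<exists>G. R n G" for n
      using lborel_pair.sesquilinear_slices[OF Q' w' e, of n, unfolded lborel_prod]
      unfolding R_def by (simp add: E_def U_def[abs_def] Bex_def)
    then obtain G where "\<And>n. R n (G n)" by metis
    then have G: "G n \<in> l2 lborel" and GQ: "AE z in lborel. ?Q (\<lambda>x. w n (x, fst z)) (\<lambda>x. w n (x, snd z)) = G n z"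
      and Gnm: "nm lborel (G n) \<le> C * (nm lborel (w n))\<^sup>2"
      and GE: "ip lborel (G n) (E (i, j)) = ?Q (U n i) (U n j) * of_real ((nm lborel (E (i, j)))\<^sup>2)" for n i j
      unfolding R_def by blast+
    have GB: "nm lborel (G n) \<le> C * B\<^sup>2" for n
      using Gnm[of n] mult_left_mono[OF power_mono[OF wB[of n] nm_nonneg, of 2] sesquilinear_C[OF Q]] by linarith
    have Gb [measurable]: "G n \<in> borel_measurable borel" for n using l2_measurable[OF G] by simp
    \<comment> \<open>Conjugating \<open>v\<close> turns both sides of the limit relation into inner
      products with \<open>V\<close>.\<close>
    define V where "V z = cnj (v' z)" for z
    have V: "V \<in> l2 lborel" unfolding V_def by (rule l2_cnj[OF v'])
    have lhs: "(\<integral>(p, q). (\<integral>x. v (p, q)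
               * multiplier_op (\<psi> \<circ> Pproj \<alpha>) (\<lambda>x. \<phi>\<^sub>1 x * u (r n) (x, p)) x
               * cnj (\<phi>\<^sub>2 x * u (r n) (x, q)) \<partial>lebesgue) \<partial>lebesgue) = ip lborel (G n) V" for n
    proof -
      have "AE p in lborel. (\<lambda>x. w n (x, p)) \<in> l2 lborel \<and> (AE x in lborel. u (r n) (x, p) = w n (x, p))"
        using lborel_pair.l2_slice_snd[OF w'[of n]] AE_lborel_slices(2)[OF uw[of n]] by eventually_elim simp
      from lborel.AE_pair_both[OF this]
      have "AE z in lborel. v z * ?Q (\<lambda>x. u (r n) (x, fst z)) (\<lambda>x. u (r n) (x, snd z)) = v' z * G n z"
        unfolding lborel_prod using GQ[of n] vv'
      proof eventually_elim
        case (elim z)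
        have a: "(\<lambda>x. w n (x, q)) \<in> l2 lebesgue \<and> (\<lambda>x. u (r n) (x, q)) \<in> l2 lebesgue \<and> (AE x in lebesgue. w n (x, q) = u (r n) (x, q))"
          if "(\<lambda>x. w n (x, q)) \<in> l2 lborel" "AE x in lborel. u (r n) (x, q) = w n (x, q)" for q
        proof -
          have 1: "(\<lambda>x. w n (x, q)) \<in> l2 lebesgue"
            using that(1) l2_measurable[OF that(1)] by (simp add: l2_lebesgue_iff)
          have 2: "AE x in lebesgue. w n (x, q) = u (r n) (x, q)"
            using AE_completion[OF that(2)] by eventually_elim simp
          show ?thesis
            using 1 2 l2_AE_cong[OF 1 lebesgue_measurable_AE_cong[OF l2_measurable[OF 1] 2] 2] by blast
        qed
        from elim(1) a[of "fst z"] a[of "snd z"]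
        have s: "(\<lambda>x. w n (x, fst z)) \<in> l2 lebesgue" "(\<lambda>x. u (r n) (x, fst z)) \<in> l2 lebesgue" "AE x in lebesgue. w n (x, fst z) = u (r n) (x, fst z)"
          "(\<lambda>x. w n (x, snd z)) \<in> l2 lebesgue" "(\<lambda>x. u (r n) (x, snd z)) \<in> l2 lebesgue" "AE x in lebesgue. w n (x, snd z) = u (r n) (x, snd z)"
          by auto
        have "?Q (\<lambda>x. w n (x, fst z)) (\<lambda>x. w n (x, snd z)) = ?Q (\<lambda>x. u (r n) (x, fst z)) (\<lambda>x. u (r n) (x, snd z))"
          using sesquilinear_AE_cong(1)[OF Q s(1,2,4,3)] sesquilinear_AE_cong(2)[OF Q s(4,5,2,6)] by simp
        then show ?case using elim(2,3) by simp
      qed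
      then have ae: "AE z in lebesgue. v' z * G n z = v z * ?Q (\<lambda>x. u (r n) (x, fst z)) (\<lambda>x. u (r n) (x, snd z))"
        by (intro AE_completion) (auto simp: eq_commute)
      have m: "(\<lambda>z. v' z * G n z) \<in> borel_measurable lebesgue"
        by (rule borel_imp_lebesgue_measurable) measurable
      have "(\<integral>(p, q). (\<integral>x. v (p, q)
               * multiplier_op (\<psi> \<circ> Pproj \<alpha>) (\<lambda>x. \<phi>\<^sub>1 x * u (r n) (x, p)) x
               * cnj (\<phi>\<^sub>2 x * u (r n) (x, q)) \<partial>lebesgue) \<partial>lebesgue)
          = (\<integral>z. v z * ?Q (\<lambda>x. u (r n) (x, fst z)) (\<lambda>x. u (r n) (x, snd z)) \<partial>lebesgue)"
        unfolding multiplier_form_def case_prod_unfold by (simp add: mult.assoc)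
      also have "\<dots> = (\<integral>z. v' z * G n z \<partial>lebesgue)"
        using ae by (intro integral_cong_AE lebesgue_measurable_AE_cong[OF m ae] m) auto
      also have "\<dots> = (\<integral>z. v' z * G n z \<partial>lborel)" by (rule integral_completion) measurable
      also have "\<dots> = ip lborel (G n) V" by (simp add: ip_def V_def mult.commute)
      finally show ?thesis .
    qed
    \<comment> \<open>Conjugation does the same for the test function: integrating it against the
      measure at \<open>z\<close> becomes an inner product for \<open>\<nu>\<close>.\<close>
    define \<Psi> where "\<Psi> z = cnj (?S z)" for z
    have \<Psi>: "\<Psi> \<in> l2 \<nu>"
    proof (rule l2_dominated[where h = "\<lambda>_. BS\<^sup>2"])
      show "\<Psi> \<in> borel_measurable \<nu>"
        unfolding \<Psi>_def using Sm by (simp add: measurable_cong_sets[OF \<nu>(2) refl])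
    qed (use BS in \<open>auto simp: \<Psi>_def intro!: power_mono\<close>)
    have rhs: "(\<integral>(p, q). v (p, q) * complex_integral ?X (\<mu> (p, q)) (\<lambda>(x, \<xi>). \<phi>\<^sub>1 x * cnj (\<phi>\<^sub>2 x) * \<psi> \<xi>) \<partial>lebesgue)
        = ip (lborel \<Otimes>\<^sub>M \<nu>) H (\<lambda>(z, x). V z * \<Psi> x)"
    proof -
      have one: "(\<lambda>_. 1) \<in> l2 \<nu>" by (rule l2I) auto
      have int: "integrable \<nu> (\<lambda>x. H (z, x))" for z using l2_mult_integrable[OF slice[of z] one] by simp
      have S: "?S = (\<lambda>z. indicator ?X z *\<^sub>R (case z of (x, \<xi>) \<Rightarrow> \<phi>\<^sub>1 x * cnj (\<phi>\<^sub>2 x) * \<psi> \<xi>))"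
        by (simp add: test_symbol_def[abs_def])
      obtain B' where B': "\<forall>z\<in>?X. norm (case z of (x, \<xi>) \<Rightarrow> \<phi>\<^sub>1 x * cnj (\<phi>\<^sub>2 x) * \<psi> \<xi>) \<le> B'"
        using test_symbol(3)[OF P \<phi> \<psi>] by blast
      have ci: "complex_integral ?X (\<mu> z) (\<lambda>(x, \<xi>). \<phi>\<^sub>1 x * cnj (\<phi>\<^sub>2 x) * \<psi> \<xi>) = ip \<nu> (\<lambda>x. H (z, x)) \<Psi>" for z
      proof -
        have "complex_integral ?X (\<mu> z) (\<lambda>(x, \<xi>). \<phi>\<^sub>1 x * cnj (\<phi>\<^sub>2 x) * \<psi> \<xi>) = (\<integral>x. ?S x * H (z, x) \<partial>\<nu>)"
          unfolding \<mu>_def[abs_def] S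
          by (rule complex_integral_density[OF X \<nu> int]) (use Sm B' in \<open>auto simp: S\<close>)
        then show ?thesis by (simp add: ip_def \<Psi>_def mult.commute)
      qed
      have cb: "(\<lambda>z. ip \<nu> (\<lambda>x. H (z, x)) \<Psi>) \<in> borel_measurable borel"
        using l2_measurable[OF N.l2_coefficient[OF H \<Psi>]] by simp
      have ae: "AE z in lebesgue. v' z * ip \<nu> (\<lambda>x. H (z, x)) \<Psi> = v z * ip \<nu> (\<lambda>x. H (z, x)) \<Psi>"
        using AE_completion[OF vv'] by eventually_elim simp
      have m: "(\<lambda>z. v' z * ip \<nu> (\<lambda>x. H (z, x)) \<Psi>) \<in> borel_measurable lebesgue"
        by (rule borel_imp_lebesgue_measurable) (use cb in measurable)
      have "(\<integral>(p, q). v (p, q) * complex_integral ?X (\<mu> (p, q)) (\<lambda>(x, \<xi>). \<phi>\<^sub>1 x * cnj (\<phi>\<^sub>2 x) * \<psi> \<xi>) \<partial>lebesgue)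
          = (\<integral>z. v z * ip \<nu> (\<lambda>x. H (z, x)) \<Psi> \<partial>lebesgue)"
        unfolding ci[symmetric] by (rule Bochner_Integration.integral_cong) auto
      also have "\<dots> = (\<integral>z. v' z * ip \<nu> (\<lambda>x. H (z, x)) \<Psi> \<partial>lebesgue)"
        using ae by (intro integral_cong_AE lebesgue_measurable_AE_cong[OF m ae] m) auto
      also have "\<dots> = (\<integral>z. v' z * ip \<nu> (\<lambda>x. H (z, x)) \<Psi> \<partial>lborel)"
        by (rule integral_completion) (use cb in measurable)
      also have "\<dots> = ip lborel (\<lambda>z. ip \<nu> (\<lambda>x. H (z, x)) \<Psi>) V" by (simp add: ip_def V_def mult.commute)
      also have "\<dots> = ip (lborel \<Otimes>\<^sub>M \<nu>) H (\<lambda>(z, x). V z * \<Psi> x)"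
        by (rule N.ip_tensor_right[OF H V \<Psi>, symmetric])
      finally show ?thesis .
    qed
    define \<beta> where "\<beta> k = ip lborel V (E k)" for k
    \<comment> \<open>For a finite section of the expansion of \<open>V\<close> the limit in
      \<open>n\<close> is a finite sum of known limits.\<close>
    define s where "s N z = (\<Sum>k\<in>I N. \<beta> k * E k z)" for N z
    have s: "s N \<in> l2 lborel" for N unfolding s_def by (intro l2_sum l2_scale orthosys_l2[OF E])
    have slim: "(\<lambda>N. nm lborel (\<lambda>z. s N z - V z)) \<longlonglongrightarrow> 0"
      unfolding s_def \<beta>_def by (rule orthosys_expansion[OF E Etot V I])
    \<comment> \<open>The factor \<open>(nm lborel (E k))\<^sup>2\<close> is 1 or 0 and takes care
      of the zero vectors in the system.\<close>
    define L where "L N = (\<Sum>k\<in>I N. cnj (\<beta> k) * (of_real ((nm lborel (E k))\<^sup>2) * (\<integral>z. ?S z * (case k of (i, j) \<Rightarrow> f i j z) \<partial>\<rho>)))" for N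
    have inner: "(\<lambda>n. ip lborel (G n) (s N)) \<longlonglongrightarrow> L N" for N
    proof -
      have "ip lborel (G n) (s N) = (\<Sum>k\<in>I N. cnj (\<beta> k) * (of_real ((nm lborel (E k))\<^sup>2) * (case k of (i, j) \<Rightarrow> ?Q (U n i) (U n j))))" for n
        unfolding s_def
        by (simp add: ip_sum_right[OF I(1) l2_scale[OF orthosys_l2[OF E]] G] ip_scale_right)
          (intro sum.cong refl, auto simp: GE)
      then show ?thesis
        unfolding L_def by (simp only:) (intro tendsto_sum tendsto_mult_left, auto intro: limU[OF \<phi> \<psi>])
    qed
    \<comment> \<open>On the kernel side the coefficients agree by the construction of
      \<open>H\<close>, after passing from \<open>g i j\<close> and \<open>\<nu>\<close> back to
      \<open>f i j\<close> and \<open>\<rho>\<close>.\<close>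
    have Hs: "ip (lborel \<Otimes>\<^sub>M \<nu>) H (\<lambda>(z, x). s N z * \<Psi> x) = L N" for N
    proof -
      have "ip (lborel \<Otimes>\<^sub>M \<nu>) H (\<lambda>(z, x). s N z * \<Psi> x)
          = ip (lborel \<Otimes>\<^sub>M \<nu>) H (\<lambda>w. \<Sum>k\<in>I N. \<beta> k * (case w of (z, x) \<Rightarrow> E k z * \<Psi> x))"
        by (intro arg_cong[where f = "ip _ H"] ext) (auto simp: s_def sum_distrib_right mult.assoc)
      also have "\<dots> = (\<Sum>k\<in>I N. cnj (\<beta> k) * ip (lborel \<Otimes>\<^sub>M \<nu>) H (\<lambda>(z, x). E k z * \<Psi> x))"
        by (simp add: ip_sum_right[OF I(1) l2_scale[OF N.l2_tensor[OF orthosys_l2[OF E] \<Psi>]] H] ip_scale_right)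
      also have "\<dots> = L N"
        unfolding L_def
      proof (intro sum.cong refl arg_cong2[where f = "(*)"])
        fix k :: "nat \<times> nat"
        obtain i j where k: "k = (i, j)" by (cases k)
        have "ip \<nu> (g i j) \<Psi> = (\<integral>z. ?S z * f i j z \<partial>\<rho>)"
          unfolding fg[OF Sm] by (simp add: ip_def \<Psi>_def mult.commute)
        then show "ip (lborel \<Otimes>\<^sub>M \<nu>) H (\<lambda>(z, x). E k z * \<Psi> x)
            = of_real ((nm lborel (E k))\<^sup>2) * (\<integral>z. ?S z * (case k of (i, j) \<Rightarrow> f i j z) \<partial>\<rho>)"
          unfolding k using HE[OF \<Psi>, of i j] by simp
      qed
      finally show ?thesis .
    qed
    \<comment> \<open>Both truncation errors are constant multiples of the distance between
      \<open>V\<close> and \<open>s N\<close>, the first with a constant independent of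
      \<open>n\<close>.\<close>
    have "(\<lambda>n. ip lborel (G n) V) \<longlonglongrightarrow> ip (lborel \<Otimes>\<^sub>M \<nu>) H (\<lambda>(z, x). V z * \<Psi> x)"
    proof (rule double_limit[OF inner])
      let ?d = "\<lambda>N. nm lborel (\<lambda>z. s N z - V z)"
      show "norm (ip lborel (G n) V - ip lborel (G n) (s N)) \<le> C * B\<^sup>2 * ?d N" for n N
      proof -
        have "ip lborel (G n) V - ip lborel (G n) (s N) = ip lborel (G n) (\<lambda>z. V z - s N z)"
          by (rule ip_diff_right[OF V s G, symmetric])
        also have "norm \<dots> \<le> nm lborel (G n) * nm lborel (\<lambda>z. V z - s N z)"
          by (rule Cauchy_Schwarz_l2[OF G l2_diff[OF V s]])
        also have "\<dots> \<le> C * B\<^sup>2 * ?d N"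
          unfolding nm_minus_commute[of lborel V] by (rule mult_right_mono[OF GB nm_nonneg])
        finally show ?thesis .
      qed
      show "norm (ip (lborel \<Otimes>\<^sub>M \<nu>) H (\<lambda>(z, x). V z * \<Psi> x) - L N) \<le> nm (lborel \<Otimes>\<^sub>M \<nu>) H * (nm \<nu> \<Psi> * ?d N)" for N
      proof -
        have "ip (lborel \<Otimes>\<^sub>M \<nu>) H (\<lambda>(z, x). V z * \<Psi> x) - L N
            = ip (lborel \<Otimes>\<^sub>M \<nu>) H (\<lambda>w. (case w of (z, x) \<Rightarrow> V z * \<Psi> x) - (case w of (z, x) \<Rightarrow> s N z * \<Psi> x))"
          unfolding Hs[symmetric] by (rule ip_diff_right[OF N.l2_tensor[OF V \<Psi>] N.l2_tensor[OF s \<Psi>] H, symmetric])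
        also have "(\<lambda>w. (case w of (z, x) \<Rightarrow> V z * \<Psi> x) - (case w of (z, x) \<Rightarrow> s N z * \<Psi> x)) = (\<lambda>(z, x). (V z - s N z) * \<Psi> x)"
          by (auto simp: left_diff_distrib)
        also have "norm (ip (lborel \<Otimes>\<^sub>M \<nu>) H (\<lambda>(z, x). (V z - s N z) * \<Psi> x))
            \<le> nm (lborel \<Otimes>\<^sub>M \<nu>) H * nm (lborel \<Otimes>\<^sub>M \<nu>) (\<lambda>(z, x). (V z - s N z) * \<Psi> x)"
          by (rule Cauchy_Schwarz_l2[OF H N.l2_tensor[OF l2_diff[OF V s] \<Psi>]])
        also have "nm (lborel \<Otimes>\<^sub>M \<nu>) (\<lambda>(z, x). (V z - s N z) * \<Psi> x) = nm \<nu> \<Psi> * ?d N"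
          unfolding N.nm_tensor[OF l2_diff[OF V s] \<Psi>] nm_minus_commute[of lborel V] by (rule mult.commute)
        finally show ?thesis .
      qed
    qed (use tendsto_mult_left[OF slim, of "C * B\<^sup>2"] tendsto_mult_left[OF slim, of "nm (lborel \<Otimes>\<^sub>M \<nu>) H * nm \<nu> \<Psi>"] in \<open>simp_all add: mult.assoc\<close>)
    then show ?thesis unfolding lhs rhs .
  qed
  ultimately show ?thesis by blast
qed

end
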